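(* There exist subgroups $G$ of $\mathrm{Diff}([0,1])$ such that $G$ is isomorphic to the fundamental group of a closed (orientable) surface of genus $2$ and the action of $G$ on the open interval $(0,1)$ satisfies all of the following: it has no global fixed point in $(0,1)$; it is topologically transitive; and only countably many points of $(0,1)$ have non-trivial stabiliser in $G$.
   Context: $\mathrm{Diff}([0,1])=\{\phi \mid \phi \text{ a } C^\infty\text{-diffeomorphism of } \mathbb{R} \text{ with } \phi(t)=t \text{ for all } t\notin(0,1)\}$, a group under composition; each of its elements maps $(0,1)$ to itself, so subgroups act on $(0,1)$. A global fixed point of $G$ is a point fixed by every element of $G$. A group action is topologically transitive if it has a dense orbit. *)

theory Defs
  imports "HOL-Analysis.Analysis" "HOL-Algebra.Group_Action"
begin

section \<open>The group of smooth diffeomorphisms supported on the unit interval\<close>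

definition smooth :: "(real \<Rightarrow> real) \<Rightarrow> bool" where
  "smooth f \<longleftrightarrow> (\<forall>n x. ((deriv ^^ n) f) differentiable (at x))"

definition smooth_diffeo :: "(real \<Rightarrow> real) \<Rightarrow> bool" where
  "smooth_diffeo f \<longleftrightarrow> bij f \<and> smooth f \<and> smooth (inv_into UNIV f)"

definition Diff01 :: "(real \<Rightarrow> real) monoid" where
  "Diff01 = \<lparr>carrier = {\<phi>. smooth_diffeo \<phi> \<and> (\<forall>t. t \<notin> {0<..<1} \<longrightarrow> \<phi> t = t)},
             mult = (\<circ>), one = id\<rparr>"

text \<open>The restriction makes the maps extensional on \<open>(0,1)\<close>, which is what the library's
  notion of a group action on a set (\<open>group_action\<close>) requires.\<close>

definition interval_action :: "(real \<Rightarrow> real) \<Rightarrow> real \<Rightarrow> real" where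
  "interval_action \<phi> = restrict \<phi> {0<..<1}"

section \<open>Group actions on a set\<close>

definition has_global_fixed_point ::
    "('g, 'm) monoid_scheme \<Rightarrow> ('g \<Rightarrow> 'b \<Rightarrow> 'b) \<Rightarrow> 'b set \<Rightarrow> bool" where
  "has_global_fixed_point G \<alpha> E \<longleftrightarrow> (\<exists>x\<in>E. \<forall>g\<in>carrier G. \<alpha> g x = x)"

definition topologically_transitive ::
    "('g, 'm) monoid_scheme \<Rightarrow> ('g \<Rightarrow> 'b \<Rightarrow> 'b) \<Rightarrow> 'b::topological_space set \<Rightarrow> bool" where
  "topologically_transitive G \<alpha> E \<longleftrightarrow> (\<exists>x\<in>E. E \<subseteq> closure (orbit G \<alpha> x))"

section \<open>The fundamental group\<close>

text \<open>Loops are functions on all of \<open>\<real>\<close>, but only their values on \<open>[0,1]\<close> matter: two loops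
  that agree on \<open>[0,1]\<close> are homotopic in the sense below.\<close>

definition loops :: "'a topology \<Rightarrow> 'a \<Rightarrow> (real \<Rightarrow> 'a) set" where
  "loops X x0 = {p. pathin X p \<and> p 0 = x0 \<and> p 1 = x0}"

definition loop_class :: "'a topology \<Rightarrow> 'a \<Rightarrow> (real \<Rightarrow> 'a) \<Rightarrow> (real \<Rightarrow> 'a) set" where
  "loop_class X x0 p =
     {q. homotopic_with (\<lambda>r. r 0 = x0 \<and> r 1 = x0) (top_of_set {0..1}) X p q}"

text \<open>The same formula as \<open>joinpaths\<close>, which is only available for type-class topologies.\<close>

definition loop_join :: "(real \<Rightarrow> 'a) \<Rightarrow> (real \<Rightarrow> 'a) \<Rightarrow> real \<Rightarrow> 'a" where
  "loop_join p q = (\<lambda>t. if t \<le> 1/2 then p (2 * t) else q (2 * t - 1))"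

definition fundamental_group :: "'a topology \<Rightarrow> 'a \<Rightarrow> (real \<Rightarrow> 'a) set monoid" where
  "fundamental_group X x0 =
     \<lparr>carrier = loop_class X x0 ` loops X x0,
      mult = (\<lambda>A B. \<Union>p\<in>A. \<Union>q\<in>B. loop_class X x0 (loop_join p q)),
      one = loop_class X x0 (\<lambda>_. x0)\<rparr>"

section \<open>Closed orientable surfaces\<close>

definition quotient_topology :: "'a topology \<Rightarrow> ('a \<Rightarrow> 'b) \<Rightarrow> 'b topology" where
  "quotient_topology X q =
     topology (\<lambda>U. U \<subseteq> q ` topspace X \<and> openin X {x \<in> topspace X. q x \<in> U})"

lemma openin_quotient_topology:
  "openin (quotient_topology X q) U \<longleftrightarrow>
     U \<subseteq> q ` topspace X \<and> openin X {x \<in> topspace X. q x \<in> U}"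
proof -
  have "istopology (\<lambda>U. U \<subseteq> q ` topspace X \<and> openin X {x \<in> topspace X. q x \<in> U})"
    unfolding istopology_def
  proof (intro conjI allI impI, goal_cases)
    case (1 S T)
    then show ?case by blast
  next
    case (2 S T)
    have "{x \<in> topspace X. q x \<in> S \<inter> T} =
        {x \<in> topspace X. q x \<in> S} \<inter> {x \<in> topspace X. q x \<in> T}" by blast
    with 2 show ?case by (simp add: openin_Int)
  next
    case (3 \<K>)
    then show ?case by blast
  next
    case (4 \<K>)
    have "{x \<in> topspace X. q x \<in> \<Union>\<K>} = (\<Union>S\<in>\<K>. {x \<in> topspace X. q x \<in> S})" by blast
    with 4 show ?case by auto
  qed
  then show ?thesis by (simp add: quotient_topology_def)
qed

lemma topspace_quotient_topology: "topspace (quotient_topology X q) = q ` topspace X"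
proof
  show "topspace (quotient_topology X q) \<subseteq> q ` topspace X"
    using openin_topspace openin_quotient_topology by metis
  have "{x \<in> topspace X. q x \<in> q ` topspace X} = topspace X" by blast
  then have "openin (quotient_topology X q) (q ` topspace X)"
    by (simp add: openin_quotient_topology)
  then show "q ` topspace X \<subseteq> topspace (quotient_topology X q)"
    by (rule openin_subset)
qed

lemma quotient_map_quotient_topology: "quotient_map X (quotient_topology X q) q"
  by (simp add: quotient_map_def topspace_quotient_topology openin_quotient_topology)

text \<open>The closed orientable surface of genus \<open>g \<ge> 1\<close> is the standard \<open>4g\<close>-gon with boundary
  word \<open>a\<^sub>1 b\<^sub>1 a\<^sub>1\<inverse> b\<^sub>1\<inverse> \<dots> a\<^sub>g b\<^sub>g a\<^sub>g\<inverse> b\<^sub>g\<inverse>\<close> whose sides are glued accordingly.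
  The polygon is modelled by the closed unit disc; its \<open>k\<close>-th side is the arc
  parametrised by \<open>boundary_point g (k + t)\<close> for \<open>t \<in> [0,1]\<close>. In the \<open>i\<close>-th block
  (counted from 0), side \<open>4i\<close> (\<open>a\<close>) is glued to side \<open>4i + 2\<close> and side \<open>4i + 1\<close> (\<open>b\<close>) to side
  \<open>4i + 3\<close>, each with reversed direction: \<open>k + t\<close> is identified with
  \<open>(k + 2) + (1 - t) = k + 3 - t\<close>.\<close>

definition boundary_point :: "nat \<Rightarrow> real \<Rightarrow> complex" where
  "boundary_point g s = cis (2 * pi * s / (4 * real g))"

definition side_gluing :: "nat \<Rightarrow> complex rel" where
  "side_gluing g =
     {(boundary_point g (real k + t), boundary_point g (real k + 3 - t)) | k i t.
        i < g \<and> k \<in> {4 * i, 4 * i + 1} \<and> t \<in> {0..1}}"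

definition gluing_equiv :: "nat \<Rightarrow> complex rel" where
  "gluing_equiv g = (side_gluing g \<union> (side_gluing g)\<inverse>)\<^sup>*"

definition orientable_surface :: "nat \<Rightarrow> complex set topology" where
  "orientable_surface g =
     quotient_topology (top_of_set (cball 0 1)) (\<lambda>z. gluing_equiv g `` {z})"

end

theory Submission
  imports Defs "HOL-Complex_Analysis.Complex_Analysis" "HOL-Library.Countable" "HOL-Real_Asymp.Real_Asymp"
begin

text \<open>The group is generated by \<open>a, b, c, d\<close> with \<open>[a, b] = [c, d]\<close>, where \<open>a\<close> is a fixed diffeomorphism
  moving every point of \<open>(0,1)\<close> to the right and \<open>b, c, d\<close> fix the end points of the blocks
  \<open>[a\<^sup>n l, a\<^sup>n\<^sup>+\<^sup>1 l)\<close>. Pulled back to the block \<open>[l, r)\<close>, such an action is a sequence of triples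
  \<open>(b\<^sub>n, c\<^sub>n, d\<^sub>n)\<close> with \<open>b\<^sub>n\<^sub>-\<^sub>1 = [c\<^sub>n, d\<^sub>n] b\<^sub>n\<close>, so all but one \<open>b\<^sub>n\<close> can be eliminated and a word of exponent
  \<open>0\<close> in \<open>a\<close> becomes a freely reduced word in independent maps. In the closure of the finitely supported,
  blockwise analytic actions it is therefore a generic property that such a word, if not trivial in the
  surface group, is nowhere infinitely tangent to the identity inside the block, and so has isolated
  fixed points there; that the orbit of one point is dense is generic as well. The Baire category theorem
  gives an action with all these properties.

  A faithful action identifies the group with the fundamental group of the surface by the holonomy of
  the associated flat bundle: every loop is homotopic to one spelled by a word in the generators, and a
  loop of trivial holonomy is spelled by a word that is trivial in the surface group.\<close>

text \<open>The action cannot be perturbed block by block. A change of \<open>c_n\<close> or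
  \<open>d_n\<close> runs through the recursion into \<open>b_m\<close> for all
  \<open>m < n\<close>, and infinitely many nontrivial blocks accumulating at 0 need not fit
  together to a smooth map. Hence the restriction to finitely supported actions, and hence the form
  of the perturbations that make a word move a point: each is a commutator of two maps close to the
  identity, so that the error left in \<open>b\<close> is a product of such commutators up to
  conjugation. This can be absorbed by the choice of \<open>c\<close> and \<open>d\<close> in blocks
  where the action is still trivial. The second difficulty is that analyticity does not survive in
  the C-infinity closure. What survives is a consequence of it: on a compact part of the open block
  no point is infinitely tangent to the identity. This is an open condition, and by Taylor's formula
  it isolates fixed points. Words of nonzero exponent in \<open>a\<close> shift the blocks and fix
  no point of (0,1); the end points of the blocks may have large stabilisers, but they are countably
  many.\<close>

abbreviation finv :: "('a \<Rightarrow> 'b) \<Rightarrow> 'b \<Rightarrow> 'a" where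
  "finv f \<equiv> inv_into UNIV f"

section \<open>Flat bundles and their holonomy\<close>

lemma bij_comp_inv:
  fixes h :: "'c \<Rightarrow> 'c"
  assumes "bij h"
  shows "h \<circ> finv h = id" "finv h \<circ> h = id"
    "f \<circ> h \<circ> finv h = f" "f \<circ> finv h \<circ> h = f"
proof -
  show *: "h \<circ> finv h = id" "finv h \<circ> h = id"
    using assms by (auto simp: bij_is_inj bij_is_surj surj_iff[symmetric] fun_eq_iff surj_f_inv_f)
  show "f \<circ> h \<circ> finv h = f" "f \<circ> finv h \<circ> h = f"
    using * by (simp_all add: comp_assoc)
qed

lemma bij_cancel_right: "bij (h :: 'c \<Rightarrow> 'c) \<Longrightarrow> f \<circ> h = g \<circ> h \<Longrightarrow> f = g"
  by (metis bij_comp_inv(3))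

text \<open>\<open>L i x\<close> is the \<open>i\<close>-th local trivialisation at
  \<open>x\<close>, measured against a trivialisation of the fibres that need not be continuous.
  Thus only quotients of two of these maps are meaningful, and their local constancy,
  \<open>trans_L\<close>, is flatness.\<close>

locale flat_bundle =
  fixes I :: "'i set" and U :: "'i \<Rightarrow> 'x::topological_space set"
    and L :: "'i \<Rightarrow> 'x \<Rightarrow> ('c \<Rightarrow> 'c)"
  assumes open_U: "i \<in> I \<Longrightarrow> open (U i)"
    and cover_U: "\<exists>i\<in>I. x \<in> U i"
    and bij_L: "i \<in> I \<Longrightarrow> bij (L i x)"
    and trans_L: "\<lbrakk>i \<in> I; j \<in> I; x \<in> U i; x \<in> U j\<rbrakk>
      \<Longrightarrow> \<exists>V D. open V \<and> x \<in> V \<and> (\<forall>y\<in>V. L i y = D \<circ> L j y)"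
begin

definition lift_at where
  "lift_at S f g t i T \<longleftrightarrow> (\<exists>N. open N \<and> t \<in> N \<and> (\<forall>s\<in>S \<inter> N. g s = T \<circ> L i (f s)))"

text \<open>\<open>g\<close> is a parallel frame over \<open>f\<close>; on a connected domain it is
  determined up to composition on the left with a fixed bijection. An arbitrary set \<open>S\<close>
  is allowed so that one notion serves segments and rectangles.\<close>

definition flat_lift :: "('s::topological_space) set \<Rightarrow> ('s \<Rightarrow> 'x) \<Rightarrow> ('s \<Rightarrow> 'c \<Rightarrow> 'c) \<Rightarrow> bool" where
  "flat_lift S f g \<longleftrightarrow> (\<forall>t\<in>S. \<exists>i\<in>I. \<exists>T. f t \<in> U i \<and> bij T \<and> lift_at S f g t i T)"

lemma lift_at_change:
  assumes "continuous_on S f" "t \<in> S" "i \<in> I" "j \<in> I" "f t \<in> U i" "f t \<in> U j"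
    "bij T" "lift_at S f g t i T"
  shows "\<exists>T'. bij T' \<and> lift_at S f g t j T'"
proof -
  obtain V D where V: "open V" "f t \<in> V" "\<forall>y\<in>V. L i y = D \<circ> L j y"
    using trans_L assms by metis
  have "bij D"
  proof -
    have "D = L i (f t) \<circ> finv (L j (f t))"
      using V bij_L[OF assms(4)] by (auto simp: bij_comp_inv comp_assoc)
    then show ?thesis using bij_L assms by (simp add: bij_comp bij_imp_bij_inv)
  qed
  obtain N where N: "open N" "t \<in> N" "\<forall>s\<in>S \<inter> N. g s = T \<circ> L i (f s)"
    using assms(8) lift_at_def by metis
  obtain M where M: "open M" "M \<inter> S = f -` V \<inter> S"
    using assms(1) V(1) continuous_on_open_invariant by metis
  have "f s \<in> V" if "s \<in> S" "s \<in> M" for s using M(2) that by blast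
  then have "\<forall>s\<in>S \<inter> (N \<inter> M). g s = (T \<circ> D) \<circ> L j (f s)"
    using N(3) V(3) by (simp add: comp_assoc)
  moreover have "t \<in> N \<inter> M" "open (N \<inter> M)" using N M V assms by auto
  ultimately show ?thesis unfolding lift_at_def using bij_comp[OF \<open>bij D\<close> \<open>bij T\<close>] by blast
qed

lemma flat_lift_at:
  assumes "flat_lift S f g" "continuous_on S f" "t \<in> S" "j \<in> I" "f t \<in> U j"
  shows "\<exists>T. bij T \<and> lift_at S f g t j T"
  using assms lift_at_change unfolding flat_lift_def by blast

lemma flat_lift_bij:
  assumes "flat_lift S f g" "t \<in> S"
  shows "bij (g t)"
proof -
  obtain i T where "i \<in> I" "bij T" "lift_at S f g t i T" using assms unfolding flat_lift_def by blast
  then show ?thesis using assms(2) bij_L bij_comp unfolding lift_at_def by (metis IntI)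
qed

lemma flat_lift_cell:
  assumes "i \<in> I" "\<And>s. s \<in> S \<Longrightarrow> f s \<in> U i" "bij T"
  shows "flat_lift S f (\<lambda>s. T \<circ> L i (f s))"
  unfolding flat_lift_def lift_at_def using assms by (metis open_UNIV UNIV_I)

lemma flat_lift_translate:
  assumes "flat_lift S f g" "bij T"
  shows "flat_lift S f (\<lambda>s. T \<circ> g s)"
  unfolding flat_lift_def
proof
  fix t assume "t \<in> S"
  then obtain i T' where i: "i \<in> I" "f t \<in> U i" "bij T'" "lift_at S f g t i T'"
    using assms unfolding flat_lift_def by blast
  then obtain N where "open N" "t \<in> N" "\<forall>s\<in>S \<inter> N. g s = T' \<circ> L i (f s)"
    unfolding lift_at_def by blast
  then have "lift_at S f (\<lambda>s. T \<circ> g s) t i (T \<circ> T')"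
    unfolding lift_at_def by (intro exI[of _ N]) (simp add: comp_assoc)
  then show "\<exists>i\<in>I. \<exists>T'. f t \<in> U i \<and> bij T' \<and> lift_at S f (\<lambda>s. T \<circ> g s) t i T'"
    using i assms(2) bij_comp by blast
qed

lemma flat_lift_reparam:
  assumes g: "flat_lift S f g" and h: "continuous_on S' h" "h ` S' \<subseteq> S"
    and f': "\<And>s. s \<in> S' \<Longrightarrow> f' s = f (h s)"
  shows "flat_lift S' f' (g \<circ> h)"
  unfolding flat_lift_def
proof
  fix t assume t: "t \<in> S'"
  then have "h t \<in> S" using h(2) by blast
  then obtain i T where "i \<in> I" "f (h t) \<in> U i" "bij T" "lift_at S f g (h t) i T"
    using g unfolding flat_lift_def by blast
  then obtain N where i: "i \<in> I" "f (h t) \<in> U i" "bij T" "open N" "h t \<in> N"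
    "\<forall>s\<in>S \<inter> N. g s = T \<circ> L i (f s)"
    unfolding lift_at_def by blast
  obtain M where M: "open M" "M \<inter> S' = h -` N \<inter> S'"
    using h(1) i(4) continuous_on_open_invariant by metis
  have "\<forall>s\<in>S' \<inter> M. (g \<circ> h) s = T \<circ> L i (f' s)"
  proof
    fix s assume s: "s \<in> S' \<inter> M"
    then have "h s \<in> S \<inter> N" using M(2) h(2) by blast
    then show "(g \<circ> h) s = T \<circ> L i (f' s)" using i(6) f' s by simp
  qed
  moreover have "t \<in> M" using M t i by auto
  ultimately have "lift_at S' f' (g \<circ> h) t i T"
    unfolding lift_at_def using M(1) by (intro exI[of _ M]) auto
  then show "\<exists>i\<in>I. \<exists>T. f' t \<in> U i \<and> bij T \<and> lift_at S' f' (g \<circ> h) t i T"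
    using i f'[OF t] by (intro bexI[of _ i] exI[of _ T]) auto
qed

lemma flat_lift_subset:
  assumes "flat_lift S f g" "S' \<subseteq> S"
  shows "flat_lift S' f g"
proof -
  have "flat_lift S' f (g \<circ> id)"
    by (rule flat_lift_reparam[OF assms(1)]) (use assms(2) in auto)
  then show ?thesis by simp
qed

text \<open>Near each point both lifts have the form \<open>T \<circ> L i (f s)\<close> in the same
  chart, so the factor \<open>L i (f s)\<close> cancels from the quotient, which is therefore
  locally constant.\<close>

lemma flat_lift_unique:
  assumes "connected S" "continuous_on S f" "flat_lift S f g" "flat_lift S f g'"
    "s \<in> S" "t \<in> S"
  shows "g' s \<circ> finv (g s) = g' t \<circ> finv (g t)"
proof (rule connected_local_const[OF assms(1,5,6)], intro ballI)
  fix a assume a: "a \<in> S"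
  obtain i T where i: "i \<in> I" "f a \<in> U i" "bij T" "lift_at S f g a i T"
    using assms(3) a unfolding flat_lift_def by blast
  obtain T' where T': "bij T'" "lift_at S f g' a i T'"
    using flat_lift_at[OF assms(4,2) a i(1,2)] by blast
  obtain N where N: "open N" "a \<in> N" "\<forall>s\<in>S \<inter> N. g s = T \<circ> L i (f s)"
    using i(4) lift_at_def by metis
  obtain N' where N': "open N'" "a \<in> N'" "\<forall>s\<in>S \<inter> N'. g' s = T' \<circ> L i (f s)"
    using T'(2) lift_at_def by metis
  have eq: "g' s \<circ> finv (g s) = T' \<circ> finv T" if "s \<in> S \<inter> (N \<inter> N')" for s
  proof -
    have "bij (L i (f s))" using bij_L i(1) by blast
    moreover have "g s = T \<circ> L i (f s)" "g' s = T' \<circ> L i (f s)" using N N' that by auto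
    ultimately show ?thesis using i(3) by (simp add: o_inv_distrib o_assoc bij_comp_inv)
  qed
  show "\<forall>\<^sub>F b in at a within S. g' a \<circ> finv (g a) = g' b \<circ> finv (g b)"
    unfolding eventually_at_topological
    using N N' eq a by (intro exI[of _ "N \<inter> N'"]) auto
qed

lemma flat_lift_unique':
  assumes "connected S" "continuous_on S f" "flat_lift S f g" "flat_lift S f g'" "S \<noteq> {}"
  obtains T where "bij T" "\<And>s. s \<in> S \<Longrightarrow> g' s = T \<circ> g s"
proof -
  obtain t where t: "t \<in> S" using assms by blast
  have bij: "bij (g t)" "bij (g' t)" using assms flat_lift_bij t by auto
  show ?thesis
  proof (rule that)
    show "bij (g' t \<circ> finv (g t))" using bij by (simp add: bij_comp bij_imp_bij_inv)
    show "g' s = (g' t \<circ> finv (g t)) \<circ> g s" if s: "s \<in> S" for s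
    proof -
      have "g' s \<circ> finv (g s) \<circ> g s = g' t \<circ> finv (g t) \<circ> g s"
        using flat_lift_unique[OF assms(1-4) s t] by simp
      then show ?thesis using flat_lift_bij[OF assms(3) s] by (simp add: bij_comp_inv)
    qed
  qed
qed

text \<open>On the connected overlap the two lifts differ by one bijection \<open>T\<close>, and
  translating \<open>g2\<close> by it makes them agree there. Closedness serves the points that lie
  in only one of the sets: they have a neighbourhood missing the other.\<close>

lemma flat_lift_glue:
  assumes cl: "closed S1" "closed S2" and con: "connected (S1 \<inter> S2)" "S1 \<inter> S2 \<noteq> {}"
    and f: "continuous_on (S1 \<union> S2) f"
    and g1: "flat_lift S1 f g1" and g2: "flat_lift S2 f g2"
  obtains g T where "flat_lift (S1 \<union> S2) f g" "bij T" "\<And>s. s \<in> S1 \<Longrightarrow> g s = g1 s"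
    "\<And>s. s \<in> S2 \<Longrightarrow> g s = T \<circ> g2 s"
proof -
  have cont: "continuous_on S1 f" "continuous_on S2 f" "continuous_on (S1 \<inter> S2) f"
    using f continuous_on_subset by blast+
  obtain T where T: "bij T" "\<And>s. s \<in> S1 \<inter> S2 \<Longrightarrow> g1 s = T \<circ> g2 s"
    using flat_lift_unique'[OF con(1) cont(3) flat_lift_subset[OF g2] flat_lift_subset[OF g1] con(2)]
    by blast
  define g3 where "g3 s = T \<circ> g2 s" for s
  have g3: "flat_lift S2 f g3" unfolding g3_def by (rule flat_lift_translate[OF g2 T(1)])
  define g where "g s = (if s \<in> S1 then g1 s else g3 s)" for s
  have gS: "s \<in> S1 \<Longrightarrow> g s = g1 s" "s \<in> S2 \<Longrightarrow> g s = g3 s" for s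
    using T(2) by (auto simp: g_def g3_def)
  have "flat_lift (S1 \<union> S2) f g"
    unfolding flat_lift_def
  proof
    fix t assume t: "t \<in> S1 \<union> S2"
    obtain i where i: "i \<in> I" "f t \<in> U i" using cover_U by blast
    have 1: "\<exists>T1 N. bij T1 \<and> open N \<and> t \<in> N \<and> (\<forall>s\<in>S1 \<inter> N. g s = T1 \<circ> L i (f s))" if "t \<in> S1"
      using flat_lift_at[OF g1 cont(1) that i] gS unfolding lift_at_def by (metis IntD1)
    have 2: "\<exists>T1 N. bij T1 \<and> open N \<and> t \<in> N \<and> (\<forall>s\<in>S2 \<inter> N. g s = T1 \<circ> L i (f s))" if "t \<in> S2"
      using flat_lift_at[OF g3 cont(2) that i] gS unfolding lift_at_def by (metis IntD1)
    have "\<exists>T N. bij T \<and> open N \<and> t \<in> N \<and> (\<forall>s\<in>(S1 \<union> S2) \<inter> N. g s = T \<circ> L i (f s))"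
    proof (cases "t \<in> S1 \<and> t \<in> S2")
      case True
      obtain T1 N1 where N1: "bij T1" "open N1" "t \<in> N1" "\<forall>s\<in>S1 \<inter> N1. g s = T1 \<circ> L i (f s)"
        using 1 True by blast
      obtain T2 N2 where N2: "bij T2" "open N2" "t \<in> N2" "\<forall>s\<in>S2 \<inter> N2. g s = T2 \<circ> L i (f s)"
        using 2 True by blast
      have "T1 \<circ> L i (f t) = T2 \<circ> L i (f t)" using N1 N2 True by (metis IntI)
      then have "T1 = T2" using bij_cancel_right bij_L i(1) by blast
      then show ?thesis using N1 N2 by (intro exI[of _ T1] exI[of _ "N1 \<inter> N2"]) auto
    next
      case False
      then consider "t \<in> S1" "t \<notin> S2" | "t \<in> S2" "t \<notin> S1" using t by blast
      then show ?thesis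
      proof cases
        case a: 1
        obtain T1 N1 where N1: "bij T1" "open N1" "t \<in> N1" "\<forall>s\<in>S1 \<inter> N1. g s = T1 \<circ> L i (f s)"
          using 1 a by blast
        then show ?thesis using a cl by (intro exI[of _ T1] exI[of _ "N1 \<inter> -S2"]) auto
      next
        case a: 2
        obtain T1 N1 where N1: "bij T1" "open N1" "t \<in> N1" "\<forall>s\<in>S2 \<inter> N1. g s = T1 \<circ> L i (f s)"
          using 2 a by blast
        then show ?thesis using a cl by (intro exI[of _ T1] exI[of _ "N1 \<inter> -S1"]) auto
      qed
    qed
    then show "\<exists>i\<in>I. \<exists>T. f t \<in> U i \<and> bij T \<and> lift_at (S1 \<union> S2) f g t i T"
      unfolding lift_at_def using i by blast
  qed
  then show ?thesis using that T(1) gS g3_def by metis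
qed

text \<open>Bisection in the first coordinate replaces a Lebesgue number: rectangles inside one
  chart lift, and two lifted neighbours are glued along a vertical segment, at the cost of the
  smaller of their heights. The second coordinate is treated in the same way in the next
  lemma.\<close>

lemma flat_lift_strip_exists:
  fixes f :: "real \<times> real \<Rightarrow> 'x"
  assumes f: "continuous_on ({a..b} \<times> {c..d}) f" and y: "y \<in> {c..d}" and ab: "a \<le> b"
  shows "\<exists>e>0. \<forall>c' d'. c \<le> c' \<and> c' \<le> y \<and> y \<le> d' \<and> d' \<le> d \<and> d' - c' < e \<longrightarrow>
     (\<exists>g. flat_lift ({a..b} \<times> {c'..d'}) f g)"
proof -
  let ?P = "\<lambda>a' b'. a \<le> a' \<longrightarrow> b' \<le> b \<longrightarrow> (\<exists>e>0. \<forall>c' d'. c \<le> c' \<and> c' \<le> y \<and> y \<le> d' \<and> d' \<le> d \<and> d' - c' < e \<longrightarrow>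
     (\<exists>g. flat_lift ({a'..b'} \<times> {c'..d'}) f g))"
  have "?P a b" using ab
  proof (rule Bolzano[where P = "?P"])
    fix x1 x2 x3 assume P: "?P x1 x2" "?P x2 x3" and le: "x1 \<le> x2" "x2 \<le> x3"
    show "?P x1 x3"
    proof (intro impI)
      assume ab': "a \<le> x1" "x3 \<le> b"
      obtain e1 where e1: "e1 > 0" "\<And>c' d'. \<lbrakk>c \<le> c'; c' \<le> y; y \<le> d'; d' \<le> d; d' - c' < e1\<rbrakk> \<Longrightarrow>
         (\<exists>g. flat_lift ({x1..x2} \<times> {c'..d'}) f g)" using P(1) ab' le by auto
      obtain e2 where e2: "e2 > 0" "\<And>c' d'. \<lbrakk>c \<le> c'; c' \<le> y; y \<le> d'; d' \<le> d; d' - c' < e2\<rbrakk> \<Longrightarrow>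
         (\<exists>g. flat_lift ({x2..x3} \<times> {c'..d'}) f g)" using P(2) ab' le by auto
      show "\<exists>e>0. \<forall>c' d'. c \<le> c' \<and> c' \<le> y \<and> y \<le> d' \<and> d' \<le> d \<and> d' - c' < e \<longrightarrow>
         (\<exists>g. flat_lift ({x1..x3} \<times> {c'..d'}) f g)"
      proof (intro exI[of _ "min e1 e2"] conjI allI impI, goal_cases)
        case 1 then show ?case using e1 e2 by simp
      next
        case (2 c' d')
        obtain g1 where g1: "flat_lift ({x1..x2} \<times> {c'..d'}) f g1" using e1 2 by auto
        obtain g2 where g2: "flat_lift ({x2..x3} \<times> {c'..d'}) f g2" using e2 2 by auto
        have I: "({x1..x2} \<times> {c'..d'}) \<inter> ({x2..x3} \<times> {c'..d'}) = {x2} \<times> {c'..d'}" using le by auto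
        have Un: "({x1..x2} \<times> {c'..d'}) \<union> ({x2..x3} \<times> {c'..d'}) = {x1..x3} \<times> {c'..d'}" using le by auto
        have cont: "continuous_on ({x1..x3} \<times> {c'..d'}) f"
          by (rule continuous_on_subset[OF f]) (use ab' 2 in auto)
        have cl: "closed ({x1..x2} \<times> {c'..d'})" "closed ({x2..x3} \<times> {c'..d'})"
          "connected ({x2} \<times> {c'..d'})" "{x2} \<times> {c'..d'} \<noteq> {}"
          using 2 by (auto simp: closed_Times connected_Times)
        show ?case
          by (rule flat_lift_glue[OF _ _ _ _ _ g1 g2, unfolded I Un, OF cl cont]) (rule exI)
      qed
    qed
  next
    fix x assume x: "a \<le> x" "x \<le> b"
    obtain i where i: "i \<in> I" "f (x, y) \<in> U i" using cover_U by blast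
    obtain M where M: "open M" "M \<inter> ({a..b} \<times> {c..d}) = f -` (U i) \<inter> ({a..b} \<times> {c..d})"
      using f open_U[OF i(1)] continuous_on_open_invariant by metis
    have "(x, y) \<in> M" using M x y i by auto
    then obtain A B where AB: "open A" "open B" "x \<in> A" "y \<in> B" "A \<times> B \<subseteq> M"
      using M(1) open_prod_elim by (metis mem_Sigma_iff)
    obtain e1 where e1: "e1 > 0" "ball x e1 \<subseteq> A" using AB openE by blast
    obtain e2 where e2: "e2 > 0" "ball y e2 \<subseteq> B" using AB openE by blast
    show "\<exists>d'>0. \<forall>a' b'. a' \<le> x \<and> x \<le> b' \<and> b' - a' < d' \<longrightarrow> ?P a' b'"
    proof (rule exI[of _ e1], intro conjI allI impI, goal_cases)
      case 1 then show ?case using e1 by simp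
    next
      case (2 a' b')
      show ?case
      proof (intro exI[of _ e2] conjI allI impI, goal_cases)
        case 1 then show ?case using e2 by simp
      next
        case (2 c' d')
        have "{a'..b'} \<subseteq> A" using e1 \<open>a' \<le> x \<and> x \<le> b' \<and> b' - a' < e1\<close> by (auto simp: dist_real_def subset_iff)
        moreover have "{c'..d'} \<subseteq> B" using e2 2 by (auto simp: dist_real_def subset_iff)
        ultimately have "{a'..b'} \<times> {c'..d'} \<subseteq> M \<inter> ({a..b} \<times> {c..d})"
          using AB(5) \<open>a \<le> a'\<close> \<open>b' \<le> b\<close> 2 by (auto simp: subset_iff)
        then have "\<And>s. s \<in> {a'..b'} \<times> {c'..d'} \<Longrightarrow> f s \<in> U i" using M(2) by auto
        then show ?case using flat_lift_cell[OF i(1) _ bij_id] by blast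
      qed
    qed
  qed
  then show ?thesis by simp
qed

lemma flat_lift_rectangle_exists:
  fixes f :: "real \<times> real \<Rightarrow> 'x"
  assumes f: "continuous_on ({a..b} \<times> {c..d}) f" and ab: "a \<le> b" and cd: "c \<le> d"
  shows "\<exists>g. flat_lift ({a..b} \<times> {c..d}) f g"
proof -
  let ?P = "\<lambda>c' d'. c \<le> c' \<longrightarrow> d' \<le> d \<longrightarrow> (\<exists>g. flat_lift ({a..b} \<times> {c'..d'}) f g)"
  have "?P c d" using cd
  proof (rule Bolzano[where P = "?P"])
    fix x1 x2 x3 assume P: "?P x1 x2" "?P x2 x3" and le: "x1 \<le> x2" "x2 \<le> x3"
    show "?P x1 x3"
    proof (intro impI)
      assume cd': "c \<le> x1" "x3 \<le> d"
      obtain g1 where g1: "flat_lift ({a..b} \<times> {x1..x2}) f g1" using P cd' le by auto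
      obtain g2 where g2: "flat_lift ({a..b} \<times> {x2..x3}) f g2" using P cd' le by auto
      have I: "({a..b} \<times> {x1..x2}) \<inter> ({a..b} \<times> {x2..x3}) = {a..b} \<times> {x2}" using le by auto
      have Un: "({a..b} \<times> {x1..x2}) \<union> ({a..b} \<times> {x2..x3}) = {a..b} \<times> {x1..x3}" using le by auto
      have cont: "continuous_on ({a..b} \<times> {x1..x3}) f"
        by (rule continuous_on_subset[OF f]) (use cd' in auto)
      have cl: "closed ({a..b} \<times> {x1..x2})" "closed ({a..b} \<times> {x2..x3})"
          "connected ({a..b} \<times> {x2})" "{a..b} \<times> {x2} \<noteq> {}"
        using ab by (auto simp: closed_Times connected_Times)
      show "\<exists>g. flat_lift ({a..b} \<times> {x1..x3}) f g"
        by (rule flat_lift_glue[OF _ _ _ _ _ g1 g2, unfolded I Un, OF cl cont]) (rule exI)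
    qed
  next
    fix y assume "c \<le> y" "y \<le> d"
    then show "\<exists>e>0. \<forall>c' d'. c' \<le> y \<and> y \<le> d' \<and> d' - c' < e \<longrightarrow> ?P c' d'"
      using flat_lift_strip_exists[OF f _ ab, of y] by auto
  qed
  then show ?thesis by simp
qed

text \<open>The factor \<open>finv (g 0)\<close> cancels the left translation by which lifts may
  differ. With this order, joined paths have the composed holonomies in the same order, which gives
  a homomorphism and not an antihomomorphism.\<close>

definition holonomy :: "(real \<Rightarrow> 'x) \<Rightarrow> ('c \<Rightarrow> 'c) \<Rightarrow> bool" where
  "holonomy p T \<longleftrightarrow> (\<exists>g. flat_lift {0..1} p g \<and> T = finv (g 0) \<circ> g 1)"

lemma holonomy_unique:
  assumes "path p" "holonomy p T" "holonomy p T'"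
  shows "T = T'"
proof -
  obtain g g' where g: "flat_lift {0..1} p g" "T = finv (g 0) \<circ> g 1"
    and g': "flat_lift {0..1} p g'" "T' = finv (g' 0) \<circ> g' 1"
    using assms unfolding holonomy_def by blast
  obtain D where D: "bij D" "\<And>s. s \<in> {0..1} \<Longrightarrow> g' s = D \<circ> g s"
    using flat_lift_unique'[OF _ _ g(1) g'(1)] assms(1) by (auto simp: path_def)
  have "bij (g 0)" using flat_lift_bij[OF g(1)] by simp
  then have "finv (D \<circ> g 0) \<circ> (D \<circ> g 1) = finv (g 0) \<circ> g 1"
    using D(1) by (simp add: o_inv_distrib o_assoc bij_comp_inv)
  then show ?thesis using g(2) g'(2) D(2) by simp
qed

lemma holonomy_cell:
  assumes "i \<in> I" "path_image p \<subseteq> U i"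
  shows "holonomy p (finv (L i (pathstart p)) \<circ> L i (pathfinish p))"
  unfolding holonomy_def pathstart_def pathfinish_def
proof -
  have "flat_lift {0..1} p (\<lambda>s. id \<circ> L i (p s))"
    by (rule flat_lift_cell[OF assms(1) _ bij_id]) (use assms(2) in \<open>auto simp: path_image_def\<close>)
  then show "\<exists>g. flat_lift {0..1} p g \<and> finv (L i (p 0)) \<circ> L i (p 1) = finv (g 0) \<circ> g 1"
    by (intro exI[of _ "\<lambda>s. id \<circ> L i (p s)"]) simp
qed

lemma holonomy_join:
  assumes p: "path p" "path q" "pathfinish p = pathstart q"
    and h: "holonomy p T" "holonomy q T'"
  shows "holonomy (p +++ q) (T \<circ> T')"
proof -
  obtain g g' where g: "flat_lift {0..1} p g" "T = finv (g 0) \<circ> g 1"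
    and g': "flat_lift {0..1} q g'" "T' = finv (g' 0) \<circ> g' 1"
    using h unfolding holonomy_def by blast
  have 1: "flat_lift {0..1/2} (p +++ q) (g \<circ> (\<lambda>t. 2 * t))"
    by (rule flat_lift_reparam[OF g(1)]) (auto intro!: continuous_intros simp: joinpaths_def)
  have eq: "(p +++ q) s = q (2 * s - 1)" if "s \<in> {1/2..1}" for s
  proof (cases "s = 1/2")
    case True
    show ?thesis unfolding True using p(3) by (simp add: joinpaths_def pathstart_def pathfinish_def)
  next
    case False
    then show ?thesis using that by (simp add: joinpaths_def)
  qed
  have 2: "flat_lift {1/2..1} (p +++ q) (g' \<circ> (\<lambda>t. 2 * t - 1))"
    by (rule flat_lift_reparam[OF g'(1) _ _ eq]) (auto intro!: continuous_intros)
  have Un: "{0..1/2} \<union> {1/2..1} = {0..1::real}" and I: "{0..1/2} \<inter> {1/2..1} = {1/2::real}" by auto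
  have cont: "continuous_on {0..1} (p +++ q)" using p by (simp flip: path_def)
  obtain G D where G: "flat_lift {0..1} (p +++ q) G" "bij D" "\<And>s. s \<in> {0..1/2} \<Longrightarrow> G s = g (2 * s)"
    "\<And>s. s \<in> {1/2..1} \<Longrightarrow> G s = D \<circ> g' (2 * s - 1)"
  proof (rule flat_lift_glue[OF _ _ _ _ _ 1 2, unfolded Un I, OF closed_atLeastAtMost closed_atLeastAtMost
      connected_sing insert_not_empty cont], goal_cases)
    case (1 g T)
    then show ?case using that[of g T] by simp
  qed
  have G0: "G 0 = g 0" "G 1 = D \<circ> g' 1" using G(3)[of 0] G(4)[of 1] by auto
  have "g 1 = D \<circ> g' 0" using G(3)[of "1/2"] G(4)[of "1/2"] by simp
  moreover have "bij (g' 0)" using flat_lift_bij[OF g'(1)] by simp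
  ultimately have "T \<circ> T' = finv (G 0) \<circ> G 1"
    using g(2) g'(2) G0 by (simp add: o_assoc bij_comp_inv)
  then show ?thesis unfolding holonomy_def using G(1) by blast
qed

lemma holonomy_const:
  assumes "holonomy p T" "\<And>t. t \<in> {0..1} \<Longrightarrow> p t = x"
  shows "T = id"
proof -
  have "path p" using assms(2) unfolding path_def
    by (metis continuous_on_cong continuous_on_const)
  moreover obtain i where i: "i \<in> I" "x \<in> U i" using cover_U by blast
  then have "holonomy p (finv (L i (pathstart p)) \<circ> L i (pathfinish p))"
    using assms(2) by (intro holonomy_cell[OF i(1)]) (auto simp: path_image_def)
  ultimately have "T = finv (L i x) \<circ> L i x"
    using holonomy_unique[OF _ assms(1)] assms(2) by (simp add: pathstart_def pathfinish_def)
  then show ?thesis using bij_L[OF i(1)] by (simp add: bij_comp_inv)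
qed

text \<open>The whole square is lifted. On the two sides where the homotopy fixes an end point the
  path is constant and has trivial holonomy, so \<open>G\<close> takes equal values at the corners
  that such a side joins.\<close>

lemma holonomy_homotopic:
  assumes hom: "homotopic_paths UNIV p q" and T: "holonomy p T"
  shows "holonomy q T"
proof -
  obtain h where h: "continuous_on ({0..1} \<times> {0..1}) h" "\<forall>x \<in> {0..1}. h(0,x) = p x"
     "\<forall>x \<in> {0..1}. h(1,x) = q x"
     "\<forall>t \<in> {0..1::real}. h (t, 0) = pathstart p \<and> h (t, 1) = pathfinish p"
    using hom unfolding homotopic_paths by (auto simp: pathstart_def pathfinish_def)
  obtain G where G: "flat_lift ({0..1} \<times> {0..1}) h G"
    using flat_lift_rectangle_exists[OF h(1)] by auto
  have P: "flat_lift {0..1} p (G \<circ> (\<lambda>x. (0, x)))"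
    by (rule flat_lift_reparam[OF G]) (use h(2) in \<open>auto intro!: continuous_intros\<close>)
  have Q: "flat_lift {0..1} q (G \<circ> (\<lambda>x. (1, x)))"
    by (rule flat_lift_reparam[OF G]) (use h(3) in \<open>auto intro!: continuous_intros\<close>)
  have side: "G (0, x) = G (1, x)" if x: "x = 0 \<or> x = 1" for x
  proof -
    have "flat_lift {0..1} (\<lambda>t. h (t, x)) (G \<circ> (\<lambda>t. (t, x)))"
      by (rule flat_lift_reparam[OF G]) (use x in \<open>auto intro!: continuous_intros\<close>)
    then have "holonomy (\<lambda>t. h (t, x)) (finv (G (0, x)) \<circ> G (1, x))"
      unfolding holonomy_def by force
    then have "finv (G (0, x)) \<circ> G (1, x) = id"
      by (rule holonomy_const[where x = "h (0, x)"]) (use h(4) x in auto)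
    moreover have "bij (G (0, x))" using flat_lift_bij[OF G] x by force
    ultimately show ?thesis
      by (metis bij_comp_inv(1) comp_assoc comp_id id_comp)
  qed
  have "holonomy p (finv (G (0,0)) \<circ> G (0,1))" using P unfolding holonomy_def by force
  then have "T = finv (G (0,0)) \<circ> G (0,1)"
    using holonomy_unique T hom homotopic_paths_imp_path by blast
  then have "T = finv (G (1,0)) \<circ> G (1,1)" using side by simp
  then show ?thesis using Q unfolding holonomy_def by force
qed

end

section \<open>Words in the surface group and their normal form\<close>

datatype gen = GA | GB | GC | GD

type_synonym gword = "(gen \<times> bool) list"

definition ilet :: "gen \<times> bool \<Rightarrow> gen \<times> bool" where
  "ilet l = (fst l, \<not> snd l)"

definition winv :: "gword \<Rightarrow> gword" where
  "winv w = rev (map ilet w)"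

text \<open>This is \<open>[a, b] [d, c]\<close>, equivalent to the relation
  \<open>[a, b] = [c, d]\<close>. Its letters stand in the order in which the sides of the octagon
  are crossed on a walk round the vertex of the surface.\<close>

definition surface_relator :: gword where
  "surface_relator = [(GA,True),(GB,True),(GA,False),(GB,False),
     (GD,True),(GC,True),(GD,False),(GC,False)]"

inductive weq :: "gword \<Rightarrow> gword \<Rightarrow> bool" where
  weq_refl: "weq w w"
| weq_sym: "weq u v \<Longrightarrow> weq v u"
| weq_trans: "weq u v \<Longrightarrow> weq v w \<Longrightarrow> weq u w"
| weq_cancel: "weq (u @ [l, ilet l] @ v) (u @ v)"
| weq_relator: "weq (u @ surface_relator @ v) (u @ v)"

lemma ilet_ilet [simp]: "ilet (ilet l) = l"
  by (simp add: ilet_def)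

lemma winv_simps [simp]: "winv [] = []" "winv (u @ v) = winv v @ winv u" "winv (winv u) = u"
  "winv (l # u) = winv u @ [ilet l]"
  by (simp_all add: winv_def rev_map o_def)

lemma weq_ctxt: "weq u v \<Longrightarrow> weq (x @ u @ y) (x @ v @ y)"
proof (induction rule: weq.induct)
  case (weq_cancel u l v)
  show ?case using weq.weq_cancel[of "x @ u" l "v @ y"] by simp
next
  case (weq_relator u v)
  show ?case using weq.weq_relator[of "x @ u" "v @ y"] by simp
qed (blast intro: weq.intros)+

lemma weq_append: "weq u v \<Longrightarrow> weq u' v' \<Longrightarrow> weq (u @ u') (v @ v')"
  using weq_ctxt[of u v "[]" u'] weq_ctxt[of u' v' v "[]"] weq_trans by auto

lemma weq_right_inv: "weq (u @ winv u) []"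
proof (induction u)
  case (Cons l u)
  have "weq ([l] @ (u @ winv u) @ [ilet l]) ([l] @ [] @ [ilet l])"
    using Cons weq_ctxt by blast
  moreover have "weq [l, ilet l] []" using weq_cancel[of "[]" l "[]"] by simp
  ultimately show ?case using weq_trans by fastforce
qed (simp add: weq_refl)

lemma weq_left_inv: "weq (winv u @ u) []"
  using weq_right_inv[of "winv u"] by simp

lemma weq_cancel_inv: "weq (x @ u @ winv u @ y) (x @ y)" "weq (x @ winv u @ u @ y) (x @ y)"
  using weq_ctxt[OF weq_right_inv, of x u y] weq_ctxt[OF weq_left_inv, of x u y] by simp_all

lemma weq_winv: "weq u v \<Longrightarrow> weq (winv u) (winv v)"
proof -
  assume a: "weq u v"
  have "weq (winv u @ v @ winv v) (winv u @ u @ winv v)"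
    by (rule weq_ctxt[OF weq_sym[OF a]])
  then show ?thesis
    using weq_cancel_inv(1)[of "winv u" v "[]"] weq_cancel_inv(2)[of "[]" u "winv v"]
    by (metis append.left_neutral append.right_neutral weq_sym weq_trans)
qed

subsection \<open>Evaluation\<close>

definition evl :: "(gen \<Rightarrow> 'c \<Rightarrow> 'c) \<Rightarrow> gen \<times> bool \<Rightarrow> 'c \<Rightarrow> 'c" where
  "evl \<phi> l = (if snd l then \<phi> (fst l) else finv (\<phi> (fst l)))"

definition ev :: "(gen \<Rightarrow> 'c \<Rightarrow> 'c) \<Rightarrow> gword \<Rightarrow> 'c \<Rightarrow> 'c" where
  "ev \<phi> w = foldr (\<lambda>l f. evl \<phi> l \<circ> f) w id"

lemma ev_simps [simp]: "ev \<phi> [] = id" "ev \<phi> (l # w) = evl \<phi> l \<circ> ev \<phi> w"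
  by (simp_all add: ev_def)

lemma ev_append: "ev \<phi> (u @ v) = ev \<phi> u \<circ> ev \<phi> v"
  by (induction u) (simp_all add: comp_assoc)

lemma bij_evl: "(\<And>x. bij (\<phi> x)) \<Longrightarrow> bij (evl \<phi> l)"
  by (simp add: evl_def bij_imp_bij_inv)

lemma bij_ev: "(\<And>x. bij (\<phi> x)) \<Longrightarrow> bij (ev \<phi> w)"
  by (induction w) (simp_all add: bij_evl bij_comp)

lemma evl_ilet: "(\<And>x. bij (\<phi> x)) \<Longrightarrow> evl \<phi> (ilet l) = finv (evl \<phi> l)"
  by (simp add: evl_def ilet_def inv_inv_eq)

lemma ev_winv:
  assumes "\<And>x. bij (\<phi> x)"
  shows "ev \<phi> (winv w) = finv (ev \<phi> w)"
proof (induction w)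
  case (Cons l w)
  have "ev \<phi> (winv (l # w)) = finv (ev \<phi> w) \<circ> finv (evl \<phi> l)"
    by (simp add: ev_append evl_ilet assms Cons)
  also have "\<dots> = finv (evl \<phi> l \<circ> ev \<phi> w)"
    by (rule o_inv_distrib[symmetric]) (simp_all add: bij_evl bij_ev assms)
  finally show ?case by (simp only: ev_simps)
qed simp

lemma ev_weq:
  assumes bij: "\<And>x. bij (\<phi> x)" and rel: "\<phi> GA \<circ> \<phi> GB \<circ> finv (\<phi> GA) \<circ> finv (\<phi> GB)
    = \<phi> GC \<circ> \<phi> GD \<circ> finv (\<phi> GC) \<circ> finv (\<phi> GD)"
  shows "weq u v \<Longrightarrow> ev \<phi> u = ev \<phi> v"
proof (induction rule: weq.induct)
  case (weq_cancel u l v)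
  have "evl \<phi> l \<circ> evl \<phi> (ilet l) = id"
    using bij_evl[of \<phi> l] bij by (simp add: evl_ilet bij_comp_inv)
  then show ?case by (simp add: ev_append o_assoc)
next
  case (weq_relator u v)
  have "ev \<phi> surface_relator = (\<phi> GA \<circ> \<phi> GB \<circ> finv (\<phi> GA) \<circ> finv (\<phi> GB)) \<circ>
    (\<phi> GD \<circ> \<phi> GC \<circ> finv (\<phi> GD) \<circ> finv (\<phi> GC))"
    by (simp add: surface_relator_def evl_def o_assoc)
  also have "\<dots> = id"
    unfolding rel using bij by (simp add: o_assoc bij_comp_inv)
  finally show ?case by (simp add: ev_append)
qed simp_all

subsection \<open>Conjugates by powers of the first generator\<close>

definition apow :: "int \<Rightarrow> gword" where
  "apow k = replicate (nat \<bar>k\<bar>) (GA, k \<ge> 0)"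

lemma apow_0 [simp]: "apow 0 = []" by (simp add: apow_def)

lemma apow_minus: "apow (- k) = winv (apow k)"
  by (cases "k = 0") (auto simp: apow_def winv_def ilet_def)

lemma apow_succ: "weq ((GA,True) # apow k) (apow (k + 1))"
proof (cases "k \<ge> 0")
  case True
  then have "nat \<bar>k + 1\<bar> = Suc (nat \<bar>k\<bar>)" by simp
  then show ?thesis using True by (simp add: apow_def weq_refl)
next
  case False
  then have "nat \<bar>k\<bar> = Suc (nat \<bar>k + 1\<bar>)" by simp
  then have "apow k = (GA,False) # replicate (nat \<bar>k + 1\<bar>) (GA,False)"
    using False by (simp add: apow_def)
  moreover have "replicate (nat \<bar>k + 1\<bar>) (GA,False) = apow (k + 1)"
    using False by (cases "k = -1") (auto simp: apow_def)
  ultimately show ?thesis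
    using weq_cancel[of "[]" "(GA,True)" "apow (k + 1)"] by (simp add: ilet_def)
qed

lemma apow_pred: "weq ((GA,False) # apow k) (apow (k - 1))"
proof -
  have "weq ([(GA,False)] @ ((GA,True) # apow (k - 1)) @ []) ([(GA,False)] @ apow k @ [])"
    using weq_ctxt[OF apow_succ[of "k - 1"], of "[(GA,False)]" "[]"] by simp
  moreover have "weq ((GA,False) # (GA,True) # apow (k - 1)) (apow (k - 1))"
    using weq_cancel[of "[]" "(GA,False)" "apow (k - 1)"] by (simp add: ilet_def)
  ultimately show ?thesis by (metis append_Cons append_Nil append_Nil2 weq_sym weq_trans)
qed

lemma apow_add_nat: "weq (apow (int n) @ apow k) (apow (int n + k))"
proof (induction n)
  case (Suc n)
  have e: "apow (int (Suc n)) = (GA,True) # apow (int n)" by (simp add: apow_def nat_add_distrib flip: replicate_Suc)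
  have "weq ([(GA,True)] @ (apow (int n) @ apow k) @ []) ([(GA,True)] @ apow (int n + k) @ [])"
    by (rule weq_ctxt[OF Suc])
  then have "weq (apow (int (Suc n)) @ apow k) ((GA,True) # apow (int n + k))"
    unfolding e by simp
  then have "weq (apow (int (Suc n)) @ apow k) (apow (int n + k + 1))"
    using weq_trans apow_succ by blast
  moreover have "int n + k + 1 = int (Suc n) + k" by simp
  ultimately show ?case by (simp only:)
qed (simp add: weq_refl)

lemma apow_add: "weq (apow m @ apow k) (apow (m + k))"
proof (cases "m \<ge> 0")
  case True
  then show ?thesis using apow_add_nat[of "nat m" k] by simp
next
  case False
  have "weq (winv (apow (-m)) @ apow (- m + (m + k))) (winv (apow (-m)) @ (apow (-m) @ apow (m + k)))"
    using weq_append[OF weq_refl weq_sym[OF apow_add_nat[of "nat (-m)" "m + k"]]] False by simp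
  moreover have "weq (winv (apow (-m)) @ (apow (-m) @ apow (m + k))) (apow (m + k))"
    using weq_cancel_inv(2)[of "[]" "apow (-m)" "apow (m + k)"] by simp
  ultimately show ?thesis using weq_trans by (simp add: apow_minus) 
qed

type_synonym pword = "(gen \<times> int \<times> bool) list"

text \<open>The letter \<open>(x, n, True)\<close> stands for \<open>a^-n x a^n\<close>: what
  \<open>x\<close> does in the \<open>n\<close>-th block, carried back to the base block.\<close>

fun pw :: "gen \<times> int \<times> bool \<Rightarrow> gword" where
  "pw (x, n, s) = apow (- n) @ [(x, s)] @ apow n"

definition pws :: "pword \<Rightarrow> gword" where
  "pws xs = concat (map pw xs)"

lemma pws_simps [simp]: "pws [] = []" "pws (l # xs) = pw l @ pws xs" "pws (xs @ ys) = pws xs @ pws ys"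
  by (simp_all add: pws_def)

fun pil :: "gen \<times> int \<times> bool \<Rightarrow> gen \<times> int \<times> bool" where
  "pil (x, n, s) = (x, n, \<not> s)"

definition pinv :: "pword \<Rightarrow> pword" where
  "pinv xs = rev (map pil xs)"

lemma pil_pil [simp]: "pil (pil l) = l" by (cases l) simp

lemma pw_pil: "pw (pil l) = winv (pw l)"
  by (cases l) (simp add: apow_minus ilet_def)

lemma pws_pinv: "pws (pinv xs) = winv (pws xs)"
  by (induction xs) (auto simp: pinv_def pw_pil)

text \<open>\<open>e\<close> is the exponent of \<open>a\<close> collected so far. A letter
  \<open>x\<close> met after \<open>a^e\<close> is rewritten by
  \<open>a^e x = (a^e x a^-e) a^e\<close>, whence the position \<open>- e\<close>.\<close>

fun pull :: "int \<Rightarrow> gword \<Rightarrow> pword" where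
  "pull e [] = []"
| "pull e ((x, s) # w) =
    (if x = GA then pull (if s then e + 1 else e - 1) w else (x, - e, s) # pull e w)"

fun expA :: "gword \<Rightarrow> int" where
  "expA [] = 0"
| "expA ((x, s) # w) = (if x = GA then (if s then 1 else -1) else 0) + expA w"

lemma pull_weq: "weq (apow e @ w) (pws (pull e w) @ apow (e + expA w))"
proof (induction e w rule: pull.induct)
  case (1 e)
  then show ?case by (simp add: weq_refl)
next
  case (2 e x s w)
  show ?case
  proof (cases "x = GA")
    case True
    define e' where "e' = (if s then e + 1 else e - 1)"
    have "weq (apow e @ [(GA, s)]) (apow e')"
      using apow_add[of e "if s then 1 else -1"] by (auto simp: e'_def apow_def)
    then have "weq (apow e @ [(GA, s)] @ w) (apow e' @ w)"
      using weq_append[OF _ weq_refl] by (metis append_assoc)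
    moreover have "weq (apow e' @ w) (pws (pull e' w) @ apow (e' + expA w))"
      using 2(1) True by (simp add: e'_def)
    ultimately have "weq (apow e @ [(GA, s)] @ w) (pws (pull e' w) @ apow (e' + expA w))"
      using weq_trans by blast
    moreover have "e' + expA w = e + expA ((x, s) # w)" using True by (simp add: e'_def)
    moreover have "pull e ((x, s) # w) = pull e' w" using True by (simp add: e'_def)
    ultimately show ?thesis using True by simp
  next
    case False
    have "weq (apow e @ [(x, s)] @ w) ((apow e @ [(x, s)]) @ apow (- e) @ apow e @ w)"
      using weq_sym[OF weq_cancel_inv(2)[of "apow e @ [(x, s)]" "apow e" w]] by (simp add: apow_minus)
    moreover have "weq ((apow e @ [(x, s)] @ apow (- e)) @ (apow e @ w))
        ((apow e @ [(x, s)] @ apow (- e)) @ (pws (pull e w) @ apow (e + expA w)))"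
      using 2(2) False weq_append[OF weq_refl] by blast
    ultimately show ?thesis using False weq_trans by fastforce
  qed
qed

definition pcomm :: "int \<Rightarrow> pword" where
  "pcomm n = [(GC, n, True), (GD, n, True), (GC, n, False), (GD, n, False)]"

text \<open>This is the relation in the form \<open>a b a^-1 = [c, d] b\<close>, multiplied by
  \<open>a^-n\<close> on the left and by \<open>a^n\<close> on the right.\<close>

lemma pw_GB_step: "weq (pw (GB, n - 1, True)) (pws (pcomm n) @ pw (GB, n, True))"
proof -
  let ?c = "[(GC,True),(GD,True),(GC,False),(GD,False)] :: gword"
  let ?ic = "[(GD,True),(GC,True),(GD,False),(GC,False)] :: gword"
  have 1: "weq (pws (pcomm n)) (apow (-n) @ ?c @ apow n)"
  proof -
    have c: "weq (x @ apow n @ apow (- n) @ y) (x @ y)" for x y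
      using weq_cancel_inv(1)[of x "apow n" y] by (simp add: apow_minus)
    have "weq (pws (pcomm n)) (apow (-n) @ [(GC,True)] @ [(GD,True)] @ apow n @ apow (-n) @ [(GC,False)] @ apow n @ apow (-n) @ [(GD,False)] @ apow n)"
      using c[of "apow (-n) @ [(GC,True)]" "[(GD,True)] @ apow n @ apow (-n) @ [(GC,False)] @ apow n @ apow (-n) @ [(GD,False)] @ apow n"]
      by (simp add: pcomm_def)
    moreover have "weq (apow (-n) @ [(GC,True)] @ [(GD,True)] @ apow n @ apow (-n) @ [(GC,False)] @ apow n @ apow (-n) @ [(GD,False)] @ apow n)
       (apow (-n) @ [(GC,True)] @ [(GD,True)] @ [(GC,False)] @ apow n @ apow (-n) @ [(GD,False)] @ apow n)"
      using c[of "apow (-n) @ [(GC,True)] @ [(GD,True)]" "[(GC,False)] @ apow n @ apow (-n) @ [(GD,False)] @ apow n"]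
      by simp
    moreover have "weq (apow (-n) @ [(GC,True)] @ [(GD,True)] @ [(GC,False)] @ apow n @ apow (-n) @ [(GD,False)] @ apow n)
       (apow (-n) @ ?c @ apow n)"
      using c[of "apow (-n) @ [(GC,True)] @ [(GD,True)] @ [(GC,False)]" "[(GD,False)] @ apow n"]
      by simp
    ultimately show ?thesis using weq_trans by blast
  qed
  have 2: "weq (pws (pcomm n) @ pw (GB, n, True)) (apow (-n) @ ?c @ [(GB,True)] @ apow n)"
  proof -
    have "weq (pws (pcomm n) @ pw (GB, n, True)) ((apow (-n) @ ?c @ apow n) @ pw (GB, n, True))"
      using weq_append[OF 1 weq_refl] .
    moreover have "weq ((apow (-n) @ ?c) @ apow n @ winv (apow n) @ [(GB,True)] @ apow n) ((apow (-n) @ ?c) @ [(GB,True)] @ apow n)"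
      by (rule weq_cancel_inv)
    ultimately show ?thesis using weq_trans by (simp add: apow_minus)
  qed
  have 3: "weq [(GA,True),(GB,True),(GA,False)] (?c @ [(GB,True)])"
  proof -
    let ?r = "[(GA,True),(GB,True),(GA,False),(GB,False)] :: gword"
    have "weq (?r @ [(GB,True)]) [(GA,True),(GB,True),(GA,False)]"
      using weq_cancel[of "[(GA,True),(GB,True),(GA,False)]" "(GB,False)" "[]"] by (simp add: ilet_def)
    moreover have "weq (?r @ ?ic @ ?c @ [(GB,True)]) (?r @ [(GB,True)])"
      using weq_cancel_inv(2)[of ?r ?c "[(GB,True)]"] by (simp add: ilet_def)
    moreover have "weq (?r @ ?ic @ ?c @ [(GB,True)]) (?c @ [(GB,True)])"
      using weq_relator[of "[]" "?c @ [(GB,True)]"] by (simp add: surface_relator_def)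
    ultimately show ?thesis
      by (blast intro: weq_sym weq_trans)
  qed
  have a1: "weq (apow (-n) @ [(GA,True)]) (apow (- (n - 1)))"
    using apow_add[of "-n" 1] by (simp add: apow_def)
  have a2: "weq ([(GA,False)] @ apow n) (apow (n - 1))" using apow_pred by simp
  have "weq (pw (GB, n - 1, True)) ((apow (-n) @ [(GA,True)]) @ [(GB,True)] @ ([(GA,False)] @ apow n))"
    using weq_append[OF weq_sym[OF a1] weq_append[OF weq_refl[of "[(GB,True)]"] weq_sym[OF a2]]] by simp
  moreover have "weq (apow (-n) @ [(GA,True),(GB,True),(GA,False)] @ apow n) (apow (-n) @ (?c @ [(GB,True)]) @ apow n)"
    by (rule weq_ctxt[OF 3])
  ultimately have "weq (pw (GB, n - 1, True)) (apow (-n) @ ?c @ [(GB,True)] @ apow n)"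
    using weq_trans by fastforce
  then show ?thesis using 2 weq_sym weq_trans by blast
qed

primrec bexp :: "int \<Rightarrow> nat \<Rightarrow> pword" where
  "bexp M 0 = [(GB, M, True)]"
| "bexp M (Suc k) = pcomm (M - int k) @ bexp M k"

lemma bexp_weq: "weq (pw (GB, M - int k, True)) (pws (bexp M k))"
proof (induction k)
  case (Suc k)
  have "weq (pw (GB, (M - int k) - 1, True)) (pws (pcomm (M - int k)) @ pw (GB, M - int k, True))"
    by (rule pw_GB_step)
  then show ?case using weq_append[OF weq_refl Suc, of "pws (pcomm (M - int k))"] weq_trans
    by (simp add: algebra_simps)
qed (simp add: weq_refl)

fun belim :: "int \<Rightarrow> gen \<times> int \<times> bool \<Rightarrow> pword" where
  "belim M (x, n, s) = (if x = GB then (if s then bexp M (nat (M - n)) else pinv (bexp M (nat (M - n))))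
     else [(x, n, s)])"

lemma belim_weq:
  assumes "fst (snd l) \<le> M"
  shows "weq (pw l) (pws (belim M l))"
proof -
  obtain x n s where l: "l = (x, n, s)" by (cases l)
  have 1: "weq (pw (GB, n, True)) (pws (bexp M (nat (M - n))))"
    using bexp_weq[of M "nat (M - n)"] assms l by simp
  moreover have "weq (pw (GB, n, False)) (pws (pinv (bexp M (nat (M - n)))))"
    using weq_winv[OF 1] pw_pil[of "(GB, n, True)"] by (simp add: pws_pinv)
  ultimately show ?thesis by (simp add: l weq_refl del: pw.simps)
qed

text \<open>The generators left free by the elimination. Among the letters \<open>b\<close> only the
  topmost remains, because the recursion expresses \<open>b\<close> at position \<open>n - 1\<close>
  by letters at position \<open>n\<close>.\<close>

definition window :: "nat \<Rightarrow> (gen \<times> int) set" where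
  "window M = insert (GB, int M) ({GC, GD} \<times> {- int M..int M})"

abbreviation pkey :: "gen \<times> int \<times> bool \<Rightarrow> gen \<times> int" where
  "pkey l \<equiv> (fst l, fst (snd l))"

lemma bexp_window: "int k \<le> 2 * int M \<Longrightarrow> l \<in> set (bexp (int M) k) \<Longrightarrow> pkey l \<in> window M"
  by (induction k) (auto simp: window_def pcomm_def)

lemma belim_window:
  assumes "l \<in> set (belim (int M) l')" "fst l' \<noteq> GA" "\<bar>fst (snd l')\<bar> \<le> int M"
  shows "pkey l \<in> window M"
proof -
  obtain x n s where l': "l' = (x, n, s)" by (cases l')
  have n: "- int M \<le> n" "n \<le> int M" using assms(3) l' by auto
  show ?thesis
  proof (cases "x = GB")
    case True
    have k: "int (nat (int M - n)) \<le> 2 * int M" using n by simp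
    have "pkey (pil y) = pkey y" for y :: "gen \<times> int \<times> bool" by (cases y) simp
    then show ?thesis using assms(1) True l' bexp_window[OF k]
      by (auto simp: pinv_def split: if_splits)
  next
    case False
    then show ?thesis using n assms l' by (cases x) (auto simp: window_def)
  qed
qed

definition reduced :: "pword \<Rightarrow> bool" where
  "reduced xs \<longleftrightarrow> successively (\<lambda>l l'. l' \<noteq> pil l) xs"

lemma free_reduce: "\<exists>r. reduced r \<and> set r \<subseteq> set xs \<and> weq (pws xs) (pws r)"
proof (induction xs)
  case Nil
  then show ?case by (auto simp: reduced_def weq_refl)
next
  case (Cons l xs)
  then obtain r where r: "reduced r" "set r \<subseteq> set xs" "weq (pws xs) (pws r)" by blast
  have eq: "weq (pws (l # xs)) (pws (l # r))" using weq_append[OF weq_refl r(3)] by simp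
  show ?case
  proof (cases "r \<noteq> [] \<and> hd r = pil l")
    case True
    then obtain r' where r': "r = pil l # r'" by (metis list.collapse)
    have "weq (pws (l # r)) (pws r')"
      using weq_cancel_inv(1)[of "[]" "pw l" "pws r'"] by (simp add: r' pw_pil)
    moreover have "reduced r'" using r(1) unfolding r' reduced_def by (auto simp: successively_Cons)
    ultimately show ?thesis using eq weq_trans r(2) r' by (intro exI[of _ r']) auto
  next
    case False
    then have "reduced (l # r)" using r(1) unfolding reduced_def by (auto simp: successively_Cons)
    then show ?thesis using eq r(2) by (intro exI[of _ "l # r"]) auto
  qed
qed

lemma pull_not_GA: "l \<in> set (pull e w) \<Longrightarrow> fst l \<noteq> GA"
  by (induction e w rule: pull.induct) (auto split: if_splits)

text \<open>The purpose is to turn a word that is not trivial in the group into a nonempty reduced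
  one in independent letters, which can then be made to move a point. Uniqueness is not
  claimed.\<close>

theorem normal_form:
  assumes "\<And>l. l \<in> set (pull 0 w) \<Longrightarrow> \<bar>fst (snd l)\<bar> \<le> int M"
  obtains r where "reduced r" "\<And>l. l \<in> set r \<Longrightarrow> pkey l \<in> window M"
    "weq w (pws r @ apow (expA w))"
proof -
  have "weq (pws xs) (pws (concat (map (belim (int M)) xs)))"
    if "\<And>l. l \<in> set xs \<Longrightarrow> fst (snd l) \<le> int M" for xs
    using that by (induction xs) (auto intro!: weq_append belim_weq simp: weq_refl)
  then have 1: "weq (pws (pull 0 w)) (pws (concat (map (belim (int M)) (pull 0 w))))"
    using assms by (meson abs_le_D1)
  obtain r where r: "reduced r" "set r \<subseteq> set (concat (map (belim (int M)) (pull 0 w)))"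
    "weq (pws (concat (map (belim (int M)) (pull 0 w)))) (pws r)"
    using free_reduce by blast
  have "weq w (pws (pull 0 w) @ apow (expA w))" using pull_weq[of 0 w] by simp
  moreover have "weq (pws (pull 0 w) @ apow (expA w)) (pws r @ apow (expA w))"
    using weq_append[OF weq_trans[OF 1 r(3)] weq_refl] .
  ultimately have "weq w (pws r @ apow (expA w))" using weq_trans by blast
  moreover have "pkey l \<in> window M" if l: "l \<in> set r" for l
  proof -
    obtain l' where l': "l' \<in> set (pull 0 w)" "l \<in> set (belim (int M) l')"
      using r(2) l unfolding set_concat set_map by blast
    show ?thesis by (rule belim_window[OF l'(2) pull_not_GA[OF l'(1)] assms[OF l'(1)]])
  qed
  ultimately show ?thesis using that r(1) by blast
qed

subsection \<open>Homotopies of paths in a topological space\<close>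

abbreviation hp :: "(real \<Rightarrow> 'a::topological_space) \<Rightarrow> (real \<Rightarrow> 'a) \<Rightarrow> bool" where
  "hp \<equiv> homotopic_paths UNIV"

abbreviation cp :: "'a \<Rightarrow> real \<Rightarrow> 'a" where
  "cp x \<equiv> (\<lambda>_. x)"

lemma path_cp [simp]: "path (cp x)" "pathstart (cp x) = x" "pathfinish (cp x) = x"
  by (simp_all add: path_def pathstart_def pathfinish_def)

lemma convex_hp:
  fixes f g :: "real \<Rightarrow> 'a::real_normed_vector"
  assumes "convex S" "path f" "path g" "path_image f \<subseteq> S" "path_image g \<subseteq> S"
    "pathstart f = pathstart g" "pathfinish f = pathfinish g"
  shows "homotopic_paths S f g"
proof -
  have "\<forall>p q. path p \<and> path_image p \<subseteq> S \<and> path q \<and> path_image q \<subseteq> S \<and>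
      pathstart q = pathstart p \<and> pathfinish q = pathfinish p \<longrightarrow> homotopic_paths S p q"
    using convex_imp_simply_connected[OF assms(1)] unfolding simply_connected_eq_homotopic_paths by (rule conjunct2)
  from this[rule_format, of f g] show ?thesis using assms by simp
qed

lemma image_hp:
  assumes "homotopic_paths S f g" "continuous_on S h"
  shows "hp (h \<circ> f) (h \<circ> g)"
  using homotopic_paths_continuous_image[OF assms] by auto

text \<open>Since \<open>[0,1]\<close> is convex, two paths in it with the same end points are
  homotopic, and \<open>p\<close> carries the homotopy over. The unit and inverse laws for paths are
  instances with piecewise linear \<open>f\<close> and \<open>g\<close>.\<close>

lemma reparam_hp:
  assumes "path p" "path f" "path g" "path_image f \<subseteq> {0..1}" "path_image g \<subseteq> {0..1}"
    "pathstart f = pathstart g" "pathfinish f = pathfinish g"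
  shows "hp (p \<circ> f) (p \<circ> g)"
  by (rule image_hp[OF convex_hp[of "{0..1}"]]) (use assms in \<open>auto simp: path_def\<close>)

lemma linepath_01_subset: "u \<in> {0..1} \<Longrightarrow> v \<in> {0..1} \<Longrightarrow> path_image (linepath u v) \<subseteq> {0..1::real}"
  by (simp add: closed_segment_subset)

lemma hp_sym: "hp p q \<Longrightarrow> hp q p"
  by (rule homotopic_paths_sym)

lemma hp_trans: "hp p q \<Longrightarrow> hp q r \<Longrightarrow> hp p r"
  by (rule homotopic_paths_trans)

lemma hp_refl: "path p \<Longrightarrow> hp p p" by simp

lemma hp_rid: "path p \<Longrightarrow> x = pathfinish p \<Longrightarrow> hp (p +++ cp x) p"
proof -
  assume p: "path p" "x = pathfinish p"
  have "p +++ cp x = p \<circ> (linepath 0 1 +++ linepath 1 1)" "p = p \<circ> linepath 0 1"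
    by (auto simp: fun_eq_iff joinpaths_def p linepath_def pathfinish_def)
  then show ?thesis
    using reparam_hp[OF p(1), of "linepath 0 1 +++ linepath 1 1" "linepath 0 1"]
    by (simp add: path_image_join closed_segment_eq_real_ivl)
qed

lemma hp_lid: "path p \<Longrightarrow> x = pathstart p \<Longrightarrow> hp (cp x +++ p) p"
proof -
  assume p: "path p" "x = pathstart p"
  have e: "cp x +++ p = (\<lambda>t. if t = 1/2 then (cp x +++ p) t else (p \<circ> (linepath 0 0 +++ linepath 0 1)) t)"
    "p = p \<circ> linepath 0 1"
    by (auto simp: fun_eq_iff joinpaths_def p linepath_def pathstart_def)
  have "(cp x +++ p) = p \<circ> (linepath 0 0 +++ linepath 0 1)"
    by (auto simp: fun_eq_iff joinpaths_def p linepath_def pathstart_def)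
  then show ?thesis
    using reparam_hp[OF p(1), of "linepath 0 0 +++ linepath 0 1" "linepath 0 1"] e(2)
    by (simp add: path_image_join closed_segment_eq_real_ivl)
qed

lemma hp_rinv: "path p \<Longrightarrow> x = pathstart p \<Longrightarrow> hp (p +++ reversepath p) (cp x)"
proof -
  assume p: "path p" "x = pathstart p"
  have "p +++ reversepath p = p \<circ> (linepath 0 1 +++ linepath 1 0)" "cp x = p \<circ> linepath 0 0"
    by (auto simp: fun_eq_iff joinpaths_def p linepath_def pathstart_def reversepath_def)
  then show ?thesis
    using reparam_hp[OF p(1), of "linepath 0 1 +++ linepath 1 0" "linepath 0 0"]
    by (simp add: path_image_join closed_segment_eq_real_ivl)
qed

lemma hp_join: "hp p p' \<Longrightarrow> hp q q' \<Longrightarrow> pathfinish p = pathstart q \<Longrightarrow> hp (p +++ q) (p' +++ q')"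
  by (rule homotopic_paths_join)

lemma hp_assoc:
  "\<lbrakk>path p; path q; path r; pathfinish p = pathstart q; pathfinish q = pathstart r\<rbrakk>
    \<Longrightarrow> hp ((p +++ q) +++ r) (p +++ (q +++ r))"
  by (rule hp_sym, rule homotopic_paths_assoc) auto

lemma hp_ends: "hp p q \<Longrightarrow> path p \<and> path q \<and> pathstart p = pathstart q \<and> pathfinish p = pathfinish q"
  using homotopic_paths_imp_path homotopic_paths_imp_pathstart homotopic_paths_imp_pathfinish by blast

lemma hp_cancel_l:
  assumes "path p" "path q" "pathstart q = pathfinish p"
  shows "hp (reversepath p +++ (p +++ q)) q"
proof -
  have "hp ((reversepath p +++ p) +++ q) (reversepath p +++ (p +++ q))"
    by (rule hp_assoc) (use assms in auto)
  moreover have "hp (reversepath p +++ p) (cp (pathfinish p))"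
    using hp_rinv[of "reversepath p"] assms by simp
  then have "hp ((reversepath p +++ p) +++ q) (cp (pathfinish p) +++ q)"
    by (rule hp_join) (use assms in auto)
  moreover have "hp (cp (pathfinish p) +++ q) q" by (rule hp_lid) (use assms in auto)
  ultimately show ?thesis using hp_sym hp_trans by blast
qed

lemma hp_cancel_l':
  assumes "path p" "path q" "pathstart q = pathstart p"
  shows "hp (p +++ (reversepath p +++ q)) q"
  using hp_cancel_l[of "reversepath p" q] assms by simp

lemma hp_cancel_r:
  assumes "path p" "path q" "pathfinish q = pathstart p"
  shows "hp ((q +++ p) +++ reversepath p) q"
proof -
  have "hp ((q +++ p) +++ reversepath p) (q +++ (p +++ reversepath p))"
    by (rule hp_assoc) (use assms in auto)
  moreover have "hp (q +++ (p +++ reversepath p)) (q +++ cp (pathstart p))"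
    by (rule hp_join) (use assms hp_rinv in auto)
  moreover have "hp (q +++ cp (pathstart p)) q" by (rule hp_rid) (use assms in auto)
  ultimately show ?thesis using hp_trans by blast
qed

lemma hp_move_l:
  assumes "hp (p +++ q) r" "pathfinish p = pathstart q"
  shows "hp q (reversepath p +++ r)"
proof -
  have pq: "path p" "path q" using hp_ends[OF assms(1)] assms(2) by auto
  have "hp (reversepath p +++ (p +++ q)) (reversepath p +++ r)"
    by (rule hp_join) (use pq assms in auto)
  then show ?thesis using hp_cancel_l[OF pq] assms(2) hp_sym hp_trans by metis
qed

lemma hp_move_r:
  assumes "hp (p +++ q) r" "pathfinish p = pathstart q"
  shows "hp p (r +++ reversepath q)"
proof -
  have pq: "path p" "path q" using hp_ends[OF assms(1)] assms(2) by auto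
  have "hp ((p +++ q) +++ reversepath q) (r +++ reversepath q)"
    by (rule hp_join) (use pq assms in auto)
  then show ?thesis using hp_cancel_r[OF pq(2,1)] assms(2) hp_sym hp_trans by metis
qed

subsection \<open>The genus two surface as a type\<close>

text \<open>A type with a topology of its own gives access to the type-class notions
  \<open>path\<close> and \<open>homotopic_paths\<close>. The way back to
  \<open>orientable_surface 2\<close> is taken at the end, through \<open>rep_surf\<close> and
  \<open>abs_surf\<close>.\<close>

typedef surf = "topspace (orientable_surface 2)"
  morphisms rep_surf abs_surf
  by (auto simp: orientable_surface_def topspace_quotient_topology intro!: exI[of _ 0])

instantiation surf :: topological_space
begin

definition open_surf :: "surf set \<Rightarrow> bool" where
  "open_surf U \<longleftrightarrow> openin (orientable_surface 2) (rep_surf ` U)"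

instance
proof
  have "rep_surf ` UNIV = topspace (orientable_surface 2)"
    by (metis type_definition.Rep_range type_definition_surf)
  then show "open (UNIV :: surf set)" by (simp add: open_surf_def)
next
  fix S T :: "surf set" assume "open S" "open T"
  moreover have "rep_surf ` (S \<inter> T) = rep_surf ` S \<inter> rep_surf ` T"
    by (auto simp: rep_surf_inject)
  ultimately show "open (S \<inter> T)" by (simp add: open_surf_def openin_Int)
next
  fix K :: "surf set set" assume "\<forall>S\<in>K. open S"
  then have "openin (orientable_surface 2) (\<Union>S\<in>K. rep_surf ` S)"
    by (auto simp: open_surf_def)
  then show "open (\<Union>K)" by (simp add: open_surf_def image_Union)
qed

end

definition Qm :: "complex \<Rightarrow> surf" where
  "Qm z = abs_surf (gluing_equiv 2 `` {z})"

abbreviation "disc \<equiv> cball (0::complex) 1"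

lemma topspace_surface: "topspace (orientable_surface 2) = (\<lambda>z. gluing_equiv 2 `` {z}) ` disc"
  by (simp add: orientable_surface_def topspace_quotient_topology)

lemma rep_Qm: "z \<in> disc \<Longrightarrow> rep_surf (Qm z) = gluing_equiv 2 `` {z}"
  unfolding Qm_def by (rule abs_surf_inverse) (auto simp: topspace_surface)

lemma surf_cases: obtains z where "z \<in> disc" "x = Qm z"
  using rep_surf[of x] rep_surf_inject[of x] rep_Qm unfolding topspace_surface
  by (metis (no_types, lifting) imageE)

lemma open_surf_iff: "open U \<longleftrightarrow> openin (top_of_set disc) {z \<in> disc. Qm z \<in> U}"
proof -
  have "{z \<in> disc. gluing_equiv 2 `` {z} \<in> rep_surf ` U} = {z \<in> disc. Qm z \<in> U}"
    using rep_Qm by (metis (no_types, lifting) image_iff rep_surf_inject)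
  moreover have "rep_surf ` U \<subseteq> (\<lambda>z. gluing_equiv 2 `` {z}) ` disc"
    using rep_surf unfolding topspace_surface by blast
  ultimately show ?thesis
    unfolding open_surf_def by (simp add: orientable_surface_def openin_quotient_topology)
qed

lemma gluing_equiv_sym: "(z, z') \<in> gluing_equiv g \<Longrightarrow> (z', z) \<in> gluing_equiv g"
  unfolding gluing_equiv_def
  by (metis converse_Un converse_converse rtrancl_converseD sup_commute)

lemma gluing_equiv_trans: "(z, z') \<in> gluing_equiv g \<Longrightarrow> (z', z'') \<in> gluing_equiv g \<Longrightarrow> (z, z'') \<in> gluing_equiv g"
  unfolding gluing_equiv_def by (rule rtrancl_trans)

lemma Qm_eq_iff:
  assumes "z \<in> disc" "z' \<in> disc"
  shows "Qm z = Qm z' \<longleftrightarrow> (z, z') \<in> gluing_equiv 2"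
proof -
  have "Qm z = Qm z' \<longleftrightarrow> gluing_equiv 2 `` {z} = gluing_equiv 2 `` {z'}"
    using rep_Qm assms rep_surf_inject by metis
  also have "\<dots> \<longleftrightarrow> (z, z') \<in> gluing_equiv 2"
  proof
    assume "gluing_equiv 2 `` {z} = gluing_equiv 2 `` {z'}"
    moreover have "z' \<in> gluing_equiv 2 `` {z'}" by (simp add: gluing_equiv_def)
    ultimately show "(z, z') \<in> gluing_equiv 2" by blast
  qed (use gluing_equiv_sym gluing_equiv_trans in blast)
  finally show ?thesis .
qed

text \<open>Points with the same image are joined by a chain of gluings, so single gluings suffice
  as a test. With truth values or option values for \<open>f\<close> this is the induction principle
  of the gluing relation.\<close>

lemma Qm_respects:
  assumes "\<And>z z'. (z, z') \<in> side_gluing 2 \<Longrightarrow> f z = f z'" "z \<in> disc" "z' \<in> disc" "Qm z = Qm z'"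
  shows "f z = f z'"
proof -
  have "(z, z') \<in> (side_gluing 2 \<union> (side_gluing 2)\<inverse>)\<^sup>*"
    using assms Qm_eq_iff by (simp add: gluing_equiv_def)
  then show ?thesis
    by (induction rule: rtrancl_induct) (use assms(1) in force)+
qed

definition bp :: "real \<Rightarrow> complex" where
  "bp s = cis (pi * s / 4)"

text \<open>The first side of each pair of glued sides \<open>k\<close>, \<open>k + 2\<close> of the
  octagon.\<close>

definition side_starts :: "nat set" where
  "side_starts = {0, 1, 4, 5}"

lemma boundary_point_2: "boundary_point 2 s = bp s"
  by (simp add: boundary_point_def bp_def field_simps)

lemma side_gluing_2: "(z, z') \<in> side_gluing 2 \<longleftrightarrow>
    (\<exists>k\<in>side_starts. \<exists>t\<in>{0..1}. z = bp (real k + t) \<and> z' = bp (real k + 3 - t))"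
proof -
  have "(\<exists>i<2. k \<in> {4 * i, 4 * i + 1}) \<longleftrightarrow> k \<in> side_starts" for k :: nat
    by (auto simp: side_starts_def less_2_cases_iff)
  moreover have "(z, z') \<in> side_gluing 2 \<longleftrightarrow> (\<exists>k i t. z = bp (real k + t) \<and> z' = bp (real k + 3 - t) \<and>
      i < 2 \<and> k \<in> {4 * i, 4 * i + 1} \<and> t \<in> {0..1})"
    by (simp only: side_gluing_def boundary_point_2 mem_Collect_eq prod.inject conj_assoc)
  ultimately show ?thesis by metis
qed

lemma norm_bp [simp]: "norm (bp s) = 1"
  by (simp add: bp_def)

lemma bp_in_disc [simp]: "bp s \<in> disc" by simp

lemma Qm_glue: "k \<in> side_starts \<Longrightarrow> t \<in> {0..1} \<Longrightarrow> Qm (bp (real k + t)) = Qm (bp (real k + 3 - t))"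
proof -
  assume "k \<in> side_starts" "t \<in> {0..1}"
  then have "(bp (real k + t), bp (real k + 3 - t)) \<in> side_gluing 2" using side_gluing_2 by blast
  then show ?thesis by (subst Qm_eq_iff) (auto simp: gluing_equiv_def)
qed

lemma Qm_interior: "norm z < 1 \<Longrightarrow> z' \<in> disc \<Longrightarrow> Qm z = Qm z' \<Longrightarrow> z' = z"
proof -
  assume a: "norm z < 1" "z' \<in> disc" "Qm z = Qm z'"
  define f where "f y = (y = z)" for y
  have "f z = f z'"
    by (rule Qm_respects[OF _ _ a(2,3)]) (use a(1) in \<open>auto simp: f_def side_gluing_2\<close>)
  then show "z' = z" by (simp add: f_def)
qed

lemma quotient_map_Qm: "quotient_map (top_of_set disc) euclidean Qm"
  unfolding quotient_map_def
proof
  show "Qm ` topspace (top_of_set disc) = topspace euclidean"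
    using surf_cases by auto (metis imageI mem_cball_0)
qed (simp add: open_surf_iff)

lemma continuous_on_Qm: "continuous_on disc Qm"
  using quotient_imp_continuous_map[OF quotient_map_Qm] by simp

definition saturated :: "complex set \<Rightarrow> bool" where
  "saturated A \<longleftrightarrow> (\<forall>(z, z') \<in> side_gluing 2. z \<in> A \<longleftrightarrow> z' \<in> A)"

lemma saturated_iff:
  assumes "saturated A" "A \<subseteq> disc" "z \<in> disc"
  shows "Qm z \<in> Qm ` A \<longleftrightarrow> z \<in> A"
proof
  assume "Qm z \<in> Qm ` A"
  then obtain z' where z': "z' \<in> A" "Qm z' = Qm z" by auto
  have "(z' \<in> A) = (z \<in> A)"
    by (rule Qm_respects[where f = "\<lambda>z. z \<in> A"]) (use assms z' in \<open>auto simp: saturated_def\<close>)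
  then show "z \<in> A" using z' by simp
qed simp

lemma open_Qm_image:
  assumes "saturated A" "openin (top_of_set disc) A"
  shows "open (Qm ` A)"
proof -
  have "A \<subseteq> disc" using assms(2) openin_imp_subset by blast
  then have "{z \<in> disc. Qm z \<in> Qm ` A} = A" using saturated_iff[OF assms(1)] by blast
  then show ?thesis using assms(2) by (simp add: open_surf_iff)
qed

lemma quotient_map_Qm_restrict:
  assumes "saturated A" "openin (top_of_set disc) A"
  shows "quotient_map (top_of_set A) (top_of_set (Qm ` A)) Qm"
proof -
  have sub: "A \<subseteq> disc" using assms(2) openin_imp_subset by blast
  then have "{z \<in> topspace (top_of_set disc). Qm z \<in> Qm ` A} = A"
    using saturated_iff[OF assms(1)] by auto
  then have "quotient_map (subtopology (top_of_set disc) A) (subtopology euclidean (Qm ` A)) Qm"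
    by (intro quotient_map_restriction[OF quotient_map_Qm]) (use open_Qm_image[OF assms] in auto)
  then show ?thesis using sub by (simp add: subtopology_subtopology Int_absorb1)
qed

subsection \<open>Contractions of saturated sets\<close>

text \<open>A deformation in the disc that respects the gluing, so that it descends to a contraction
  of the image of \<open>A\<close>. Its end need only be one point of the surface: the cell round
  the vertex consists of eight pieces of the disc, each contracted to its own corner.\<close>

locale surface_cell =
  fixes A :: "complex set" and K :: "real \<times> complex \<Rightarrow> complex" and m :: surf
  assumes sat: "saturated A" and op: "openin (top_of_set disc) A"
    and cont_K: "continuous_on ({0..1} \<times> A) K"
    and K_disc: "\<And>t z. t \<in> {0..1} \<Longrightarrow> z \<in> A \<Longrightarrow> K (t, z) \<in> disc"
    and K_0: "\<And>z. z \<in> A \<Longrightarrow> K (0, z) = z"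
    and K_1: "\<And>z. z \<in> A \<Longrightarrow> Qm (K (1, z)) = m"
    and K_glue: "\<And>z z' t. (z, z') \<in> side_gluing 2 \<Longrightarrow> z \<in> A \<Longrightarrow> t \<in> {0..1} \<Longrightarrow> Qm (K (t, z)) = Qm (K (t, z'))"
begin

lemma sub: "A \<subseteq> disc" using op openin_imp_subset by blast

definition F :: "real \<times> surf \<Rightarrow> surf" where
  "F y = Qm (K (fst y, SOME z. z \<in> A \<and> Qm z = snd y))"

lemma F_Qm:
  assumes "z \<in> A" "t \<in> {0..1}"
  shows "F (t, Qm z) = Qm (K (t, z))"
proof -
  define z' where "z' = (SOME z'. z' \<in> A \<and> Qm z' = Qm z)"
  have z': "z' \<in> A" "Qm z' = Qm z"
    using someI[of "\<lambda>z'. z' \<in> A \<and> Qm z' = Qm z" z] assms by (auto simp: z'_def)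
  define f where "f y = (if y \<in> A then Some (Qm (K (t, y))) else None)" for y
  have "f z' = f z"
  proof (rule Qm_respects)
    show "f y = f y'" if "(y, y') \<in> side_gluing 2" for y y'
      using sat that K_glue[OF that _ assms(2)] by (auto simp: f_def saturated_def)
  qed (use z' sub assms in auto)
  then show ?thesis using z' assms by (simp add: f_def F_def flip: z'_def)
qed

text \<open>To descend a homotopy, the product of \<open>Qm\<close> with the identity of
  \<open>[0,1]\<close> must be a quotient map; this holds because \<open>[0,1]\<close> is locally
  compact and Hausdorff.\<close>

lemma continuous_F: "continuous_on ({0..1} \<times> Qm ` A) F"
proof -
  have q: "quotient_map (prod_topology (top_of_set {0..1::real}) (top_of_set A))
     (prod_topology (top_of_set {0..1}) (top_of_set (Qm ` A))) (\<lambda>(x,y). (x, Qm y))"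
  proof (rule quotient_map_prod_right[OF _ _ quotient_map_Qm_restrict[OF sat op]])
    show "locally_compact_space (top_of_set {0..1::real})"
      by (intro compact_imp_locally_compact_space) (simp add: compact_space_subtopology)
    show "Hausdorff_space (top_of_set {0..1::real}) \<or> regular_space (top_of_set {0..1::real})"
      by (simp add: Hausdorff_space_subtopology)
  qed
  have "continuous_on ({0..1} \<times> A) (Qm \<circ> K)"
    by (intro continuous_on_compose[OF cont_K] continuous_on_subset[OF continuous_on_Qm])
      (use K_disc in auto)
  then have "continuous_map (prod_topology (top_of_set {0..1::real}) (top_of_set A)) euclidean (Qm \<circ> K)"
    by (simp flip: subtopology_Times add: subtopology_Times[symmetric] euclidean_product_topology)
  then have "continuous_map (prod_topology (top_of_set {0..1::real}) (top_of_set A)) euclidean (F \<circ> (\<lambda>(x,y). (x, Qm y)))"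
    by (rule continuous_map_eq) (auto simp: F_Qm)
  then have "continuous_map (prod_topology (top_of_set {0..1}) (top_of_set (Qm ` A))) euclidean F"
    by (rule continuous_compose_quotient_map[OF q])
  then show ?thesis by (simp flip: subtopology_Times add: subtopology_Times[symmetric] euclidean_product_topology)
qed

text \<open>The contraction spans a square with \<open>\<gamma>\<close> as one side. The other sides
  are the track of its start, the constant path at \<open>m\<close> and the reversed track of its
  end.\<close>

lemma contract_hp:
  assumes g: "path \<gamma>" "path_image \<gamma> \<subseteq> Qm ` A" and zx: "zx \<in> A" "Qm zx = \<gamma> 0"
    and zy: "zy \<in> A" "Qm zy = \<gamma> 1"
  shows "hp \<gamma> ((\<lambda>t. Qm (K (t, zx))) +++ reversepath (\<lambda>t. Qm (K (t, zy))))"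
proof -
  define G where "G y = F (snd y, \<gamma> (fst y))" for y
  let ?S = "{0..1::real} \<times> {0..1::real}"
  have gam: "\<gamma> s \<in> Qm ` A" if "s \<in> {0..1}" for s using g(2) that by (auto simp: path_image_def)
  have G: "continuous_on ?S G"
  proof -
    have "continuous_on ?S (\<lambda>y. (snd y, \<gamma> (fst y)))"
      by (intro continuous_intros continuous_on_compose2[OF g(1)[unfolded path_def]]) auto
    then have "continuous_on ?S (F \<circ> (\<lambda>y. (snd y, \<gamma> (fst y))))"
      by (intro continuous_on_compose continuous_on_subset[OF continuous_F]) (use gam in auto)
    then show ?thesis by (simp add: o_def G_def)
  qed
  define l0 l1 l2 l3 where "l0 = linepath (0::real,0::real) (1,0)" and "l1 = linepath (0::real,0::real) (0,1)"
    and "l2 = linepath (0::real,1::real) (1,1)" and "l3 = linepath (1::real,1::real) (1,0)"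
  have l: "path l0" "path l1" "path l2" "path l3" by (simp_all add: l0_def l1_def l2_def l3_def)
  have ends: "pathfinish l1 = pathstart l2" "pathfinish l2 = pathstart l3" "pathstart l0 = pathstart l1"
    "pathfinish l0 = pathfinish l3"
    by (simp_all add: l0_def l1_def l2_def l3_def)
  have conv: "convex ?S" by (intro convex_Times convex_real_interval)
  have im: "path_image l0 \<subseteq> ?S" "path_image l1 \<subseteq> ?S" "path_image l2 \<subseteq> ?S" "path_image l3 \<subseteq> ?S"
    unfolding l0_def l1_def l2_def l3_def path_image_linepath
    by (intro closed_segment_subset conv; simp)+
  have "homotopic_paths ?S l0 (l1 +++ (l2 +++ l3))"
    by (rule convex_hp[OF conv]) (use l ends im in \<open>auto simp: path_image_join\<close>)
  then have "hp (G \<circ> l0) (G \<circ> (l1 +++ (l2 +++ l3)))" by (rule image_hp[OF _ G])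
  then have 1: "hp (G \<circ> l0) ((G \<circ> l1) +++ ((G \<circ> l2) +++ (G \<circ> l3)))"
    by (simp add: path_compose_join)
  have pl: "path (G \<circ> l0)" "path (G \<circ> l1)" "path (G \<circ> l2)" "path (G \<circ> l3)"
    by (intro path_continuous_image l continuous_on_subset[OF G] im)+
  have F0: "F (0, x) = x" "F (1, x) = m" if "x \<in> Qm ` A" for x
    using that by (auto simp: F_Qm K_0 K_1)
  have e0: "hp (G \<circ> l0) \<gamma>"
    by (rule homotopic_paths_eq[OF pl(1)]) (auto simp: G_def l0_def linepath_def F0 gam)
  define k1 where "k1 t = Qm (K (t, zx))" for t
  define k2 where "k2 t = Qm (K (t, zy))" for t
  have e1: "hp (G \<circ> l1) k1"
    by (rule homotopic_paths_eq[OF pl(2)])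
      (use zx in \<open>auto simp: G_def l1_def linepath_def k1_def F_Qm simp flip: zx(2)\<close>)
  have e2: "hp (G \<circ> l2) (cp m)"
    by (rule homotopic_paths_eq[OF pl(3)]) (auto simp: G_def l2_def linepath_def F0 gam)
  have e3: "hp (G \<circ> l3) (reversepath k2)"
    by (rule homotopic_paths_eq[OF pl(4)])
      (use zy in \<open>auto simp: G_def l3_def linepath_def k2_def F_Qm reversepath_def simp flip: zy(2)\<close>)
  have ends': "pathfinish (G \<circ> l1) = pathstart (G \<circ> l2)" "pathfinish (G \<circ> l2) = pathstart (G \<circ> l3)"
    using ends by (simp_all add: pathfinish_compose pathstart_compose)
  have "hp ((G \<circ> l2) +++ (G \<circ> l3)) (cp m +++ reversepath k2)"
    by (rule hp_join[OF e2 e3 ends'(2)])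
  moreover have "hp (cp m +++ reversepath k2) (reversepath k2)"
    by (rule hp_lid) (use hp_ends[OF e3] hp_ends[OF e2] ends' in auto)
  ultimately have "hp ((G \<circ> l2) +++ (G \<circ> l3)) (reversepath k2)" by (rule hp_trans)
  then have "hp ((G \<circ> l1) +++ ((G \<circ> l2) +++ (G \<circ> l3))) (k1 +++ reversepath k2)"
    by (rule hp_join[OF e1]) (use ends' in simp)
  then have "hp \<gamma> (k1 +++ reversepath k2)" using 1 e0 hp_sym hp_trans by blast
  then show ?thesis by (simp add: k1_def[abs_def] k2_def[abs_def])
qed

end

subsection \<open>Loops labelled by words\<close>

definition ray :: "complex \<Rightarrow> real \<Rightarrow> surf" where
  "ray z = Qm \<circ> linepath 0 z"

abbreviation orig :: surf where "orig \<equiv> Qm 0"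

lemma disc_hp:
  assumes "path f" "path g" "path_image f \<subseteq> disc" "path_image g \<subseteq> disc"
    "pathstart f = pathstart g" "pathfinish f = pathfinish g"
  shows "hp (Qm \<circ> f) (Qm \<circ> g)"
  by (rule image_hp[OF convex_hp[OF convex_cball] continuous_on_Qm]) (use assms in auto)

lemma path_Qm: "path f \<Longrightarrow> path_image f \<subseteq> disc \<Longrightarrow> path (Qm \<circ> f)"
  by (intro path_continuous_image continuous_on_subset[OF continuous_on_Qm])

lemma linepath_disc: "z \<in> disc \<Longrightarrow> z' \<in> disc \<Longrightarrow> path_image (linepath z z') \<subseteq> disc"
  unfolding path_image_linepath by (rule closed_segment_subset[OF _ _ convex_cball])

lemma ray: "z \<in> disc \<Longrightarrow> path (ray z)" "pathstart (ray z) = orig" "pathfinish (ray z) = Qm z"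
proof -
  show "z \<in> disc \<Longrightarrow> path (ray z)"
    unfolding ray_def by (rule path_Qm[OF path_linepath linepath_disc]) simp_all
qed (simp_all add: ray_def pathstart_compose pathfinish_compose)

text \<open>The loop leaves the octagon through the midpoint of side \<open>k\<close> and re-enters
  through the midpoint of the side glued to it. It is the loop dual to the side, not the loop along
  the side.\<close>

definition crossing :: "nat \<Rightarrow> real \<Rightarrow> surf" where
  "crossing k = ray (bp (real k + 1/2)) +++ reversepath (ray (bp (real k + 5/2)))"

lemma Qm_mid: "k \<in> side_starts \<Longrightarrow> Qm (bp (real k + 1/2)) = Qm (bp (real k + 5/2))"
  using Qm_glue[of k "1/2"] by (simp add: add.commute)

lemma crossing: "k \<in> side_starts \<Longrightarrow> path (crossing k)" "pathstart (crossing k) = orig"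
  "pathfinish (crossing k) = orig"
  unfolding crossing_def by (auto simp: ray Qm_mid)

text \<open>The assignment and the directions are chosen such that the crossings met on a walk round
  the vertex spell exactly \<open>surface_relator\<close>.\<close>

fun gloop :: "gen \<Rightarrow> real \<Rightarrow> surf" where
  "gloop GA = crossing 0"
| "gloop GB = reversepath (crossing 1)"
| "gloop GC = reversepath (crossing 5)"
| "gloop GD = crossing 4"

definition side_letter :: "nat \<Rightarrow> gen \<times> bool" where
  "side_letter k = (if k = 0 then (GA, True) else if k = 1 then (GB, False)
     else if k = 4 then (GD, True) else (GC, False))"

definition lloop :: "gen \<times> bool \<Rightarrow> real \<Rightarrow> surf" where
  "lloop l = (if snd l then gloop (fst l) else reversepath (gloop (fst l)))"

lemma lloop_side_letter: "k \<in> side_starts \<Longrightarrow> lloop (side_letter k) = crossing k"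
  by (auto simp: side_starts_def side_letter_def lloop_def)

lemma lloop_ilet: "lloop (ilet l) = reversepath (lloop l)"
  by (simp add: lloop_def ilet_def)

lemma lloop: "path (lloop l)" "pathstart (lloop l) = orig" "pathfinish (lloop l) = orig"
  by (cases l; cases "fst l"; auto simp: lloop_def crossing side_starts_def)+

definition wloop :: "gword \<Rightarrow> real \<Rightarrow> surf" where
  "wloop w = foldr (\<lambda>l p. lloop l +++ p) w (cp orig)"

lemma wloop_simps: "wloop [] = cp orig" "wloop (l # w) = lloop l +++ wloop w"
  by (simp_all add: wloop_def)

lemma wloop [simp]: "path (wloop w)" "pathstart (wloop w) = orig" "pathfinish (wloop w) = orig"
proof -
  have "path (wloop w) \<and> pathstart (wloop w) = orig \<and> pathfinish (wloop w) = orig"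
    by (induction w) (auto simp: wloop_simps lloop)
  then show "path (wloop w)" "pathstart (wloop w) = orig" "pathfinish (wloop w) = orig" by auto
qed

lemma wloop_append: "hp (wloop (u @ v)) (wloop u +++ wloop v)"
proof (induction u)
  case Nil
  show ?case unfolding append_Nil wloop_simps(1) by (rule hp_sym, rule hp_lid) auto
next
  case (Cons l u)
  have "hp (lloop l +++ wloop (u @ v)) (lloop l +++ (wloop u +++ wloop v))"
    by (rule hp_join[OF hp_refl Cons]) (simp_all add: lloop)
  moreover have "hp ((lloop l +++ wloop u) +++ wloop v) (lloop l +++ (wloop u +++ wloop v))"
    by (rule hp_assoc) (simp_all add: lloop)
  ultimately show ?case unfolding append_Cons wloop_simps using hp_sym hp_trans by blast
qed

lemma wloop_single: "hp (wloop [l]) (lloop l)"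
  unfolding wloop_simps by (rule hp_rid) (simp_all add: lloop)

lemma wloop_cancel2: "hp (wloop [l, ilet l]) (cp orig)"
proof -
  have "hp (lloop l +++ (reversepath (lloop l) +++ cp orig)) (cp orig)"
    by (rule hp_cancel_l') (simp_all add: lloop)
  then show ?thesis unfolding wloop_simps lloop_ilet .
qed

lemma wloop_null_ctxt:
  assumes "hp (wloop w) (cp orig)"
  shows "hp (wloop (u @ w @ v)) (wloop (u @ v))"
proof -
  have "hp (wloop w +++ wloop v) (cp orig +++ wloop v)"
    by (rule hp_join[OF assms]) simp_all
  moreover have "hp (cp orig +++ wloop v) (wloop v)" by (rule hp_lid) simp_all
  ultimately have 1: "hp (wloop (w @ v)) (wloop v)"
    using wloop_append[of w v] hp_trans by blast
  have "hp (wloop u +++ wloop (w @ v)) (wloop u +++ wloop v)"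
    by (rule hp_join[OF hp_refl 1]) simp_all
  then show ?thesis
    using wloop_append[of u "w @ v"] wloop_append[of u v] hp_sym hp_trans by blast
qed

lemma wloop_winv_null: "hp (wloop (u @ winv u)) (cp orig)"
proof (induction u)
  case Nil
  show ?case by (simp add: wloop_simps)
next
  case (Cons l u)
  have "hp (wloop ([l] @ (u @ winv u) @ [ilet l])) (wloop ([l] @ [ilet l]))"
    by (rule wloop_null_ctxt[OF Cons])
  then show ?case using wloop_cancel2[of l] hp_trans by simp
qed

text \<open>Crossing boundary points along \<open>w\<close> turns the ray to \<open>z\<close> into the ray to \<open>z'\<close>.\<close>

definition ray_rel :: "gword \<Rightarrow> complex \<Rightarrow> complex \<Rightarrow> bool" where
  "ray_rel w z z' \<longleftrightarrow> z \<in> disc \<and> z' \<in> disc \<and> hp (ray z) (wloop w +++ ray z')"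

lemma ray_rel_refl: "z \<in> disc \<Longrightarrow> ray_rel [] z z"
  unfolding ray_rel_def wloop_simps by (auto intro!: hp_sym[OF hp_lid] simp: ray)

lemma ray_rel_trans: "ray_rel w z z' \<Longrightarrow> ray_rel w' z' z'' \<Longrightarrow> ray_rel (w @ w') z z''"
proof -
  assume a: "ray_rel w z z'" "ray_rel w' z' z''"
  then have d: "z \<in> disc" "z' \<in> disc" "z'' \<in> disc" by (auto simp: ray_rel_def)
  have "hp (wloop w +++ ray z') (wloop w +++ (wloop w' +++ ray z''))"
    by (rule hp_join[OF hp_refl]) (use a in \<open>auto simp: ray_rel_def ray\<close>)
  moreover have "hp ((wloop w +++ wloop w') +++ ray z'') (wloop w +++ (wloop w' +++ ray z''))"
    by (rule hp_assoc) (use d in \<open>auto simp: ray\<close>)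
  moreover have "hp (wloop (w @ w') +++ ray z'') ((wloop w +++ wloop w') +++ ray z'')"
    by (rule hp_join[OF wloop_append]) (use d in \<open>auto simp: ray\<close>)
  ultimately show ?thesis using a d hp_sym hp_trans unfolding ray_rel_def by blast
qed

lemma ray_rel_null: "ray_rel w z z \<Longrightarrow> hp (wloop w) (cp orig)"
proof -
  assume a: "ray_rel w z z"
  then have d: "z \<in> disc" by (simp add: ray_rel_def)
  have "hp (wloop w) (ray z +++ reversepath (ray z))"
    by (rule hp_move_r) (use a d in \<open>auto simp: ray_rel_def ray intro: hp_sym\<close>)
  moreover have "hp (ray z +++ reversepath (ray z)) (cp orig)"
    by (rule hp_rinv) (use d in \<open>auto simp: ray\<close>)
  ultimately show ?thesis by (rule hp_trans)
qed

lemma ray_rel_sym: "ray_rel w z z' \<Longrightarrow> ray_rel (winv w) z' z"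
proof -
  assume a: "ray_rel w z z'"
  then have d: "z \<in> disc" "z' \<in> disc" by (auto simp: ray_rel_def)
  have s1: "hp (wloop (winv w) +++ ray z) (wloop (winv w) +++ (wloop w +++ ray z'))"
    by (rule hp_join[OF hp_refl]) (use a d in \<open>auto simp: ray_rel_def ray\<close>)
  have s2: "hp ((wloop (winv w) +++ wloop w) +++ ray z') (wloop (winv w) +++ (wloop w +++ ray z'))"
    by (rule hp_assoc) (use d in \<open>auto simp: ray\<close>)
  have s3: "hp (wloop (winv w @ w) +++ ray z') ((wloop (winv w) +++ wloop w) +++ ray z')"
    by (rule hp_join[OF wloop_append]) (use d in \<open>auto simp: ray\<close>)
  have "hp (wloop (winv w @ w)) (cp orig)"
    using wloop_winv_null[of "winv w"] by simp
  then have s4: "hp (wloop (winv w @ w) +++ ray z') (cp orig +++ ray z')"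
    by (rule hp_join[OF _ hp_refl]) (use d in \<open>auto simp: ray\<close>)
  have s5: "hp (cp orig +++ ray z') (ray z')" by (rule hp_lid) (use d in \<open>auto simp: ray\<close>)
  show ?thesis unfolding ray_rel_def
    by (intro conjI d hp_sym[OF hp_trans[OF s1 hp_trans[OF hp_sym[OF s2] hp_trans[OF hp_sym[OF s3] hp_trans[OF s4 s5]]]]])
qed

lemma arc_hp: "hp (ray (bp s)) (ray (bp s') +++ (\<lambda>u. Qm (bp (s' + u * (s - s')))))"
proof -
  let ?a = "\<lambda>u::real. bp (s' + u * (s - s'))"
  have a: "path ?a" "path_image ?a \<subseteq> disc"
    by (auto simp: path_def bp_def path_image_def intro!: continuous_intros continuous_on_compose2[OF continuous_on_cis])
  have e: "pathstart ?a = bp s'" "pathfinish ?a = bp s" by (simp_all add: pathstart_def pathfinish_def)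
  have l: "path_image (linepath 0 (bp s)) \<subseteq> disc" "path_image (linepath 0 (bp s')) \<subseteq> disc"
    by (rule linepath_disc; simp)+
  have "hp (Qm \<circ> linepath 0 (bp s)) (Qm \<circ> (linepath 0 (bp s') +++ ?a))"
    by (rule disc_hp) (use a e l in \<open>simp_all add: path_image_join\<close>)
  moreover have "Qm \<circ> ?a = (\<lambda>u. Qm (?a u))" by (simp add: o_def)
  ultimately show ?thesis unfolding path_compose_join ray_def by simp
qed

text \<open>The arc from the midpoint of side \<open>k\<close> to the point with parameter
  \<open>k + t\<close> and the arc from the glued midpoint to the glued point are the same path in
  the surface. Passing from one arc to the other replaces one ray by the other at the cost of one
  crossing.\<close>

lemma ray_crossing:
  assumes k: "k \<in> side_starts" and t: "t \<in> {0..1}"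
  shows "ray_rel [side_letter k] (bp (real k + t)) (bp (real k + 3 - t))"
proof -
  let ?p = "real k + 1/2" and ?q = "real k + 5/2"
  define a where "a = (\<lambda>u. Qm (bp (?p + u * (real k + t - ?p))))"
  define b where "b = (\<lambda>u. Qm (bp (?q + u * (real k + 3 - t - ?q))))"
  have 1: "hp (ray (bp (real k + t))) (ray (bp ?p) +++ a)"
    unfolding a_def by (rule arc_hp)
  have 2: "hp (ray (bp (real k + 3 - t))) (ray (bp ?q) +++ b)"
    unfolding b_def by (rule arc_hp)
  have ab: "a u = b u" if u: "u \<in> {0..1}" for u
  proof -
    have t': "(1 - u) * (1/2) + u * t \<in> {0..1}"
    proof -
      have "(1 - u) * (1/2) + u * t \<le> (1 - u) * 1 + u * 1" using u t by (intro add_mono mult_left_mono) auto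
      then show ?thesis using u t by auto
    qed
    have e1: "?p + u * (real k + t - ?p) = real k + ((1 - u) * (1/2) + u * t)" by (simp add: field_simps)
    have e2: "?q + u * (real k + 3 - t - ?q) = real k + 3 - ((1 - u) * (1/2) + u * t)" by (simp add: field_simps)
    show ?thesis unfolding a_def b_def e1 e2 by (rule Qm_glue[OF k t'])
  qed
  have pa: "path a" "path b" and st: "pathstart a = Qm (bp ?p)" "pathstart b = Qm (bp ?q)"
    using hp_ends[OF 1] hp_ends[OF 2] by (auto simp: a_def b_def pathstart_def ray)
  have hab: "hp a b" by (rule homotopic_paths_eq[OF pa(1)]) (use ab in auto)
  have "hp b (reversepath (ray (bp ?q)) +++ ray (bp (real k + 3 - t)))"
    by (rule hp_move_l[OF hp_sym[OF 2]]) (simp add: ray st)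
  from hp_trans[OF hab this] have haa: "hp a (reversepath (ray (bp ?q)) +++ ray (bp (real k + 3 - t)))" .
  have c1: "hp (ray (bp ?p) +++ a) (ray (bp ?p) +++ (reversepath (ray (bp ?q)) +++ ray (bp (real k + 3 - t))))"
    by (rule hp_join[OF hp_refl haa]) (simp_all add: ray st)
  have c2: "hp (crossing k +++ ray (bp (real k + 3 - t))) (ray (bp ?p) +++ (reversepath (ray (bp ?q)) +++ ray (bp (real k + 3 - t))))"
    unfolding crossing_def by (rule hp_assoc) (simp_all add: ray Qm_mid k)
  have c3: "hp (wloop [side_letter k] +++ ray (bp (real k + 3 - t))) (crossing k +++ ray (bp (real k + 3 - t)))"
    using wloop_single[of "side_letter k"] lloop_side_letter[OF k]
    by (intro hp_join) (simp_all add: ray)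
  show ?thesis unfolding ray_rel_def
    by (intro conjI bp_in_disc hp_trans[OF 1 hp_trans[OF c1 hp_sym[OF hp_trans[OF c3 c2]]]])
qed

lemma bp_periodic: "bp (s + 8 * of_int n) = bp s"
proof -
  have "bp (s + 8 * of_int n) = cis (pi * s / 4) * cis (2 * pi * of_int n)"
    unfolding bp_def cis_mult by (rule arg_cong[where f = cis]) (simp add: field_simps)
  then show ?thesis by (simp add: bp_def cis_multiple_2pi)
qed

text \<open>All eight corners are one point of the surface. Crossing sides round it visits the
  corners in the order 0, 3, 2, 1, 4, 7, 6, 5; back at 0 the collected word is the relator.
  Comparing the first ray with itself then shows that the loop of the relator is
  null-homotopic.\<close>

lemma star_rays:
  "ray_rel [(GA,True)] (bp 0) (bp 3)"
  "ray_rel [(GA,True),(GB,True)] (bp 0) (bp 2)"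
  "ray_rel [(GA,True),(GB,True),(GA,False)] (bp 0) (bp 1)"
  "ray_rel [(GA,True),(GB,True),(GA,False),(GB,False)] (bp 0) (bp 4)"
  "ray_rel [(GA,True),(GB,True),(GA,False),(GB,False),(GD,True)] (bp 0) (bp 7)"
  "ray_rel [(GA,True),(GB,True),(GA,False),(GB,False),(GD,True),(GC,True)] (bp 0) (bp 6)"
  "ray_rel [(GA,True),(GB,True),(GA,False),(GB,False),(GD,True),(GC,True),(GD,False)] (bp 0) (bp 5)"
  "ray_rel surface_relator (bp 0) (bp 0)"
proof -
  have s: "side_letter 0 = (GA,True)" "side_letter 1 = (GB,False)" "side_letter (Suc 0) = (GB,False)"
    "side_letter 4 = (GD,True)" "side_letter 5 = (GC,False)"
    by (simp_all add: side_letter_def)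
  have k: "0 \<in> side_starts" "1 \<in> side_starts" "4 \<in> side_starts" "5 \<in> side_starts"
    by (simp_all add: side_starts_def)
  show 1: "ray_rel [(GA,True)] (bp 0) (bp 3)"
    using ray_crossing[OF k(1), of 0] by (simp add: s)
  have "ray_rel [(GB,True)] (bp 3) (bp 2)"
    using ray_rel_sym[OF ray_crossing[OF k(2), of 1]] by (simp add: s ilet_def)
  from ray_rel_trans[OF 1 this]
  show 2: "ray_rel [(GA,True),(GB,True)] (bp 0) (bp 2)" by simp
  have "ray_rel [(GA,False)] (bp 2) (bp 1)"
    using ray_rel_sym[OF ray_crossing[OF k(1), of 1]] by (simp add: s ilet_def)
  from ray_rel_trans[OF 2 this]
  show 3: "ray_rel [(GA,True),(GB,True),(GA,False)] (bp 0) (bp 1)" by simp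
  have "ray_rel [(GB,False)] (bp 1) (bp 4)"
    using ray_crossing[OF k(2), of 0] by (simp add: s)
  from ray_rel_trans[OF 3 this]
  show 4: "ray_rel [(GA,True),(GB,True),(GA,False),(GB,False)] (bp 0) (bp 4)" by simp
  have "ray_rel [(GD,True)] (bp 4) (bp 7)"
    using ray_crossing[OF k(3), of 0] by (simp add: s)
  from ray_rel_trans[OF 4 this]
  show 5: "ray_rel [(GA,True),(GB,True),(GA,False),(GB,False),(GD,True)] (bp 0) (bp 7)" by simp
  have "ray_rel [(GC,True)] (bp 7) (bp 6)"
    using ray_rel_sym[OF ray_crossing[OF k(4), of 1]] by (simp add: s ilet_def)
  from ray_rel_trans[OF 5 this]
  show 6: "ray_rel [(GA,True),(GB,True),(GA,False),(GB,False),(GD,True),(GC,True)] (bp 0) (bp 6)" by simp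
  have "ray_rel [(GD,False)] (bp 6) (bp 5)"
    using ray_rel_sym[OF ray_crossing[OF k(3), of 1]] by (simp add: s ilet_def)
  from ray_rel_trans[OF 6 this]
  show 7: "ray_rel [(GA,True),(GB,True),(GA,False),(GB,False),(GD,True),(GC,True),(GD,False)] (bp 0) (bp 5)" by simp
  have "ray_rel [(GC,False)] (bp 5) (bp 0)"
    using ray_crossing[OF k(4), of 0] bp_periodic[of 0 1] by (simp add: s)
  from ray_rel_trans[OF 7 this]
  show "ray_rel surface_relator (bp 0) (bp 0)" by (simp add: surface_relator_def)
qed

lemma wloop_weq: "weq u v \<Longrightarrow> hp (wloop u) (wloop v)"
proof (induction rule: weq.induct)
  case (weq_cancel u l v)
  show ?case by (rule wloop_null_ctxt[OF wloop_cancel2])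
next
  case (weq_relator u v)
  show ?case by (rule wloop_null_ctxt[OF ray_rel_null[OF star_rays(8)]])
qed (auto intro: hp_sym hp_trans)

lemma wloop_winv: "hp (wloop (winv w)) (reversepath (wloop w))"
proof -
  have "hp (wloop w +++ wloop (winv w)) (cp orig)"
    using wloop_winv_null[of w] wloop_append[of w "winv w"] hp_sym hp_trans by blast
  then have "hp (wloop (winv w)) (reversepath (wloop w) +++ cp orig)"
    by (rule hp_move_l) simp
  moreover have "hp (reversepath (wloop w) +++ cp orig) (reversepath (wloop w))"
    by (rule hp_rid) simp_all
  ultimately show ?thesis by (rule hp_trans)
qed

subsection \<open>Labelled cells\<close>

text \<open>Within the cell, \<open>lab z\<close> records the copy of the octagon in which
  \<open>z\<close> lies, relative to the base point of the cell: passing through side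
  \<open>k\<close> appends its letter. By \<open>lab_ray\<close> the inverse of this word is the
  loop formed by the radius to \<open>z\<close>, the contraction track and the radius of
  \<open>m0\<close> backwards.\<close>

locale labelled_cell = surface_cell A K "Qm m0" for A K m0 +
  fixes lab :: "complex \<Rightarrow> gword"
  assumes m0: "m0 \<in> disc"
    and lab_loc: "\<And>z. z \<in> A \<Longrightarrow> \<exists>V. open V \<and> z \<in> V \<and> (\<forall>z'\<in>V \<inter> A. lab z' = lab z)"
    and lab_glue: "\<And>k t. \<lbrakk>k \<in> side_starts; t \<in> {0..1}; bp (real k + t) \<in> A\<rbrakk> \<Longrightarrow>
      weq (lab (bp (real k + 3 - t))) (lab (bp (real k + t)) @ [side_letter k])"
    and lab_ray: "\<And>z. z \<in> A \<Longrightarrow>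
      hp (ray z +++ (\<lambda>t. Qm (K (t, z)))) (wloop (winv (lab z)) +++ ray m0)"
begin

lemma path_K: "z \<in> A \<Longrightarrow> path (\<lambda>t. Qm (K (t, z)))"
proof -
  assume z: "z \<in> A"
  have "continuous_on {0..1} (\<lambda>t. K (t, z))"
    by (rule continuous_on_compose2[OF cont_K]) (use z in \<open>auto intro!: continuous_intros\<close>)
  then have "path (\<lambda>t. K (t, z))" by (simp add: path_def)
  then have "path (Qm \<circ> (\<lambda>t. K (t, z)))"
    by (rule path_Qm) (use z K_disc in \<open>auto simp: path_image_def\<close>)
  then show ?thesis by (simp add: o_def)
qed

text \<open>\<open>\<gamma>\<close> is replaced by the two contraction tracks; by
  \<open>lab_ray\<close> each of them, with its radius, turns into a word, and the radii to
  \<open>m0\<close> cancel.\<close>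

lemma cell_path:
  assumes g: "path \<gamma>" "path_image \<gamma> \<subseteq> Qm ` A" and zx: "zx \<in> A" "Qm zx = pathstart \<gamma>"
    and zy: "zy \<in> A" "Qm zy = pathfinish \<gamma>"
  shows "hp (ray zx +++ (\<gamma> +++ reversepath (ray zy))) (wloop (winv (lab zx) @ lab zy))"
proof -
  define kx where "kx = (\<lambda>t. Qm (K (t, zx)))"
  define ky where "ky = (\<lambda>t. Qm (K (t, zy)))"
  have k: "path kx" "path ky" using path_K zx zy by (auto simp: kx_def ky_def)
  have e: "pathstart kx = Qm zx" "pathstart ky = Qm zy" "pathfinish kx = Qm m0" "pathfinish ky = Qm m0"
    using zx zy K_0 K_1 by (auto simp: kx_def ky_def pathstart_def pathfinish_def)
  have d: "zx \<in> disc" "zy \<in> disc" using sub zx zy by auto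
  have r: "path (ray zx)" "path (ray zy)" "path (ray m0)" using ray d m0 by auto
  note [simp] = e k r ray
  define P Q where "P = wloop (winv (lab zx))" and "Q = wloop (winv (lab zy))"
  have [simp]: "path P" "path Q" "pathstart P = orig" "pathfinish P = orig" "pathstart Q = orig" "pathfinish Q = orig"
    by (auto simp: P_def Q_def)
  have G: "hp \<gamma> (kx +++ reversepath ky)"
    unfolding kx_def ky_def by (rule contract_hp[OF g zx(1) _ zy(1)]) (use zx zy in \<open>auto simp: pathstart_def pathfinish_def\<close>)
  have gs [simp]: "path \<gamma>" "pathstart \<gamma> = Qm zx" "pathfinish \<gamma> = Qm zy" using g zx zy by auto
  have X: "hp (ray zx +++ kx) (P +++ ray m0)" unfolding kx_def P_def by (rule lab_ray[OF zx(1)])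
  have Y: "hp (ray zy +++ ky) (Q +++ ray m0)" unfolding ky_def Q_def by (rule lab_ray[OF zy(1)])
  have Y': "hp (reversepath ky +++ reversepath (ray zy)) (reversepath (ray m0) +++ reversepath Q)"
    using homotopic_paths_reversepath_D[OF Y] by (simp add: reversepath_joinpaths)
  have "hp (ray zx +++ (\<gamma> +++ reversepath (ray zy))) (ray zx +++ ((kx +++ reversepath ky) +++ reversepath (ray zy)))"
    by (intro hp_join hp_refl G) simp_all
  also have "hp \<dots> (ray zx +++ (kx +++ (reversepath ky +++ reversepath (ray zy))))"
    by (intro hp_join hp_refl hp_assoc) simp_all
  also have "hp \<dots> ((ray zx +++ kx) +++ (reversepath ky +++ reversepath (ray zy)))"
    by (rule hp_sym, rule hp_assoc) simp_all
  also have "hp \<dots> ((P +++ ray m0) +++ (reversepath (ray m0) +++ reversepath Q))"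
    by (rule hp_join[OF X Y']) simp
  also have "hp \<dots> (P +++ (ray m0 +++ (reversepath (ray m0) +++ reversepath Q)))"
    by (rule hp_assoc) simp_all
  also have "hp \<dots> (P +++ reversepath Q)"
    by (intro hp_join hp_refl hp_cancel_l') simp_all
  also have "hp \<dots> (P +++ wloop (lab zy))"
    using wloop_winv[of "winv (lab zy)"] by (intro hp_join hp_refl hp_sym[of _ "reversepath Q"]) (simp_all add: Q_def)
  also have "hp \<dots> (wloop (winv (lab zx) @ lab zy))"
    unfolding P_def by (rule hp_sym[OF wloop_append])
  finally show ?thesis .
qed

end

lemma cmod_one_minus: "cmod (1 - complex_of_real t) = \<bar>1 - t\<bar>"
  by (metis norm_of_real of_real_1 of_real_diff)

lemma central_cell: "labelled_cell (ball 0 1) (\<lambda>(t, z). complex_of_real (1 - t) * z) 0 (\<lambda>z. [])"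
proof (unfold_locales, goal_cases)
  case 1
  then show ?case by (auto simp: saturated_def side_gluing_2)
next
  case 2
  show ?case unfolding openin_open by (rule exI[of _ "ball 0 1"]) auto
next
  case 3
  then show ?case by (auto simp: split_beta intro!: continuous_intros)
next
  case (4 t z)
  then have "\<bar>1 - t\<bar> * norm z \<le> 1 * 1" by (intro mult_mono) auto
  then show ?case by (simp add: norm_mult cmod_one_minus)
next
  case (7 z z' t)
  then show ?case by (auto simp: side_gluing_2)
next
  case (9 z)
  then show ?case by (intro exI[of _ UNIV]) auto
next
  case (11 z)
  define f where "f = (\<lambda>t. complex_of_real (1 - t) * z)"
  have f: "path f" by (auto simp: path_def f_def intro!: continuous_intros)
  have fi: "path_image f \<subseteq> disc"
  proof (clarsimp simp: path_image_def f_def)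
    fix t :: real assume "0 \<le> t" "t \<le> 1"
    then have "\<bar>1 - t\<bar> * norm z \<le> 1 * 1" using 11 by (intro mult_mono) auto
    then show "cmod ((1 - complex_of_real t) * z) \<le> 1" by (simp add: norm_mult cmod_one_minus)
  qed
  have z: "z \<in> disc" using 11 by simp
  have e: "pathstart f = z" "pathfinish f = 0" by (simp_all add: f_def pathstart_def pathfinish_def)
  have l: "path_image (linepath 0 z) \<subseteq> disc" "path_image (linepath 0 (0::complex)) \<subseteq> disc"
    by (rule linepath_disc; use z in simp)+
  have "hp (Qm \<circ> (linepath 0 z +++ f)) (Qm \<circ> (linepath 0 0))"
    by (rule disc_hp) (use f fi l e in \<open>simp_all add: path_image_join\<close>)
  then have 1: "hp (ray z +++ (Qm \<circ> f)) (ray 0)" by (simp only: path_compose_join ray_def)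
  have 2: "hp (wloop [] +++ ray 0) (ray 0)" unfolding wloop_simps by (rule hp_lid) (auto simp: ray)
  have "Qm \<circ> f = (\<lambda>t. Qm (case (t, z) of (t, z) \<Rightarrow> complex_of_real (1 - t) * z))" by (simp add: f_def o_def)
  then show ?case using hp_trans[OF 1 hp_sym[OF 2]] by simp
qed auto


subsection \<open>Sectors of the disc\<close>

definition rot :: "real \<Rightarrow> complex \<Rightarrow> complex" where
  "rot c z = z * cis (- (pi * c / 4))"

text \<open>The cone over the boundary parameters at distance less than \<open>1/2\<close> from
  \<open>c\<close>: a side has parameter length 1 and spans the angle \<open>pi / 4\<close>.\<close>

definition sector :: "real \<Rightarrow> complex set" where
  "sector c = {z. 0 < Re (rot c z) \<and> \<bar>Im (Ln (rot c z))\<bar> < pi / 8}"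

text \<open>Linear contraction in the coordinate \<open>Ln (rot c z)\<close>. On the unit circle it
  is linear in the boundary parameter, which makes it compatible with the gluing.\<close>

definition sector_contraction :: "real \<Rightarrow> real \<times> complex \<Rightarrow> complex" where
  "sector_contraction c y = cis (pi * c / 4) * exp (complex_of_real (1 - fst y) * Ln (rot c (snd y)))"

lemma rot_nonpos: "0 < Re z \<Longrightarrow> z \<notin> \<real>\<^sub>\<le>\<^sub>0"
  by (auto simp: complex_nonpos_Reals_iff)

lemma continuous_Ln_rot: "continuous_on {z. 0 < Re (rot c z)} (\<lambda>z. Ln (rot c z))"
proof (rule continuous_on_compose2[where t = "{w. 0 < Re w}" and g = Ln and f = "rot c"])
  show "continuous_on {w. 0 < Re w} Ln"
    by (intro continuous_at_imp_continuous_on ballI continuous_at_Ln rot_nonpos) simp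
  show "continuous_on {z. 0 < Re (rot c z)} (rot c)"
    unfolding rot_def by (intro continuous_intros)
qed auto

lemma open_sector: "open (sector c)"
proof -
  let ?S = "{z. 0 < Re (rot c z)}"
  have o: "open ?S" unfolding rot_def by (intro open_Collect_less continuous_intros)
  have "continuous_on ?S (\<lambda>z. \<bar>Im (Ln (rot c z))\<bar>)"
    by (intro continuous_on_rabs continuous_on_Im continuous_Ln_rot)
  then have "open (?S \<inter> (\<lambda>z. \<bar>Im (Ln (rot c z))\<bar>) -` {..<pi/8})"
    by (rule continuous_open_preimage[OF _ o]) simp
  moreover have "sector c = ?S \<inter> (\<lambda>z. \<bar>Im (Ln (rot c z))\<bar>) -` {..<pi/8}"
    by (auto simp: sector_def)
  ultimately show ?thesis by simp
qed

lemma rot_cis: "rot c z * cis (pi * c / 4) = z"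
  by (simp add: rot_def mult.assoc cis_mult)

lemma norm_rot: "norm (rot c z) = norm z"
  by (simp add: rot_def norm_mult)

lemma sector_polar:
  assumes "z \<in> sector c"
  obtains s where "\<bar>s - c\<bar> < 1 / 2" "z = of_real (norm z) * bp s" "z \<noteq> 0"
proof -
  define w where "w = rot c z"
  have w: "w \<noteq> 0" "\<bar>Im (Ln w)\<bar> < pi / 8" using assms by (auto simp: sector_def w_def)
  have "z \<noteq> 0" using w by (auto simp: w_def rot_def)
  define s where "s = c + 4 * Im (Ln w) / pi"
  have "w = exp (Ln w)" using w by simp
  also have "\<dots> = of_real (exp (Re (Ln w))) * cis (Im (Ln w))" by (rule exp_eq_polar)
  also have "exp (Re (Ln w)) = norm z" using w norm_rot[of c z] \<open>z \<noteq> 0\<close> by (simp add: w_def)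
  finally have 0: "w = of_real (norm z) * cis (Im (Ln w))" .
  have "z = w * cis (pi * c / 4)" using rot_cis[of c z] by (simp add: w_def)
  also have "\<dots> = of_real (norm z) * cis (Im (Ln w)) * cis (pi * c / 4)"
    by (rule arg_cong[OF 0, of "\<lambda>u. u * cis (pi * c / 4)"])
  finally have 1: "z = of_real (norm z) * (cis (Im (Ln w)) * cis (pi * c / 4))"
    by (simp only: mult.assoc)
  have 2: "pi * s / 4 = Im (Ln w) + pi * c / 4" by (simp add: s_def field_simps)
  have "z = of_real (norm z) * bp s"
    unfolding bp_def 2 using 1 unfolding cis_mult .
  moreover have "\<bar>s - c\<bar> < 1 / 2" using w(2) by (simp add: s_def abs_mult field_simps)
  ultimately show ?thesis using that \<open>z \<noteq> 0\<close> by blast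
qed

lemma bp_eq_iff: "bp s = bp s' \<longleftrightarrow> (\<exists>n::int. s = s' + 8 * of_int n)"
proof
  assume "bp s = bp s'"
  then have "exp (\<i> * complex_of_real (pi * s / 4)) = exp (\<i> * complex_of_real (pi * s' / 4))"
    by (simp add: bp_def cis_conv_exp)
  then obtain n :: int where "\<i> * complex_of_real (pi * s / 4) = \<i> * complex_of_real (pi * s' / 4) + complex_of_real (of_int (2 * n) * pi) * \<i>"
    unfolding exp_eq by blast
  then have "Im (\<i> * complex_of_real (pi * s / 4)) = Im (\<i> * complex_of_real (pi * s' / 4) + complex_of_real (of_int (2 * n) * pi) * \<i>)"
    by simp
  then have "pi * s / 4 = pi * s' / 4 + of_int (2 * n) * pi" by simp
  then have "pi * s = pi * (s' + 8 * of_int n)" by (simp add: field_simps)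
  then have "s = s' + 8 * of_int n" using pi_neq_zero mult_cancel_left by blast
  then show "\<exists>n::int. s = s' + 8 * of_int n" by blast
qed (auto simp: bp_periodic)

lemma Ln_rot_bp:
  assumes "\<bar>s - c - 8 * of_int n\<bar> < 1 / 2"
  shows "rot c (bp s) = cis (pi * (s - c - 8 * of_int n) / 4)"
    "Ln (rot c (bp s)) = \<i> * complex_of_real (pi * (s - c - 8 * of_int n) / 4)"
    "bp s \<in> sector c"
proof -
  define x where "x = s - c - 8 * of_int n"
  have x: "\<bar>x\<bar> < 1 / 2" using assms by (simp add: x_def)
  have px: "\<bar>pi * x / 4\<bar> < pi / 8" using x by (simp add: abs_mult field_simps)
  have "bp s = bp (c + x)" unfolding x_def by (simp add: bp_eq_iff)
  then have 1: "rot c (bp s) = cis (pi * x / 4)"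
    by (simp add: rot_def bp_def cis_mult field_simps)
  then show "rot c (bp s) = cis (pi * (s - c - 8 * of_int n) / 4)" by (simp add: x_def)
  have "Ln (exp (\<i> * complex_of_real (pi * x / 4))) = \<i> * complex_of_real (pi * x / 4)"
  proof (rule Ln_exp)
    have "Im (\<i> * complex_of_real (pi * x / 4)) = pi * x / 4" by simp
    then show "- pi < Im (\<i> * complex_of_real (pi * x / 4))" "Im (\<i> * complex_of_real (pi * x / 4)) \<le> pi"
      using px pi_gt_zero by linarith+
  qed
  then have 2: "Ln (rot c (bp s)) = \<i> * complex_of_real (pi * x / 4)" unfolding 1 by (simp add: cis_conv_exp)
  then show "Ln (rot c (bp s)) = \<i> * complex_of_real (pi * (s - c - 8 * of_int n) / 4)" by (simp add: x_def)
  have "cos (pi * x / 4) > 0" by (rule cos_gt_zero_pi) (use px pi_gt_zero in linarith)+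
  then have "Re (rot c (bp s)) > 0" using 1 by simp
  moreover have "\<bar>Im (Ln (rot c (bp s)))\<bar> < pi / 8" unfolding 2 using px by simp
  ultimately show "bp s \<in> sector c" by (simp add: sector_def)
qed

lemma bp_in_sector: "bp s \<in> sector c \<longleftrightarrow> (\<exists>n::int. \<bar>s - c - 8 * of_int n\<bar> < 1 / 2)"
proof
  assume "bp s \<in> sector c"
  then obtain s' where s': "\<bar>s' - c\<bar> < 1 / 2" "bp s = bp s'" by (rule sector_polar) simp
  then obtain n :: int where "s = s' + 8 * of_int n" unfolding bp_eq_iff by blast
  then show "\<exists>n::int. \<bar>s - c - 8 * of_int n\<bar> < 1 / 2" using s'(1) by (intro exI[of _ n]) simp
qed (use Ln_rot_bp(3) in blast)

lemma sector_contraction_bp: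
  assumes "\<bar>s - c - 8 * of_int n\<bar> < 1 / 2"
  shows "sector_contraction c (t, bp s) = bp ((c + 8 * of_int n) + (1 - t) * (s - (c + 8 * of_int n)))"
proof -
  have e: "complex_of_real (1 - t) * (\<i> * complex_of_real (pi * (s - c - 8 * of_int n) / 4)) =
      \<i> * complex_of_real ((1 - t) * (pi * (s - c - 8 * of_int n) / 4))" by simp
  have "sector_contraction c (t, bp s) = cis (pi * c / 4) * cis ((1 - t) * (pi * (s - c - 8 * of_int n) / 4))"
    unfolding sector_contraction_def fst_conv snd_conv Ln_rot_bp(2)[OF assms] e cis_conv_exp by (rule refl)
  also have "\<dots> = bp (c + (1 - t) * (s - (c + 8 * of_int n)))"
    unfolding cis_mult bp_def by (rule arg_cong[where f = cis]) (simp add: field_simps)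
  also have "\<dots> = bp ((c + (1 - t) * (s - (c + 8 * of_int n))) + 8 * of_int n)" by (rule bp_periodic[symmetric])
  finally show ?thesis by (simp add: algebra_simps)
qed

lemma sector_contraction:
  assumes "z \<in> sector c"
  shows "sector_contraction c (0, z) = z" "sector_contraction c (1, z) = bp c"
    "z \<in> disc \<Longrightarrow> t \<in> {0..1} \<Longrightarrow> sector_contraction c (t, z) \<in> disc"
proof -
  have w: "rot c z \<noteq> 0" using assms by (auto simp: sector_def)
  show "sector_contraction c (0, z) = z"
    using w rot_cis[of c z] by (simp add: sector_contraction_def mult.commute)
  show "sector_contraction c (1, z) = bp c"
    by (simp add: sector_contraction_def bp_def)
  assume a: "z \<in> disc" "t \<in> {0..1}"
  have "Re (complex_of_real (1 - t) * Ln (rot c z)) = (1 - t) * ln (norm z)"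
    using w by (simp add: norm_rot)
  then have "norm (sector_contraction c (t, z)) = exp ((1 - t) * ln (norm z))"
    unfolding sector_contraction_def fst_conv snd_conv norm_mult norm_exp_eq_Re norm_cis by simp
  moreover have "0 < norm z" using w by (simp flip: norm_rot[of c z])
  then have "(1 - t) * ln (norm z) \<le> 0"
    using a by (intro mult_nonneg_nonpos) auto
  ultimately show "sector_contraction c (t, z) \<in> disc" by simp
qed

lemma continuous_sector_contraction:
  "continuous_on (UNIV \<times> sector c) (sector_contraction c)"
proof -
  have "continuous_on (UNIV \<times> sector c) (\<lambda>y. Ln (rot c (snd y)))"
    by (rule continuous_on_compose2[OF continuous_Ln_rot continuous_on_snd[OF continuous_on_id]])
      (auto simp: sector_def)
  then show ?thesis
    unfolding sector_contraction_def
    by (intro continuous_on_mult continuous_on_const continuous_on_exp continuous_on_of_real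
        continuous_on_diff continuous_on_fst continuous_on_id)
qed

text \<open>Disjoint sectors round boundary points that are one point of the surface, each with a
  label. Parameters count modulo 8, hence the multiples of 8. As \<open>k + t\<close> is glued to
  \<open>k + 3 - t\<close>, the sum \<open>2 * real k + 3\<close> of the two centres says that they
  are glued to each other as well, the first one lying on side \<open>k\<close>.\<close>

locale fan =
  fixes P :: "(real \<times> gword) set" and c0 :: real
  assumes sep: "\<And>p p' n. \<lbrakk>p \<in> P; p' \<in> P; \<bar>fst p - fst p' - 8 * of_int n\<bar> < 1\<rbrakk> \<Longrightarrow> p = p'"
    and glue: "\<And>k t. \<lbrakk>k \<in> side_starts; t \<in> {0..1};
       (\<exists>p\<in>P. bp (real k + t) \<in> sector (fst p)) \<or> (\<exists>p\<in>P. bp (real k + 3 - t) \<in> sector (fst p))\<rbrakk> \<Longrightarrow>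
       \<exists>p\<in>P. \<exists>p'\<in>P. \<exists>n n'. \<bar>real k + t - fst p - 8 * of_int n\<bar> < 1 / 2 \<and>
         \<bar>real k + 3 - t - fst p' - 8 * of_int n'\<bar> < 1 / 2 \<and>
         fst p + 8 * of_int n + (fst p' + 8 * of_int n') = 2 * real k + 3 \<and>
         real k \<le> fst p + 8 * of_int n \<and> fst p + 8 * of_int n \<le> real k + 1 \<and>
         weq (snd p') (snd p @ [side_letter k])"
    and rays: "\<And>p. p \<in> P \<Longrightarrow> ray_rel (winv (snd p)) (bp (fst p)) (bp c0)"
begin

definition A where "A = (\<Union>p\<in>P. sector (fst p)) \<inter> disc"
definition idx where "idx z = (THE p. p \<in> P \<and> z \<in> sector (fst p))"
definition K where "K y = sector_contraction (fst (idx (snd y))) y"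
definition lab where "lab z = snd (idx z)"

lemma idx:
  assumes "p \<in> P" "z \<in> sector (fst p)"
  shows "idx z = p"
  unfolding idx_def
proof (rule the_equality)
  fix p' assume p': "p' \<in> P \<and> z \<in> sector (fst p')"
  obtain s where s: "\<bar>s - fst p\<bar> < 1 / 2" "z = of_real (norm z) * bp s" "z \<noteq> 0"
    using sector_polar[OF assms(2)] by blast
  obtain s' where s': "\<bar>s' - fst p'\<bar> < 1 / 2" "z = of_real (norm z) * bp s'"
    using sector_polar p' by blast
  have "of_real (norm z) * bp s = of_real (norm z) * bp s'" using s s' by simp
  then have "bp s = bp s'" using s(3) by simp
  then obtain n :: int where n: "s = s' + 8 * of_int n" unfolding bp_eq_iff by blast
  have "\<bar>fst p' - fst p - 8 * of_int (- n)\<bar> < 1" using s s' n by (simp add: abs_real_def split: if_splits)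
  then show "p' = p" using sep p' assms by blast
qed (use assms in simp)

lemma A_cases: "z \<in> A \<Longrightarrow> idx z \<in> P \<and> z \<in> sector (fst (idx z)) \<and> z \<in> disc"
  unfolding A_def using idx by auto

lemma A_I: "p \<in> P \<Longrightarrow> z \<in> sector (fst p) \<Longrightarrow> z \<in> disc \<Longrightarrow> z \<in> A"
  unfolding A_def by auto

lemma glueA:
  assumes k: "k \<in> side_starts" and t: "t \<in> {0..1}" and A: "bp (real k + t) \<in> A \<or> bp (real k + 3 - t) \<in> A"
  obtains C C' where "C + C' = 2 * real k + 3" "real k \<le> C" "C \<le> real k + 1"
    "bp (real k + t) \<in> A" "bp (real k + 3 - t) \<in> A"
    "\<And>u. K (u, bp (real k + t)) = bp (C + (1 - u) * (real k + t - C))"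
    "\<And>u. K (u, bp (real k + 3 - t)) = bp (C' + (1 - u) * (real k + 3 - t - C'))"
    "weq (lab (bp (real k + 3 - t))) (lab (bp (real k + t)) @ [side_letter k])"
proof -
  have "(\<exists>p\<in>P. bp (real k + t) \<in> sector (fst p)) \<or> (\<exists>p\<in>P. bp (real k + 3 - t) \<in> sector (fst p))"
    using A unfolding A_def by blast
  then obtain p p' n n' where p: "p \<in> P" "p' \<in> P" and n: "\<bar>real k + t - fst p - 8 * of_int n\<bar> < 1 / 2"
    and n': "\<bar>real k + 3 - t - fst p' - 8 * of_int n'\<bar> < 1 / 2"
    and c: "fst p + 8 * of_int n + (fst p' + 8 * of_int n') = 2 * real k + 3"
       "real k \<le> fst p + 8 * of_int n" "fst p + 8 * of_int n \<le> real k + 1"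
    and w: "weq (snd p') (snd p @ [side_letter k])"
    using glue[OF k t] by blast
  have s: "bp (real k + t) \<in> sector (fst p)" "bp (real k + 3 - t) \<in> sector (fst p')"
    using Ln_rot_bp(3)[OF n] Ln_rot_bp(3)[OF n'] by auto
  show ?thesis
  proof (rule that[OF c])
    show "bp (real k + t) \<in> A" "bp (real k + 3 - t) \<in> A" using A_I p s by auto
    show "K (u, bp (real k + t)) = bp (fst p + 8 * of_int n + (1 - u) * (real k + t - (fst p + 8 * of_int n)))" for u
      unfolding K_def snd_conv idx[OF p(1) s(1)] by (rule sector_contraction_bp[OF n])
    show "K (u, bp (real k + 3 - t)) = bp (fst p' + 8 * of_int n' + (1 - u) * (real k + 3 - t - (fst p' + 8 * of_int n')))" for u
      unfolding K_def snd_conv idx[OF p(2) s(2)] by (rule sector_contraction_bp[OF n'])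
    show "weq (lab (bp (real k + 3 - t))) (lab (bp (real k + t)) @ [side_letter k])"
      unfolding lab_def idx[OF p(1) s(1)] idx[OF p(2) s(2)] by (rule w)
  qed
qed

lemma continuous_K: "continuous_on (UNIV \<times> (\<Union>p\<in>P. sector (fst p))) K"
proof -
  have "continuous_on (\<Union>p\<in>P. UNIV \<times> sector (fst p)) K"
  proof (rule continuous_on_open_UN)
    fix p assume p: "p \<in> P"
    show "open ((UNIV :: real set) \<times> sector (fst p))" by (intro open_Times open_sector) simp
    show "continuous_on (UNIV \<times> sector (fst p)) K"
      by (rule continuous_on_eq[OF continuous_sector_contraction[of "fst p"]])
        (use idx[OF p] in \<open>auto simp: K_def\<close>)
  qed
  moreover have "(\<Union>p\<in>P. (UNIV :: real set) \<times> sector (fst p)) = UNIV \<times> (\<Union>p\<in>P. sector (fst p))" by auto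
  ultimately show ?thesis by simp
qed

lemma fan_cell: "labelled_cell A K (bp c0) lab"
proof (unfold_locales, goal_cases)
  case 1
  show ?case unfolding saturated_def
  proof (clarify)
    fix z z' assume "(z, z') \<in> side_gluing 2"
    then obtain k t where kt: "k \<in> side_starts" "t \<in> {0..1}" "z = bp (real k + t)" "z' = bp (real k + 3 - t)"
      unfolding side_gluing_2 by blast
    show "(z \<in> A) = (z' \<in> A)" using glueA[OF kt(1,2)] unfolding kt by blast
  qed
next
  case 2
  have "open (\<Union>p\<in>P. sector (fst p))" using open_sector by blast
  then show ?case unfolding openin_open A_def by (metis Int_commute)
next
  case 3
  show ?case by (rule continuous_on_subset[OF continuous_K]) (auto simp: A_def)
next
  case (4 t z)
  then show ?case using A_cases sector_contraction(3) by (simp add: K_def)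
next
  case (5 z)
  then show ?case using A_cases sector_contraction(1) by (simp add: K_def)
next
  case (6 z)
  then have "K (1, z) = bp (fst (idx z))" "idx z \<in> P" using A_cases sector_contraction(2) by (auto simp: K_def)
  moreover have "Qm (bp (fst p)) = Qm (bp c0)" if "p \<in> P" for p
  proof -
    have "hp (ray (bp (fst p))) (wloop (winv (snd p)) +++ ray (bp c0))" using rays[OF that] by (simp add: ray_rel_def)
    from hp_ends[OF this] show ?thesis by (simp add: ray)
  qed
  ultimately show ?case by simp
next
  case (7 z z' u)
  then obtain k t where kt: "k \<in> side_starts" "t \<in> {0..1}" "z = bp (real k + t)" "z' = bp (real k + 3 - t)"
    unfolding side_gluing_2 by blast
  obtain C C' where C: "C + C' = 2 * real k + 3" "real k \<le> C" "C \<le> real k + 1"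
    "K (u, z) = bp (C + (1 - u) * (real k + t - C))" "K (u, z') = bp (C' + (1 - u) * (real k + 3 - t - C'))"
    using glueA[OF kt(1,2)] 7(2) unfolding kt by metis
  \<comment> \<open>The contracted point in the parameter of side \<open>k\<close>: a convex
    combination of \<open>t\<close> and the position \<open>C - real k\<close> of the centre, hence
    still on the side.\<close>
  define t' where "t' = (1 - u) * t + u * (C - real k)"
  have "t' \<le> (1 - u) * 1 + u * 1" unfolding t'_def using C kt 7(3) by (intro add_mono mult_left_mono) auto
  moreover have "0 \<le> t'" unfolding t'_def using C kt 7(3) by (intro add_nonneg_nonneg mult_nonneg_nonneg) auto
  ultimately have t': "t' \<in> {0..1}" by simp
  have C': "C' = 2 * real k + 3 - C" using C(1) by simp
  have e: "C + (1 - u) * (real k + t - C) = real k + t'"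
    "C' + (1 - u) * (real k + 3 - t - C') = real k + 3 - t'"
    unfolding t'_def C' by (simp_all add: algebra_simps)
  show ?case unfolding C(4,5) e by (rule Qm_glue[OF kt(1) t'])
next
  case 8
  show ?case by simp
next
  case (9 z)
  have "idx z' = idx z" if "z' \<in> sector (fst (idx z))" for z'
    using idx[OF _ that] A_cases[OF 9] by blast
  then have "\<forall>z'\<in>sector (fst (idx z)) \<inter> A. lab z' = lab z" by (simp add: lab_def)
  then show ?case using A_cases[OF 9] open_sector by blast
next
  case (10 k t)
  show ?case using glueA[OF 10(1,2)] 10(3) by metis
next
  case (11 z)
  then have z: "idx z \<in> P" "z \<in> sector (fst (idx z))" "z \<in> disc" using A_cases by auto
  define f where "f = (\<lambda>t. K (t, z))"
  have "continuous_on {0..1} f"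
    unfolding f_def by (rule continuous_on_compose2[OF continuous_K])
      (use z in \<open>auto intro!: continuous_intros\<close>)
  then have f: "path f" by (simp add: path_def)
  have fi: "path_image f \<subseteq> disc"
    using sector_contraction(3)[OF z(2,3)] by (auto simp: path_image_def f_def K_def)
  have e: "pathstart f = z" "pathfinish f = bp (fst (idx z))"
    using sector_contraction(1,2)[OF z(2)] by (simp_all add: f_def pathstart_def pathfinish_def K_def)
  have l: "path_image (linepath 0 z) \<subseteq> disc" "path_image (linepath 0 (bp (fst (idx z)))) \<subseteq> disc"
    by (rule linepath_disc; use z in simp)+
  have "hp (Qm \<circ> (linepath 0 z +++ f)) (Qm \<circ> (linepath 0 (bp (fst (idx z)))))"
    by (rule disc_hp) (use f fi l e in \<open>simp_all add: path_image_join\<close>)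
  then have "hp (ray z +++ (Qm \<circ> f)) (ray (bp (fst (idx z))))" by (simp only: path_compose_join ray_def)
  moreover have "hp (ray (bp (fst (idx z)))) (wloop (winv (lab z)) +++ ray (bp c0))"
    using rays[OF z(1)] by (simp add: ray_rel_def lab_def)
  moreover have "Qm \<circ> f = (\<lambda>t. Qm (K (t, z)))" by (simp add: f_def o_def)
  ultimately show ?case using hp_trans by simp
qed

end

subsection \<open>The cells of the surface\<close>

lemma of_real_bp_in_sector:
  assumes "\<bar>s - c\<bar> < 1 / 2" "\<rho> > 0"
  shows "of_real \<rho> * bp s \<in> sector c"
proof -
  have s: "\<bar>s - c - 8 * of_int 0\<bar> < 1 / 2" using assms(1) by simp
  have b: "bp s \<in> sector c" by (rule Ln_rot_bp(3)[OF s])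
  have r: "rot c (of_real \<rho> * bp s) = of_real \<rho> * rot c (bp s)" by (simp add: rot_def)
  have "rot c (bp s) \<noteq> 0" using b by (auto simp: sector_def)
  then have "Im (Ln (rot c (of_real \<rho> * bp s))) = Im (Ln (rot c (bp s)))"
    unfolding r using Ln_times_of_real[OF assms(2)] Ln_of_real[OF assms(2)] by simp
  moreover have "Re (rot c (of_real \<rho> * bp s)) = \<rho> * Re (rot c (bp s))" unfolding r by simp
  ultimately show ?thesis using b assms(2) by (simp add: sector_def)
qed

text \<open>The words of \<open>star_rays\<close>, indexed by the corner that they lead to; the last
  branch is meant for corner 5.\<close>

definition star_label :: "int \<Rightarrow> gword" where
  "star_label m = (if m = 0 then [] else if m = 3 then [(GA,True)]
     else if m = 2 then [(GA,True),(GB,True)]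
     else if m = 1 then [(GA,True),(GB,True),(GA,False)]
     else if m = 4 then [(GA,True),(GB,True),(GA,False),(GB,False)]
     else if m = 7 then [(GA,True),(GB,True),(GA,False),(GB,False),(GD,True)]
     else if m = 6 then [(GA,True),(GB,True),(GA,False),(GB,False),(GD,True),(GC,True)]
     else [(GA,True),(GB,True),(GA,False),(GB,False),(GD,True),(GC,True),(GD,False)])"

lemma side_letter_simps:
  "side_letter 0 = (GA,True)" "side_letter 1 = (GB,False)" "side_letter (Suc 0) = (GB,False)"
  "side_letter 4 = (GD,True)" "side_letter 5 = (GC,False)"
  by (simp_all add: side_letter_def)

lemma weq_undo: "weq w (w @ [l, ilet l])"
  using weq_sym[OF weq_cancel[of w l "[]"]] by simp

text \<open>Gluing side \<open>k\<close> to side \<open>k + 2\<close> identifies corner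
  \<open>k\<close> with \<open>k + 3\<close> and corner \<open>k + 1\<close> with
  \<open>k + 2\<close>. The labels were read off along the walk round the vertex, so seven of the
  eight identifications hold up to cancellation; only the step from 5 back to 0, which closes the
  walk, uses the relator.\<close>

lemma star_label_step:
  assumes "k \<in> side_starts"
  shows "weq (star_label ((int k + 3) mod 8)) (star_label (int k mod 8) @ [side_letter k])"
    "weq (star_label ((int k + 2) mod 8)) (star_label ((int k + 1) mod 8) @ [side_letter k])"
proof -
  have k: "k = 0 \<or> k = 1 \<or> k = 4 \<or> k = 5" using assms by (auto simp: side_starts_def)
  have rel: "weq [] surface_relator" using weq_sym[OF weq_relator[of "[]" "[]"]] by simp
  show "weq (star_label ((int k + 3) mod 8)) (star_label (int k mod 8) @ [side_letter k])"
    using k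
  proof (elim disjE)
    assume "k = 5"
    then show ?thesis using rel by (simp add: star_label_def side_letter_simps surface_relator_def)
  qed (simp_all add: star_label_def side_letter_simps weq_refl)
  show "weq (star_label ((int k + 2) mod 8)) (star_label ((int k + 1) mod 8) @ [side_letter k])"
    using k
  proof (elim disjE)
    assume "k = 0"
    then show ?thesis using weq_undo[of "[(GA,True),(GB,True)]" "(GA,False)"]
      by (simp add: star_label_def side_letter_simps ilet_def)
  next
    assume "k = 1"
    then show ?thesis using weq_undo[of "[(GA,True)]" "(GB,True)"]
      by (simp add: star_label_def side_letter_simps ilet_def)
  next
    assume "k = 4"
    then show ?thesis using weq_undo[of "[(GA,True),(GB,True),(GA,False),(GB,False),(GD,True),(GC,True)]" "(GD,False)"]
      by (simp add: star_label_def side_letter_simps ilet_def)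
  next
    assume "k = 5"
    then show ?thesis using weq_undo[of "[(GA,True),(GB,True),(GA,False),(GB,False),(GD,True)]" "(GC,True)"]
      by (simp add: star_label_def side_letter_simps ilet_def)
  qed
qed

definition star_data :: "(real \<times> gword) set" where
  "star_data = (\<lambda>m. (real_of_int m, star_label m)) ` {0..7}"

lemma star_data_mod: "(real_of_int (m mod 8), star_label (m mod 8)) \<in> star_data"
  unfolding star_data_def by (rule image_eqI[of _ _ "m mod 8"]) auto

lemma real_mod8: "real_of_int (m mod 8) + 8 * real_of_int (m div 8) = real_of_int m"
  using mod_mult_div_eq[of m 8] by (metis of_int_add of_int_mult of_int_numeral)

lemma fan_star: "fan star_data 0"
proof
  fix p p' n assume p: "p \<in> star_data" "p' \<in> star_data" and n: "\<bar>fst p - fst p' - 8 * of_int n\<bar> < 1"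
  obtain m m' where m: "p = (real_of_int m, star_label m)" "m \<in> {0..7}"
    "p' = (real_of_int m', star_label m')" "m' \<in> {0..7}"
    using p unfolding star_data_def by blast
  have "\<bar>real_of_int (m - m' - 8 * n)\<bar> < 1" using n m by simp
  then have "m - m' - 8 * n = 0" by linarith
  moreover have "0 \<le> m" "m \<le> 7" "0 \<le> m'" "m' \<le> 7" using m by auto
  ultimately have "m = m'" by presburger
  then show "p = p'" using m by simp
next
  fix k t assume k: "k \<in> side_starts" and t: "t \<in> {0..1}" and
    h: "(\<exists>p\<in>star_data. bp (real k + t) \<in> sector (fst p)) \<or> (\<exists>p\<in>star_data. bp (real k + 3 - t) \<in> sector (fst p))"
  \<comment> \<open>The midpoint of a side has distance exactly \<open>1 / 2\<close> from the
    nearest corners and lies in no sector of the star. Every other point of the side lies in the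
    sector of its nearer end, and its partner in that of the corner glued to this end.\<close>
  have "t \<noteq> 1 / 2"
  proof
    assume t2: "t = 1 / 2"
    have no: "\<not> \<bar>real k + 1 / 2 - fst p - 8 * real_of_int n\<bar> < 1 / 2 \<and>
        \<not> \<bar>real k + 3 - 1 / 2 - fst p - 8 * real_of_int n\<bar> < 1 / 2" if p: "p \<in> star_data" for p n
    proof -
      obtain m where m: "fst p = real_of_int m" using p unfolding star_data_def by auto
      have "\<not> \<bar>real_of_int j + 1 / 2\<bar> < 1 / 2" for j :: int
      proof
        assume "\<bar>real_of_int j + 1 / 2\<bar> < 1 / 2"
        then have "real_of_int j < real_of_int 0" "real_of_int (-1) < real_of_int j" by linarith+
        then have "j < 0" "-1 < j" unfolding of_int_less_iff .
        then show False by simp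
      qed
      from this[of "int k - m - 8 * n"] this[of "int k + 2 - m - 8 * n"]
      show ?thesis unfolding m by (simp add: algebra_simps)
    qed
    show False using h no unfolding bp_in_sector t2 by blast
  qed
  have rep: "\<exists>p\<in>star_data. \<exists>p'\<in>star_data. \<exists>n n'. \<bar>real k + t - fst p - 8 * of_int n\<bar> < 1 / 2 \<and>
         \<bar>real k + 3 - t - fst p' - 8 * of_int n'\<bar> < 1 / 2 \<and>
         fst p + 8 * of_int n + (fst p' + 8 * of_int n') = 2 * real k + 3 \<and>
         real k \<le> fst p + 8 * of_int n \<and> fst p + 8 * of_int n \<le> real k + 1 \<and>
         weq (snd p') (snd p @ [side_letter k])"
    if C: "C + C' = 2 * int k + 3" "int k \<le> C" "C \<le> int k + 1" "\<bar>real k + t - real_of_int C\<bar> < 1 / 2"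
      and w: "weq (star_label (C' mod 8)) (star_label (C mod 8) @ [side_letter k])" for C C' :: int
  proof (rule bexI[OF _ star_data_mod[of C]], rule bexI[OF _ star_data_mod[of C']],
      rule exI[of _ "C div 8"], rule exI[of _ "C' div 8"])
    have s: "real_of_int C + real_of_int C' = 2 * real k + 3"
      using C(1) by (metis of_int_add of_int_mult of_int_numeral of_int_of_nat_eq)
    then have "\<bar>real k + 3 - t - real_of_int C'\<bar> < 1 / 2" using C(4) by linarith
    moreover have "real k \<le> real_of_int C" "real_of_int C \<le> real k + 1" using C(2,3) by linarith+
    ultimately show "\<bar>real k + t - fst (real_of_int (C mod 8), star_label (C mod 8)) - 8 * of_int (C div 8)\<bar> < 1 / 2 \<and>
         \<bar>real k + 3 - t - fst (real_of_int (C' mod 8), star_label (C' mod 8)) - 8 * of_int (C' div 8)\<bar> < 1 / 2 \<and>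
         fst (real_of_int (C mod 8), star_label (C mod 8)) + 8 * of_int (C div 8) + (fst (real_of_int (C' mod 8), star_label (C' mod 8)) + 8 * of_int (C' div 8)) = 2 * real k + 3 \<and>
         real k \<le> fst (real_of_int (C mod 8), star_label (C mod 8)) + 8 * of_int (C div 8) \<and> fst (real_of_int (C mod 8), star_label (C mod 8)) + 8 * of_int (C div 8) \<le> real k + 1 \<and>
         weq (snd (real_of_int (C' mod 8), star_label (C' mod 8))) (snd (real_of_int (C mod 8), star_label (C mod 8)) @ [side_letter k])"
      using real_mod8[of C] real_mod8[of C'] C(4) s w unfolding fst_conv snd_conv by (intro conjI) linarith+
  qed
  show "\<exists>p\<in>star_data. \<exists>p'\<in>star_data. \<exists>n n'. \<bar>real k + t - fst p - 8 * of_int n\<bar> < 1 / 2 \<and>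
         \<bar>real k + 3 - t - fst p' - 8 * of_int n'\<bar> < 1 / 2 \<and>
         fst p + 8 * of_int n + (fst p' + 8 * of_int n') = 2 * real k + 3 \<and>
         real k \<le> fst p + 8 * of_int n \<and> fst p + 8 * of_int n \<le> real k + 1 \<and>
         weq (snd p') (snd p @ [side_letter k])"
  proof (cases "t < 1 / 2")
    case True
    show ?thesis by (rule rep[of "int k" "int k + 3"]) (use True t star_label_step(1)[OF k] in auto)
  next
    case False
    then have "t > 1 / 2" using \<open>t \<noteq> 1 / 2\<close> by simp
    then show ?thesis by (intro rep[of "int k + 1" "int k + 2"]) (use t star_label_step(2)[OF k] in \<open>auto simp: abs_if\<close>)
  qed
next
  fix p assume "p \<in> star_data"
  then obtain m where m: "p = (real_of_int m, star_label m)" "m \<in> {0..7}" unfolding star_data_def by blast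
  have "m = 0 \<or> m = 1 \<or> m = 2 \<or> m = 3 \<or> m = 4 \<or> m = 5 \<or> m = 6 \<or> m = 7" using m(2) by auto
  then have "ray_rel (star_label m) (bp 0) (bp (real_of_int m))"
    using star_rays ray_rel_refl[of "bp 0"] by (auto simp: star_label_def)
  then show "ray_rel (winv (snd p)) (bp (fst p)) (bp 0)" using ray_rel_sym m(1) by simp
qed

definition edge_data :: "nat \<Rightarrow> (real \<times> gword) set" where
  "edge_data k = {(real k + 1/2, []), (real k + 5/2, [side_letter k])}"

lemma fan_edge:
  assumes k: "k \<in> side_starts"
  shows "fan (edge_data k) (real k + 1/2)"
proof
  fix p p' n assume p: "p \<in> edge_data k" "p' \<in> edge_data k" and n: "\<bar>fst p - fst p' - 8 * of_int n\<bar> < 1"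
  have far: "\<not> \<bar>real_of_int (j - 8 * n)\<bar> < 1" if "j = 2 \<or> j = -2" for j
  proof
    assume "\<bar>real_of_int (j - 8 * n)\<bar> < 1"
    then have "j - 8 * n = 0" by linarith
    then show False using that by presburger
  qed
  have "\<not> \<bar>2 - 8 * real_of_int n\<bar> < 1" "\<not> \<bar>- 2 - 8 * real_of_int n\<bar> < 1"
    using far[of 2] far[of "-2"] by simp_all
  then show "p = p'" using p n by (auto simp: edge_data_def)
next
  fix k' t assume k': "k' \<in> side_starts" and t: "t \<in> {0..1}" and
    h: "(\<exists>p\<in>edge_data k. bp (real k' + t) \<in> sector (fst p)) \<or> (\<exists>p\<in>edge_data k. bp (real k' + 3 - t) \<in> sector (fst p))"
  from h obtain n :: int where n: "\<bar>real k' + t - (real k + 1/2) - 8 * real_of_int n\<bar> < 1 / 2 \<or>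
     \<bar>real k' + t - (real k + 5/2) - 8 * real_of_int n\<bar> < 1 / 2 \<or>
     \<bar>real k' + 3 - t - (real k + 1/2) - 8 * real_of_int n\<bar> < 1 / 2 \<or>
     \<bar>real k' + 3 - t - (real k + 5/2) - 8 * real_of_int n\<bar> < 1 / 2"
    unfolding edge_data_def bp_in_sector by force
  have unit: "j = 0 \<and> 0 < u \<and> u < 1" if "\<bar>real_of_int j + u - 1/2\<bar> < 1/2" "0 \<le> u" "u \<le> 1" for j u
  proof -
    have "real_of_int j < 1" "real_of_int j > -1" using that by linarith+
    then have j: "j = 0" by linarith
    then have "\<bar>u - 1/2\<bar> < 1/2" using that(1) by simp
    then have "0 < u" "u < 1" by linarith+
    then show ?thesis using j by simp
  qed
  have "(int k' = int k + 8 * n \<or> int k' = int k + 2 + 8 * n \<or> int k' + 2 = int k + 8 * n) \<and> 0 < t \<and> t < 1"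
  proof -
    have e: "real k' + t - (real k + 1/2) - 8 * real_of_int n = real_of_int (int k' - int k - 8 * n) + t - 1/2"
      "real k' + t - (real k + 5/2) - 8 * real_of_int n = real_of_int (int k' - int k - 2 - 8 * n) + t - 1/2"
      "real k' + 3 - t - (real k + 1/2) - 8 * real_of_int n = real_of_int (int k' + 2 - int k - 8 * n) + (1 - t) - 1/2"
      "real k' + 3 - t - (real k + 5/2) - 8 * real_of_int n = real_of_int (int k' - int k - 8 * n) + (1 - t) - 1/2"
      by simp_all
    have t01: "0 \<le> t" "t \<le> 1" "0 \<le> 1 - t" "1 - t \<le> 1" using t by auto
    show ?thesis
      using n unfolding e
    proof (elim disjE)
      assume "\<bar>real_of_int (int k' - int k - 8 * n) + t - 1/2\<bar> < 1/2"
      from unit[OF this t01(1,2)] show ?thesis by linarith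
    next
      assume "\<bar>real_of_int (int k' - int k - 2 - 8 * n) + t - 1/2\<bar> < 1/2"
      from unit[OF this t01(1,2)] show ?thesis by linarith
    next
      assume "\<bar>real_of_int (int k' + 2 - int k - 8 * n) + (1 - t) - 1/2\<bar> < 1/2"
      from unit[OF this t01(3,4)] show ?thesis by linarith
    next
      assume "\<bar>real_of_int (int k' - int k - 8 * n) + (1 - t) - 1/2\<bar> < 1/2"
      from unit[OF this t01(3,4)] show ?thesis by linarith
    qed
  qed
  then have kk: "int k' = int k + 8 * n \<or> int k' = int k + 2 + 8 * n \<or> int k' + 2 = int k + 8 * n"
    and t': "0 < t" "t < 1" by auto
  \<comment> \<open>No two elements of \<open>side_starts\<close> differ by 2 modulo 8, so an edge
    cell meets only the two sides that it was made for.\<close>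
  have "int k' = int k"
    using kk k k' unfolding side_starts_def by (auto; presburger)
  then have kk: "k' = k" by simp
  show "\<exists>p\<in>edge_data k. \<exists>p'\<in>edge_data k. \<exists>n n'. \<bar>real k' + t - fst p - 8 * of_int n\<bar> < 1 / 2 \<and>
         \<bar>real k' + 3 - t - fst p' - 8 * of_int n'\<bar> < 1 / 2 \<and>
         fst p + 8 * of_int n + (fst p' + 8 * of_int n') = 2 * real k' + 3 \<and>
         real k' \<le> fst p + 8 * of_int n \<and> fst p + 8 * of_int n \<le> real k' + 1 \<and>
         weq (snd p') (snd p @ [side_letter k'])"
    unfolding kk
    by (rule bexI[of _ "(real k + 1/2, [])"], rule bexI[of _ "(real k + 5/2, [side_letter k])"], rule exI[of _ 0], rule exI[of _ 0])
      (use t' in \<open>auto simp: edge_data_def weq_refl abs_if\<close>)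
next
  fix p assume p: "p \<in> edge_data k"
  have 1: "ray_rel [side_letter k] (bp (real k + 1/2)) (bp (real k + 5/2))"
    using ray_crossing[OF k, of "1/2"] by (simp add: add.commute)
  show "ray_rel (winv (snd p)) (bp (fst p)) (bp (real k + 1/2))"
    using p ray_rel_sym[OF 1] ray_rel_refl[of "bp (real k + 1/2)"] by (auto simp: edge_data_def)
qed

datatype cell = Center | Star | Edge nat

definition cells :: "cell set" where "cells = {Center, Star} \<union> Edge ` side_starts"

fun cell_data :: "cell \<Rightarrow> (real \<times> gword) set" where
  "cell_data Center = {}"
| "cell_data Star = star_data"
| "cell_data (Edge k) = edge_data k"

definition cell_set :: "cell \<Rightarrow> complex set" where
  "cell_set i = (if i = Center then ball 0 1 else fan.A (cell_data i))"

definition cell_lab :: "cell \<Rightarrow> complex \<Rightarrow> gword" where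
  "cell_lab i = (if i = Center then (\<lambda>z. []) else fan.lab (cell_data i))"

lemma cell:
  assumes "i \<in> cells"
  obtains K m where "labelled_cell (cell_set i) K m (cell_lab i)"
proof -
  consider "i = Center" | "i = Star" | k where "i = Edge k" "k \<in> side_starts"
    using assms unfolding cells_def by blast
  then show ?thesis
  proof cases
    case 1
    then show ?thesis using central_cell that by (simp add: cell_set_def cell_lab_def)
  next
    case 2
    then show ?thesis using fan.fan_cell[OF fan_star] that by (simp add: cell_set_def cell_lab_def)
  next
    case 3
    then show ?thesis using fan.fan_cell[OF fan_edge[OF 3(2)]] that by (simp add: cell_set_def cell_lab_def)
  qed
qed

text \<open>On the unit circle the corner sectors miss only the midpoints of the sides, and these
  are the centres of the edge cells; the open disc is the central cell.\<close>

lemma cells_cover: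
  assumes "z \<in> disc"
  shows "\<exists>i\<in>cells. z \<in> cell_set i"
proof (cases "norm z < 1")
  case True
  then show ?thesis by (intro bexI[of _ Center]) (auto simp: cells_def cell_set_def)
next
  case False
  then have nz: "norm z = 1" using assms by simp
  define s where "s = 4 * Arg z / pi"
  have "z \<noteq> 0" using nz by auto
  then have "z = cis (Arg z)" using nz Arg_eq[of z] by (simp add: cis_conv_exp)
  then have z: "z = bp s" by (simp add: bp_def s_def)
  define m where "m = \<lfloor>s\<rfloor>"
  define f where "f = s - m"
  have f: "0 \<le> f" "f < 1" "s = m + f" unfolding f_def m_def by linarith+
  have star: "\<exists>i\<in>cells. z \<in> cell_set i" if "\<bar>s - real_of_int j\<bar> < 1 / 2" for j :: int
  proof -
    have "\<bar>s - real_of_int (j mod 8) - 8 * real_of_int (j div 8)\<bar> < 1 / 2"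
      using that real_mod8[of j] by linarith
    then have "z \<in> sector (real_of_int (j mod 8))" unfolding z bp_in_sector by blast
    then have "z \<in> fan.A star_data"
      using fan.A_I[OF fan_star star_data_mod[of j]] z by simp
    then show ?thesis by (intro bexI[of _ Star]) (auto simp: cells_def cell_set_def)
  qed
  consider "f < 1 / 2" | "f > 1 / 2" | "f = 1 / 2" by linarith
  then show ?thesis
  proof cases
    case 1
    then show ?thesis using star[of m] f by simp
  next
    case 2
    then show ?thesis using star[of "m + 1"] f by (simp add: abs_if)
  next
    case 3
    have m8: "real_of_int (m mod 8) + 8 * real_of_int (m div 8) = real_of_int m" by (rule real_mod8)
    have "\<exists>k\<in>side_starts. m mod 8 = int k \<or> m mod 8 = int k + 2"
      unfolding side_starts_def by simp presburger
    then obtain k where k: "k \<in> side_starts" "m mod 8 = int k \<or> m mod 8 = int k + 2" by blast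
    have "\<exists>p\<in>edge_data k. z \<in> sector (fst p)"
      using k(2)
    proof
      assume "m mod 8 = int k"
      then have "\<bar>s - (real k + 1/2) - 8 * real_of_int (m div 8)\<bar> < 1 / 2" using m8 f 3 by simp
      then have "z \<in> sector (real k + 1/2)" unfolding z bp_in_sector by blast
      then show ?thesis by (auto simp: edge_data_def)
    next
      assume "m mod 8 = int k + 2"
      then have "\<bar>s - (real k + 5/2) - 8 * real_of_int (m div 8)\<bar> < 1 / 2" using m8 f 3 by simp
      then have "z \<in> sector (real k + 5/2)" unfolding z bp_in_sector by blast
      then show ?thesis by (auto simp: edge_data_def)
    qed
    then have "z \<in> fan.A (edge_data k)" using fan.A_I[OF fan_edge[OF k(1)]] assms by blast
    then show ?thesis using k(1) by (intro bexI[of _ "Edge k"]) (auto simp: cells_def cell_set_def)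
  qed
qed

text \<open>One representative for each point of the surface, chosen without any continuity; only on
  the boundary is there a choice.\<close>

definition sec :: "surf \<Rightarrow> complex" where
  "sec x = (SOME z. z \<in> disc \<and> Qm z = x)"

lemma sec: "sec x \<in> disc" "Qm (sec x) = x"
proof -
  have "sec x \<in> disc \<and> Qm (sec x) = x"
    unfolding sec_def by (rule someI_ex) (metis surf_cases)
  then show "sec x \<in> disc" "Qm (sec x) = x" by auto
qed

lemma ray_sec [simp]: "path (ray (sec x))" "pathstart (ray (sec x)) = orig" "pathfinish (ray (sec x)) = x"
  using ray(1)[OF sec(1)] by (simp_all add: ray sec)

lemma sec_interior: "norm z < 1 \<Longrightarrow> sec (Qm z) = z"
  using Qm_interior[of z "sec (Qm z)"] sec[of "Qm z"] by simp

lemma cell_set_props: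
  assumes "i \<in> cells"
  shows "saturated (cell_set i)" "openin (top_of_set disc) (cell_set i)" "cell_set i \<subseteq> disc"
    "Qm z \<in> Qm ` cell_set i \<Longrightarrow> z \<in> disc \<Longrightarrow> z \<in> cell_set i"
    "x \<in> Qm ` cell_set i \<Longrightarrow> sec x \<in> cell_set i"
    "z \<in> cell_set i \<Longrightarrow> \<exists>V. open V \<and> z \<in> V \<and> (\<forall>z'\<in>V \<inter> cell_set i. cell_lab i z' = cell_lab i z)"
    "\<lbrakk>k \<in> side_starts; t \<in> {0..1}; bp (real k + t) \<in> cell_set i\<rbrakk> \<Longrightarrow>
      weq (cell_lab i (bp (real k + 3 - t))) (cell_lab i (bp (real k + t)) @ [side_letter k])"
proof -
  obtain K m where c: "labelled_cell (cell_set i) K m (cell_lab i)" using cell[OF assms] .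
  interpret labelled_cell "cell_set i" K m "cell_lab i" by (rule c)
  show "saturated (cell_set i)" "openin (top_of_set disc) (cell_set i)" "cell_set i \<subseteq> disc"
    using sat op sub by auto
  show i: "Qm z \<in> Qm ` cell_set i \<Longrightarrow> z \<in> disc \<Longrightarrow> z \<in> cell_set i" for z
    using saturated_iff[OF sat sub] by simp
  show "x \<in> Qm ` cell_set i \<Longrightarrow> sec x \<in> cell_set i" using i[of "sec x"] sec[of x] by simp
  show "z \<in> cell_set i \<Longrightarrow> \<exists>V. open V \<and> z \<in> V \<and> (\<forall>z'\<in>V \<inter> cell_set i. cell_lab i z' = cell_lab i z)"
    by (rule lab_loc)
  show "\<lbrakk>k \<in> side_starts; t \<in> {0..1}; bp (real k + t) \<in> cell_set i\<rbrakk> \<Longrightarrow>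
      weq (cell_lab i (bp (real k + 3 - t))) (cell_lab i (bp (real k + t)) @ [side_letter k])"
    by (rule lab_glue)
qed


section \<open>The fundamental group as the group of holonomies\<close>

definition seg :: "real \<Rightarrow> real \<Rightarrow> (real \<Rightarrow> 'a) \<Rightarrow> real \<Rightarrow> 'a" where
  "seg u v p = p \<circ> linepath u v"

lemma seg_ends [simp]: "pathstart (seg u v p) = p u" "pathfinish (seg u v p) = p v"
  by (simp_all add: seg_def pathstart_compose pathfinish_compose)

lemma path_image_seg: "u \<le> v \<Longrightarrow> path_image (seg u v p) = p ` {u..v}"
  by (simp add: seg_def path_image_compose closed_segment_eq_real_ivl)

lemma path_seg: "path p \<Longrightarrow> u \<in> {0..1} \<Longrightarrow> v \<in> {0..1} \<Longrightarrow> path (seg u v p)"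
  unfolding seg_def
  by (rule path_continuous_image[OF path_linepath continuous_on_subset[of "{0..1}"]])
    (simp_all add: path_def closed_segment_subset)

lemma seg_01: "seg 0 1 p = p"
  by (auto simp: seg_def linepath_def)

lemma hp_seg_join:
  assumes p: "path p" and u: "u \<in> {0..1}" "v \<in> {0..1}" "w \<in> {0..1}"
  shows "hp (seg u v p +++ seg v w p) (seg u w p)"
proof -
  have "seg u v p +++ seg v w p = p \<circ> (linepath u v +++ linepath v w)"
    by (simp add: seg_def path_compose_join)
  then show ?thesis
    using reparam_hp[OF p, of "linepath u v +++ linepath v w" "linepath u w"] u linepath_01_subset
    by (simp add: path_image_join seg_def closed_segment_subset)
qed

context flat_bundle
begin

lemma holonomy_reversepath:
  assumes "holonomy p T"
  shows "holonomy (reversepath p) (finv T)"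
proof -
  obtain g where g: "flat_lift {0..1} p g" "T = finv (g 0) \<circ> g 1"
    using assms unfolding holonomy_def by blast
  have "flat_lift {0..1} (reversepath p) (g \<circ> (\<lambda>t. 1 - t))"
    by (rule flat_lift_reparam[OF g(1)]) (auto intro!: continuous_intros simp: reversepath_def)
  moreover have b: "bij (g 0)" "bij (g 1)" using flat_lift_bij[OF g(1)] by auto
  then have "finv T = finv ((g \<circ> (\<lambda>t. 1 - t)) 0) \<circ> (g \<circ> (\<lambda>t. 1 - t)) 1"
    unfolding g(2) by (simp add: o_inv_distrib bij_imp_bij_inv inv_inv_eq)
  ultimately show ?thesis unfolding holonomy_def by blast
qed

end

subsection \<open>The fundamental group\<close>

locale surface_action =
  fixes \<phi> :: "gen \<Rightarrow> 'c \<Rightarrow> 'c"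
  assumes bij_phi: "bij (\<phi> x)"
    and relation: "\<phi> GA \<circ> \<phi> GB \<circ> finv (\<phi> GA) \<circ> finv (\<phi> GB)
      = \<phi> GC \<circ> \<phi> GD \<circ> finv (\<phi> GC) \<circ> finv (\<phi> GD)"
begin

lemma bij_ev_phi: "bij (ev \<phi> w)" by (rule bij_ev[OF bij_phi])

lemma ev_phi_weq: "weq u v \<Longrightarrow> ev \<phi> u = ev \<phi> v" by (rule ev_weq[OF bij_phi relation])

lemma ev_phi_winv: "ev \<phi> (winv w) = finv (ev \<phi> w)" by (rule ev_winv[OF bij_phi])

text \<open>Replacing the representative \<open>sec x\<close> by a glued one multiplies all
  \<open>L i x\<close> on the right by the value of one and the same letter. The quotients, and with
  them the bundle, do not see the choice.\<close>

definition L where "L i x = ev \<phi> (cell_lab i (sec x))"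

definition cell_image where "cell_image i = Qm ` cell_set i"

lemma side_gluing_labels:
  assumes "(z, z') \<in> side_gluing 2"
  shows "\<exists>l. \<forall>j\<in>cells. z \<in> cell_set j \<longrightarrow> weq (cell_lab j z') (cell_lab j z @ [l])"
proof -
  obtain k t where kt: "k \<in> side_starts" "t \<in> {0..1}" "z = bp (real k + t)" "z' = bp (real k + 3 - t)"
    using assms unfolding side_gluing_2 by blast
  have "weq (cell_lab j z') (cell_lab j z @ [side_letter k])" if "j \<in> cells" "z \<in> cell_set j" for j
    using cell_set_props(7)[OF that(1) kt(1,2)] that(2) unfolding kt by blast
  then show ?thesis by blast
qed

text \<open>The quotient \<open>d\<close> is locally constant because the labels are, and invariant
  under gluing. So the set \<open>W\<close> where it has the value \<open>d (sec x)\<close> is open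
  and saturated, and its image is the neighbourhood required.\<close>

lemma transition:
  assumes i: "i \<in> cells" "j \<in> cells" and x: "x \<in> cell_image i" "x \<in> cell_image j"
  shows "\<exists>V D. open V \<and> x \<in> V \<and> (\<forall>y\<in>V. L i y = D \<circ> L j y)"
proof -
  define d where "d z = ev \<phi> (cell_lab i z) \<circ> finv (ev \<phi> (cell_lab j z))" for z
  define W where "W = {z \<in> cell_set i \<inter> cell_set j. d z = d (sec x)}"
  have sx: "sec x \<in> W" using x cell_set_props(5) i unfolding W_def cell_image_def by simp
  have "openin (top_of_set disc) W"
  proof (subst openin_subopen, intro ballI)
    fix z assume z: "z \<in> W"
    obtain V1 where V1: "open V1" "z \<in> V1" "\<forall>z'\<in>V1 \<inter> cell_set i. cell_lab i z' = cell_lab i z"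
      using cell_set_props(6)[OF i(1)] z unfolding W_def by blast
    obtain V2 where V2: "open V2" "z \<in> V2" "\<forall>z'\<in>V2 \<inter> cell_set j. cell_lab j z' = cell_lab j z"
      using cell_set_props(6)[OF i(2)] z unfolding W_def by blast
    have "openin (top_of_set disc) (cell_set i \<inter> cell_set j \<inter> (disc \<inter> (V1 \<inter> V2)))"
      using cell_set_props(2) i V1(1) V2(1) by (intro openin_Int openin_open_Int open_Int)
    moreover have "z \<in> cell_set i \<inter> cell_set j \<inter> (disc \<inter> (V1 \<inter> V2))"
      using z V1 V2 cell_set_props(3)[OF i(1)] unfolding W_def by blast
    moreover have "d z' = d z" if "z' \<in> cell_set i \<inter> cell_set j \<inter> (disc \<inter> (V1 \<inter> V2))" for z'
      using that V1(3) V2(3) by (simp add: d_def)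
    then have "cell_set i \<inter> cell_set j \<inter> (disc \<inter> (V1 \<inter> V2)) \<subseteq> W" using z by (auto simp: W_def)
    ultimately show "\<exists>T. openin (top_of_set disc) T \<and> z \<in> T \<and> T \<subseteq> W" by blast
  qed
  moreover have "saturated W"
    unfolding saturated_def
  proof (clarify)
    fix z z' assume g: "(z, z') \<in> side_gluing 2"
    have mem: "z \<in> cell_set i \<longleftrightarrow> z' \<in> cell_set i" "z \<in> cell_set j \<longleftrightarrow> z' \<in> cell_set j"
      using cell_set_props(1)[OF i(1)] cell_set_props(1)[OF i(2)] g unfolding saturated_def by blast+
    have "d z' = d z" if zz: "z \<in> cell_set i" "z \<in> cell_set j"
    proof -
      obtain l where l: "\<forall>j\<in>cells. z \<in> cell_set j \<longrightarrow> weq (cell_lab j z') (cell_lab j z @ [l])"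
        using side_gluing_labels[OF g] by blast
      define s where "s = ev \<phi> [l]"
      have b: "bij s" unfolding s_def by (rule bij_ev_phi)
      have "ev \<phi> (cell_lab i z') = ev \<phi> (cell_lab i z) \<circ> s" "ev \<phi> (cell_lab j z') = ev \<phi> (cell_lab j z) \<circ> s"
        using ev_phi_weq[OF l[rule_format, OF i(1) zz(1)]] ev_phi_weq[OF l[rule_format, OF i(2) zz(2)]]
        by (simp_all add: ev_append s_def)
      then show ?thesis unfolding d_def
        using o_inv_distrib[OF bij_ev_phi b] b by (simp add: o_assoc bij_comp_inv)
    qed
    then show "(z \<in> W) = (z' \<in> W)" unfolding W_def using mem by auto
  qed
  ultimately have o: "open (Qm ` W)" and W: "Qm z \<in> Qm ` W \<Longrightarrow> z \<in> disc \<Longrightarrow> z \<in> W" for z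
    using open_Qm_image saturated_iff openin_imp_subset by (metis, metis)
  have "L i y = d (sec x) \<circ> L j y" if "y \<in> Qm ` W" for y
  proof -
    have "sec y \<in> W" using W[of "sec y"] that sec[of y] by simp
    then have "d (sec x) = d (sec y)" by (simp add: W_def)
    then show ?thesis unfolding L_def d_def using bij_ev_phi by (simp add: bij_comp_inv)
  qed
  moreover have "x \<in> Qm ` W" using sx sec(2)[of x] by (metis imageI)
  ultimately show ?thesis using o by blast
qed

sublocale flat_bundle cells cell_image L
proof
  show "open (cell_image i)" if "i \<in> cells" for i
    unfolding cell_image_def using open_Qm_image cell_set_props(1,2) that by blast
  show "\<exists>i\<in>cells. x \<in> cell_image i" for x
    using cells_cover[OF sec(1)[of x]] sec(2)[of x] unfolding cell_image_def by (metis imageI)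
  show "bij (L i x)" for i x unfolding L_def by (rule bij_ev_phi)
qed (rule transition)

lemma cell_holonomy:
  assumes i: "i \<in> cells" and p: "path p" "path_image p \<subseteq> cell_image i"
  shows "\<exists>w. hp (ray (sec (pathstart p)) +++ (p +++ reversepath (ray (sec (pathfinish p))))) (wloop w)
     \<and> holonomy p (ev \<phi> w)"
proof -
  obtain K m where "labelled_cell (cell_set i) K m (cell_lab i)" using cell[OF i] .
  then interpret labelled_cell "cell_set i" K m "cell_lab i" .
  have ends: "pathstart p \<in> cell_image i" "pathfinish p \<in> cell_image i"
    using p(2) by (meson pathfinish_in_path_image pathstart_in_path_image subsetD)+
  then have s: "sec (pathstart p) \<in> cell_set i" "sec (pathfinish p) \<in> cell_set i"
    using cell_set_props(5)[OF i] unfolding cell_image_def by auto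
  define w where "w = winv (cell_lab i (sec (pathstart p))) @ cell_lab i (sec (pathfinish p))"
  have "hp (ray (sec (pathstart p)) +++ (p +++ reversepath (ray (sec (pathfinish p))))) (wloop w)"
    unfolding w_def by (rule cell_path[OF p[unfolded cell_image_def] s(1) _ s(2)]) (simp_all add: sec)
  moreover have "ev \<phi> w = finv (L i (pathstart p)) \<circ> L i (pathfinish p)"
    by (simp add: w_def ev_append ev_phi_winv L_def)
  ultimately show ?thesis using holonomy_cell[OF i p(2)] by metis
qed

lemma conn_join:
  assumes g: "path g1" "path g2" "pathfinish g1 = pathstart g2"
    and X: "path X" "pathfinish X = pathstart g1" "pathstart X = orig"
    and Y: "path Y" "pathfinish Y = pathstart g2" "pathstart Y = orig"
    and Z: "path Z" "pathfinish Z = pathfinish g2" "pathstart Z = orig"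
    and h1: "hp (X +++ (g1 +++ reversepath Y)) (wloop w1)" and h2: "hp (Y +++ (g2 +++ reversepath Z)) (wloop w2)"
  shows "hp (X +++ ((g1 +++ g2) +++ reversepath Z)) (wloop (w1 @ w2))"
proof -
  note [simp] = g X Y Z
  have "hp (wloop (w1 @ w2)) (wloop w1 +++ wloop w2)" by (rule wloop_append)
  also have "hp \<dots> ((X +++ (g1 +++ reversepath Y)) +++ (Y +++ (g2 +++ reversepath Z)))"
    by (rule hp_join[OF hp_sym[OF h1] hp_sym[OF h2]]) simp
  also have "hp \<dots> (X +++ ((g1 +++ reversepath Y) +++ (Y +++ (g2 +++ reversepath Z))))"
    by (rule hp_assoc) simp_all
  also have "hp \<dots> (X +++ (g1 +++ (reversepath Y +++ (Y +++ (g2 +++ reversepath Z)))))"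
    by (intro hp_join hp_refl hp_assoc) simp_all
  also have "hp \<dots> (X +++ (g1 +++ (g2 +++ reversepath Z)))"
    by (intro hp_join hp_refl hp_cancel_l) simp_all
  also have "hp \<dots> (X +++ ((g1 +++ g2) +++ reversepath Z))"
    by (intro hp_join hp_refl hp_sym[OF hp_assoc]) simp_all
  finally show ?thesis by (rule hp_sym)
qed

end

context surface_action
begin

text \<open>Word and holonomy are carried together through one bisection: a short piece lies in one
  cell, where the same difference of labels yields both, and joining pieces concatenates words and
  composes holonomies.\<close>

lemma path_word:
  assumes p: "path p"
  shows "\<exists>w. hp (ray (sec (pathstart p)) +++ (p +++ reversepath (ray (sec (pathfinish p))))) (wloop w)
     \<and> holonomy p (ev \<phi> w)"
proof -
  define Q where "Q a b w \<longleftrightarrow> hp (ray (sec (p a)) +++ (seg a b p +++ reversepath (ray (sec (p b))))) (wloop w)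
     \<and> holonomy (seg a b p) (ev \<phi> w)" for a b w
  let ?P = "\<lambda>a b. 0 \<le> a \<longrightarrow> b \<le> 1 \<longrightarrow> a \<le> b \<longrightarrow> (\<exists>w. Q a b w)"
  have "?P 0 1"
  proof (rule Bolzano[where P = ?P])
    fix a b c assume P: "?P a b" "?P b c" and le: "a \<le> b" "b \<le> c"
    show "?P a c"
    proof (intro impI)
      assume ac: "0 \<le> a" "c \<le> 1" "a \<le> c"
      obtain w1 w2 where w: "Q a b w1" "Q b c w2" using P ac le by auto
      have in01: "a \<in> {0..1}" "b \<in> {0..1}" "c \<in> {0..1}" using ac le by auto
      have sp: "path (seg a b p)" "path (seg b c p)" "path (seg a c p)"
        using path_seg[OF p] in01 by auto
      have "hp (ray (sec (p a)) +++ ((seg a b p +++ seg b c p) +++ reversepath (ray (sec (p c))))) (wloop (w1 @ w2))"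
        by (rule conn_join[of _ _ _ "ray (sec (p b))"]) (use w sp sec in \<open>auto simp: Q_def ray\<close>)
      moreover have j: "hp (seg a b p +++ seg b c p) (seg a c p)"
        by (rule hp_seg_join[OF p in01])
      then have "hp (ray (sec (p a)) +++ ((seg a b p +++ seg b c p) +++ reversepath (ray (sec (p c)))))
          (ray (sec (p a)) +++ (seg a c p +++ reversepath (ray (sec (p c)))))"
        by (intro hp_join hp_refl) (simp_all add: ray sec)
      ultimately have 1: "hp (ray (sec (p a)) +++ (seg a c p +++ reversepath (ray (sec (p c))))) (wloop (w1 @ w2))"
        using hp_sym hp_trans by blast
      have "holonomy (seg a b p +++ seg b c p) (ev \<phi> w1 \<circ> ev \<phi> w2)"
        by (rule holonomy_join) (use w sp in \<open>auto simp: Q_def\<close>)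
      then have "holonomy (seg a c p) (ev \<phi> (w1 @ w2))"
        unfolding ev_append by (rule holonomy_homotopic[OF j])
      then show "\<exists>w. Q a c w" using 1 unfolding Q_def by blast
    qed
  next
    fix t :: real assume t: "0 \<le> t" "t \<le> 1"
    obtain i where i: "i \<in> cells" "p t \<in> cell_image i" using cover_U by blast
    have "\<exists>M. open M \<and> M \<inter> {0..1} = p -` cell_image i \<inter> {0..1}"
      by (rule continuous_on_open_invariant[THEN iffD1, rule_format, OF p[unfolded path_def] open_U[OF i(1)]])
    then obtain M where M: "open M" "M \<inter> {0..1} = p -` cell_image i \<inter> {0..1}" by blast
    have "t \<in> M" using M(2) t i(2) by auto
    then obtain d where d: "d > 0" "ball t d \<subseteq> M" using openE[OF M(1)] by metis
    show "\<exists>d>0. \<forall>a b. a \<le> t \<and> t \<le> b \<and> b - a < d \<longrightarrow> ?P a b"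
    proof (rule exI[of _ d], intro conjI allI impI, rule d(1))
      fix a b assume ab: "a \<le> t \<and> t \<le> b \<and> b - a < d" "0 \<le> a" "b \<le> 1" "a \<le> b"
      have in01: "a \<in> {0..1}" "b \<in> {0..1}" using ab by auto
      have "{a..b} \<subseteq> ball t d" using ab by (auto simp: dist_real_def)
      then have "{a..b} \<subseteq> M \<inter> {0..1}" using d(2) ab by auto
      then have "p ` {a..b} \<subseteq> cell_image i" unfolding M(2) by auto
      then have "path_image (seg a b p) \<subseteq> cell_image i"
        using path_image_seg[of a b p] ab by simp
      then show "\<exists>w. Q a b w"
        using cell_holonomy[OF i(1) path_seg[OF p in01]] unfolding Q_def by simp
    qed
  qed simp
  then show ?thesis unfolding Q_def seg_01 by (simp add: pathstart_def pathfinish_def)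
qed

text \<open>The inner half of the radius runs in the central cell, whose frame is constant. The
  outer half stays in one sector of the edge cell, where the label is constantly \<open>w\<close>.
  The two meet at an interior point, which is its own representative.\<close>

lemma holonomy_half_ray:
  assumes k: "k \<in> side_starts" and c: "(c, w) \<in> edge_data k"
  shows "holonomy (ray (bp c)) (finv (ev \<phi> w) \<circ> L (Edge k) (Qm (bp c)))"
proof -
  have cells: "Center \<in> cells" "Edge k \<in> cells" using k by (auto simp: cells_def)
  have p: "path (ray (bp c))" by (simp add: ray)
  have sc: "of_real \<rho> * bp c \<in> sector c" if "\<rho> > 0" for \<rho> by (rule of_real_bp_in_sector) (use that in auto)
  have lab: "cell_lab (Edge k) (of_real \<rho> * bp c) = w" if "\<rho> > 0" for \<rho>
    using fan.idx[OF fan_edge[OF k] c] sc[OF that] by (simp add: cell_lab_def fan.lab_def[OF fan_edge[OF k]])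
  have mem: "of_real \<rho> * bp c \<in> cell_set (Edge k)" if "0 < \<rho>" "\<rho> \<le> 1" for \<rho>
    using fan.A_I[OF fan_edge[OF k] c] sc[OF that(1)] that by (simp add: cell_set_def norm_mult)
  have r: "ray (bp c) u = Qm (of_real u * bp c)" for u
    by (simp add: ray_def linepath_def scaleR_conv_of_real)
  have e1: "pathstart (seg 0 (1/2) (ray (bp c))) = Qm 0" "pathfinish (seg 0 (1/2) (ray (bp c))) = Qm (of_real (1/2) * bp c)"
    "pathstart (seg (1/2) 1 (ray (bp c))) = Qm (of_real (1/2) * bp c)" "pathfinish (seg (1/2) 1 (ray (bp c))) = Qm (bp c)"
    unfolding seg_ends r by simp_all
  have 1: "holonomy (seg 0 (1/2) (ray (bp c))) (finv (L Center (Qm 0)) \<circ> L Center (Qm (of_real (1/2) * bp c)))"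
  proof -
    have "path_image (seg 0 (1/2) (ray (bp c))) \<subseteq> cell_image Center"
    proof -
      have "ray (bp c) u \<in> cell_image Center" if "u \<in> {0..1/2}" for u
        unfolding r cell_image_def by (rule imageI) (use that in \<open>auto simp: cell_set_def norm_mult\<close>)
      then show ?thesis by (auto simp: path_image_seg)
    qed
    from holonomy_cell[OF cells(1) this] show ?thesis unfolding e1 .
  qed
  have 2: "holonomy (seg (1/2) 1 (ray (bp c))) (finv (L (Edge k) (Qm (of_real (1/2) * bp c))) \<circ> L (Edge k) (Qm (bp c)))"
  proof -
    have "path_image (seg (1/2) 1 (ray (bp c))) \<subseteq> cell_image (Edge k)"
    proof -
      have "ray (bp c) u \<in> cell_image (Edge k)" if "u \<in> {1/2..1}" for u
        unfolding r cell_image_def by (intro imageI mem) (use that in auto)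
      then show ?thesis by (auto simp: path_image_seg)
    qed
    from holonomy_cell[OF cells(2) this] show ?thesis unfolding e1 .
  qed
  have e: "sec (Qm (of_real (1/2) * bp c)) = of_real (1/2) * bp c"
    by (rule sec_interior) (simp add: norm_mult)
  have "cell_lab (Edge k) (of_real (1/2) * bp c) = w" by (rule lab) simp
  then have Lw: "L (Edge k) (Qm (of_real (1/2) * bp c)) = ev \<phi> w" unfolding L_def e by simp
  have LC: "L Center x = id" for x by (simp add: L_def cell_lab_def)
  have "finv (id :: 'c \<Rightarrow> 'c) = id" by simp
  then have "holonomy (seg 0 (1/2) (ray (bp c)) +++ seg (1/2) 1 (ray (bp c))) (id \<circ> (finv (ev \<phi> w) \<circ> L (Edge k) (Qm (bp c))))"
    using 1 2 unfolding LC Lw by (intro holonomy_join) (simp_all add: p path_seg)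
  moreover have "hp (seg 0 (1/2) (ray (bp c)) +++ seg (1/2) 1 (ray (bp c))) (seg 0 1 (ray (bp c)))"
    by (rule hp_seg_join[OF p]) auto
  ultimately have "holonomy (seg 0 1 (ray (bp c))) (id \<circ> (finv (ev \<phi> w) \<circ> L (Edge k) (Qm (bp c))))"
    using holonomy_homotopic by blast
  then show ?thesis unfolding seg_01 by simp
qed

lemma holonomy_lloop: "holonomy (lloop l) (evl \<phi> l)"
proof -
  have cr: "holonomy (crossing k) (evl \<phi> (side_letter k))" if k: "k \<in> side_starts" for k
  proof -
    define T where "T = L (Edge k) (Qm (bp (real k + 1/2)))"
    define s where "s = evl \<phi> (side_letter k)"
    have b: "bij T" "bij s" using bij_L bij_evl[OF bij_phi] k by (auto simp: T_def s_def cells_def L_def bij_ev_phi)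
    have 1: "holonomy (ray (bp (real k + 1/2))) (finv (ev \<phi> []) \<circ> T)"
      unfolding T_def by (rule holonomy_half_ray[OF k]) (simp add: edge_data_def)
    have 2: "holonomy (ray (bp (real k + 5/2))) (finv (ev \<phi> [side_letter k]) \<circ> T)"
      unfolding T_def Qm_mid[OF k] by (rule holonomy_half_ray[OF k]) (simp add: edge_data_def)
    have "holonomy (crossing k) ((finv (ev \<phi> []) \<circ> T) \<circ> finv (finv (ev \<phi> [side_letter k]) \<circ> T))"
      unfolding crossing_def
      by (rule holonomy_join[OF _ _ _ 1 holonomy_reversepath[OF 2]]) (simp_all add: ray Qm_mid[OF k])
    moreover have "finv (finv (ev \<phi> [side_letter k]) \<circ> T) = finv T \<circ> s"
      using o_inv_distrib[of "finv s" T] b by (simp add: s_def bij_imp_bij_inv inv_inv_eq)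
    moreover have "(finv (ev \<phi> []) \<circ> T) \<circ> (finv T \<circ> s) = s"
      using b by (simp add: o_assoc bij_comp_inv)
    ultimately show ?thesis by (simp add: s_def)
  qed
  have ss: "0 \<in> side_starts" "1 \<in> side_starts" "4 \<in> side_starts" "5 \<in> side_starts" by (simp_all add: side_starts_def)
  have g: "holonomy (gloop x) (\<phi> x)" for x
  proof (cases x)
    case GA
    then show ?thesis using cr[OF ss(1)] by (simp add: side_letter_simps evl_def)
  next
    case GB
    have "holonomy (reversepath (crossing 1)) (finv (finv (\<phi> GB)))"
      using holonomy_reversepath[OF cr[OF ss(2)]] by (simp add: side_letter_simps evl_def)
    then show ?thesis using GB by (simp add: inv_inv_eq bij_phi)
  next
    case GC
    have "holonomy (reversepath (crossing 5)) (finv (finv (\<phi> GC)))"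
      using holonomy_reversepath[OF cr[OF ss(4)]] by (simp add: side_letter_simps evl_def)
    then show ?thesis using GC by (simp add: inv_inv_eq bij_phi)
  next
    case GD
    then show ?thesis using cr[OF ss(3)] by (simp add: side_letter_simps evl_def)
  qed
  show ?thesis using g[of "fst l"] holonomy_reversepath[OF g[of "fst l"]] by (simp add: lloop_def evl_def)
qed

lemma holonomy_wloop: "holonomy (wloop w) (ev \<phi> w)"
proof (induction w)
  case Nil
  obtain u where "holonomy (cp orig) (ev \<phi> u)" using path_word[of "cp orig"] by auto
  moreover from this have "ev \<phi> u = id" by (rule holonomy_const) simp
  ultimately show ?case by (simp only: wloop_simps ev_simps)
next
  case (Cons l w)
  show ?case unfolding wloop_simps ev_simps
    by (rule holonomy_join[OF _ _ _ holonomy_lloop Cons]) (simp_all add: lloop)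
qed

text \<open>Equal holonomy gives words with equal values; faithfulness makes these words equivalent
  in the group, and equivalent words spell homotopic loops.\<close>

lemma loops_homotopic:
  assumes faithful: "\<And>w. ev \<phi> w = id \<Longrightarrow> weq w []"
    and p: "path p" "pathstart p = x" "pathfinish p = x" "holonomy p T"
    and q: "path q" "pathstart q = x" "pathfinish q = x" "holonomy q T"
  shows "hp p q"
proof -
  define X where "X = ray (sec x)"
  have [simp]: "path X" "pathstart X = orig" "pathfinish X = x" by (simp_all add: X_def)
  note [simp] = p(1-3) q(1-3)
  obtain u where u: "hp (X +++ (p +++ reversepath X)) (wloop u)" "holonomy p (ev \<phi> u)"
    using path_word[OF p(1)] by (auto simp: X_def)
  obtain v where v: "hp (X +++ (q +++ reversepath X)) (wloop v)" "holonomy q (ev \<phi> v)"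
    using path_word[OF q(1)] by (auto simp: X_def)
  have "ev \<phi> u = ev \<phi> v"
    using holonomy_unique[OF p(1,4) u(2)] holonomy_unique[OF q(1,4) v(2)] by (rule trans[OF sym])
  then have "ev \<phi> (u @ winv v) = id"
    by (simp add: ev_append ev_phi_winv bij_comp_inv bij_ev_phi)
  then have "weq (u @ winv v) []" by (rule faithful)
  from weq_append[OF this weq_refl[of v]] have "weq (u @ winv v @ v) v" by simp
  moreover have "weq (u @ winv v @ v) u" using weq_cancel_inv(2)[of u v "[]"] by simp
  ultimately have "weq u v" using weq_sym weq_trans by blast
  then have "hp (X +++ (p +++ reversepath X)) (X +++ (q +++ reversepath X))"
    by (rule hp_trans[OF hp_trans[OF u(1) wloop_weq] hp_sym[OF v(1)]])
  then have "hp (p +++ reversepath X) (reversepath X +++ (X +++ (q +++ reversepath X)))"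
    by (rule hp_move_l) simp
  moreover have "hp (reversepath X +++ (X +++ (q +++ reversepath X))) (q +++ reversepath X)"
    by (rule hp_cancel_l) simp_all
  ultimately have "hp (p +++ reversepath X) (q +++ reversepath X)" by (rule hp_trans)
  then have "hp p ((q +++ reversepath X) +++ reversepath (reversepath X))"
    by (rule hp_move_r) simp
  moreover have "hp ((q +++ reversepath X) +++ reversepath (reversepath X)) q"
    by (rule hp_cancel_r) simp_all
  ultimately show ?thesis by (rule hp_trans)
qed

text \<open>Moving the loop of a word from \<open>orig\<close> to \<open>x\<close> along
  \<open>X\<close> conjugates its holonomy by that of \<open>X\<close>. The conjugated word
  \<open>u @ w @ winv u\<close> compensates for this.\<close>

lemma loop_exists:
  "\<exists>p. path p \<and> pathstart p = x \<and> pathfinish p = x \<and> holonomy p (ev \<phi> w)"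
proof -
  define X where "X = ray (sec x)"
  have [simp]: "path X" "pathstart X = orig" "pathfinish X = x" by (simp_all add: X_def)
  obtain u where u: "holonomy X (ev \<phi> u)" using path_word[of X] by auto
  have "holonomy (reversepath X +++ (wloop (u @ w @ winv u) +++ X)) (finv (ev \<phi> u) \<circ> (ev \<phi> (u @ w @ winv u) \<circ> ev \<phi> u))"
    by (intro holonomy_join holonomy_reversepath holonomy_wloop u) simp_all
  moreover have "finv (ev \<phi> u) \<circ> (ev \<phi> (u @ w @ winv u) \<circ> ev \<phi> u) = ev \<phi> w"
    by (simp add: ev_append ev_phi_winv o_assoc bij_comp_inv bij_ev_phi)
  ultimately show ?thesis
    by (intro exI[of _ "reversepath X +++ (wloop (u @ w @ winv u) +++ X)"]) simp
qed

end

lemma continuous_map_rep_surf: "continuous_map euclidean (orientable_surface 2) rep_surf"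
  unfolding continuous_map_def
proof (intro conjI allI impI)
  fix U assume U: "openin (orientable_surface 2) U"
  have "rep_surf ` {x. rep_surf x \<in> U} = U"
    using openin_subset[OF U] abs_surf_inverse by (auto intro!: image_eqI[where x = "abs_surf _"])
  then show "openin euclidean {x \<in> topspace euclidean. rep_surf x \<in> U}"
    using U by (simp add: open_surf_def)
qed (use rep_surf in auto)

lemma continuous_map_abs_surf: "continuous_map (orientable_surface 2) euclidean abs_surf"
  unfolding continuous_map_def
proof (intro conjI allI impI)
  fix U :: "surf set" assume U: "openin euclidean U"
  have "{x \<in> topspace (orientable_surface 2). abs_surf x \<in> U} = rep_surf ` U"
    using rep_surf rep_surf_inverse abs_surf_inverse by (auto intro!: image_eqI[where x = "abs_surf _"])
  then show "openin (orientable_surface 2) {x \<in> topspace (orientable_surface 2). abs_surf x \<in> U}"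
    using U by (simp add: open_surf_def)
qed auto

lemma loop_homotopic_iff:
  assumes p: "p \<in> loops (orientable_surface 2) x0"
  shows "q \<in> loop_class (orientable_surface 2) x0 p \<longleftrightarrow>
    q \<in> loops (orientable_surface 2) x0 \<and> hp (abs_surf \<circ> p) (abs_surf \<circ> q)"
proof -
  let ?X = "orientable_surface 2"
  have x0: "x0 \<in> topspace ?X"
    using p by (auto simp: loops_def pathin_def continuous_map_def Pi_iff)
  have rep_back: "rep_surf ((abs_surf \<circ> r) t) = r t" if "r \<in> loops ?X x0" "t \<in> {0..1}" for r t
  proof -
    have "r t \<in> topspace ?X" using that by (auto simp: loops_def pathin_def continuous_map_def Pi_iff)
    then show ?thesis by (simp add: abs_surf_inverse)
  qed
  have 1: "q \<in> loops ?X x0 \<and> hp (abs_surf \<circ> p) (abs_surf \<circ> q)" if "q \<in> loop_class ?X x0 p"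
  proof
    have h: "homotopic_with (\<lambda>r. r 0 = x0 \<and> r 1 = x0) (top_of_set {0..1}) ?X p q"
      using that by (simp add: loop_class_def)
    show "q \<in> loops ?X x0"
      using homotopic_with_imp_continuous_maps[OF h] homotopic_with_imp_property[OF h]
      by (simp add: loops_def pathin_def)
    show "hp (abs_surf \<circ> p) (abs_surf \<circ> q)"
      unfolding homotopic_paths_def
      by (simp, rule homotopic_with_compose_continuous_map_left[OF h continuous_map_abs_surf])
        (use p in \<open>auto simp: pathstart_def pathfinish_def loops_def\<close>)
  qed
  have 2: "q \<in> loop_class ?X x0 p" if q: "q \<in> loops ?X x0" "hp (abs_surf \<circ> p) (abs_surf \<circ> q)"
  proof -
    have a0: "abs_surf (p 0) = abs_surf x0" "abs_surf (p 1) = abs_surf x0" using p by (auto simp: loops_def)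
    have "homotopic_with (\<lambda>r. r 0 = abs_surf x0 \<and> r 1 = abs_surf x0) (top_of_set {0..1}) euclidean (abs_surf \<circ> p) (abs_surf \<circ> q)"
      using q(2) a0 unfolding homotopic_paths_def by (simp add: pathstart_def pathfinish_def)
    then have "homotopic_with (\<lambda>r. r 0 = x0 \<and> r 1 = x0) (top_of_set {0..1}) ?X (rep_surf \<circ> (abs_surf \<circ> p)) (rep_surf \<circ> (abs_surf \<circ> q))"
      by (rule homotopic_with_compose_continuous_map_left[OF _ continuous_map_rep_surf])
        (use x0 in \<open>simp add: abs_surf_inverse\<close>)
    then have "homotopic_with (\<lambda>r. r 0 = x0 \<and> r 1 = x0) (top_of_set {0..1}) ?X p q"
      by (rule homotopic_with_eq) (use rep_back[OF p] rep_back[OF q(1)] in auto)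
    then show ?thesis by (simp add: loop_class_def)
  qed
  show ?thesis using 1 2 by blast
qed

text \<open>The isomorphism sends \<open>T\<close> to the set of all loops with holonomy
  \<open>T\<close>. Homotopy invariance of the holonomy and \<open>loops_homotopic\<close> show that
  this set is exactly one homotopy class, so no representatives have to be chosen to define
  it.\<close>

theorem (in surface_action) fundamental_group_iso:
  fixes M :: "('c \<Rightarrow> 'c, 'm) monoid_scheme"
  assumes faithful: "\<And>w. ev \<phi> w = id \<Longrightarrow> weq w []"
    and M: "carrier M = range (ev \<phi>)" "mult M = (\<circ>)" and x0: "x0 \<in> topspace (orientable_surface 2)"
  shows "M \<cong> fundamental_group (orientable_surface 2) x0"
proof -
  let ?X = "orientable_surface 2" and ?F = "fundamental_group (orientable_surface 2) x0"
  define C where "C T = {q \<in> loops ?X x0. holonomy (abs_surf \<circ> q) T}" for T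
  have path: "path (abs_surf \<circ> p)" "pathstart (abs_surf \<circ> p) = abs_surf x0" "pathfinish (abs_surf \<circ> p) = abs_surf x0"
    if "p \<in> loops ?X x0" for p
  proof -
    have "continuous_map (top_of_set {0..1}) ?X p" using that by (simp add: loops_def pathin_def)
    then have "continuous_map (top_of_set {0..1}) euclidean (abs_surf \<circ> p)"
      by (rule continuous_map_compose[OF _ continuous_map_abs_surf])
    then show "path (abs_surf \<circ> p)" by (simp add: path_def)
  qed (use that in \<open>auto simp: loops_def pathstart_def pathfinish_def\<close>)
  have class_C: "loop_class ?X x0 p = C T" if p: "p \<in> C T" for p T
  proof -
    have pl: "p \<in> loops ?X x0" "holonomy (abs_surf \<circ> p) T" using p by (auto simp: C_def)
    have "hp (abs_surf \<circ> p) (abs_surf \<circ> q) \<longleftrightarrow> holonomy (abs_surf \<circ> q) T" if q: "q \<in> loops ?X x0" for q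
    proof
      assume "hp (abs_surf \<circ> p) (abs_surf \<circ> q)"
      then show "holonomy (abs_surf \<circ> q) T" using holonomy_homotopic pl(2) by blast
    next
      assume "holonomy (abs_surf \<circ> q) T"
      then show "hp (abs_surf \<circ> p) (abs_surf \<circ> q)"
        using loops_homotopic[OF faithful path[OF pl(1)] pl(2) path[OF q]] by blast
    qed
    then show ?thesis using loop_homotopic_iff[OF pl(1)] unfolding C_def by blast
  qed
  have C_ex: "\<exists>p. p \<in> C T" if T: "T \<in> carrier M" for T
  proof -
    obtain w where w: "T = ev \<phi> w" using T M by auto
    obtain p where p: "path p" "pathstart p = abs_surf x0" "pathfinish p = abs_surf x0" "holonomy p T"
      using loop_exists[of "abs_surf x0" w] w by auto
    have "continuous_map (top_of_set {0..1}) euclidean p" using p(1) by (simp add: path_def)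
    then have "continuous_map (top_of_set {0..1}) ?X (rep_surf \<circ> p)"
      by (rule continuous_map_compose[OF _ continuous_map_rep_surf])
    then have "rep_surf \<circ> p \<in> loops ?X x0"
      using p(2,3) x0 by (simp add: loops_def pathin_def pathstart_def pathfinish_def abs_surf_inverse)
    moreover have "abs_surf \<circ> (rep_surf \<circ> p) = p" by (auto simp: rep_surf_inverse)
    ultimately have "rep_surf \<circ> p \<in> C T" using p(4) by (simp add: C_def)
    then show ?thesis by blast
  qed
  have hol_ex: "\<exists>T\<in>carrier M. p \<in> C T" if p: "p \<in> loops ?X x0" for p
  proof -
    obtain w where "holonomy (abs_surf \<circ> p) (ev \<phi> w)" using path_word[OF path(1)[OF p]] by blast
    then show ?thesis using p M by (auto simp: C_def)
  qed
  have join: "loop_join p q \<in> C (T \<circ> T')" if pq: "p \<in> C T" "q \<in> C T'" for p q T T'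
  proof -
    have l: "p \<in> loops ?X x0" "q \<in> loops ?X x0" using pq by (auto simp: C_def)
    have e: "abs_surf \<circ> loop_join p q = (abs_surf \<circ> p) +++ (abs_surf \<circ> q)"
      by (auto simp: loop_join_def joinpaths_def fun_eq_iff)
    have "path ((abs_surf \<circ> p) +++ (abs_surf \<circ> q))" using path[OF l(1)] path[OF l(2)] by simp
    then have "continuous_map (top_of_set {0..1}) euclidean (abs_surf \<circ> loop_join p q)"
      unfolding e[symmetric] by (simp add: path_def)
    then have "continuous_map (top_of_set {0..1}) ?X (rep_surf \<circ> (abs_surf \<circ> loop_join p q))"
      by (rule continuous_map_compose[OF _ continuous_map_rep_surf])
    then have "continuous_map (top_of_set {0..1}) ?X (loop_join p q)"
    proof (rule continuous_map_eq)
      fix t assume t: "t \<in> topspace (top_of_set {0..1::real})"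
      have "loop_join p q t \<in> topspace ?X"
        using l t by (auto simp: loop_join_def loops_def pathin_def continuous_map_def Pi_iff)
      then show "(rep_surf \<circ> (abs_surf \<circ> loop_join p q)) t = loop_join p q t" by (simp add: abs_surf_inverse)
    qed
    then have "loop_join p q \<in> loops ?X x0"
      using l by (simp add: loops_def pathin_def loop_join_def)
    moreover have "holonomy (abs_surf \<circ> loop_join p q) (T \<circ> T')"
      unfolding e by (rule holonomy_join) (use pq path[OF l(1)] path[OF l(2)] in \<open>auto simp: C_def\<close>)
    ultimately show ?thesis by (simp add: C_def)
  qed
  have inC: "C T \<in> carrier ?F" if T: "T \<in> carrier M" for T
  proof -
    obtain p where p: "p \<in> C T" using C_ex[OF T] by blast
    then have "p \<in> loops ?X x0" by (simp add: C_def)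
    then show ?thesis unfolding fundamental_group_def using class_C[OF p] by (auto intro!: image_eqI[of _ _ p])
  qed
  have "C \<in> iso M ?F"
    unfolding iso_def hom_def mem_Collect_eq
  proof (intro conjI ballI)
    show "C \<in> carrier M \<rightarrow> carrier ?F" using inC by blast
    fix T T' assume T: "T \<in> carrier M" "T' \<in> carrier M"
    obtain p q where "p \<in> C T" "q \<in> C T'" using C_ex[OF T(1)] C_ex[OF T(2)] by blast
    moreover have "loop_class ?X x0 (loop_join p q) = C (T \<circ> T')" if "p \<in> C T" "q \<in> C T'" for p q
      using class_C[OF join[OF that]] .
    ultimately have "(\<Union>p\<in>C T. \<Union>q\<in>C T'. loop_class ?X x0 (loop_join p q)) = C (T \<circ> T')" by blast
    then show "C (T \<otimes>\<^bsub>M\<^esub> T') = C T \<otimes>\<^bsub>?F\<^esub> C T'" by (simp add: M fundamental_group_def)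
  next
    show "bij_betw C (carrier M) (carrier ?F)"
      unfolding bij_betw_def
    proof
      show "inj_on C (carrier M)"
      proof (rule inj_onI)
        fix T T' assume T: "T \<in> carrier M" "T' \<in> carrier M" "C T = C T'"
        obtain p where p: "p \<in> C T" using C_ex[OF T(1)] by blast
        then have h: "holonomy (abs_surf \<circ> p) T" "holonomy (abs_surf \<circ> p) T'" "p \<in> loops ?X x0"
          using T(3) by (auto simp: C_def)
        show "T = T'" by (rule holonomy_unique[OF path(1)[OF h(3)] h(1,2)])
      qed
      show "C ` carrier M = carrier ?F"
      proof
        show "C ` carrier M \<subseteq> carrier ?F" using inC by blast
        show "carrier ?F \<subseteq> C ` carrier M"
        proof
          fix c assume "c \<in> carrier ?F"
          then obtain p where p: "p \<in> loops ?X x0" "c = loop_class ?X x0 p"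
            by (auto simp: fundamental_group_def)
          obtain T where T: "T \<in> carrier M" "p \<in> C T" using hol_ex[OF p(1)] by blast
          then show "c \<in> C ` carrier M" using p(2) class_C by blast
        qed
      qed
    qed
  qed
  then show ?thesis by (auto simp: is_iso_def)
qed

subsection \<open>Calculus of smooth functions\<close>

primrec Ck :: "nat \<Rightarrow> (real \<Rightarrow> real) \<Rightarrow> bool" where
  "Ck 0 f = True"
| "Ck (Suc n) f = ((\<forall>x. f differentiable (at x)) \<and> Ck n (deriv f))"

lemma Ck_iff: "Ck n f \<longleftrightarrow> (\<forall>m<n. \<forall>x. (deriv ^^ m) f differentiable (at x))"
proof (induction n arbitrary: f)
  case (Suc n)
  have "Ck (Suc n) f \<longleftrightarrow> (\<forall>x. f differentiable (at x)) \<and> (\<forall>m<n. \<forall>x. (deriv ^^ Suc m) f differentiable (at x))"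
    by (simp only: Ck.simps Suc funpow_Suc_right o_apply)
  also have "\<dots> \<longleftrightarrow> (\<forall>m<Suc n. \<forall>x. (deriv ^^ m) f differentiable (at x))"
    unfolding All_less_Suc2 by (simp del: funpow.simps(2))
  finally show ?case .
qed simp

lemma smooth_iff_Ck: "smooth f \<longleftrightarrow> (\<forall>n. Ck n f)"
  unfolding smooth_def Ck_iff by blast

lemma smoothD: "smooth f \<Longrightarrow> DERIV f x :> deriv f x" "smooth f \<Longrightarrow> smooth (deriv f)"
  unfolding smooth_iff_Ck
  by (metis Ck.simps(2) DERIV_deriv_iff_real_differentiable) (metis Ck.simps(2))

lemma smooth_cont: "smooth f \<Longrightarrow> continuous_on S f"
  by (meson DERIV_continuous_on has_field_derivative_at_within smoothD(1))

lemma smooth_funpow: "smooth f \<Longrightarrow> smooth ((deriv ^^ k) f)"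
  by (induction k) (auto intro: smoothD(2))

lemma Ck_Suc: "Ck (Suc n) f \<Longrightarrow> Ck n f"
  unfolding Ck_iff by simp

lemma Ck_SucD: "Ck (Suc n) f \<Longrightarrow> DERIV f x :> deriv f x" "Ck (Suc n) f \<Longrightarrow> Ck n (deriv f)"
  by (simp_all add: DERIV_deriv_iff_real_differentiable)

lemma Ck_SucI:
  assumes "\<And>x. DERIV f x :> f' x" "Ck n f'"
  shows "Ck (Suc n) f"
proof -
  have "deriv f = f'" using assms(1) by (auto intro!: DERIV_imp_deriv)
  then show ?thesis using assms by (auto simp: real_differentiable_def)
qed

lemma Ck_const: "Ck n (\<lambda>x. c)"
  by (induction n arbitrary: c) (simp_all del: Ck.simps(2), rule Ck_SucI[where f' = "\<lambda>x. 0"], auto)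

lemma Ck_id: "Ck n (\<lambda>x. x)"
  by (cases n) (simp_all del: Ck.simps(2), rule Ck_SucI[where f' = "\<lambda>x. 1"], auto intro: Ck_const)

lemma Ck_add: "Ck n f \<Longrightarrow> Ck n g \<Longrightarrow> Ck n (\<lambda>x. f x + g x)"
proof (induction n arbitrary: f g)
  case (Suc n)
  show ?case
    by (rule Ck_SucI[where f' = "\<lambda>x. deriv f x + deriv g x"])
      (use Suc Ck_SucD in \<open>auto intro!: DERIV_add Suc.IH simp del: Ck.simps(2)\<close>)
qed simp

lemma Ck_mult: "Ck n f \<Longrightarrow> Ck n g \<Longrightarrow> Ck n (\<lambda>x. f x * g x)"
proof (induction n arbitrary: f g)
  case (Suc n)
  show ?case
  proof (rule Ck_SucI[where f' = "\<lambda>x. deriv f x * g x + deriv g x * f x"])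
    show "DERIV (\<lambda>x. f x * g x) x :> deriv f x * g x + deriv g x * f x" for x
      using DERIV_mult[OF Ck_SucD(1)[OF Suc(2)] Ck_SucD(1)[OF Suc(3)]] .
    show "Ck n (\<lambda>x. deriv f x * g x + deriv g x * f x)"
      by (intro Ck_add Suc.IH Ck_SucD Ck_Suc[of n f] Ck_Suc[of n g] Suc.prems)
  qed
qed simp

lemma Ck_compose: "Ck n f \<Longrightarrow> Ck n g \<Longrightarrow> Ck n (\<lambda>x. f (g x))"
proof (induction n arbitrary: f)
  case (Suc n)
  show ?case
  proof (rule Ck_SucI[where f' = "\<lambda>x. deriv f (g x) * deriv g x"])
    show "DERIV (\<lambda>x. f (g x)) x :> deriv f (g x) * deriv g x" for x
      by (rule DERIV_chain2[OF Ck_SucD(1)[OF Suc(2)] Ck_SucD(1)[OF Suc(3)]])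
    show "Ck n (\<lambda>x. deriv f (g x) * deriv g x)"
      by (rule Ck_mult[OF Suc.IH[OF Ck_SucD(2)[OF Suc.prems(1)] Ck_Suc[OF Suc.prems(2)]] Ck_SucD(2)[OF Suc.prems(2)]])
  qed
qed simp

lemma Ck_recip: "Ck n u \<Longrightarrow> (\<And>x. u x \<noteq> 0) \<Longrightarrow> Ck n (\<lambda>x. 1 / u x)"
proof (induction n)
  case (Suc n)
  have r: "Ck n (\<lambda>x. 1 / u x)" by (rule Suc.IH[OF Ck_Suc[OF Suc.prems(1)] Suc.prems(2)])
  show ?case
  proof (rule Ck_SucI[where f' = "\<lambda>x. (-1) * deriv u x * (1 / u x) * (1 / u x)"])
    show "DERIV (\<lambda>x. 1 / u x) x :> (-1) * deriv u x * (1 / u x) * (1 / u x)" for x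
      using Ck_SucD(1)[OF Suc(2)] Suc(3)[of x]
      by (auto intro!: derivative_eq_intros simp: field_simps power2_eq_square)
    show "Ck n (\<lambda>x. (-1) * deriv u x * (1 / u x) * (1 / u x))"
      by (rule Ck_mult[OF Ck_mult[OF Ck_mult[OF Ck_const[of n "-1"] Ck_SucD(2)[OF Suc.prems(1)]] r] r])
  qed
qed simp

lemma DERIV_inverse_fun:
  fixes f g :: "real \<Rightarrow> real"
  assumes "\<And>x. g (f x) = x" "\<And>y. f (g y) = y" "\<And>x. DERIV f x :> f' x" "f' (g y) \<noteq> 0"
  shows "DERIV g y :> 1 / f' (g y)"
proof -
  have "isCont g (f (g y))"
    by (rule isCont_inverse_function[where d = 1]) (use assms in \<open>auto intro: DERIV_isCont\<close>)
  then have "isCont g y" using assms by simp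
  then have "DERIV g y :> inverse (f' (g y))"
    by (intro DERIV_inverse_function[where f = f and a = "y - 1" and b = "y + 1"]) (use assms in auto)
  then show ?thesis by (simp add: inverse_eq_divide)
qed

text \<open>Bootstrapping: the derivative of \<open>g\<close> at \<open>y\<close> is
  \<open>1 / deriv f (g y)\<close>, which is differentiable as often as \<open>g\<close> is, so
  \<open>g\<close> gains one derivative.\<close>

lemma Ck_inverse_fun:
  fixes f g :: "real \<Rightarrow> real"
  assumes "\<And>x. g (f x) = x" "\<And>y. f (g y) = y" "smooth f" "\<And>x. deriv f x \<noteq> 0"
  shows "Ck n g"
proof (induction n)
  case (Suc n)
  show ?case
  proof (rule Ck_SucI[where f' = "\<lambda>y. 1 / deriv f (g y)"])
    show "DERIV g y :> 1 / deriv f (g y)" for y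
      by (rule DERIV_inverse_fun[where f = f]) (use assms smoothD in auto)
    show "Ck n (\<lambda>y. 1 / deriv f (g y))"
    proof (rule Ck_recip)
      show "Ck n (\<lambda>y. deriv f (g y))"
        by (rule Ck_compose[of n "deriv f" g]) (use assms smoothD(2) smooth_iff_Ck Suc in auto)
    qed (use assms in auto)
  qed
qed simp

lemma smooth_intros:
  "smooth (\<lambda>x. c)" "smooth (\<lambda>x. x)" "smooth id"
  "smooth f \<Longrightarrow> smooth g \<Longrightarrow> smooth (\<lambda>x. f x + g x)"
  "smooth f \<Longrightarrow> smooth g \<Longrightarrow> smooth (\<lambda>x. f x * g x)"
  "smooth f \<Longrightarrow> smooth g \<Longrightarrow> smooth (\<lambda>x. f (g x))"
  "smooth f \<Longrightarrow> smooth g \<Longrightarrow> smooth (f \<circ> g)"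
  unfolding smooth_iff_Ck o_def id_def
  by (simp_all add: Ck_const Ck_id Ck_add Ck_mult Ck_compose[of _ f g])

lemma smooth_diff: "smooth f \<Longrightarrow> smooth g \<Longrightarrow> smooth (\<lambda>x. f x - g x)"
  using smooth_intros(4)[of f "\<lambda>x. (-1) * g x"] smooth_intros(5)[OF smooth_intros(1)[of "-1"]] by simp

lemma smooth_deriv_add: "smooth f \<Longrightarrow> smooth g \<Longrightarrow> deriv (\<lambda>x. f x + g x) = (\<lambda>x. deriv f x + deriv g x)"
  by (rule ext, rule DERIV_imp_deriv, intro DERIV_add smoothD)

lemma smooth_deriv_cmult: "smooth f \<Longrightarrow> deriv (\<lambda>x. c * f x) = (\<lambda>x. c * deriv f x)"
  by (rule ext, rule DERIV_imp_deriv, intro DERIV_cmult smoothD)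

lemma smooth_funpow_add: "smooth f \<Longrightarrow> smooth g \<Longrightarrow>
    (deriv ^^ k) (\<lambda>x. f x + g x) = (\<lambda>x. (deriv ^^ k) f x + (deriv ^^ k) g x)"
  by (induction k) (simp_all add: smooth_deriv_add smooth_funpow)

lemma smooth_funpow_cmult: "smooth f \<Longrightarrow>
    (deriv ^^ k) (\<lambda>x. c * f x) = (\<lambda>x. c * (deriv ^^ k) f x)"
  by (induction k) (simp_all add: smooth_deriv_cmult smooth_funpow)

subsection \<open>A flat bump\<close>

text \<open>The powers in the denominator close the family under differentiation: the derivative of
  \<open>flat k\<close> is a combination of \<open>flat (Suc k)\<close> and
  \<open>flat (Suc (Suc k))\<close>. Smoothness at 0 thus reduces to one limit, for all
  \<open>k\<close>.\<close>

definition flat :: "nat \<Rightarrow> real \<Rightarrow> real" where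
  "flat k x = (if x > 0 then exp (- 1 / x) / x ^ k else 0)"

lemma flat_limit: "((\<lambda>h. flat k h) \<longlongrightarrow> 0) (at 0)"
proof -
  have "((\<lambda>y::real. y ^ k / exp y) \<longlongrightarrow> 0) at_top" by (rule tendsto_power_div_exp_0)
  then have "((\<lambda>h::real. inverse h ^ k / exp (inverse h)) \<longlongrightarrow> 0) (at_right 0)"
    using filterlim_compose[OF _ filterlim_inverse_at_top_right] by fast
  then have "(flat k \<longlongrightarrow> 0) (at_right 0)"
  proof (rule Lim_transform_eventually)
    show "\<forall>\<^sub>F h in at_right 0. inverse h ^ k / exp (inverse h) = flat k h"
      unfolding eventually_at_right_field
      by (intro exI[of _ 1]) (auto simp: flat_def exp_minus field_simps power_inverse)
  qed
  moreover have "(flat k \<longlongrightarrow> 0) (at_left 0)"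
  proof (rule Lim_transform_eventually[where f = "\<lambda>_. 0"])
    show "\<forall>\<^sub>F h in at_left 0. 0 = flat k h"
      unfolding eventually_at_left_field by (intro exI[of _ "-1"]) (auto simp: flat_def)
  qed simp
  ultimately show ?thesis by (simp add: filterlim_at_split)
qed

lemma DERIV_flat: "DERIV (flat k) x :> (- real k) * flat (Suc k) x + flat (Suc (Suc k)) x"
proof -
  consider "x > 0" | "x < 0" | "x = 0" by linarith
  then show ?thesis
  proof cases
    case 1
    have e: "DERIV (\<lambda>x. exp (- 1 / x)) x :> exp (- 1 / x) / (x * x)"
      using 1 by (auto intro!: derivative_eq_intros simp: field_simps)
    have p: "DERIV (\<lambda>x. x ^ k) x :> real k * x ^ k / x"
    proof -
      have eq: "real k * x ^ (k - Suc 0) = real k * x ^ k / x" using 1 by (cases k) auto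
      show ?thesis using DERIV_pow[of k x] by (simp only: eq)
    qed
    have "DERIV (\<lambda>x. exp (- 1 / x) / x ^ k) x :>
        (exp (- 1 / x) / (x * x) * x ^ k - exp (- 1 / x) * (real k * x ^ k / x)) / (x ^ k * x ^ k)"
      by (rule DERIV_divide[OF e p]) (use 1 in auto)
    also have "(exp (- 1 / x) / (x * x) * x ^ k - exp (- 1 / x) * (real k * x ^ k / x)) / (x ^ k * x ^ k)
        = (- real k) * flat (Suc k) x + flat (Suc (Suc k)) x"
      using 1 by (simp add: flat_def field_simps)
    finally have "DERIV (\<lambda>x. exp (- 1 / x) / x ^ k) x :> (- real k) * flat (Suc k) x + flat (Suc (Suc k)) x" .
    then show ?thesis
      by (rule has_field_derivative_transform_within_open[where S = "{0<..}"]) (use 1 in \<open>auto simp: flat_def\<close>)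
  next
    case 2
    have "DERIV (\<lambda>x. 0 :: real) x :> 0" by simp
    then have "DERIV (flat k) x :> 0"
      by (rule has_field_derivative_transform_within_open[where S = "{..<0}"]) (use 2 in \<open>auto simp: flat_def\<close>)
    then show ?thesis using 2 by (simp add: flat_def)
  next
    case 3
    have "((\<lambda>h. (flat k (0 + h) - flat k 0) / h) \<longlongrightarrow> 0) (at 0)"
    proof (rule Lim_transform_eventually[OF flat_limit[of "Suc k"]])
      show "\<forall>\<^sub>F h in at 0. flat (Suc k) h = (flat k (0 + h) - flat k 0) / h"
        by (intro always_eventually) (auto simp: flat_def)
    qed
    then have "DERIV (flat k) 0 :> 0" by (simp add: DERIV_def)
    then show ?thesis using 3 by (simp add: flat_def)
  qed
qed

lemma smooth_flat: "smooth (flat k)"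
proof -
  have "Ck n (flat k)" for n
  proof (induction n arbitrary: k)
    case (Suc n)
    show ?case by (rule Ck_SucI[OF DERIV_flat]) (intro Ck_add Ck_mult Ck_const Suc)
  qed simp
  then show ?thesis by (simp add: smooth_iff_Ck)
qed

definition bump :: "real \<Rightarrow> real \<Rightarrow> real \<Rightarrow> real" where
  "bump l r x = flat 0 (x - l) * flat 0 (r - x)"

lemma bump_pos: "l < x \<Longrightarrow> x < r \<Longrightarrow> bump l r x > 0"
  by (simp add: bump_def flat_def)

lemma bump_zero: "x \<notin> {l<..<r} \<Longrightarrow> bump l r x = 0"
  by (auto simp: bump_def flat_def)

lemma smooth_bump: "smooth (bump l r)"
proof -
  have "smooth (\<lambda>x. x + (-l))" "smooth (\<lambda>x. (-1) * x + r)"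
    by (intro smooth_intros(1,2,4,5))+
  then have "smooth (\<lambda>x. flat 0 (x + (-l)) * flat 0 ((-1) * x + r))"
    by (intro smooth_intros(5) smooth_intros(6)[OF smooth_flat])
  moreover have "bump l r = (\<lambda>x. flat 0 (x + (-l)) * flat 0 ((-1) * x + r))"
    by (auto simp: bump_def fun_eq_iff)
  ultimately show ?thesis by simp
qed

subsection \<open>Uniform convergence of all derivatives\<close>

abbreviation ucl :: "(nat \<Rightarrow> real \<Rightarrow> real) \<Rightarrow> (real \<Rightarrow> real) \<Rightarrow> bool" where
  "ucl F f \<equiv> uniform_limit UNIV F f sequentially"

primrec CL :: "nat \<Rightarrow> (nat \<Rightarrow> real \<Rightarrow> real) \<Rightarrow> (real \<Rightarrow> real) \<Rightarrow> bool" where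
  "CL 0 F f = ucl F f"
| "CL (Suc n) F f = (ucl F f \<and> CL n (\<lambda>j. deriv (F j)) (deriv f))"

lemma CL_iff: "CL n F f \<longleftrightarrow> (\<forall>k\<le>n. ucl (\<lambda>j. (deriv ^^ k) (F j)) ((deriv ^^ k) f))"
proof (induction n arbitrary: F f)
  case (Suc n)
  have "CL (Suc n) F f \<longleftrightarrow> ucl F f \<and> (\<forall>k\<le>n. ucl (\<lambda>j. (deriv ^^ Suc k) (F j)) ((deriv ^^ Suc k) f))"
    by (simp only: CL.simps Suc funpow_Suc_right o_apply)
  also have "\<dots> \<longleftrightarrow> (\<forall>k\<le>Suc n. ucl (\<lambda>j. (deriv ^^ k) (F j)) ((deriv ^^ k) f))"
    unfolding less_Suc_eq_le[symmetric] by (subst (2) All_less_Suc2) (simp del: funpow.simps(2))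
  finally show ?case .
qed simp

definition Cinf :: "(nat \<Rightarrow> real \<Rightarrow> real) \<Rightarrow> (real \<Rightarrow> real) \<Rightarrow> bool" where
  "Cinf F f \<longleftrightarrow> (\<forall>k. ucl (\<lambda>j. (deriv ^^ k) (F j)) ((deriv ^^ k) f))"

lemma Cinf_iff_CL: "Cinf F f \<longleftrightarrow> (\<forall>n. CL n F f)"
  unfolding Cinf_def CL_iff by blast

lemma CL_Suc: "CL (Suc n) F f \<Longrightarrow> CL n F f"
  unfolding CL_iff by simp

lemma CL_ucl: "CL n F f \<Longrightarrow> ucl F f"
  by (cases n) auto

definition bsm :: "(real \<Rightarrow> real) \<Rightarrow> bool" where
  "bsm f \<longleftrightarrow> smooth f \<and> (\<forall>k. bounded (range ((deriv ^^ k) f)))"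

text \<open>A diffeomorphism that is the identity outside a bounded interval is an unbounded
  function, but all its derivatives are bounded. For limits of this kind, composition is continuous
  with respect to uniform convergence of all derivatives.\<close>

definition DS :: "(real \<Rightarrow> real) \<Rightarrow> bool" where
  "DS f \<longleftrightarrow> smooth f \<and> bsm (deriv f)"

primrec Bk :: "nat \<Rightarrow> (real \<Rightarrow> real) \<Rightarrow> bool" where
  "Bk 0 f = bounded (range f)"
| "Bk (Suc n) f = (bounded (range f) \<and> Bk n (deriv f))"

lemma Bk_iff: "Bk n f \<longleftrightarrow> (\<forall>k\<le>n. bounded (range ((deriv ^^ k) f)))"
proof (induction n arbitrary: f)
  case (Suc n)
  have "Bk (Suc n) f \<longleftrightarrow> bounded (range f) \<and> (\<forall>k\<le>n. bounded (range ((deriv ^^ Suc k) f)))"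
    by (simp only: Bk.simps Suc funpow_Suc_right o_apply)
  also have "\<dots> \<longleftrightarrow> (\<forall>k\<le>Suc n. bounded (range ((deriv ^^ k) f)))"
    unfolding less_Suc_eq_le[symmetric] by (subst (2) All_less_Suc2) (simp del: funpow.simps(2))
  finally show ?case .
qed simp

lemma bsm_iff: "bsm f \<longleftrightarrow> smooth f \<and> (\<forall>n. Bk n f)"
  unfolding bsm_def Bk_iff by blast

lemma bsm_deriv: "bsm f \<Longrightarrow> bsm (deriv f)"
  unfolding bsm_iff by (metis Bk.simps(2) smoothD(2))

lemma bsm_DS: "bsm f \<Longrightarrow> DS f"
  unfolding DS_def using bsm_deriv bsm_def by blast

lemma bounded_real_mult:
  fixes f g :: "real \<Rightarrow> real"
  assumes "bounded (range f)" "bounded (range g)"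
  shows "bounded (range (\<lambda>x. f x * g x))"
proof -
  obtain A where A: "\<And>x. \<bar>f x\<bar> \<le> A" using assms(1) by (auto simp: bounded_iff)
  obtain B where B: "\<And>x. \<bar>g x\<bar> \<le> B" using assms(2) by (auto simp: bounded_iff)
  have "\<bar>f x * g x\<bar> \<le> A * B" for x
    unfolding abs_mult by (rule mult_mono) (use A B in \<open>auto intro: order_trans[OF abs_ge_zero]\<close>)
  then show ?thesis by (auto simp: bounded_iff)
qed

lemma bounded_real_add:
  fixes f g :: "real \<Rightarrow> real"
  assumes "bounded (range f)" "bounded (range g)"
  shows "bounded (range (\<lambda>x. f x + g x))"
proof -
  obtain A where A: "\<And>x. \<bar>f x\<bar> \<le> A" using assms(1) by (auto simp: bounded_iff)
  obtain B where B: "\<And>x. \<bar>g x\<bar> \<le> B" using assms(2) by (auto simp: bounded_iff)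
  have "\<bar>f x + g x\<bar> \<le> A + B" for x using A[of x] B[of x] by linarith
  then show ?thesis by (auto simp: bounded_iff)
qed

lemma Bk_SucD: "Bk (Suc n) f \<Longrightarrow> Bk n f"
  unfolding Bk_iff by simp

lemma Bk_bdd: "Bk n f \<Longrightarrow> bounded (range f)" by (cases n) auto

lemma Bk_add: "smooth f \<Longrightarrow> smooth g \<Longrightarrow> Bk n f \<Longrightarrow> Bk n g \<Longrightarrow> Bk n (\<lambda>x. f x + g x)"
  unfolding Bk_iff by (simp add: smooth_funpow_add bounded_real_add)

lemma smooth_deriv_mult: "smooth f \<Longrightarrow> smooth g \<Longrightarrow>
    deriv (\<lambda>x. f x * g x) = (\<lambda>x. deriv f x * g x + deriv g x * f x)"
  by (rule ext, rule DERIV_imp_deriv, intro DERIV_mult smoothD)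

lemma smooth_deriv_compose: "smooth f \<Longrightarrow> smooth g \<Longrightarrow>
    deriv (\<lambda>x. f (g x)) = (\<lambda>x. deriv f (g x) * deriv g x)"
  by (rule ext, rule DERIV_imp_deriv, intro DERIV_chain2[where f = f] smoothD)

lemma Bk_mult: "smooth f \<Longrightarrow> smooth g \<Longrightarrow> Bk n f \<Longrightarrow> Bk n g \<Longrightarrow> Bk n (\<lambda>x. f x * g x)"
proof (induction n arbitrary: f g)
  case 0
  then show ?case by (simp add: bounded_real_mult)
next
  case (Suc n)
  have "Bk n (\<lambda>x. deriv f x * g x + deriv g x * f x)"
    by (intro Bk_add Suc.IH smooth_intros(5) smoothD(2) Suc.prems(1,2) Bk_SucD[of n f] Bk_SucD[of n g])
      (use Suc.prems in auto)
  then show ?case using Suc.prems by (simp add: smooth_deriv_mult bounded_real_mult)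
qed

lemma Bk_compose: "smooth f \<Longrightarrow> smooth g \<Longrightarrow> Bk n f \<Longrightarrow> (\<And>m. Bk m (deriv g)) \<Longrightarrow> Bk n (\<lambda>x. f (g x))"
proof (induction n arbitrary: f)
  case 0
  have "range (\<lambda>x. f (g x)) \<subseteq> range f" by auto
  then show ?case using 0 bounded_subset by auto
next
  case (Suc n)
  have "range (\<lambda>x. f (g x)) \<subseteq> range f" by auto
  then have "bounded (range (\<lambda>x. f (g x)))" using Suc bounded_subset by auto
  moreover have "Bk n (\<lambda>x. deriv f (g x) * deriv g x)"
    by (rule Bk_mult[OF smooth_intros(6)[OF smoothD(2) Suc.prems(2)] smoothD(2) Suc.IH[OF smoothD(2)]])
      (use Suc.prems in auto)
  ultimately show ?case using Suc.prems by (simp add: smooth_deriv_compose)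
qed

lemma bsm_mult: "bsm f \<Longrightarrow> bsm g \<Longrightarrow> bsm (\<lambda>x. f x * g x)"
  unfolding bsm_iff by (simp add: Bk_mult smooth_intros)

lemma bsm_compose: "bsm f \<Longrightarrow> DS g \<Longrightarrow> bsm (\<lambda>x. f (g x))"
  unfolding bsm_iff DS_def by (simp add: Bk_compose[of f g] smooth_intros(6)[of f g])

lemma DS_lipschitz:
  assumes "DS f"
  obtains L where "L > 0" "\<And>x y. \<bar>f x - f y\<bar> \<le> L * \<bar>x - y\<bar>"
proof -
  have "bounded (range (deriv f))" using assms Bk_bdd unfolding DS_def bsm_iff by blast
  then obtain L where L: "\<And>x. \<bar>deriv f x\<bar> \<le> L" by (auto simp: bounded_iff)
  have "norm (f x - f y) \<le> max L 1 * norm (x - y)" for x y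
    by (rule field_differentiable_bound[where S = UNIV and f' = "deriv f"])
      (use L assms smoothD in \<open>auto simp: DS_def max.coboundedI1\<close>)
  then show ?thesis by (intro that[of "max L 1"]) auto
qed

text \<open>Only the limit \<open>f\<close> has to be Lipschitz: \<open>F j (G j x)\<close> is
  compared with \<open>f (G j x)\<close>, and that with \<open>f (g x)\<close>.\<close>

lemma ucl_compose:
  assumes "DS f" "ucl F f" "ucl G g"
  shows "ucl (\<lambda>j x. F j (G j x)) (\<lambda>x. f (g x))"
proof (rule uniform_limitI)
  fix e :: real assume e: "e > 0"
  obtain L where L: "L > 0" "\<And>x y. \<bar>f x - f y\<bar> \<le> L * \<bar>x - y\<bar>" using DS_lipschitz[OF assms(1)] by blast
  have "\<forall>\<^sub>F j in sequentially. \<forall>x\<in>UNIV. dist (F j x) (f x) < e / 2"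
    by (rule uniform_limitD[OF assms(2)]) (use e in simp)
  moreover have "\<forall>\<^sub>F j in sequentially. \<forall>x\<in>UNIV. dist (G j x) (g x) < e / (2 * L)"
    by (rule uniform_limitD[OF assms(3)]) (use e L in simp)
  ultimately show "\<forall>\<^sub>F j in sequentially. \<forall>x\<in>UNIV. dist (F j (G j x)) (f (g x)) < e"
  proof eventually_elim
    case (elim j)
    show ?case
    proof
      fix x
      have "\<bar>f (G j x) - f (g x)\<bar> \<le> L * \<bar>G j x - g x\<bar>" by (rule L(2))
      also have "\<dots> < L * (e / (2 * L))"
        using elim L by (intro mult_strict_left_mono) (auto simp: dist_real_def)
      finally have "\<bar>f (G j x) - f (g x)\<bar> < e / 2" using L by simp
      moreover have "\<bar>F j (G j x) - f (G j x)\<bar> < e / 2" using elim by (auto simp: dist_real_def)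
      ultimately show "dist (F j (G j x)) (f (g x)) < e" unfolding dist_real_def by linarith
    qed
  qed
qed

lemma CL_add: "\<lbrakk>smooth f; smooth g; \<And>j. smooth (F j); \<And>j. smooth (G j); CL n F f; CL n G g\<rbrakk>
    \<Longrightarrow> CL n (\<lambda>j x. F j x + G j x) (\<lambda>x. f x + g x)"
  unfolding CL_iff by (simp add: smooth_funpow_add uniform_limit_add)

lemma CL_mult: "\<lbrakk>bsm f; bsm g; \<And>j. smooth (F j); \<And>j. smooth (G j); CL n F f; CL n G g\<rbrakk>
    \<Longrightarrow> CL n (\<lambda>j x. F j x * G j x) (\<lambda>x. f x * g x)"
proof (induction n arbitrary: f g F G)
  case 0
  have "bounded (range f)" "bounded (range g)" using 0 Bk_bdd by (auto simp: bsm_iff)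
  then show ?case using 0 by (simp add: uniform_lim_mult)
next
  case (Suc n)
  have sm: "smooth f" "smooth g" using Suc.prems by (auto simp: bsm_def)
  have b: "bounded (range f)" "bounded (range g)" using Suc.prems Bk_bdd by (auto simp: bsm_iff)
  have 1: "ucl (\<lambda>j x. F j x * G j x) (\<lambda>x. f x * g x)"
    using uniform_lim_mult[OF CL_ucl CL_ucl, of "Suc n" F f "Suc n" G g] Suc.prems(5,6) b by simp
  have "CL n (\<lambda>j x. deriv (F j) x * G j x + deriv (G j) x * F j x) (\<lambda>x. deriv f x * g x + deriv g x * f x)"
    by (intro CL_add Suc.IH smooth_intros(5) smoothD(2) Suc.prems(1-4) sm bsm_deriv CL_Suc[of n F] CL_Suc[of n G])
      (use Suc.prems in auto)
  then show ?case using 1 sm Suc.prems(3,4) by (simp add: smooth_deriv_mult)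
qed

lemma CL_compose: "\<lbrakk>DS f; DS g; \<And>j. smooth (F j); \<And>j. smooth (G j); CL n F f; CL n G g\<rbrakk>
    \<Longrightarrow> CL n (\<lambda>j x. F j (G j x)) (\<lambda>x. f (g x))"
proof (induction n arbitrary: f F)
  case 0
  then show ?case using ucl_compose by simp
next
  case (Suc n)
  have sm: "smooth f" "smooth g" "bsm (deriv f)" "bsm (deriv g)" using Suc.prems by (auto simp: DS_def)
  have 1: "ucl (\<lambda>j x. F j (G j x)) (\<lambda>x. f (g x))"
    using ucl_compose[OF Suc.prems(1) CL_ucl CL_ucl] Suc.prems(5,6) by blast
  have a: "CL n (\<lambda>j x. deriv (F j) (G j x)) (\<lambda>x. deriv f (g x))"
    by (rule Suc.IH[of "deriv f" "\<lambda>j. deriv (F j)"]) (use Suc.prems sm bsm_DS smoothD(2) CL_Suc[of n G] in auto)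
  have "CL n (\<lambda>j x. deriv (F j) (G j x) * deriv (G j) x) (\<lambda>x. deriv f (g x) * deriv g x)"
    by (rule CL_mult[OF bsm_compose[OF sm(3) Suc.prems(2)] sm(4) smooth_intros(6)[OF smoothD(2) Suc.prems(4)] smoothD(2) a])
      (use Suc.prems in auto)
  moreover have "deriv (\<lambda>x. F j (G j x)) = (\<lambda>x. deriv (F j) (G j x) * deriv (G j) x)" for j
    by (rule smooth_deriv_compose[OF Suc.prems(3,4)])
  ultimately show ?case using 1 smooth_deriv_compose[OF sm(1,2)] by simp
qed

lemma Cinf_compose: "\<lbrakk>DS f; DS g; \<And>j. smooth (F j); \<And>j. smooth (G j); Cinf F f; Cinf G g\<rbrakk>
    \<Longrightarrow> Cinf (\<lambda>j x. F j (G j x)) (\<lambda>x. f (g x))"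
  unfolding Cinf_iff_CL by (simp add: CL_compose[of f g F G])

lemma CL_recip:
  assumes c: "c > 0" "\<And>j x. u j x \<ge> c"
  shows "\<lbrakk>\<And>j. smooth (u j); CL n u (\<lambda>x. 1)\<rbrakk> \<Longrightarrow> CL n (\<lambda>j x. 1 / u j x) (\<lambda>x. 1)"
proof (induction n)
  case 0
  have "ucl (\<lambda>j x. inverse (u j x)) (inverse \<circ> (\<lambda>x. 1))"
    by (rule uniform_lim_inverse[where b = 1]) (use 0 in auto)
  then show ?case by (simp add: o_def inverse_eq_divide)
next
  case (Suc n)
  have nz: "u j x \<noteq> 0" for j x using c(1) c(2)[of j x] by linarith
  have "ucl (\<lambda>j x. inverse (u j x)) (inverse \<circ> (\<lambda>x. 1))"
    by (rule uniform_lim_inverse[where b = 1]) (use Suc in auto)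
  then have 1: "ucl (\<lambda>j x. 1 / u j x) (\<lambda>x. 1)" by (simp add: o_def inverse_eq_divide)
  have sm: "smooth (\<lambda>x. 1 / u j x)" for j
    using Suc.prems(1) nz Ck_recip by (auto simp: smooth_iff_Ck)
  have d: "deriv (\<lambda>x. 1 / u j x) = (\<lambda>x. ((-1) * deriv (u j) x) * ((1 / u j x) * (1 / u j x)))" for j
    by (rule ext, rule DERIV_imp_deriv)
      (use smoothD(1)[OF Suc.prems(1)] nz in \<open>auto intro!: derivative_eq_intros simp: field_simps power2_eq_square\<close>)
  have bc: "bsm (\<lambda>x. c)" for c :: real
  proof -
    have "(deriv ^^ k) (\<lambda>x. c::real) = (if k = 0 then (\<lambda>x. c) else (\<lambda>x. 0))" for k
      by (induction k) simp_all
    then show ?thesis by (auto simp: bsm_def smooth_intros)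
  qed
  have cc: "CL n (\<lambda>j. (\<lambda>x. c)) (\<lambda>x. c)" for c :: real by (auto simp: CL_iff intro: uniform_limit_const)
  have "CL n (\<lambda>j x. ((-1) * deriv (u j) x) * ((1 / u j x) * (1 / u j x))) (\<lambda>x. ((-1) * 0) * (1 * 1))"
    by (intro CL_mult cc bc bsm_mult smooth_intros(1,5) smoothD(2) Suc.prems(1) sm Suc.IH CL_Suc[of n u])
      (use Suc.prems(2) in auto)
  then show ?case using 1 by (simp add: d)
qed

subsection \<open>The group of diffeomorphisms\<close>

lemma Diff01D:
  assumes "f \<in> carrier Diff01"
  shows "bij f" "smooth f" "smooth (finv f)" "x \<notin> {0<..<1} \<Longrightarrow> f x = x"
  using assms by (simp_all add: Diff01_def smooth_diffeo_def)

lemma Diff01_finv_simps: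
  assumes "f \<in> carrier Diff01"
  shows "f (finv f x) = x" "finv f (f x) = x"
  using Diff01D(1)[OF assms] by (simp_all add: bij_is_surj surj_f_inv_f bij_is_inj)

lemma Diff01_id: "id \<in> carrier Diff01"
  by (simp add: Diff01_def smooth_diffeo_def smooth_intros)

lemma Diff01_comp:
  assumes "f \<in> carrier Diff01" "g \<in> carrier Diff01"
  shows "f \<circ> g \<in> carrier Diff01"
proof -
  have "finv (f \<circ> g) = finv g \<circ> finv f"
    using Diff01D(1)[OF assms(1)] Diff01D(1)[OF assms(2)] by (simp add: o_inv_distrib)
  moreover have "bij (f \<circ> g)" by (rule bij_comp[OF Diff01D(1)[OF assms(2)] Diff01D(1)[OF assms(1)]])
  moreover have "(f \<circ> g) t = t" if "t \<notin> {0<..<1}" for t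
    using Diff01D(4)[OF assms(1) that] Diff01D(4)[OF assms(2) that] by simp
  ultimately show ?thesis
    using smooth_intros(7)[OF Diff01D(2)[OF assms(1)] Diff01D(2)[OF assms(2)]]
      smooth_intros(7)[OF Diff01D(3)[OF assms(2)] Diff01D(3)[OF assms(1)]]
    by (simp add: Diff01_def smooth_diffeo_def)
qed

lemma Diff01_finv:
  assumes "f \<in> carrier Diff01"
  shows "finv f \<in> carrier Diff01"
proof -
  have "finv f t = t" if "t \<notin> {0<..<1}" for t
    using Diff01_finv_simps(2)[OF assms, of t] Diff01D(4)[OF assms that] by simp
  moreover have "finv (finv f) = f" using Diff01D(1)[OF assms] by (rule inv_inv_eq)
  ultimately show ?thesis
    using bij_imp_bij_inv[OF Diff01D(1)[OF assms]] Diff01D(2,3)[OF assms]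
    by (simp add: Diff01_def smooth_diffeo_def)
qed

lemma Diff01I:
  assumes f: "smooth f" "\<And>x. deriv f x > 0" "\<And>x. x \<notin> {0<..<1} \<Longrightarrow> f x = x"
  shows "f \<in> carrier Diff01"
proof -
  have mono: "f x < f y" if "x < y" for x y
    by (rule DERIV_pos_imp_increasing[OF that]) (use smoothD(1)[OF f(1)] f(2) in blast)
  have "inj f" by (rule linorder_injI) (use mono in force)
  moreover have "\<exists>x. f x = y" for y
  proof (cases "y \<in> {0<..<1}")
    case True
    have "f 0 = 0" "f 1 = 1" using f(3) by auto
    then show ?thesis using IVT'[of f 0 y 1] True smooth_cont[OF f(1)] by auto
  qed (use f(3) in blast)
  ultimately have bij: "bij f" unfolding bij_def surj_def by metis
  have "smooth (finv f)"
    unfolding smooth_iff_Ck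
  proof
    fix n
    show "Ck n (finv f)"
      by (rule Ck_inverse_fun[of _ f])
        (use bij f(1) less_imp_neq[OF f(2)] in \<open>auto simp: bij_is_surj surj_f_inv_f bij_is_inj\<close>)
  qed
  then show ?thesis using bij f by (simp add: Diff01_def smooth_diffeo_def)
qed

lemma Diff01_mono:
  assumes f: "f \<in> carrier Diff01" and xy: "x < y"
  shows "f x < f y"
proof -
  define a b where "a = min x 0 - 1" and "b = max y 1 + 1"
  have ab: "f a = a" "f b = b" by (rule Diff01D(4)[OF f], simp add: a_def b_def)+
  have c: "continuous_on S f" for S by (rule smooth_cont[OF Diff01D(2)[OF f]])
  have i: "inj_on f S" for S using bij_is_inj[OF Diff01D(1)[OF f]] by (rule inj_on_subset) simp
  have o: "a < x" "x < b" "y < b" "a < b" using xy by (auto simp: a_def b_def)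
  have "f x < b" using continuous_inj_imp_mono[OF o(1,2) c i] ab o by auto
  then show ?thesis using continuous_inj_imp_mono[OF xy o(3) c i] ab by auto
qed

lemma Diff01_less_iff: "f \<in> carrier Diff01 \<Longrightarrow> f x < f y \<longleftrightarrow> x < y"
  by (metis Diff01_mono linorder_neqE not_less_iff_gr_or_eq)

lemma Diff01_le_iff: "f \<in> carrier Diff01 \<Longrightarrow> f x \<le> f y \<longleftrightarrow> x \<le> y"
  using Diff01_less_iff[of f y x] by (simp add: not_less[symmetric])

lemma Diff01_cont: "f \<in> carrier Diff01 \<Longrightarrow> continuous_on S f"
  by (rule smooth_cont[OF Diff01D(2)])

lemma deriv_local:
  fixes f g :: "real \<Rightarrow> real"
  assumes "open S" "x \<in> S" "\<And>y. y \<in> S \<Longrightarrow> f y = g y"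
  shows "(deriv ^^ k) f x = (deriv ^^ k) g x"
  using assms(2)
proof (induction k arbitrary: x)
  case (Suc k)
  have "\<forall>\<^sub>F y in nhds x. (deriv ^^ k) f y = (deriv ^^ k) g y"
    using Suc.IH eventually_nhds_in_open[OF assms(1) Suc.prems] by (auto elim: eventually_mono)
  then show ?case by (simp add: deriv_cong_ev)
qed (use assms(3) in simp)

lemma funpow_deriv_const: "(deriv ^^ k) (\<lambda>x::real. c) = (\<lambda>x. if k = 0 then c else 0::real)"
  by (induction k) (auto simp: fun_eq_iff)

lemma bsm_support:
  assumes h: "smooth h" "\<And>x. x \<notin> {a<..<b} \<Longrightarrow> h x = 0"
  shows "bsm h"
  unfolding bsm_def
proof (intro conjI allI h(1))
  fix k
  have z: "(deriv ^^ k) h x = 0" if "x \<notin> {a..b}" for x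
  proof -
    have "(deriv ^^ k) h x = (deriv ^^ k) (\<lambda>x. 0) x"
      by (rule deriv_local[of "- {a..b}"]) (use that h(2) in auto)
    then show ?thesis by (simp add: funpow_deriv_const)
  qed
  have "compact ((deriv ^^ k) h ` {a..b})"
    by (rule compact_continuous_image[OF smooth_cont[OF smooth_funpow[OF h(1)]]]) simp
  then have "bounded ((deriv ^^ k) h ` {a..b} \<union> {0})"
    by (simp add: compact_imp_bounded)
  then show "bounded (range ((deriv ^^ k) h))"
    by (rule bounded_subset) (use z in force)
qed

lemma DS_support:
  assumes f: "smooth f" "\<And>x. x \<notin> {a<..<b} \<Longrightarrow> f x = x"
  shows "DS f"
proof -
  have h: "smooth (\<lambda>x. f x - x)" by (rule smooth_diff[OF f(1) smooth_intros(2)])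
  have b: "bsm (\<lambda>x. f x - x)" by (rule bsm_support[OF h, of a b]) (use f(2) in auto)
  have d: "deriv (\<lambda>x. f x - x) = (\<lambda>x. deriv f x - 1)"
    by (rule ext, rule DERIV_imp_deriv) (auto intro!: derivative_eq_intros smoothD(1)[OF f(1)])
  have e: "deriv f = (\<lambda>x. deriv (\<lambda>x. f x - x) x + 1)" unfolding d by simp
  have "(deriv ^^ k) (deriv f) = (\<lambda>x. (deriv ^^ k) (deriv (\<lambda>x. f x - x)) x + (if k = 0 then 1 else 0))" for k
    by (subst e, subst smooth_funpow_add[OF smoothD(2)[OF h] smooth_intros(1)]) (simp add: funpow_deriv_const)
  then have "bounded (range ((deriv ^^ k) (deriv f)))" for k
    using bounded_real_add[of "(deriv ^^ k) (deriv (\<lambda>x. f x - x))" "\<lambda>x. if k = 0 then 1 else 0"] bsm_deriv[OF b]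
    by (auto simp: bsm_def)
  then show ?thesis using smoothD(2)[OF f(1)] f(1) by (simp add: DS_def bsm_def)
qed

lemma Diff01_DS: "f \<in> carrier Diff01 \<Longrightarrow> DS f"
  by (rule DS_support[of f 0 1]) (use Diff01D in blast)+

text \<open>Completeness of the C-infinity topology, by repeated interchange of uniform limits and
  derivatives. It provides the limit maps when the closure of the set of actions is taken.\<close>

lemma Cinf_limit:
  assumes F: "\<And>j. smooth (F j)" "\<And>k. ucl (\<lambda>j. (deriv ^^ k) (F j)) (g k)"
  shows "smooth (g 0)" "(deriv ^^ k) (g 0) = g k"
proof -
  have D: "DERIV (g k) x :> g (Suc k) x" for k x
  proof -
    have lim: "(\<lambda>j. (deriv ^^ k) (F j) y) \<longlonglongrightarrow> g k y" for k y
      using tendsto_uniform_limitI[OF F(2)] by simp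
    have "\<exists>h. \<forall>x\<in>UNIV. (\<lambda>j. (deriv ^^ k) (F j) x) \<longlonglongrightarrow> h x \<and> (h has_derivative (\<lambda>t. g (Suc k) x * t)) (at x within UNIV)"
    proof (rule has_derivative_sequence[where f' = "\<lambda>j x t. (deriv ^^ Suc k) (F j) x * t" and ?x0.0 = 0, OF _ _ _ _ lim])
      show "((deriv ^^ k) (F j) has_derivative (\<lambda>t. (deriv ^^ Suc k) (F j) x * t)) (at x within UNIV)" for j x
        using smoothD(1)[OF smooth_funpow[OF F(1)], of k j x] by (simp add: has_field_derivative_def)
      fix e :: real assume "e > 0"
      then have "\<forall>\<^sub>F j in sequentially. \<forall>x\<in>UNIV. dist ((deriv ^^ Suc k) (F j) x) (g (Suc k) x) < e"
        by (rule uniform_limitD[OF F(2)])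
      then show "\<forall>\<^sub>F j in sequentially. \<forall>x\<in>UNIV. \<forall>h. norm ((deriv ^^ Suc k) (F j) x * h - g (Suc k) x * h) \<le> e * norm h"
      proof (rule eventually_mono, intro ballI allI)
        fix j x h assume "\<forall>x\<in>UNIV. dist ((deriv ^^ Suc k) (F j) x) (g (Suc k) x) < e"
        then have "\<bar>(deriv ^^ Suc k) (F j) x - g (Suc k) x\<bar> \<le> e" by (simp add: dist_real_def less_imp_le)
        then show "norm ((deriv ^^ Suc k) (F j) x * h - g (Suc k) x * h) \<le> e * norm h"
          by (simp add: left_diff_distrib[symmetric] abs_mult mult_right_mono del: funpow.simps)
      qed
    qed auto
    then obtain h where h: "\<And>x. (\<lambda>j. (deriv ^^ k) (F j) x) \<longlonglongrightarrow> h x"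
      "\<And>x. (h has_derivative (\<lambda>t. g (Suc k) x * t)) (at x)" by auto
    have "h = g k" using LIMSEQ_unique[OF h(1) lim] by blast
    then show ?thesis using h(2) by (simp add: has_field_derivative_def)
  qed
  have e: "deriv (g k) = g (Suc k)" for k by (rule ext, rule DERIV_imp_deriv, rule D)
  have f: "(deriv ^^ k) (g 0) = g k" for k by (induction k) (simp_all add: e)
  then show "(deriv ^^ k) (g 0) = g k" by simp
  show "smooth (g 0)" unfolding smooth_def f using D real_differentiable_def by blast
qed

text \<open>The derivative of \<open>finv (N j)\<close> is the reciprocal of
  \<open>deriv (N j)\<close> taken at \<open>finv (N j) x\<close>; so if \<open>n\<close>
  derivatives of the inverses converge, then \<open>n + 1\<close> do. The identity is enough as a
  limit, because convergence of actions will be demanded of generators and their inverses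
  alike.\<close>

lemma Cinf_finv:
  assumes N: "\<And>j. N j \<in> carrier Diff01" "\<And>j x. deriv (N j) x \<ge> 1 / 2" "Cinf N id"
  shows "Cinf (\<lambda>j. finv (N j)) id"
proof -
  note di = Diff01_finv[OF N(1)]
  have d1: "deriv (id::real \<Rightarrow> real) = (\<lambda>x. 1)" by (rule ext) (simp add: id_def)
  have d: "deriv (finv (N j)) = (\<lambda>x. 1 / deriv (N j) (finv (N j) x))" for j
    by (rule ext, rule DERIV_imp_deriv, rule DERIV_inverse_fun[of _ "N j"])
      (use Diff01_finv_simps[OF N(1)] smoothD(1)[OF Diff01D(2)[OF N(1)]] N(2)[of j] in
        \<open>auto simp: not_le intro!: less_imp_neq[THEN not_sym] intro: less_le_trans[of 0 "1/2"]\<close>)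
  have 0: "ucl (\<lambda>j. finv (N j)) id"
  proof (rule uniform_limitI)
    fix e :: real assume e: "e > 0"
    have "ucl N id" using CL_ucl N(3) Cinf_iff_CL by blast
    from uniform_limitD[OF this e] show "\<forall>\<^sub>F j in sequentially. \<forall>x\<in>UNIV. dist (finv (N j) x) (id x) < e"
    proof (rule eventually_mono, intro ballI)
      fix j x assume "\<forall>x\<in>UNIV. dist (N j x) (id x) < e"
      then have "dist (N j (finv (N j) x)) (finv (N j) x) < e" by simp
      then show "dist (finv (N j) x) (id x) < e" using Diff01_finv_simps(1)[OF N(1)] by (simp add: dist_commute)
    qed
  qed
  have "CL n (\<lambda>j. finv (N j)) id" for n
  proof (induction n)
    case (Suc n)
    have "CL (Suc n) N id" using N(3) Cinf_iff_CL by blast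
    then have 1: "CL n (\<lambda>j. deriv (N j)) (\<lambda>x. 1)" by (simp add: d1)
    have "CL n (\<lambda>j x. deriv (N j) (finv (N j) x)) (\<lambda>x. 1)"
      using CL_compose[of "\<lambda>x. 1" id "\<lambda>j. deriv (N j)" "\<lambda>j. finv (N j)" n] 1 Suc
        smoothD(2)[OF Diff01D(2)[OF N(1)]] Diff01D(2)[OF di] Diff01_DS[OF Diff01_id]
      by (simp add: DS_def bsm_def smooth_intros funpow_deriv_const)
    then have "CL n (\<lambda>j x. 1 / deriv (N j) (finv (N j) x)) (\<lambda>x. 1)"
      by (rule CL_recip[of "1/2", rotated 3])
        (simp, rule N(2), rule smooth_intros(6)[OF smoothD(2)[OF Diff01D(2)[OF N(1)]] Diff01D(2)[OF di]])
    then show ?case using 0 unfolding CL.simps d d1 by blast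
  next
    case 0
    then show ?case using \<open>ucl (\<lambda>j. finv (N j)) id\<close> unfolding CL.simps .
  qed
  then show ?thesis by (simp add: Cinf_iff_CL)
qed

subsection \<open>Analyticity and flat points\<close>

text \<open>A holomorphic extension takes the place of a power series: composition then needs no
  estimates, and inverses come from local invertibility of holomorphic maps.\<close>

definition ana_at :: "(real \<Rightarrow> real) \<Rightarrow> real \<Rightarrow> bool" where
  "ana_at f x \<longleftrightarrow> (\<exists>F S. open S \<and> complex_of_real x \<in> S \<and> F holomorphic_on S \<and>
     (\<forall>y. complex_of_real y \<in> S \<longrightarrow> F (of_real y) = of_real (f y)))"

lemma ana_at_compose:
  assumes g: "ana_at g x" and f: "ana_at f (g x)"
  shows "ana_at (f \<circ> g) x"
proof -
  obtain F S where F: "open S" "complex_of_real (g x) \<in> S" "F holomorphic_on S"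
    "\<And>y. complex_of_real y \<in> S \<Longrightarrow> F (of_real y) = of_real (f y)" using f unfolding ana_at_def by metis
  obtain G T where G: "open T" "complex_of_real x \<in> T" "G holomorphic_on T"
    "\<And>y. complex_of_real y \<in> T \<Longrightarrow> G (of_real y) = of_real (g y)" using g unfolding ana_at_def by metis
  define T' where "T' = T \<inter> G -` S"
  have "open T'"
    unfolding T'_def using continuous_open_preimage[OF holomorphic_on_imp_continuous_on[OF G(3)] G(1) F(1)] .
  moreover have "complex_of_real x \<in> T'" using G F by (simp add: T'_def)
  moreover have "(F \<circ> G) holomorphic_on T'"
    by (rule holomorphic_on_compose_gen[OF holomorphic_on_subset[OF G(3)] F(3)]) (auto simp: T'_def)
  moreover have "(F \<circ> G) (of_real y) = of_real ((f \<circ> g) y)" if "complex_of_real y \<in> T'" for y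
    using that G(4)[of y] F(4)[of "g y"] by (simp add: T'_def)
  ultimately show ?thesis unfolding ana_at_def by blast
qed

lemma ana_at_id: "ana_at id x"
  unfolding ana_at_def by (intro exI[of _ id] exI[of _ UNIV]) (auto intro: holomorphic_intros)

lemma ana_at_finv:
  assumes f: "f \<in> carrier Diff01" "ana_at f x" "deriv f x \<noteq> 0"
  shows "ana_at (finv f) (f x)"
proof -
  obtain F S where F: "open S" "complex_of_real x \<in> S" "F holomorphic_on S"
    "\<And>y. complex_of_real y \<in> S \<Longrightarrow> F (of_real y) = of_real (f y)" using f(2) unfolding ana_at_def by metis
  have "(F has_field_derivative deriv F (of_real x)) (at (of_real x))"
    using F by (simp add: holomorphic_derivI)
  then have "((\<lambda>y. F (of_real y)) has_vector_derivative deriv F (of_real x)) (at x)"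
    by (rule has_vector_derivative_real_field)
  moreover have "((\<lambda>y. F (of_real y)) has_vector_derivative of_real (deriv f x)) (at x)"
  proof -
    have v: "((\<lambda>y. complex_of_real (f y)) has_vector_derivative of_real (deriv f x)) (at x)"
      using smoothD(1)[OF Diff01D(2)[OF f(1)]]
      by (intro has_vector_derivative_of_real) (simp add: has_real_derivative_iff_has_vector_derivative)
    have o: "open (complex_of_real -` S)" using F(1) by (intro open_vimage continuous_intros)
    show ?thesis
      by (rule has_vector_derivative_transform_within_open[OF v o]) (use F in auto)
  qed
  ultimately have "deriv F (of_real x) = of_real (deriv f x)" by (rule vector_derivative_unique_at)
  then have nz: "deriv F (of_real x) \<noteq> 0" using f(3) by simp
  obtain \<rho> where \<rho>: "\<rho> > 0" "ball (of_real x) \<rho> \<subseteq> S" "open (F ` ball (of_real x) \<rho>)" "inj_on F (ball (of_real x) \<rho>)"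
    using has_complex_derivative_locally_invertible[OF F(3,2,1) nz] by blast
  obtain G where G: "G holomorphic_on F ` ball (of_real x) \<rho>" "\<And>z. z \<in> ball (of_real x) \<rho> \<Longrightarrow> G (F z) = z"
    using holomorphic_has_inverse[OF holomorphic_on_subset[OF F(3) \<rho>(2)] open_ball \<rho>(4)] by metis
  define T where "T = F ` ball (of_real x) \<rho> \<inter> {z. dist x (finv f (Re z)) < \<rho>}"
  have "open {z. dist x (finv f (Re z)) < \<rho>}"
    by (intro open_Collect_less continuous_intros
        continuous_on_compose2[OF Diff01_cont[OF Diff01_finv[OF f(1)], of UNIV]]) auto
  then have "open T" unfolding T_def by (intro open_Int \<rho>(3))
  moreover have "complex_of_real (f x) \<in> T"
    unfolding T_def
  proof
    have "F (of_real x) \<in> F ` ball (of_real x) \<rho>" using \<rho>(1) by simp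
    then show "complex_of_real (f x) \<in> F ` ball (of_real x) \<rho>" unfolding F(4)[OF F(2)] .
  qed (use \<rho>(1) Diff01_finv_simps(2)[OF f(1)] in simp)
  moreover have "G holomorphic_on T" by (rule holomorphic_on_subset[OF G(1)]) (auto simp: T_def)
  moreover have "G (of_real y) = of_real (finv f y)" if "complex_of_real y \<in> T" for y
  proof -
    have m: "complex_of_real (finv f y) \<in> ball (of_real x) \<rho>" using that by (simp add: T_def dist_of_real)
    then have "F (of_real (finv f y)) = of_real y"
      using F(4)[OF subsetD[OF \<rho>(2) m]] Diff01_finv_simps(1)[OF f(1)] by simp
    then show ?thesis using G(2)[OF m] by simp
  qed
  ultimately show ?thesis unfolding ana_at_def by blast
qed

definition flat_at :: "(real \<Rightarrow> real) \<Rightarrow> real \<Rightarrow> bool" where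
  "flat_at f x \<longleftrightarrow> (\<forall>k. (deriv ^^ k) f x = (deriv ^^ k) id x)"

lemma taylor_flat:
  assumes f: "smooth f" "\<And>m. m < k \<Longrightarrow> (deriv ^^ m) f x = (deriv ^^ m) id x" and k: "k > 0" and y: "y \<noteq> x"
  obtains t where "t \<noteq> x" "\<bar>t - x\<bar> < \<bar>y - x\<bar>"
    "f y - y = ((deriv ^^ k) f t - (deriv ^^ k) id t) / fact k * (y - x) ^ k"
proof -
  let ?h = "\<lambda>x. f x + (- 1) * id x"
  have sh: "smooth ?h" by (rule smooth_intros(4)[OF f(1) smooth_intros(5)[OF smooth_intros(1) smooth_intros(3)]])
  have D: "(deriv ^^ m) ?h t = (deriv ^^ m) f t - (deriv ^^ m) id t" for m t
    using smooth_funpow_add[OF f(1) smooth_intros(5)[OF smooth_intros(1) smooth_intros(3)], of m "-1"]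
      smooth_funpow_cmult[OF smooth_intros(3), of m "-1"] by simp
  have dd: "\<forall>m t. m < k \<and> min x y \<le> t \<and> t \<le> max x y \<longrightarrow> DERIV ((deriv ^^ m) ?h) t :> (deriv ^^ Suc m) ?h t"
  proof (intro allI impI)
    fix m t show "DERIV ((deriv ^^ m) ?h) t :> (deriv ^^ Suc m) ?h t"
      using smoothD(1)[OF smooth_funpow[OF sh, of m], of t] by (simp only: funpow.simps o_apply)
  qed
  have "\<exists>t. (if y < x then y < t \<and> t < x else x < t \<and> t < y) \<and>
    ?h y = (\<Sum>m<k. (deriv ^^ m) ?h x / fact m * (y - x) ^ m) + (deriv ^^ k) ?h t / fact k * (y - x) ^ k"
    by (rule Taylor[of k "\<lambda>m. (deriv ^^ m) ?h" ?h "min x y" "max x y" x y, OF k _ dd _ _ _ _ y])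
      (simp_all only: funpow.simps id_apply min.cobounded1 min.cobounded2 max.cobounded1 max.cobounded2)
  then obtain t where t: "if y < x then y < t \<and> t < x else x < t \<and> t < y"
    "?h y = (\<Sum>m<k. (deriv ^^ m) ?h x / fact m * (y - x) ^ m) + (deriv ^^ k) ?h t / fact k * (y - x) ^ k" by blast
  have s0: "(\<Sum>m<k. (deriv ^^ m) ?h x / fact m * (y - x) ^ m) = 0"
    by (rule sum.neutral, simp only: D) (use f(2) in auto)
  have "f y - y = ?h y" by simp
  also have "\<dots> = ((deriv ^^ k) f t - (deriv ^^ k) id t) / fact k * (y - x) ^ k"
    using t(2) unfolding s0 D[of k t] by (simp only: add_0)
  finally show ?thesis using t(1) by (intro that[of t]) (auto split: if_splits)
qed

text \<open>Let \<open>k\<close> be the least order at which the derivatives of \<open>f\<close> and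
  \<open>id\<close> differ at \<open>x\<close>. By Taylor's formula \<open>f y - y\<close> is
  \<open>(y - x) ^ k\<close> times a factor that does not vanish near \<open>x\<close>.\<close>

lemma fixed_point_isolated:
  assumes f: "smooth f" "\<not> flat_at f x" "f x = x"
  obtains d where "d > 0" "\<And>y. \<bar>y - x\<bar> < d \<Longrightarrow> f y = y \<Longrightarrow> y = x"
proof -
  define k where "k = (LEAST k. (deriv ^^ k) f x \<noteq> (deriv ^^ k) id x)"
  have k: "(deriv ^^ k) f x \<noteq> (deriv ^^ k) id x"
    unfolding k_def by (rule LeastI_ex) (use f(2) in \<open>auto simp: flat_at_def\<close>)
  have less: "(deriv ^^ m) f x = (deriv ^^ m) id x" if "m < k" for m
    using not_less_Least that unfolding k_def by blast
  have k0: "k > 0" using k f(3) by (cases k) auto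
  have "continuous_on UNIV (\<lambda>t. (deriv ^^ k) f t - (deriv ^^ k) id t)"
    by (intro continuous_on_diff smooth_cont smooth_funpow f(1) smooth_intros(3))
  then have "isCont (\<lambda>t. (deriv ^^ k) f t - (deriv ^^ k) id t) x" by (simp add: continuous_on_eq_continuous_at)
  from continuous_at_avoid[OF this, of 0] k obtain d where
    d: "d > 0" "\<And>t. dist x t < d \<Longrightarrow> (deriv ^^ k) f t - (deriv ^^ k) id t \<noteq> 0" by (auto; metis)
  show ?thesis
  proof (rule that[OF d(1)], rule ccontr)
    fix y assume y: "\<bar>y - x\<bar> < d" "f y = y" "y \<noteq> x"
    obtain t where t: "t \<noteq> x" "\<bar>t - x\<bar> < \<bar>y - x\<bar>"
      "f y - y = ((deriv ^^ k) f t - (deriv ^^ k) id t) / fact k * (y - x) ^ k"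
      using taylor_flat[OF f(1) less k0 y(3)] by blast
    have "dist x t < d" using t(2) y(1) by (simp add: dist_real_def abs_minus_commute)
    then show False using d(2)[of t] t(3) y by simp
  qed
qed

text \<open>If the holomorphic extension of \<open>f - id\<close> is not identically zero, its
  absolute value at distance \<open>\<epsilon>\<close> from the zero \<open>x\<close> is at least
  \<open>c * \<epsilon> ^ n\<close> for small \<open>\<epsilon>\<close>. Taylor's formula of order
  \<open>n + 1\<close> on the real line bounds it by \<open>C * \<epsilon> ^ Suc n\<close>, and the
  two bounds clash close to \<open>x\<close>.\<close>

lemma flat_locally_id:
  assumes f: "smooth f" "ana_at f x" "flat_at f x"
  obtains d where "d > 0" "\<And>y. \<bar>y - x\<bar> < d \<Longrightarrow> f y = y"
proof -
  obtain F S where F: "open S" "complex_of_real x \<in> S" "F holomorphic_on S"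
    "\<And>y. complex_of_real y \<in> S \<Longrightarrow> F (of_real y) = of_real (f y)" using f(2) unfolding ana_at_def by metis
  obtain e where e: "e > 0" "ball (of_real x) e \<subseteq> S" using F(1,2) openE by metis
  let ?B = "ball (complex_of_real x) e" and ?H = "\<lambda>z. F z - z"
  have fx: "f x = x" using f(3)[unfolded flat_at_def, rule_format, of 0] by simp
  have hx: "?H (of_real x) = 0" using F(4)[OF F(2)] fx by simp
  have "?H z = 0" if z: "z \<in> ?B" for z
  proof (rule ccontr)
    assume nz: "?H z \<noteq> 0"
    have hol: "?H holomorphic_on ?B" by (intro holomorphic_intros holomorphic_on_subset[OF F(3) e(2)])
    obtain c n \<rho> where c: "0 < c" "0 < \<rho>" "ball (of_real x) \<rho> \<subseteq> ?B"
        "\<And>w. w \<in> ball (of_real x) \<rho> \<Longrightarrow> c * norm (w - of_real x) ^ n \<le> norm (?H w - ?H (of_real x))"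
      by (rule holomorphic_lower_bound_difference[OF hol open_ball _ _ z, of "of_real x"])
        (use nz hx e in auto)
    define g where "g t = (deriv ^^ Suc n) f t - (deriv ^^ Suc n) id t" for t
    have "continuous_on {x-1..x+1} g"
      unfolding g_def by (intro continuous_on_diff smooth_cont smooth_funpow f(1) smooth_intros(3))
    then have "bounded (g ` {x-1..x+1})" by (intro compact_imp_bounded compact_continuous_image) auto
    then obtain C0 where C0: "\<forall>t\<in>{x-1..x+1}. \<bar>g t\<bar> \<le> C0" unfolding bounded_iff by auto
    define C where "C = max C0 1"
    have C: "C > 0" "\<And>t. t \<in> {x-1..x+1} \<Longrightarrow> \<bar>g t\<bar> \<le> C" using C0 by (force simp: C_def)+
    \<comment> \<open>Small enough for the ball of the lower bound, for the interval on which
      \<open>C\<close> bounds the derivative, and for \<open>C * \<epsilon> < c\<close>.\<close>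
    define \<epsilon> where "\<epsilon> = min (min (\<rho> / 2) 1) (c / (2 * C))"
    have \<epsilon>: "\<epsilon> > 0" "\<epsilon> < \<rho>" "\<epsilon> \<le> 1" "C * \<epsilon> < c"
    proof -
      show "\<epsilon> > 0" "\<epsilon> < \<rho>" "\<epsilon> \<le> 1" using c C by (auto simp: \<epsilon>_def)
      have "C * \<epsilon> \<le> C * (c / (2 * C))" using C by (intro mult_left_mono) (auto simp: \<epsilon>_def)
      also have "\<dots> < c" using C c by (simp add: field_simps)
      finally show "C * \<epsilon> < c" .
    qed
    define y where "y = x + \<epsilon>"
    have yb: "complex_of_real y \<in> ball (of_real x) \<rho>" unfolding mem_ball dist_of_real using \<epsilon> by (simp add: y_def dist_real_def)
    have "y \<noteq> x" using \<epsilon> by (simp add: y_def)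
    have fl: "(deriv ^^ m) f x = (deriv ^^ m) id x" for m using f(3) by (simp only: flat_at_def)
    obtain t where t: "\<bar>t - x\<bar> < \<bar>y - x\<bar>" "f y - y = g t / fact (Suc n) * (y - x) ^ Suc n"
      unfolding g_def by (rule taylor_flat[OF f(1) fl zero_less_Suc[of n] \<open>y \<noteq> x\<close>])
    have "complex_of_real y \<in> S" using yb c(3) e(2) by blast
    then have "?H (of_real y) - ?H (of_real x) = of_real (f y - y)" using F(4)[of y] hx by simp
    then have "norm (?H (of_real y) - ?H (of_real x)) = \<bar>f y - y\<bar>" by (simp only: norm_of_real)
    moreover have "norm (complex_of_real y - of_real x) = \<epsilon>"
      using \<epsilon>(1) by (simp add: y_def)
    ultimately have "c * \<epsilon> ^ n \<le> \<bar>f y - y\<bar>" using c(4)[OF yb] by metis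
    also have "\<dots> = \<bar>g t\<bar> / fact (Suc n) * \<epsilon> ^ Suc n"
      using \<epsilon>(1) t(2) by (simp add: y_def abs_mult power_abs del: fact_Suc power_Suc)
    also have "\<dots> \<le> C * \<epsilon> ^ Suc n"
    proof (rule mult_right_mono)
      have "\<bar>g t\<bar> \<le> C" using C(2)[of t] t(1) \<epsilon> by (simp add: y_def abs_le_iff abs_less_iff)
      moreover have "\<bar>g t\<bar> / fact (Suc n) \<le> \<bar>g t\<bar> / 1" by (rule divide_left_mono) (auto simp del: fact_Suc)
      ultimately show "\<bar>g t\<bar> / fact (Suc n) \<le> C" by linarith
    qed (use \<epsilon> in auto)
    also have "\<dots> = (C * \<epsilon>) * \<epsilon> ^ n" by simp
    also have "\<dots> < c * \<epsilon> ^ n" by (rule mult_strict_right_mono[OF \<epsilon>(4)]) (use \<epsilon> in simp)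
    finally show False by simp
  qed
  then have H: "F z = z" if "z \<in> ?B" for z using that by simp
  show ?thesis
  proof (rule that[OF e(1)])
    fix y assume "\<bar>y - x\<bar> < e"
    then have "complex_of_real y \<in> ?B" by (simp add: dist_of_real dist_real_def abs_minus_commute)
    then show "f y = y" using H F(4)[of y] e(2) by (metis of_real_eq_iff subsetD)
  qed
qed

text \<open>The flat points form an open set by the local statement and a relatively closed one by
  continuity of all derivatives, and the interval is connected.\<close>

lemma analytic_flat_imp_id:
  assumes f: "smooth f" "\<And>x. x \<in> {l<..<r} \<Longrightarrow> ana_at f x" and x: "x \<in> {l<..<r}" "flat_at f x" "y \<in> {l<..<r}"
  shows "f y = y"
proof -
  define Z where "Z = {x \<in> {l<..<r}. flat_at f x}"
  have "open Z"
    unfolding open_dist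
  proof
    fix z assume z: "z \<in> Z"
    obtain d where d: "d > 0" "\<And>y. \<bar>y - z\<bar> < d \<Longrightarrow> f y = y"
      using flat_locally_id[of f z] z f by (auto simp: Z_def)
    have fl: "flat_at f w" if w: "dist w z < d" for w
      unfolding flat_at_def
      by (intro allI deriv_local[of "ball z d"]) (use w d in \<open>auto simp: dist_real_def abs_minus_commute\<close>)
    obtain e where e: "e > 0" "ball z e \<subseteq> {l<..<r}" using z openE[of "{l<..<r}" z] by (auto simp: Z_def)
    have "w \<in> Z" if "dist w z < min d e" for w
      using fl[of w] e(2) that unfolding Z_def by (auto simp: dist_commute subset_iff)
    then show "\<exists>e>0. \<forall>y. dist y z < e \<longrightarrow> y \<in> Z" using d(1) e(1) by (intro exI[of _ "min d e"]) auto
  qed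
  moreover have "closedin (top_of_set {l<..<r}) Z"
  proof -
    have "closed {x. (deriv ^^ k) f x = (deriv ^^ k) id x}" for k
      by (intro closed_Collect_eq smooth_cont smooth_funpow f(1) smooth_intros(3))
    then have "closed (\<Inter>k. {x. (deriv ^^ k) f x = (deriv ^^ k) id x})" by blast
    moreover have "Z = {l<..<r} \<inter> (\<Inter>k. {x. (deriv ^^ k) f x = (deriv ^^ k) id x})"
      unfolding Z_def flat_at_def by blast
    ultimately show ?thesis by (simp only: closedin_closed_Int)
  qed
  moreover have "openin (top_of_set {l<..<r}) Z" by (rule open_subset[OF _ \<open>open Z\<close>]) (auto simp: Z_def)
  moreover have "Z \<noteq> {}" using x by (auto simp: Z_def)
  ultimately have "Z = {l<..<r}" using connected_clopen[THEN iffD1, OF connected_Ioo[of l r], rule_format, of Z] by blast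
  then have "y \<in> Z" using x(3) by simp
  then have "flat_at f y" unfolding Z_def by simp
  from this[unfolded flat_at_def, rule_format, of 0] show ?thesis by simp
qed

text \<open>A point of \<open>S\<close> is determined by any interval with rational end points that
  isolates it.\<close>

lemma countable_isolated:
  fixes S :: "real set"
  assumes "\<And>x. x \<in> S \<Longrightarrow> \<exists>d>0. \<forall>y\<in>S. \<bar>y - x\<bar> < d \<longrightarrow> y = x"
  shows "countable S"
proof -
  have "\<exists>q\<in>\<rat>\<times>\<rat>. {x} = S \<inter> {fst q<..<snd q}" if x: "x \<in> S" for x
  proof -
    obtain d where d: "d > 0" "\<forall>y\<in>S. \<bar>y - x\<bar> < d \<longrightarrow> y = x" using assms[OF x] by blast
    obtain p where p: "p \<in> \<rat>" "x - d < p" "p < x" using Rats_dense_in_real[of "x - d" x] d(1) by auto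
    obtain q where q: "q \<in> \<rat>" "x < q" "q < x + d" using Rats_dense_in_real[of x "x + d"] d(1) by auto
    have "y = x" if "y \<in> S" "p < y" "y < q" for y
    proof -
      have "\<bar>y - x\<bar> < d" using that p(2) q(3) by (simp add: abs_less_iff)
      then show ?thesis using d(2) that(1) by blast
    qed
    then have "S \<inter> {p<..<q} \<subseteq> {x}" unfolding subset_iff Int_iff greaterThanLessThan_iff by blast
    moreover have "{x} \<subseteq> S \<inter> {p<..<q}" using x p(3) q(2) by simp
    ultimately have "{x} = S \<inter> {fst (p,q)<..<snd (p,q)}" by (simp add: subset_antisym)
    then show ?thesis using p(1) q(1) by (rule bexI[OF _ SigmaI])
  qed
  then have "(\<lambda>x. {x}) ` S \<subseteq> (\<lambda>q. S \<inter> {fst q<..<snd q}) ` (\<rat>\<times>\<rat>)"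
    using image_iff by fast
  then have "countable ((\<lambda>x. {x}) ` S)" by (rule countable_subset) (auto simp: countable_rat)
  then show ?thesis by (rule countable_image_inj_on) auto
qed

subsection \<open>Diffeomorphisms supported on a block\<close>

locale block =
  fixes l r :: real
  assumes l: "0 < l" and lr: "l < r" and r: "r < 1"
begin

text \<open>Analyticity is confined to the open block: at \<open>l\<close> and \<open>r\<close> the
  map continues smoothly into the identity, which no nontrivial analytic map could do. Asking it of
  the inverse too makes closure under inversion immediate.\<close>

definition D :: "(real \<Rightarrow> real) set" where
  "D = {f \<in> carrier Diff01. (\<forall>x. x \<notin> {l<..<r} \<longrightarrow> f x = x) \<and>
     (\<forall>x\<in>{l<..<r}. ana_at f x \<and> ana_at (finv f) x)}"

lemma D_Diff01: "f \<in> D \<Longrightarrow> f \<in> carrier Diff01"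
  by (simp add: D_def)

lemma D_off: "f \<in> D \<Longrightarrow> x \<notin> {l<..<r} \<Longrightarrow> f x = x"
  by (simp add: D_def)

lemma D_bij: "f \<in> D \<Longrightarrow> bij f"
  by (rule Diff01D(1)[OF D_Diff01])

lemmas D_simps [simp] = Diff01_finv_simps[OF D_Diff01]

lemma D_mem: assumes "f \<in> D" shows "f x \<in> {l<..<r} \<longleftrightarrow> x \<in> {l<..<r}"
proof
  show "x \<in> {l<..<r}" if "f x \<in> {l<..<r}" using D_off[OF assms, of x] that by metis
  show "f x \<in> {l<..<r}" if "x \<in> {l<..<r}"
    using D_off[OF assms, of "f x"] that bij_is_inj[OF D_bij[OF assms]] by (metis injD)
qed

lemma D_mem_co: "f \<in> D \<Longrightarrow> f x \<in> {l..<r} \<longleftrightarrow> x \<in> {l..<r}"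
  using D_mem[of f x] D_off[of f x] lr by (cases "x \<in> {l<..<r}") auto

lemma D_id: "id \<in> D"
  by (simp add: D_def Diff01_id ana_at_id)

lemma D_finv: assumes "f \<in> D" shows "finv f \<in> D"
proof -
  have "finv f x = x" if "x \<notin> {l<..<r}" for x
    using D_off[OF assms that] D_simps(2)[OF assms, of x] by simp
  moreover have "finv (finv f) = f" by (rule inv_inv_eq[OF D_bij[OF assms]])
  ultimately show ?thesis using assms Diff01_finv by (simp add: D_def)
qed

lemma D_comp: assumes f: "f \<in> D" and g: "g \<in> D" shows "f \<circ> g \<in> D"
proof -
  have e: "finv (f \<circ> g) = finv g \<circ> finv f" using D_bij[OF f] D_bij[OF g] by (simp add: o_inv_distrib)
  have "ana_at (f \<circ> g) x" if "x \<in> {l<..<r}" for x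
    by (rule ana_at_compose) (use f g that D_mem[OF g, of x] in \<open>auto simp: D_def\<close>)
  moreover have "ana_at (finv g \<circ> finv f) x" if "x \<in> {l<..<r}" for x
    by (rule ana_at_compose) (use f g that D_mem[OF D_finv[OF f], of x] in \<open>auto simp: D_def\<close>)
  moreover have "(f \<circ> g) x = x" if "x \<notin> {l<..<r}" for x
    using D_off[OF f that] D_off[OF g that] by simp
  ultimately show ?thesis using Diff01_comp[OF D_Diff01[OF f] D_Diff01[OF g]] by (simp add: D_def e)
qed

subsection \<open>Small perturbations\<close>

definition adm :: "(real \<Rightarrow> real) \<Rightarrow> bool" where
  "adm \<phi> \<longleftrightarrow> smooth \<phi> \<and> (\<forall>x. x \<notin> {l<..<r} \<longrightarrow> \<phi> x = 0) \<and> (\<forall>x\<in>{l<..<r}. ana_at \<phi> x)"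

definition tiny :: "nat \<Rightarrow> real \<Rightarrow> (real \<Rightarrow> real) \<Rightarrow> bool" where
  "tiny K \<eta> \<phi> \<longleftrightarrow> (\<forall>k\<le>K. \<forall>x. \<bar>(deriv ^^ k) \<phi> x\<bar> \<le> \<eta>)"

definition pm :: "(real \<Rightarrow> real) \<Rightarrow> real \<Rightarrow> real" where
  "pm \<phi> x = x + \<phi> x"

lemma ana_at_add: "ana_at f x \<Longrightarrow> ana_at g x \<Longrightarrow> ana_at (\<lambda>x. f x + g x) x"
  and ana_at_mult: "ana_at f x \<Longrightarrow> ana_at g x \<Longrightarrow> ana_at (\<lambda>x. f x * g x) x"
proof -
  assume f: "ana_at f x" and g: "ana_at g x"
  obtain F S where F: "open S" "complex_of_real x \<in> S" "F holomorphic_on S"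
    "\<And>y. complex_of_real y \<in> S \<Longrightarrow> F (of_real y) = of_real (f y)" using f unfolding ana_at_def by metis
  obtain G T where G: "open T" "complex_of_real x \<in> T" "G holomorphic_on T"
    "\<And>y. complex_of_real y \<in> T \<Longrightarrow> G (of_real y) = of_real (g y)" using g unfolding ana_at_def by metis
  have h: "F holomorphic_on S \<inter> T" "G holomorphic_on S \<inter> T"
    using F(3) G(3) by (auto intro: holomorphic_on_subset)
  have "open (S \<inter> T)" "complex_of_real x \<in> S \<inter> T" using F G by auto
  then show "ana_at (\<lambda>x. f x + g x) x" "ana_at (\<lambda>x. f x * g x) x"
    unfolding ana_at_def using F(4) G(4) holomorphic_on_add[OF h] holomorphic_on_mult[OF h]
    by (intro exI[of _ "\<lambda>z. F z + G z"] exI[of _ "S \<inter> T"], auto)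
      (intro exI[of _ "\<lambda>z. F z * G z"] exI[of _ "S \<inter> T"], auto)
qed

lemma ana_at_const: "ana_at (\<lambda>x. c) x"
  unfolding ana_at_def by (rule exI[of _ "\<lambda>x. of_real c"], rule exI[of _ UNIV]) auto

lemma ana_at_linear: "ana_at (\<lambda>x. x - u) x"
  unfolding ana_at_def by (rule exI[of _ "\<lambda>x. x - of_real u"], rule exI[of _ UNIV]) (auto intro!: holomorphic_intros)

lemma ana_at_bump: assumes x: "x \<in> {l<..<r}" shows "ana_at (bump l r) x"
proof -
  let ?S = "{z. l < Re z} \<inter> {z. Re z < r}"
  let ?F = "\<lambda>z. exp (- 1 / (z - complex_of_real l)) * exp (- 1 / (complex_of_real r - z))"
  have "open ?S" by (intro open_Int open_halfspace_Re_gt open_halfspace_Re_lt)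
  moreover have "?F holomorphic_on ?S" by (intro holomorphic_intros) auto
  moreover have "?F (of_real y) = of_real (bump l r y)" if "complex_of_real y \<in> ?S" for y
    using that by (simp add: bump_def flat_def exp_of_real[symmetric])
  ultimately show ?thesis using x unfolding ana_at_def by (intro exI[of _ ?F] exI[of _ ?S]) auto
qed

text \<open>An analytic perturbation cannot have smaller support inside the block. The polynomial
  factor serves instead: adding a multiple of \<open>ker_fun U\<close> keeps all values at the
  finite set \<open>U\<close> and changes the value at every other point of the block.\<close>

definition ker_fun :: "real set \<Rightarrow> real \<Rightarrow> real" where
  "ker_fun U x = bump l r x * (\<Prod>u\<in>U. x - u)"

lemma adm_ker_fun: assumes "finite U" shows "adm (ker_fun U)"
proof -
  have 1: "smooth (\<lambda>x. \<Prod>u\<in>U. x - u)"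
    using assms by (induction U) (simp_all add: smooth_intros smooth_diff)
  have 2: "ana_at (\<lambda>x. \<Prod>u\<in>U. x - u) x" for x
    using assms by (induction U) (simp_all add: ana_at_const ana_at_mult[OF ana_at_linear])
  have "smooth (ker_fun U)"
    unfolding ker_fun_def[abs_def] by (rule smooth_intros(5)[OF smooth_bump 1])
  moreover have "ana_at (ker_fun U) x" if "x \<in> {l<..<r}" for x
    unfolding ker_fun_def[abs_def] by (rule ana_at_mult[OF ana_at_bump[OF that] 2])
  ultimately show ?thesis by (simp add: adm_def ker_fun_def bump_zero)
qed

lemma ker_fun_zero_iff: "finite U \<Longrightarrow> x \<in> {l<..<r} \<Longrightarrow> ker_fun U x = 0 \<longleftrightarrow> x \<in> U"
  using bump_pos[of l x r] by (auto simp: ker_fun_def prod_zero_iff)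

lemma adm_zero: "adm (\<lambda>x. 0)"
  by (simp add: adm_def smooth_intros ana_at_const)

lemma adm_add_cmult: "adm \<phi> \<Longrightarrow> adm \<psi> \<Longrightarrow> adm (\<lambda>x. \<phi> x + c * \<psi> x)"
  unfolding adm_def
  using smooth_intros(4)[of \<phi> "\<lambda>x. c * \<psi> x"] smooth_intros(5)[OF smooth_intros(1)[of c], of \<psi>]
    ana_at_add[of \<phi> _ "\<lambda>x. c * \<psi> x"] ana_at_mult[OF ana_at_const, where g = \<psi>] by simp

lemma adm_smooth: "adm \<phi> \<Longrightarrow> smooth \<phi>"
  by (simp add: adm_def)

lemma adm_bsm: "adm \<phi> \<Longrightarrow> bsm \<phi>"
  using bsm_support[of \<phi> l r] by (simp add: adm_def)

lemma tiny_zero: "\<eta> \<ge> 0 \<Longrightarrow> tiny K \<eta> (\<lambda>x. 0)"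
  by (simp add: tiny_def funpow_deriv_const)

lemma tiny_add_small:
  assumes "adm \<phi>" "adm \<psi>" "tiny K \<eta> \<phi>" "\<eta> < \<eta>'"
  obtains d where "d > 0" "\<And>c. \<bar>c\<bar> < d \<Longrightarrow> tiny K \<eta>' (\<lambda>x. \<phi> x + c * \<psi> x)"
proof -
  have "\<exists>C>0. \<forall>k\<le>K. \<forall>x. \<bar>(deriv ^^ k) \<psi> x\<bar> \<le> C"
  proof (induction K)
    case 0
    have "bounded (range ((deriv ^^ 0) \<psi>))" using adm_bsm[OF assms(2)] unfolding bsm_def by blast
    then obtain C where "\<And>x. \<bar>\<psi> x\<bar> \<le> C" by (auto simp: bounded_iff)
    then show ?case by (intro exI[of _ "max C 1"]) (force simp: le_max_iff_disj)
  next
    case (Suc K)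
    then obtain C where C: "C > 0" "\<forall>k\<le>K. \<forall>x. \<bar>(deriv ^^ k) \<psi> x\<bar> \<le> C" by blast
    have "bounded (range ((deriv ^^ Suc K) \<psi>))" using adm_bsm[OF assms(2)] unfolding bsm_def by blast
    then obtain C' where C': "\<forall>x. \<bar>(deriv ^^ Suc K) \<psi> x\<bar> \<le> C'" unfolding bounded_iff by auto
    show ?case
      by (intro exI[of _ "max C C'"] conjI allI impI)
        (use C C' in \<open>auto simp: le_Suc_eq le_max_iff_disj simp del: funpow.simps\<close>)
  qed
  then obtain C where C: "C > 0" "\<And>k x. k \<le> K \<Longrightarrow> \<bar>(deriv ^^ k) \<psi> x\<bar> \<le> C" by blast
  show ?thesis
  proof (rule that[of "(\<eta>' - \<eta>) / C"])
    show "(\<eta>' - \<eta>) / C > 0" using C assms by simp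
    fix c assume c: "\<bar>c\<bar> < (\<eta>' - \<eta>) / C"
    have e: "(deriv ^^ k) (\<lambda>x. \<phi> x + c * \<psi> x) x = (deriv ^^ k) \<phi> x + c * (deriv ^^ k) \<psi> x" for k x
      using smooth_funpow_add[of \<phi> "\<lambda>x. c * \<psi> x" k] smooth_funpow_cmult[of \<psi> k c] assms(1,2)
        smooth_intros(5)[OF smooth_intros(1)[of c], of \<psi>] by (simp add: adm_smooth)
    have "\<bar>(deriv ^^ k) (\<lambda>x. \<phi> x + c * \<psi> x) x\<bar> \<le> \<eta>'" if "k \<le> K" for k x
    proof -
      have "\<bar>c * (deriv ^^ k) \<psi> x\<bar> \<le> (\<eta>' - \<eta>) / C * C"
        unfolding abs_mult by (rule mult_mono) (use c C that assms in \<open>auto simp: less_imp_le\<close>)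
      moreover have "\<bar>(deriv ^^ k) \<phi> x\<bar> \<le> \<eta>" using assms(3) that by (simp add: tiny_def)
      ultimately show ?thesis unfolding e using C(1) by (simp add: abs_le_iff)
    qed
    then show "tiny K \<eta>' (\<lambda>x. \<phi> x + c * \<psi> x)" by (simp add: tiny_def)
  qed
qed

text \<open>Because of \<open>K \<ge> 1\<close>, smallness includes the first derivative, which
  keeps \<open>deriv (pm \<phi>)\<close> at least \<open>1 / 2\<close>. So \<open>pm \<phi>\<close>
  is a diffeomorphism, and its inverse is analytic inside the block.\<close>

lemma pm_D:
  assumes \<phi>: "adm \<phi>" "tiny K \<eta> \<phi>" "K \<ge> 1" "\<eta> \<le> 1 / 2"
  shows "pm \<phi> \<in> D" "deriv (pm \<phi>) x \<ge> 1 / 2"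
proof -
  have d: "deriv (pm \<phi>) x = 1 + deriv \<phi> x" for x
    unfolding pm_def[abs_def]
    by (rule DERIV_imp_deriv) (auto intro!: derivative_eq_intros smoothD(1)[OF adm_smooth[OF \<phi>(1)]])
  have "\<bar>(deriv ^^ 1) \<phi> x\<bar> \<le> \<eta>" for x using \<phi>(2,3) unfolding tiny_def by blast
  then have b: "\<bar>deriv \<phi> x\<bar> \<le> \<eta>" for x by simp
  have h: "deriv (pm \<phi>) x \<ge> 1 / 2" for x unfolding d using b[of x] \<phi>(4) by linarith
  then show "deriv (pm \<phi>) x \<ge> 1 / 2" .
  have z: "\<phi> x = 0" if "x \<notin> {l<..<r}" for x using \<phi>(1) that by (simp add: adm_def)
  have m: "pm \<phi> \<in> carrier Diff01"
  proof (rule Diff01I)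
    show "smooth (pm \<phi>)" unfolding pm_def[abs_def] by (rule smooth_intros(4)[OF smooth_intros(2) adm_smooth[OF \<phi>(1)]])
    show "deriv (pm \<phi>) x > 0" for x using h[of x] by linarith
    fix x :: real assume "x \<notin> {0<..<1}"
    then have "x \<notin> {l<..<r}" using l r by auto
    then show "pm \<phi> x = x" using z[of x] by (simp add: pm_def)
  qed
  have a: "ana_at (pm \<phi>) x" if "x \<in> {l<..<r}" for x
    using ana_at_add[OF ana_at_id[of x], where g = \<phi>] \<phi>(1) that by (simp add: pm_def[abs_def] adm_def)
  have "ana_at (finv (pm \<phi>)) y" if y: "y \<in> {l<..<r}" for y
  proof -
    have "finv (pm \<phi>) y \<in> {l<..<r}"
    proof (rule ccontr)
      assume n: "finv (pm \<phi>) y \<notin> {l<..<r}"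
      then have "finv (pm \<phi>) y = y" using z[OF n] Diff01_finv_simps(1)[OF m, of y] by (simp add: pm_def)
      then show False using n y by simp
    qed
    moreover have "deriv (pm \<phi>) (finv (pm \<phi>) y) \<noteq> 0" using h[of "finv (pm \<phi>) y"] by linarith
    ultimately show ?thesis
      using ana_at_finv[OF m a] Diff01_finv_simps(1)[OF m, of y] by fastforce
  qed
  then show "pm \<phi> \<in> D" using m a z by (simp add: D_def pm_def)
qed

subsection \<open>Moving a point along a reduced path\<close>

definition mv :: "('k \<Rightarrow> real \<Rightarrow> real) \<Rightarrow> 'k \<Rightarrow> bool \<Rightarrow> real \<Rightarrow> real" where
  "mv \<Phi> \<kappa> s = (if s then pm (\<Phi> \<kappa>) else finv (pm (\<Phi> \<kappa>)))"

text \<open>A step \<open>(g, \<kappa>, s, g')\<close> places one use of the perturbation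
  \<open>\<kappa>\<close>, or of its inverse if \<open>s\<close> is false, between two fixed maps.
  Only the perturbations are left to be chosen.\<close>

definition run :: "('k \<Rightarrow> real \<Rightarrow> real) \<Rightarrow> ((real \<Rightarrow> real) \<times> 'k \<times> bool \<times> (real \<Rightarrow> real)) list \<Rightarrow> real \<Rightarrow> real" where
  "run \<Phi> sts x = foldl (\<lambda>x (g, \<kappa>, s, g'). g' (mv \<Phi> \<kappa> s (g x))) x sts"

lemma run_simps: "run \<Phi> [] x = x" "run \<Phi> ((g, \<kappa>, s, g') # sts) x = run \<Phi> sts (g' (mv \<Phi> \<kappa> s (g x)))"
  "run \<Phi> (sts @ sts') x = run \<Phi> sts' (run \<Phi> sts x)"
  by (simp_all add: run_def)

abbreviation "key st \<equiv> fst (snd st)"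

text \<open>Varying \<open>c\<close> moves the image of \<open>v\<close> through infinitely many
  points, so a finite set can be avoided. For the map itself the image is affine and not constant in
  \<open>c\<close>. For the inverse the order is reversed: a new preimage \<open>w\<close> close to
  the old one is chosen first, and \<open>c\<close> is solved for; it depends continuously on
  \<open>w\<close> and vanishes at the old preimage.\<close>

lemma choose_target:
  assumes \<phi>: "adm \<phi>" "tiny K \<eta> \<phi>" "K \<ge> 1" "\<eta> \<le> 1 / 2" and d: "d > 0"
    and U: "finite U" and v: "v \<in> {l<..<r}" "v \<notin> U" "v \<notin> pm \<phi> ` U" and F: "finite F"
  shows "\<exists>c w. \<bar>c\<bar> < d \<and> w \<notin> F \<and>
    (if s then w = v + (\<phi> v + c * ker_fun U v) else w \<in> {l<..<r} \<and> v = w + (\<phi> w + c * ker_fun U w))"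
proof (cases s)
  case True
  have nz: "ker_fun U v \<noteq> 0" using ker_fun_zero_iff[OF U v(1)] v(2) by blast
  let ?f = "\<lambda>c. v + (\<phi> v + c * ker_fun U v)"
  have "finite (?f -` F)" by (rule finite_vimageI[OF F]) (use nz in \<open>auto intro: injI\<close>)
  moreover have "infinite {0<..<d}" using d by simp
  ultimately have "\<not> {0<..<d} \<subseteq> ?f -` F" using finite_subset by blast
  then obtain c where "c \<in> {0<..<d}" "c \<notin> ?f -` F" by blast
  then show ?thesis using True by (intro exI[of _ c] exI[of _ "?f c"]) auto
next
  case False
  have N: "pm \<phi> \<in> D" by (rule pm_D(1)[OF \<phi>])
  define w where "w = finv (pm \<phi>) v"
  have w: "w \<in> {l<..<r}" "pm \<phi> w = v" using v(1) D_mem[OF D_finv[OF N], of v] N by (simp_all add: w_def)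
  then have "w \<notin> U" using v(3) by blast
  then have nz: "ker_fun U w \<noteq> 0" using ker_fun_zero_iff[OF U w(1)] by blast
  define q where "q u = (v - u - \<phi> u) / ker_fun U u" for u
  have cont: "isCont (ker_fun U) w" "isCont \<phi> w"
    using smooth_cont[OF adm_smooth[OF adm_ker_fun[OF U]], of UNIV] smooth_cont[OF adm_smooth[OF \<phi>(1)], of UNIV]
    by (simp_all add: continuous_on_eq_continuous_at)
  then have "isCont q w" unfolding q_def by (intro continuous_intros nz)
  moreover have q0: "q w = 0" using w(2) by (simp add: q_def pm_def)
  ultimately have "(q \<longlongrightarrow> 0) (nhds w)" by (simp add: continuous_at tendsto_nhds_iff)
  then have "\<forall>\<^sub>F u in nhds w. dist (q u) 0 < d" using d by (rule tendstoD)
  moreover have "\<forall>\<^sub>F u in nhds w. ker_fun U u \<noteq> 0"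
    by (rule tendsto_imp_eventually_ne[OF _ nz]) (use cont(1) in \<open>simp add: continuous_at tendsto_nhds_iff\<close>)
  moreover have "\<forall>\<^sub>F u in nhds w. u \<in> {l<..<r}" by (rule eventually_nhds_in_open) (use w in auto)
  ultimately have "\<forall>\<^sub>F u in nhds w. dist (q u) 0 < d \<and> ker_fun U u \<noteq> 0 \<and> u \<in> {l<..<r}"
    by eventually_elim blast
  then obtain e where e: "e > 0" "\<And>u. dist u w < e \<Longrightarrow> dist (q u) 0 < d \<and> ker_fun U u \<noteq> 0 \<and> u \<in> {l<..<r}"
    unfolding eventually_nhds_metric by blast
  have "infinite {w<..<w+e}" using e(1) by simp
  then have "\<not> {w<..<w+e} \<subseteq> F" using F finite_subset by blast
  then obtain u where "u \<in> {w<..<w+e}" and u: "u \<notin> F" by blast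
  then have u: "w < u" "u < w + e" "u \<notin> F" by auto
  then have "dist u w < e" by (simp add: dist_real_def)
  from e(2)[OF this] show ?thesis
    using False u(3) by (intro exI[of _ "q u"] exI[of _ u]) (simp add: q_def)
qed

text \<open>Each step of the path can be moved without disturbing the earlier ones, because the point it acts on is
  fresh: the perturbation is taken to vanish at the points \<open>U\<close> where the same map has been used before.\<close>

lemma path_perturb:
  assumes x0: "x0 \<in> {l<..<r}" and K: "K \<ge> 1"
  shows "\<lbrakk>\<forall>st\<in>set sts. fst st \<in> D \<and> snd (snd (snd st)) \<in> D; successively (\<lambda>s t. key s \<noteq> key t) sts;
     h \<in> D; 0 < \<eta>; \<eta> \<le> 1 / 2; finite B\<rbrakk>
    \<Longrightarrow> \<exists>\<Phi> U y. (\<forall>\<kappa>. adm (\<Phi> \<kappa>) \<and> tiny K \<eta> (\<Phi> \<kappa>)) \<and> finite U \<and> y \<in> {l<..<r} \<and> (sts \<noteq> [] \<longrightarrow> y \<notin> B) \<and>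
      (\<forall>\<kappa> u. (\<kappa>, u) \<in> U \<and> (sts \<noteq> [] \<longrightarrow> \<kappa> \<noteq> key (last sts)) \<longrightarrow> h y \<noteq> u \<and> h y \<noteq> pm (\<Phi> \<kappa>) u) \<and>
      (\<forall>\<Psi>. (\<forall>\<kappa>. pm (\<Psi> \<kappa>) \<in> D) \<and> (\<forall>\<kappa> u. (\<kappa>, u) \<in> U \<longrightarrow> \<Psi> \<kappa> u = \<Phi> \<kappa> u) \<longrightarrow> run \<Psi> sts x0 = y)"
proof (induction sts arbitrary: h \<eta> B rule: rev_induct)
  case Nil
  then show ?case
    by (intro exI[of _ "\<lambda>_ _. 0"] exI[of _ "{}"] exI[of _ x0]) (use x0 in \<open>auto simp: adm_zero tiny_zero run_simps\<close>)
next
  case (snoc st sts)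
  obtain g \<kappa> s g' where st: "st = (g, \<kappa>, s, g')" by (cases st) auto
  have gD: "g \<in> D" "g' \<in> D" using snoc.prems(1) st by auto
  have su: "successively (\<lambda>s t. key s \<noteq> key t) sts" and ne: "sts \<noteq> [] \<Longrightarrow> key (last sts) \<noteq> \<kappa>"
    using snoc.prems(2) by (auto simp: successively_append_iff st)
  have half: "0 < \<eta> / 2" "\<eta> / 2 \<le> 1 / 2" using snoc.prems(4,5) by auto
  have sD: "\<forall>st\<in>set sts. fst st \<in> D \<and> snd (snd (snd st)) \<in> D"
    using snoc.prems(1) by simp
  from snoc.IH[OF sD su gD(1) half finite.emptyI] obtain \<Phi> U y where
    \<Phi>': "\<forall>\<kappa>. adm (\<Phi> \<kappa>) \<and> tiny K (\<eta> / 2) (\<Phi> \<kappa>)" and U: "finite U" and y: "y \<in> {l<..<r}"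
    and "sts \<noteq> [] \<longrightarrow> y \<notin> {}"
    and off': "\<forall>\<kappa> u. (\<kappa>, u) \<in> U \<and> (sts \<noteq> [] \<longrightarrow> \<kappa> \<noteq> key (last sts)) \<longrightarrow> g y \<noteq> u \<and> g y \<noteq> pm (\<Phi> \<kappa>) u"
    and stable: "\<forall>\<Psi>. (\<forall>\<kappa>. pm (\<Psi> \<kappa>) \<in> D) \<and> (\<forall>\<kappa> u. (\<kappa>, u) \<in> U \<longrightarrow> \<Psi> \<kappa> u = \<Phi> \<kappa> u) \<longrightarrow> run \<Psi> sts x0 = y"
    by - (elim exE conjE, rule that, assumption+)
  note off = off'[rule_format, OF conjI, OF _ impI]
  have \<Phi>: "adm (\<Phi> \<kappa>)" "tiny K (\<eta> / 2) (\<Phi> \<kappa>)" for \<kappa> using \<Phi>' by simp_all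
  define v where "v = g y"
  define U\<kappa> where "U\<kappa> = {u. (\<kappa>, u) \<in> U}"
  have U\<kappa>: "finite U\<kappa>"
    by (rule finite_subset[of _ "snd ` U"]) (use U in \<open>force simp: U\<kappa>_def\<close>)+
  have v: "v \<in> {l<..<r}" "v \<notin> U\<kappa>" "v \<notin> pm (\<Phi> \<kappa>) ` U\<kappa>"
    using y D_mem[OF gD(1)] off[of \<kappa>] ne by (auto simp: v_def U\<kappa>_def)
  have "\<eta> / 2 < \<eta>" using snoc.prems(4) by simp
  from tiny_add_small[OF \<Phi>(1) adm_ker_fun[OF U\<kappa>] \<Phi>(2) this, of \<kappa>] obtain d where
    d: "d > 0" "\<And>c. \<bar>c\<bar> < d \<Longrightarrow> tiny K \<eta> (\<lambda>x. \<Phi> \<kappa> x + c * ker_fun U\<kappa> x)" by blast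
  \<comment> \<open>The end point has to avoid \<open>B\<close>, and \<open>h\<close> must take it
    neither to an argument at which some perturbation is already pinned down nor to the value
    there.\<close>
  define Bad where "Bad = B \<union> (finv h) ` (snd ` U \<union> (\<lambda>(\<kappa>, u). pm (\<Phi> \<kappa>) u) ` U)"
  define F where "F = finv g' ` Bad"
  have F: "finite F" unfolding F_def Bad_def using snoc.prems(6) U by simp
  obtain c w where c: "\<bar>c\<bar> < d" and w: "w \<notin> F" and
    cw: "if s then w = v + (\<Phi> \<kappa> v + c * ker_fun U\<kappa> v) else w \<in> {l<..<r} \<and> v = w + (\<Phi> \<kappa> w + c * ker_fun U\<kappa> w)"
    using choose_target[OF \<Phi>(1) \<Phi>(2) K half(2) d(1) U\<kappa> v F, of s] by blast
  define \<Phi>' where "\<Phi>' = \<Phi>(\<kappa> := \<lambda>x. \<Phi> \<kappa> x + c * ker_fun U\<kappa> x)"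
  \<comment> \<open>The argument at which the map for \<open>\<kappa>\<close> itself is evaluated in
    this step: the start \<open>v\<close> if it is used forwards, the end \<open>w\<close> if its
    inverse is used.\<close>
  define p where "p = (if s then v else w)"
  define U' where "U' = insert (\<kappa>, p) U"
  have \<Phi>': "adm (\<Phi>' k)" "tiny K \<eta> (\<Phi>' k)" for k
  proof -
    show "adm (\<Phi>' k)" using \<Phi>(1) adm_add_cmult[OF \<Phi>(1) adm_ker_fun[OF U\<kappa>]] by (simp add: \<Phi>'_def)
    have "tiny K \<eta> (\<Phi> k)" using \<Phi>(2)[of k] \<open>\<eta> / 2 < \<eta>\<close> unfolding tiny_def by (meson less_imp_le order_trans)
    then show "tiny K \<eta> (\<Phi>' k)" using d(2)[OF c] by (simp add: \<Phi>'_def)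
  qed
  have N': "pm (\<Phi>' k) \<in> D" for k by (rule pm_D(1)[OF \<Phi>' K snoc.prems(5)])
  have agree: "\<Phi>' k u = \<Phi> k u" if "(k, u) \<in> U" for k u
    using that U\<kappa> by (auto simp: \<Phi>'_def U\<kappa>_def ker_fun_def prod_zero_iff)
  have step: "mv \<Psi> \<kappa> s v = w" if \<Psi>: "pm (\<Psi> \<kappa>) \<in> D" "\<Psi> \<kappa> p = \<Phi>' \<kappa> p" for \<Psi>
  proof (cases s)
    case True
    then show ?thesis using \<Psi>(2) cw by (simp add: mv_def p_def pm_def \<Phi>'_def)
  next
    case False
    then have "pm (\<Psi> \<kappa>) w = v" using \<Psi>(2) cw by (simp add: p_def pm_def \<Phi>'_def)
    then show ?thesis using False D_simps(2)[OF \<Psi>(1), of w] by (simp add: mv_def)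
  qed
  have runw: "run \<Psi> (sts @ [st]) x0 = g' w"
    if \<Psi>: "\<And>k. pm (\<Psi> k) \<in> D" "\<And>k u. (k, u) \<in> U' \<Longrightarrow> \<Psi> k u = \<Phi>' k u" for \<Psi>
  proof -
    have "run \<Psi> sts x0 = y" by (rule stable[rule_format]) (use \<Psi> agree in \<open>simp add: U'_def\<close>)
    then show ?thesis using step[of \<Psi>, OF \<Psi>(1) \<Psi>(2)] by (simp add: run_simps st v_def[symmetric] U'_def)
  qed
  have wI: "w \<in> {l<..<r}"
  proof -
    have "mv \<Phi>' \<kappa> s \<in> D" using N' D_finv by (simp add: mv_def)
    then show ?thesis using D_mem v(1) step[of \<Phi>', OF N' refl] by metis
  qed
  have nb: "g' w \<notin> Bad"
  proof
    assume "g' w \<in> Bad"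
    then have "finv g' (g' w) \<in> F" unfolding F_def by blast
    then show False using w D_simps(2)[OF gD(2)] by simp
  qed
  have off': "h (g' w) \<noteq> u \<and> h (g' w) \<noteq> pm (\<Phi>' k) u" if "(k, u) \<in> U'" "k \<noteq> \<kappa>" for k u
  proof -
    have ku: "(k, u) \<in> U" and e: "\<Phi>' k = \<Phi> k" using that by (auto simp: U'_def \<Phi>'_def)
    have "finv h u \<in> Bad" "finv h (pm (\<Phi> k) u) \<in> Bad" using ku by (force simp: Bad_def)+
    then show ?thesis using nb D_simps(2)[OF snoc.prems(3)] unfolding e by metis
  qed
  have "g' w \<notin> B" using nb by (simp add: Bad_def)
  moreover have "g' w \<in> {l<..<r}" using D_mem[OF gD(2)] wI by simp
  moreover have "finite U'" using U by (simp add: U'_def)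
  moreover have "\<forall>k u. (k, u) \<in> U' \<and> (sts @ [st] \<noteq> [] \<longrightarrow> k \<noteq> key (last (sts @ [st]))) \<longrightarrow>
      h (g' w) \<noteq> u \<and> h (g' w) \<noteq> pm (\<Phi>' k) u"
  proof (intro allI impI)
    fix k u assume "(k, u) \<in> U' \<and> (sts @ [st] \<noteq> [] \<longrightarrow> k \<noteq> key (last (sts @ [st])))"
    then have "(k, u) \<in> U'" "k \<noteq> \<kappa>" by (simp_all add: st)
    then show "h (g' w) \<noteq> u \<and> h (g' w) \<noteq> pm (\<Phi>' k) u" by (rule off')
  qed
  moreover have "\<forall>\<Psi>. (\<forall>k. pm (\<Psi> k) \<in> D) \<and> (\<forall>k u. (k, u) \<in> U' \<longrightarrow> \<Psi> k u = \<Phi>' k u) \<longrightarrow> run \<Psi> (sts @ [st]) x0 = g' w"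
    using runw by blast
  moreover have "\<forall>k. adm (\<Phi>' k) \<and> tiny K \<eta> (\<Phi>' k)" using \<Phi>' by blast
  ultimately show ?case
    by - (rule exI[of _ \<Phi>'], rule exI[of _ U'], rule exI[of _ "g' w"], intro conjI impI; assumption)
qed

definition comm :: "(real \<Rightarrow> real) \<Rightarrow> (real \<Rightarrow> real) \<Rightarrow> real \<Rightarrow> real" where
  "comm f g = f \<circ> g \<circ> finv f \<circ> finv g"

lemma D_comm: "f \<in> D \<Longrightarrow> g \<in> D \<Longrightarrow> comm f g \<in> D"
  unfolding comm_def by (intro D_comp D_finv)

text \<open>The steps of \<open>modified X \<Phi> k\<close> or of its inverse, in the order in which
  they act. The two perturbations alternate, the first key is \<open>(k, s)\<close> and the last is
  \<open>(k, \<not> s)\<close>; so at the seam of two letters the keys coincide only if the letters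
  cancel.\<close>

fun lsteps :: "('k \<Rightarrow> real \<Rightarrow> real) \<Rightarrow> 'k \<times> bool \<Rightarrow> ((real \<Rightarrow> real) \<times> ('k \<times> bool) \<times> bool \<times> (real \<Rightarrow> real)) list" where
  "lsteps X (k, s) = (if s then
      [(id, (k, True), False, id), (id, (k, False), False, id), (id, (k, True), True, id), (id, (k, False), True, X k)]
    else [(finv (X k), (k, False), False, id), (id, (k, True), False, id), (id, (k, False), True, id), (id, (k, True), True, id)])"

text \<open>The map is multiplied by a commutator of two independent perturbations rather than by a
  single one, because errors that are products of commutators can be undone in further
  blocks.\<close>

definition modified :: "('k \<Rightarrow> real \<Rightarrow> real) \<Rightarrow> ('k \<times> bool \<Rightarrow> real \<Rightarrow> real) \<Rightarrow> 'k \<Rightarrow> real \<Rightarrow> real" where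
  "modified X \<Phi> k = X k \<circ> comm (pm (\<Phi> (k, False))) (pm (\<Phi> (k, True)))"

lemma run_lsteps:
  assumes "\<And>k. pm (\<Phi> k) \<in> D" "X k \<in> D"
  shows "run \<Phi> (lsteps X (k, s)) x = (if s then modified X \<Phi> k else finv (modified X \<Phi> k)) x"
proof -
  note [simp] = D_bij[OF assms(1)] D_bij[OF assms(2)] bij_comp bij_imp_bij_inv inv_inv_eq
  show ?thesis
    by (simp add: run_simps mv_def modified_def comm_def o_inv_distrib)
qed

text \<open>The path of the midpoint of the block is perturbed, with that midpoint as the point its
  end has to avoid. Since adjacent letters do not cancel, neighbouring steps use different
  perturbations.\<close>

theorem reduced_word_moves:
  assumes X: "\<And>k. X k \<in> D" and ws: "ws \<noteq> []" "successively (\<lambda>w w'. \<not> (fst w = fst w' \<and> snd w \<noteq> snd w')) ws"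
    and K: "K \<ge> 1" and \<eta>: "0 < \<eta>" "\<eta> \<le> 1 / 2"
  shows "\<exists>\<Phi>. (\<forall>k. adm (\<Phi> k) \<and> tiny K \<eta> (\<Phi> k)) \<and>
    (\<exists>x\<in>{l<..<r}. foldl (\<lambda>x (k, s). (if s then modified X \<Phi> k else finv (modified X \<Phi> k)) x) x ws \<noteq> x)"
proof -
  define sts where "sts = concat (map (lsteps X) ws)"
  have 1: "\<forall>st\<in>set sts. fst st \<in> D \<and> snd (snd (snd st)) \<in> D"
    by (auto simp: sts_def D_id X D_finv split: if_splits)
  have 2: "successively (\<lambda>s t. key s \<noteq> key t) (concat (map (lsteps X) ws)) \<and>
      (ws \<noteq> [] \<longrightarrow> concat (map (lsteps X) ws) \<noteq> [] \<and> key (hd (concat (map (lsteps X) ws))) = (fst (hd ws), snd (hd ws)))"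
    using ws(2)
  proof (induction ws)
    case (Cons w ws)
    obtain k s where w: "w = (k, s)" by (cases w) auto
    show ?case
    proof (cases "ws = []")
      case True
      then show ?thesis by (simp add: w)
    next
      case False
      define R where "R = concat (map (lsteps X) ws)"
      have adj: "\<not> (k = fst (hd ws) \<and> s \<noteq> snd (hd ws))" "successively (\<lambda>w w'. \<not> (fst w = fst w' \<and> snd w \<noteq> snd w')) ws"
        using Cons.prems False by (simp_all add: w successively_Cons)
      have IH: "successively (\<lambda>s t. key s \<noteq> key t) R" "R \<noteq> []" "key (hd R) = (fst (hd ws), snd (hd ws))"
        using Cons.IH[OF adj(2)] False unfolding R_def by simp_all
      have "concat (map (lsteps X) (w # ws)) = lsteps X (k, s) @ R" by (simp add: w R_def)
      moreover have "successively (\<lambda>s t. key s \<noteq> key t) (lsteps X (k, s))" "lsteps X (k, s) \<noteq> []"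
        "key (hd (lsteps X (k, s))) = (k, s)" "key (last (lsteps X (k, s))) = (k, \<not> s)"
        by simp_all
      moreover have "(k, \<not> s) \<noteq> key (hd R)" using adj(1) IH(3) by (metis fst_conv snd_conv)
      ultimately show ?thesis using IH(1,2) by (simp only: successively_append_iff hd_append) (simp add: w)
    qed
  qed simp
  then have ne: "sts \<noteq> []" and su: "successively (\<lambda>s t. key s \<noteq> key t) sts" using ws(1) by (auto simp: sts_def)
  define x0 where "x0 = (l + r) / 2"
  have x0: "x0 \<in> {l<..<r}" using lr by (simp add: x0_def)
  obtain \<Phi> U y where \<Phi>: "\<forall>\<kappa>. adm (\<Phi> \<kappa>) \<and> tiny K \<eta> (\<Phi> \<kappa>)" and y: "y \<noteq> x0"
    and stable: "(\<forall>\<Psi>. (\<forall>\<kappa>. pm (\<Psi> \<kappa>) \<in> D) \<and> (\<forall>\<kappa> u. (\<kappa>, u) \<in> U \<longrightarrow> \<Psi> \<kappa> u = \<Phi> \<kappa> u) \<longrightarrow> run \<Psi> sts x0 = y)"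
  proof -
    note path_perturb[OF x0 K 1 su D_id \<eta> finite.insertI[OF finite.emptyI], of x0]
    then show thesis
      by - (elim exE conjE, rule that, assumption, use ne in blast, assumption)
  qed
  have N: "pm (\<Phi> k) \<in> D" for k using pm_D(1)[OF _ _ K \<eta>(2)] \<Phi> by blast
  have run: "run \<Phi> (concat (map (lsteps X) ws)) x =
      foldl (\<lambda>x (k, s). (if s then modified X \<Phi> k else finv (modified X \<Phi> k)) x) x ws" for x
  proof (induction ws arbitrary: x)
    case (Cons w ws)
    then show ?case by (cases w) (simp add: run_simps(3) run_lsteps[OF N X] del: lsteps.simps)
  qed (simp add: run_simps)
  have "run \<Phi> sts x0 = y" using stable N by blast
  then have "foldl (\<lambda>x (k, s). (if s then modified X \<Phi> k else finv (modified X \<Phi> k)) x) x0 ws \<noteq> x0"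
    using y unfolding run[symmetric] sts_def by simp
  then show ?thesis by (intro exI[of _ \<Phi>] conjI[OF \<Phi>] bexI[OF _ x0])
qed

end

subsection \<open>A translation and its fundamental blocks\<close>

lemma ev_Diff01: "(\<And>x. \<phi> x \<in> carrier Diff01) \<Longrightarrow> ev \<phi> w \<in> carrier Diff01"
  by (induction w) (simp_all add: Diff01_id Diff01_comp Diff01_finv evl_def)

lemma Cinf_comp_Diff01:
  assumes "\<And>j. F j \<in> carrier Diff01" "\<And>j. G j \<in> carrier Diff01" "f \<in> carrier Diff01" "g \<in> carrier Diff01"
    "Cinf F f" "Cinf G g"
  shows "Cinf (\<lambda>j. F j \<circ> G j) (f \<circ> g)"
  using Cinf_compose[OF Diff01_DS[OF assms(3)] Diff01_DS[OF assms(4)] Diff01D(2)[OF assms(1)] Diff01D(2)[OF assms(2)] assms(5,6)]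
  by (simp add: o_def)

lemma Cinf_const: "Cinf (\<lambda>_. f) f"
  by (simp add: Cinf_def uniform_limit_const)

text \<open>Otherwise the iterates would increase to a limit below \<open>\<omega>\<close>, which
  would be a fixed point.\<close>

lemma iterates_exceed:
  fixes f :: "real \<Rightarrow> real"
  assumes f: "continuous_on UNIV f" "\<And>x. p \<le> x \<Longrightarrow> x < \<omega> \<Longrightarrow> x < f x" "\<And>x. x < \<omega> \<Longrightarrow> f x < \<omega>"
    and p: "p < \<omega>" "y < \<omega>"
  shows "\<exists>n. (f ^^ n) p > y"
proof (rule ccontr)
  assume "\<not> ?thesis"
  then have le: "(f ^^ n) p \<le> y" for n by (simp add: not_less)
  have b: "p \<le> (f ^^ n) p \<and> (f ^^ n) p < \<omega>" for n
  proof (induction n)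
    case (Suc n)
    then show ?case using f(2)[of "(f ^^ n) p"] f(3)[of "(f ^^ n) p"] by simp
  qed (use p in simp)
  have "incseq (\<lambda>n. (f ^^ n) p)"
    by (rule incseq_SucI) (use b f(2) in \<open>auto intro: less_imp_le\<close>)
  then obtain L where L: "(\<lambda>n. (f ^^ n) p) \<longlonglongrightarrow> L" using incseq_convergent[of _ y] le by metis
  have L1: "L \<le> y" "p \<le> L" using LIMSEQ_le_const2[OF L] LIMSEQ_le_const[OF L] le b by blast+
  have "(\<lambda>n. f ((f ^^ n) p)) \<longlonglongrightarrow> f L"
    using f(1) L by (metis UNIV_I continuous_on_eq_continuous_at isCont_tendsto_compose open_UNIV)
  then have "(\<lambda>n. (f ^^ Suc n) p) \<longlonglongrightarrow> f L" by simp
  moreover have "(\<lambda>n. (f ^^ Suc n) p) \<longlonglongrightarrow> L" using L by (rule LIMSEQ_Suc)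
  ultimately have "f L = L" by (rule LIMSEQ_unique)
  then show False using f(2)[of L] L1 p by simp
qed

lemma exists_translation: "\<exists>a\<in>carrier Diff01. \<forall>x\<in>{0<..<1}. x < a x"
proof -
  have "bsm (bump 0 1)" by (rule bsm_support[OF smooth_bump, of 0 1]) (rule bump_zero)
  then have "bounded (range (deriv (bump 0 1)))" unfolding bsm_def by (metis funpow_0 funpow_simps_right(2) o_apply)
  then obtain C0 where C0: "\<And>x. \<bar>deriv (bump 0 1) x\<bar> \<le> C0" unfolding bounded_iff by auto
  define C where "C = max C0 1"
  have C: "C > 0" "\<bar>deriv (bump 0 1) x\<bar> \<le> C" for x using C0[of x] by (auto simp: C_def)
  \<comment> \<open>The factor keeps the derivative of the added term at most \<open>1 / 2\<close>
    in absolute value.\<close>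
  define a where "a x = x + 1 / (2 * C) * bump 0 1 x" for x
  have sm: "smooth (\<lambda>x. 1 / (2 * C) * bump 0 1 x)" by (rule smooth_intros(5)[OF smooth_intros(1) smooth_bump])
  have d: "deriv a x = 1 + 1 / (2 * C) * deriv (bump 0 1) x" for x
    unfolding a_def[abs_def]
    by (rule DERIV_imp_deriv, rule DERIV_add[OF DERIV_ident DERIV_cmult[OF smoothD(1)[OF smooth_bump]]])
  have "a \<in> carrier Diff01"
  proof (rule Diff01I)
    show "smooth a" unfolding a_def[abs_def] by (rule smooth_intros(4)[OF smooth_intros(2) sm])
    fix x
    have "\<bar>1 / (2 * C) * deriv (bump 0 1) x\<bar> \<le> 1 / (2 * C) * C"
      unfolding abs_mult using C(1) C(2)[of x] by (intro mult_mono) auto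
    then have "\<bar>1 / (2 * C) * deriv (bump 0 1) x\<bar> \<le> 1 / 2" using C(1) by simp
    then show "deriv a x > 0" unfolding d by linarith
    show "a x = x" if "x \<notin> {0<..<1}" using bump_zero[OF that] by (simp add: a_def)
  qed
  moreover have "x < a x" if "x \<in> {0<..<1}" for x
    using bump_pos[of 0 x 1] that C(1) by (simp add: a_def)
  ultimately show ?thesis by blast
qed

locale translation =
  fixes a :: "real \<Rightarrow> real"
  assumes a: "a \<in> carrier Diff01" and a_gt: "\<And>x. x \<in> {0<..<1} \<Longrightarrow> x < a x"
begin

abbreviation l :: real where "l \<equiv> 1 / 2"
abbreviation r :: real where "r \<equiv> a (1 / 2)"

lemma a_01: "x \<in> {0<..<1} \<Longrightarrow> a x \<in> {0<..<1}"
  using Diff01_mono[OF a, of 0 x] Diff01_mono[OF a, of x 1] Diff01D(4)[OF a, of 0] Diff01D(4)[OF a, of 1] by simp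

sublocale block l r
  by unfold_locales (use a_gt[of "1/2"] a_01[of "1/2"] in auto)

definition ai :: "int \<Rightarrow> real \<Rightarrow> real" where "ai n = ev (\<lambda>_. a) (apow n)"

text \<open>If all four generators act as \<open>a\<close>, the relation holds trivially. Word
  identities such as \<open>apow_add\<close> can then be evaluated to identities between powers of
  \<open>a\<close>.\<close>

interpretation sa: surface_action "\<lambda>_. a"
  by unfold_locales (simp_all add: Diff01D(1)[OF a])

lemma ai_Diff01: "ai n \<in> carrier Diff01"
  unfolding ai_def by (rule ev_Diff01) (rule a)

lemma ai_0: "ai 0 = id" by (simp add: ai_def)

lemma ai_1: "ai 1 = a" by (simp add: ai_def apow_def evl_def)

lemma ai_add: "ai (m + n) = ai m \<circ> ai n"
  unfolding ai_def using sa.ev_phi_weq[OF apow_add[of m n]] by (simp add: ev_append)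

lemma ai_ai: "ai m (ai n x) = ai (m + n) x"
  by (simp add: ai_add)

lemma ai_minus: "ai (- n) = finv (ai n)"
  unfolding ai_def apow_minus by (rule sa.ev_phi_winv)

lemma ai_cancel [simp]: "ai (- n) (ai n x) = x" "ai n (ai (- n) x) = x"
  by (simp_all add: ai_ai ai_0)

lemma ev_apow: assumes "\<phi> GA = a" shows "ev \<phi> (apow n) = ai n"
proof -
  have "ev \<phi> (replicate k (GA, s)) = ev (\<lambda>_. a) (replicate k (GA, s))" for k s
    by (induction k) (simp_all add: evl_def assms)
  then show ?thesis by (simp add: ai_def apow_def)
qed

lemma ai_01: "ai n x \<in> {0<..<1} \<longleftrightarrow> x \<in> {0<..<1}"
  using Diff01_less_iff[OF ai_Diff01, of n 0 x] Diff01_less_iff[OF ai_Diff01, of n x 1]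
    Diff01D(4)[OF ai_Diff01, of 0 n] Diff01D(4)[OF ai_Diff01, of 1 n] by simp

lemma ai_step: "x \<in> {0<..<1} \<Longrightarrow> ai n x < ai (n + 1) x"
  unfolding ai_add ai_1 using Diff01_mono[OF ai_Diff01 a_gt] by simp

lemma ai_strict_mono: assumes x: "x \<in> {0<..<1}" and mn: "m < n" shows "ai m x < ai n x"
proof -
  have "ai m x < ai (m + 1 + int k) x" for k
  proof (induction k)
    case (Suc k)
    have "ai (m + 1 + int k) x < ai (m + 1 + int k + 1) x" by (rule ai_step[OF x])
    also have "m + 1 + int k + 1 = m + 1 + int (Suc k)" by simp
    finally show ?case using Suc by simp
  qed (use ai_step[OF x, of m] in simp)
  from this[of "nat (n - m - 1)"] show ?thesis using mn by simp
qed

lemma ai_funpow: "ai (int n) = a ^^ n"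
proof (induction n)
  case (Suc n)
  have "ai (int (Suc n)) = ai (1 + int n)" by simp
  then show ?case unfolding ai_add ai_1 Suc by (simp only: funpow.simps)
qed (simp add: ai_0)

lemma ai_exceeds: assumes "x \<in> {0<..<1}" "y < 1" shows "\<exists>n::nat. y < ai (int n) x"
  unfolding ai_funpow
proof (rule iterates_exceed[where \<omega> = 1, OF Diff01_cont[OF a]])
  show "z < a z" if "x \<le> z" "z < 1" for z using a_gt that assms by simp
  show "a z < 1" if "z < 1" for z
    using Diff01_mono[OF a that] Diff01D(4)[OF a, of 1] by simp
qed (use assms in auto)

definition blk :: "real \<Rightarrow> int" where
  "blk x = (THE n. ai n l \<le> x \<and> x < ai (n + 1) l)"

lemma half_01: "l \<in> {0<..<1}" by simp

lemma blk_eq: assumes "ai n l \<le> x" "x < ai (n + 1) l" shows "blk x = n"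
  unfolding blk_def
proof (rule the_equality)
  show "ai n l \<le> x \<and> x < ai (n + 1) l" using assms by simp
  fix m assume m: "ai m l \<le> x \<and> x < ai (m + 1) l"
  have less: "p \<le> q" if "ai p l < ai (q + 1) l" for p q
  proof (rule ccontr)
    assume "\<not> p \<le> q"
    then have "q + 1 \<le> p" by simp
    then have "ai (q + 1) l \<le> ai p l" using ai_strict_mono[OF half_01, of "q + 1" p] by (cases "q + 1 = p") auto
    then show False using that by simp
  qed
  have "m \<le> n" by (rule less) (use m assms in linarith)
  moreover have "n \<le> m" by (rule less) (use m assms in linarith)
  ultimately show "m = n" by simp
qed

lemma blk: assumes x: "x \<in> {0<..<1}" shows "ai (blk x) l \<le> x" "x < ai (blk x + 1) l"
proof -
  obtain n where n: "x < ai (int n) l" using ai_exceeds[OF half_01, of x] x by auto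
  obtain m where "l < ai (int m) x" using ai_exceeds[OF x, of l] by auto
  then have m: "ai (- int m) l < x" using Diff01_mono[OF ai_Diff01, of l "ai (int m) x" "- int m"] by simp
  have "\<exists>k. ai k l \<le> x \<and> \<not> ai (k + 1) l \<le> x"
  proof (rule ccontr)
    assume c: "\<not> ?thesis"
    have "ai (- int m + int k) l \<le> x" for k
    proof (induction k)
      case (Suc k)
      then have "ai (- int m + int k + 1) l \<le> x" using c by blast
      moreover have "- int m + int k + 1 = - int m + int (Suc k)" by simp
      ultimately show ?case by metis
    qed (use m in simp)
    from this[of "m + n"] show False using n by simp
  qed
  then obtain k where k: "ai k l \<le> x" "x < ai (k + 1) l" by (auto simp: not_le)
  show "ai (blk x) l \<le> x" "x < ai (blk x + 1) l" unfolding blk_eq[OF k] using k .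
qed

lemma J_01: "y \<in> {l..<r} \<Longrightarrow> y \<in> {0<..<1}"
  using a_01[OF half_01] by auto

lemma blk_ai: assumes "y \<in> {l..<r}" shows "blk (ai n y) = n"
proof (rule blk_eq)
  show "ai n l \<le> ai n y" using assms Diff01_le_iff[OF ai_Diff01] by simp
  show "ai n y < ai (n + 1) l" unfolding ai_add ai_1 using assms Diff01_less_iff[OF ai_Diff01] by simp
qed

lemma coord: assumes "x \<in> {0<..<1}" obtains n y where "y \<in> {l..<r}" "x = ai n y"
proof (rule that)
  let ?n = "blk x"
  show "x = ai ?n (ai (- ?n) x)" by simp
  have "ai (- ?n) (ai ?n l) \<le> ai (- ?n) x" "ai (- ?n) x < ai (- ?n) (ai (?n + 1) l)"
    using blk[OF assms] Diff01_le_iff[OF ai_Diff01] Diff01_less_iff[OF ai_Diff01] by blast+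
  then show "ai (- ?n) x \<in> {l..<r}" by (simp add: ai_ai ai_0 ai_1)
qed

text \<open>In the coordinates \<open>x = ai n y\<close> with \<open>y\<close> in the base block,
  \<open>B f\<close> keeps the block number \<open>n\<close> and applies \<open>f n\<close> to
  \<open>y\<close>.\<close>

definition B :: "(int \<Rightarrow> real \<Rightarrow> real) \<Rightarrow> real \<Rightarrow> real" where
  "B f x = (if x \<in> {0<..<1} then ai (blk x) (f (blk x) (ai (- blk x) x)) else x)"

lemma B_ai: assumes "y \<in> {l..<r}" shows "B f (ai n y) = ai n (f n y)"
  using ai_01[of n y] J_01[OF assms] by (simp add: B_def blk_ai[OF assms])

lemma B_off: "x \<notin> {0<..<1} \<Longrightarrow> B f x = x" unfolding B_def by (rule if_not_P)

lemma ext01: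
  assumes "\<And>x. x \<notin> {0<..<1} \<Longrightarrow> F x = G x" "\<And>n y. y \<in> {l..<r} \<Longrightarrow> F (ai n y) = G (ai n y)"
  shows "F = G"
proof
  fix x show "F x = G x"
    using assms coord[of x] by (cases "x \<in> {0<..<1}") metis+
qed

lemma B_comp: assumes g: "\<And>n. g n \<in> D" shows "B f \<circ> B g = B (\<lambda>n. f n \<circ> g n)"
  by (rule ext01) (simp_all add: B_off B_ai D_mem_co[OF g, simplified])

lemma B_id: "B (\<lambda>n. id) = id"
  by (rule ext01) (simp_all add: B_off B_ai)

lemma B_finv: assumes f: "\<And>n. f n \<in> D" shows "finv (B f) = B (\<lambda>n. finv (f n))"
proof (rule inv_unique_comp)
  have e: "f n \<circ> finv (f n) = id" "finv (f n) \<circ> f n = id" for n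
    by (simp_all add: fun_eq_iff D_simps[OF f])
  show "B f \<circ> B (\<lambda>n. finv (f n)) = id" unfolding B_comp[OF D_finv[OF f]] e B_id ..
  show "B (\<lambda>n. finv (f n)) \<circ> B f = id" unfolding B_comp[OF f] e B_id ..
qed

text \<open>Conjugation by \<open>a\<close> shifts the blocks, which turns the relation of the surface group into a recursion.\<close>

lemma B_conj: "a \<circ> B f \<circ> finv a = B (\<lambda>n. f (n - 1))"
proof (rule ext01)
  fix x :: real assume "x \<notin> {0<..<1}"
  then show "(a \<circ> B f \<circ> finv a) x = B (\<lambda>n. f (n - 1)) x"
    using Diff01D(4)[OF Diff01_finv[OF a]] Diff01D(4)[OF a] by (simp add: B_off)
next
  fix n y assume y: "y \<in> {l..<r}"
  have e: "finv a = ai (- 1)" using ai_minus[of 1] by (simp add: ai_1)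
  have "(a \<circ> B f \<circ> finv a) (ai n y) = a (B f (ai (n - 1) y))"
    unfolding e by (simp add: ai_ai)
  also have "\<dots> = ai 1 (ai (n - 1) (f (n - 1) y))" by (simp add: B_ai[OF y] ai_1)
  also have "\<dots> = B (\<lambda>n. f (n - 1)) (ai n y)" by (simp add: B_ai[OF y] ai_ai)
  finally show "(a \<circ> B f \<circ> finv a) (ai n y) = B (\<lambda>n. f (n - 1)) (ai n y)" .
qed

lemma B_single: assumes f: "f \<in> D" shows "B (\<lambda>k. if k = n then f else id) = ai n \<circ> f \<circ> ai (- n)"
proof (rule ext01)
  fix x :: real assume x: "x \<notin> {0<..<1}"
  then have "x \<notin> {l<..<r}" using J_01[of x] by fastforce
  then have "f x = x" by (rule D_off[OF f])
  then show "B (\<lambda>k. if k = n then f else id) x = (ai n \<circ> f \<circ> ai (- n)) x"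
    using Diff01D(4)[OF ai_Diff01 x] by (simp add: B_off[OF x])
next
  fix k y assume y: "y \<in> {l..<r}"
  show "B (\<lambda>k. if k = n then f else id) (ai k y) = (ai n \<circ> f \<circ> ai (- n)) (ai k y)"
  proof (cases "k = n")
    case True
    then show ?thesis by (simp add: B_ai[OF y])
  next
    case False
    have "ai (k - n) y \<notin> {l..<r}"
    proof
      assume "ai (k - n) y \<in> {l..<r}"
      from blk_ai[OF this, of 0] show False using blk_ai[OF y, of "k - n"] False by (simp add: ai_0)
    qed
    then have "f (ai (k - n) y) = ai (k - n) y" by (intro D_off[OF f]) auto
    then show ?thesis using False by (simp add: B_ai[OF y] ai_ai)
  qed
qed

lemma B_split:
  assumes "\<And>n. f n \<in> D"
  shows "B f = (ai m \<circ> f m \<circ> ai (- m)) \<circ> B (f(m := id))"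
proof -
  have "(\<lambda>n. (if n = m then f m else id) \<circ> (f(m := id)) n) = f" by auto
  then show ?thesis
    using B_comp[of "f(m := id)" "\<lambda>n. if n = m then f m else id"] assms D_id by (simp add: B_single)
qed

text \<open>Finite support makes \<open>B f\<close> a finite composition of conjugates of elements
  of \<open>D\<close>, one for each block, so smoothness at the block ends, at 0 and at 1 needs no
  separate argument.\<close>

lemma B_Diff01:
  assumes "finite S"
  shows "(\<And>n. f n \<in> D) \<Longrightarrow> (\<And>n. n \<notin> S \<Longrightarrow> f n = id) \<Longrightarrow> B f \<in> carrier Diff01"
  using assms
proof (induction S arbitrary: f)
  case empty
  have "f = (\<lambda>n. id)" by (rule ext, rule empty.prems(2)) simp
  then show ?case by (simp only: B_id Diff01_id)
next
  case (insert m S)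
  have "B (f(m := id)) \<in> carrier Diff01"
    by (rule insert.IH) (use insert.prems D_id in auto)
  then show ?case
    unfolding B_split[of f m, OF insert.prems(1)]
    by (intro Diff01_comp ai_Diff01 D_Diff01[OF insert.prems(1)])
qed

lemma B_Cinf:
  assumes "finite S"
  shows "(\<And>j n. F j n \<in> D) \<Longrightarrow> (\<And>n. f n \<in> D) \<Longrightarrow> (\<And>j n. n \<notin> S \<Longrightarrow> F j n = id) \<Longrightarrow>
    (\<And>n. n \<notin> S \<Longrightarrow> f n = id) \<Longrightarrow> (\<And>n. Cinf (\<lambda>j. F j n) (f n)) \<Longrightarrow> Cinf (\<lambda>j. B (F j)) (B f)"
  using assms
proof (induction S arbitrary: F f)
  case empty
  have "f = (\<lambda>n. id)" by (rule ext, rule empty.prems(4)) simp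
  moreover have "F = (\<lambda>j n. id)" by (intro ext, rule fun_cong[OF empty.prems(3)]) simp
  ultimately show ?case by (simp only: B_id Cinf_const)
next
  case (insert m S)
  have "Cinf (\<lambda>j. B ((F j)(m := id))) (B (f(m := id)))"
  proof (rule insert.IH)
    show "Cinf (\<lambda>j. ((F j)(m := id)) n) ((f(m := id)) n)" for n
    proof (cases "n = m")
      case True
      show ?thesis unfolding True fun_upd_same by (rule Cinf_const)
    next
      case False
      then show ?thesis using insert.prems(5)[of n] by (simp add: fun_upd_def)
    qed
  qed (use insert.prems D_id in auto)
  moreover have "B ((F j)(m := id)) \<in> carrier Diff01" "B (f(m := id)) \<in> carrier Diff01" for j
    by (rule B_Diff01[OF insert.hyps(1)]; use insert.prems D_id in auto)+
  ultimately show ?case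
    unfolding B_split[of f m, OF insert.prems(2)] B_split[of "F _" m, OF insert.prems(1)]
    by (intro Cinf_comp_Diff01 Diff01_comp ai_Diff01 D_Diff01[OF insert.prems(1)]
        D_Diff01[OF insert.prems(2)] insert.prems(5) Cinf_const)
qed

subsection \<open>Finitely supported actions\<close>

text \<open>The data of a finitely supported action, pulled back to the base block. The last clause
  is the surface relation read in block \<open>n\<close>; its shift by one block comes from
  conjugation by \<open>a\<close>.\<close>

definition dat :: "(gen \<Rightarrow> int \<Rightarrow> real \<Rightarrow> real) \<Rightarrow> bool" where
  "dat f \<longleftrightarrow> (\<forall>x n. f x n \<in> D) \<and> (\<exists>M::nat. \<forall>x n. \<bar>n\<bar> > int M \<longrightarrow> f x n = id) \<and>
     (\<forall>n. f GB (n - 1) = comm (f GC n) (f GD n) \<circ> f GB n)"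

definition mk :: "(gen \<Rightarrow> int \<Rightarrow> real \<Rightarrow> real) \<Rightarrow> gen \<Rightarrow> real \<Rightarrow> real" where
  "mk f x = (if x = GA then a else B (f x))"

lemma finite_support: "\<bar>n\<bar> > int M \<longleftrightarrow> n \<notin> {- int M..int M}"
  by auto

lemma mk_Diff01: assumes "dat f" shows "mk f x \<in> carrier Diff01"
proof -
  obtain M where "\<And>x n. \<bar>n\<bar> > int M \<Longrightarrow> f x n = id" using assms unfolding dat_def by blast
  then have "B (f x) \<in> carrier Diff01"
    by (intro B_Diff01[of "{- int M..int M}"]) (use assms in \<open>auto simp: dat_def finite_support\<close>)
  then show ?thesis using a by (simp add: mk_def)
qed

lemma B_comm: assumes "\<And>n. f n \<in> D" "\<And>n. g n \<in> D" shows "comm (B f) (B g) = B (\<lambda>n. comm (f n) (g n))"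
  unfolding comm_def B_finv[OF assms(1)] B_finv[OF assms(2)]
  by (simp only: B_comp assms D_finv D_comp)

lemma mk_action: assumes f: "dat f" shows "surface_action (mk f)"
proof
  show "bij (mk f x)" for x by (rule Diff01D(1)[OF mk_Diff01[OF f]])
  have D: "f x n \<in> D" for x n using f by (simp add: dat_def)
  have "a \<circ> B (f GB) \<circ> finv a = comm (B (f GC)) (B (f GD)) \<circ> B (f GB)"
    unfolding B_conj B_comm[OF D D] B_comp[OF D] using f by (simp add: dat_def)
  then have "a \<circ> B (f GB) \<circ> finv a \<circ> finv (B (f GB)) = comm (B (f GC)) (B (f GD)) \<circ> (B (f GB) \<circ> finv (B (f GB)))"
    by (simp add: o_assoc)
  moreover have "B (f GB) \<circ> finv (B (f GB)) = id"
    using mk_Diff01[OF f, of GB] Diff01_finv_simps(1)[of "B (f GB)"] by (simp add: mk_def fun_eq_iff)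
  ultimately show "mk f GA \<circ> mk f GB \<circ> finv (mk f GA) \<circ> finv (mk f GB)
      = mk f GC \<circ> mk f GD \<circ> finv (mk f GC) \<circ> finv (mk f GD)"
    by (simp add: mk_def comm_def)
qed

definition lett :: "(gen \<Rightarrow> int \<Rightarrow> real \<Rightarrow> real) \<Rightarrow> gen \<times> int \<times> bool \<Rightarrow> real \<Rightarrow> real" where
  "lett f u = (if snd (snd u) then f (fst u) (fst (snd u)) else finv (f (fst u) (fst (snd u))))"

lemma evl_mk: assumes "dat f" "x \<noteq> GA" shows "evl (mk f) (x, s) = B (\<lambda>n. lett f (x, n, s))"
  using assms B_finv[of "f x"] by (auto simp: evl_def mk_def lett_def dat_def)

lemma lett_D: "dat f \<Longrightarrow> lett f u \<in> D"
  by (simp add: lett_def dat_def D_finv)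

lemma ev_pw:
  assumes f: "dat f" and x: "fst u \<noteq> GA" and y: "y \<in> {l..<r}"
  shows "ev (mk f) (pw u) y = lett f u y"
proof -
  obtain x n s where u: "u = (x, n, s)" by (cases u)
  have "mk f GA = a" by (simp add: mk_def)
  from ev_apow[of "mk f", OF this] have "ev (mk f) (pw u) y = ai (- n) (evl (mk f) (x, s) (ai n y))"
    by (simp add: u ev_append)
  then show ?thesis using x by (simp add: evl_mk[OF f] B_ai[OF y] u)
qed

text \<open>A word of conjugates does not lead out of the base block and acts there through the
  block maps alone. In this way the reduced words of the normal form become compositions of elements
  of \<open>D\<close>.\<close>

lemma ev_pws:
  assumes f: "dat f" and x: "\<And>u. u \<in> set \<rho> \<Longrightarrow> fst u \<noteq> GA" and y: "y \<in> {l..<r}"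
  shows "ev (mk f) (pws \<rho>) y = foldr (lett f) \<rho> y \<and> foldr (lett f) \<rho> y \<in> {l..<r}"
  using x
proof (induction \<rho>)
  case (Cons u \<rho>)
  then have IH: "ev (mk f) (pws \<rho>) y = foldr (lett f) \<rho> y" "foldr (lett f) \<rho> y \<in> {l..<r}" and "fst u \<noteq> GA"
    by auto
  show ?case
    using ev_pw[OF f \<open>fst u \<noteq> GA\<close> IH(2)] D_mem_co[OF lett_D[OF f], of u "foldr (lett f) \<rho> y"] IH
    by (simp only: pws_simps ev_append o_apply foldr.simps)
qed (use y in simp)

text \<open>Inverse letters are included, so that limits of invertible maps come with their inverses
  and continuity of inversion does not have to be shown.\<close>

definition conv :: "(nat \<Rightarrow> gen \<Rightarrow> real \<Rightarrow> real) \<Rightarrow> (gen \<Rightarrow> real \<Rightarrow> real) \<Rightarrow> bool" where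
  "conv F \<phi> \<longleftrightarrow> (\<forall>u. Cinf (\<lambda>j. evl (F j) u) (evl \<phi> u))"

lemma conv_ev:
  assumes "\<And>j x. F j x \<in> carrier Diff01" "\<And>x. \<phi> x \<in> carrier Diff01" "conv F \<phi>"
  shows "Cinf (\<lambda>j. ev (F j) w) (ev \<phi> w)"
proof (induction w)
  case (Cons u w)
  have e: "evl \<psi> u \<in> carrier Diff01" if "\<And>x. \<psi> x \<in> carrier Diff01" for \<psi>
    using that by (simp add: evl_def Diff01_finv)
  show ?case unfolding ev_simps
    by (rule Cinf_comp_Diff01[OF e[OF assms(1)] ev_Diff01[OF assms(1)] e[OF assms(2)] ev_Diff01[OF assms(2)] _ Cons])
      (use assms(3) in \<open>unfold conv_def, blast\<close>)
qed (simp add: Cinf_const)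

lemma conv_mk:
  assumes F: "\<And>j. dat (F j)" and f: "dat f"
    and supp: "\<And>j x n. \<bar>n\<bar> > int M \<Longrightarrow> F j x n = id"
    and lim: "\<And>x n. Cinf (\<lambda>j. F j x n) (f x n)" "\<And>x n. Cinf (\<lambda>j. finv (F j x n)) (finv (f x n))"
  shows "conv (\<lambda>j. mk (F j)) (mk f)"
  unfolding conv_def
proof
  fix u :: "gen \<times> bool"
  obtain x s where u: "u = (x, s)" by (cases u)
  obtain M' where M': "\<And>x n. \<bar>n\<bar> > int M' \<Longrightarrow> f x n = id" using f unfolding dat_def by blast
  show "Cinf (\<lambda>j. evl (mk (F j)) u) (evl (mk f) u)"
  proof (cases "x = GA")
    case True
    then show ?thesis by (simp add: u evl_def mk_def Cinf_const)
  next
    case False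
    have "Cinf (\<lambda>j. B (\<lambda>n. lett (F j) (x, n, s))) (B (\<lambda>n. lett f (x, n, s)))"
    proof (rule B_Cinf[of "{- int (max M M')..int (max M M')}"])
      show "Cinf (\<lambda>j. lett (F j) (x, n, s)) (lett f (x, n, s))" for n
        using lim by (simp add: lett_def)
      fix n assume "n \<notin> {- int (max M M')..int (max M M')}"
      then have "\<bar>n\<bar> > int M" "\<bar>n\<bar> > int M'" by auto
      then show "lett f (x, n, s) = id" "lett (F j) (x, n, s) = id" for j
        using M' supp by (simp_all add: lett_def inv_id)
    qed (simp_all add: lett_D F f)
    then show ?thesis by (simp add: u evl_mk[OF f False] evl_mk[OF F False])
  qed
qed

end

section \<open>Perturbation of finitely supported actions\<close>

context block
begin

subsection \<open>Sequences of perturbations modulo products of commutators\<close>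

lemma D_finv_comp: "f \<in> D \<Longrightarrow> g \<in> D \<Longrightarrow> finv (f \<circ> g) = finv g \<circ> finv f"
  using o_inv_distrib[OF D_bij D_bij] .

lemma D_finv_finv: "f \<in> D \<Longrightarrow> finv (finv f) = f"
  using inv_inv_eq[OF D_bij] .

lemma comm_apply: "comm f g x = f (g (finv f (finv g x)))"
  by (simp add: comm_def)

lemma comm_id: "comm f id = f \<circ> finv f" "comm id f = f \<circ> finv f"
  by (simp_all add: comm_def inv_id)

lemma D_cancel: assumes "f \<in> D" shows "f \<circ> finv f = id" "finv f \<circ> f = id"
  by (simp_all add: fun_eq_iff D_simps[OF assms])

lemma finv_comm: assumes "f \<in> D" "g \<in> D" shows "finv (comm f g) = comm g f"
  unfolding comm_def using assms
  by (simp add: D_finv_comp D_finv_finv D_comp D_finv o_assoc)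

lemma comm_conj:
  assumes "f \<in> D" "g \<in> D" "h \<in> D"
  shows "comm (h \<circ> f \<circ> finv h) (h \<circ> g \<circ> finv h) = h \<circ> comm f g \<circ> finv h"
  unfolding comm_def using assms
  by (simp add: fun_eq_iff D_finv_comp D_finv_finv D_comp D_finv)

definition null :: "(nat \<Rightarrow> real \<Rightarrow> real) \<Rightarrow> bool" where
  "null N \<longleftrightarrow> (\<forall>j. N j \<in> D) \<and> Cinf N id \<and> Cinf (\<lambda>j. finv (N j)) id"

lemma null_D: "null N \<Longrightarrow> N j \<in> D" by (simp add: null_def)

lemma null_id: "null (\<lambda>j. id)"
  by (simp add: null_def D_id Cinf_const inv_id[unfolded id_def[symmetric]])

lemma Cinf_comp_D:
  assumes "\<And>j. F j \<in> D" "\<And>j. G j \<in> D" "f \<in> D" "g \<in> D" "Cinf F f" "Cinf G g"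
  shows "Cinf (\<lambda>j. F j \<circ> G j) (f \<circ> g)"
  by (rule Cinf_comp_Diff01) (use assms D_Diff01 in auto)

lemma null_comp: assumes "null N" "null N'" shows "null (\<lambda>j. N j \<circ> N' j)"
proof -
  note d = null_D[OF assms(1)] null_D[OF assms(2)]
  have "Cinf (\<lambda>j. N j \<circ> N' j) (id \<circ> id)"
    by (rule Cinf_comp_D[OF d D_id D_id]) (use assms in \<open>simp_all add: null_def\<close>)
  moreover have "Cinf (\<lambda>j. finv (N' j) \<circ> finv (N j)) (id \<circ> id)"
    by (rule Cinf_comp_D[OF D_finv[OF d(2)] D_finv[OF d(1)] D_id D_id]) (use assms in \<open>simp_all add: null_def\<close>)
  ultimately show ?thesis using d by (simp add: null_def D_comp D_finv_comp)
qed

lemma null_finv: assumes "null N" shows "null (\<lambda>j. finv (N j))"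
  using assms by (simp add: null_def D_finv D_finv_finv)

lemma null_comm: assumes "null p" "null q" shows "null (\<lambda>j. comm (p j) (q j))"
  unfolding comm_def by (intro null_comp null_finv assms)

lemma null_conj: assumes N: "null N" and h: "h \<in> D" shows "null (\<lambda>j. h \<circ> N j \<circ> finv h)"
proof -
  note d = null_D[OF N] and hi = D_finv[OF h]
  have 1: "Cinf (\<lambda>j. h \<circ> M j \<circ> finv h) id" if M: "\<And>j. M j \<in> D" "Cinf M id" for M
  proof -
    have "Cinf (\<lambda>j. h \<circ> M j \<circ> finv h) (h \<circ> id \<circ> finv h)"
      by (intro Cinf_comp_D Cinf_const M D_comp D_id h hi)
    then show ?thesis by (simp add: D_cancel[OF h])
  qed
  have "finv (h \<circ> N j \<circ> finv h) = h \<circ> finv (N j) \<circ> finv h" for j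
    using d[of j] h hi by (simp add: D_finv_comp D_finv_finv D_comp o_assoc)
  then show ?thesis using 1[OF d] 1[OF D_finv[OF d]] N by (simp add: null_def D_comp h hi)
qed

text \<open>Perturbing the maps \<open>c\<^sub>n, d\<^sub>n\<close> in a finite window destroys the finite support of \<open>b\<close>. All perturbations
  are commutators of sequences tending to the identity, and hence so is the error, up to products and
  conjugation; such an error is undone one commutator at a time, each in a further block.\<close>

inductive Z :: "(nat \<Rightarrow> real \<Rightarrow> real) \<Rightarrow> bool" where
  Z_id: "Z (\<lambda>j. id)"
| Z_step: "Z z \<Longrightarrow> null p \<Longrightarrow> null q \<Longrightarrow> Z (\<lambda>j. comm (p j) (q j) \<circ> z j)"

lemma Z_induct [consumes 1, case_names Z_id Z_step]:
  assumes "Z z" "P (\<lambda>j. id)" "\<And>z p q. Z z \<Longrightarrow> P z \<Longrightarrow> null p \<Longrightarrow> null q \<Longrightarrow> P (\<lambda>j. comm (p j) (q j) \<circ> z j)"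
  shows "P z"
  using assms(1)
proof (induction rule: Z.induct)
  case Z_id
  show ?case using assms(2) unfolding id_def .
next
  case (Z_step z p q)
  then show ?case using assms(3)[of z p q] unfolding o_def by blast
qed

lemma Z_null: "Z z \<Longrightarrow> null z"
  by (erule Z_induct[where P = null]) (rule null_id, rule null_comp[OF null_comm])

lemma Z_D: "Z z \<Longrightarrow> z j \<in> D"
  by (rule null_D[OF Z_null])

lemma Z_comp: assumes "Z z" "Z z'" shows "Z (\<lambda>j. z j \<circ> z' j)"
proof (rule Z_induct[where P = "\<lambda>z. Z (\<lambda>j. z j \<circ> z' j)", OF assms(1)])
  show "Z (\<lambda>j. id \<circ> z' j)" unfolding id_o by (rule assms(2))
  fix z p q assume "Z (\<lambda>j. z j \<circ> z' j)" "null p" "null q"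
  then show "Z (\<lambda>j. comm (p j) (q j) \<circ> z j \<circ> z' j)" unfolding comp_assoc by (rule Z_step)
qed

lemma Z_comm: "null p \<Longrightarrow> null q \<Longrightarrow> Z (\<lambda>j. comm (p j) (q j))"
  using Z_step[OF Z_id, of p q] unfolding o_id .

lemma Z_finv: assumes "Z z" shows "Z (\<lambda>j. finv (z j))"
proof (rule Z_induct[where P = "\<lambda>z. Z (\<lambda>j. finv (z j))", OF assms])
  show "Z (\<lambda>j. finv id)" unfolding inv_id by (rule Z_id)
  fix z p q assume h: "Z z" "Z (\<lambda>j. finv (z j))" "null p" "null q"
  have "finv (comm (p j) (q j) \<circ> z j) = finv (z j) \<circ> comm (q j) (p j)" for j
    using h by (simp add: D_finv_comp finv_comm D_comm null_D Z_D)
  then show "Z (\<lambda>j. finv (comm (p j) (q j) \<circ> z j))" using Z_comp[OF h(2) Z_comm[OF h(4,3)]] by (simp only:)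
qed

lemma Z_conj: assumes "Z z" and h: "h \<in> D" shows "Z (\<lambda>j. h \<circ> z j \<circ> finv h)"
proof (rule Z_induct[where P = "\<lambda>z. Z (\<lambda>j. h \<circ> z j \<circ> finv h)", OF assms(1)])
  show "Z (\<lambda>j. h \<circ> id \<circ> finv h)" unfolding o_id D_cancel[OF h] by (rule Z_id)
  fix z p q assume z: "Z z" "Z (\<lambda>j. h \<circ> z j \<circ> finv h)" "null p" "null q"
  have "h \<circ> (comm (p j) (q j) \<circ> z j) \<circ> finv h =
      comm (h \<circ> p j \<circ> finv h) (h \<circ> q j \<circ> finv h) \<circ> (h \<circ> z j \<circ> finv h)" for j
    unfolding comm_conj[OF null_D[OF z(3)] null_D[OF z(4)] h] by (simp add: fun_eq_iff D_simps[OF h])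
  then show "Z (\<lambda>j. h \<circ> (comm (p j) (q j) \<circ> z j) \<circ> finv h)"
    using Z_step[OF z(2) null_conj[OF z(3) h] null_conj[OF z(4) h]] by (simp only:)
qed

text \<open>Congruence of a sequence with a constant one modulo \<open>Z\<close>. Like a normal
  subgroup, \<open>Z\<close> is closed under products, inverses and conjugation by \<open>D\<close>,
  so that congruences can be composed, inverted and put into commutators.\<close>

definition cg :: "(nat \<Rightarrow> real \<Rightarrow> real) \<Rightarrow> (real \<Rightarrow> real) \<Rightarrow> bool" where
  "cg F f \<longleftrightarrow> f \<in> D \<and> (\<exists>z. Z z \<and> (\<forall>j. F j = z j \<circ> f))"

lemma cg_refl: "f \<in> D \<Longrightarrow> cg (\<lambda>_. f) f"
  unfolding cg_def using Z_id by (intro conjI exI[of _ "\<lambda>j. id"]) simp_all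

lemma cg_comp: assumes "cg F f" "cg G g" shows "cg (\<lambda>j. F j \<circ> G j) (f \<circ> g)"
proof -
  obtain z z' where z: "Z z" "\<And>j. F j = z j \<circ> f" "f \<in> D" "Z z'" "\<And>j. G j = z' j \<circ> g" "g \<in> D"
    using assms unfolding cg_def by blast
  have "F j \<circ> G j = (z j \<circ> (f \<circ> z' j \<circ> finv f)) \<circ> (f \<circ> g)" for j
    using z(3) by (simp add: z(2,5) fun_eq_iff)
  then show ?thesis
    using Z_comp[OF z(1) Z_conj[OF z(4,3)]] D_comp[OF z(3,6)]
    unfolding cg_def by (intro conjI exI[of _ "\<lambda>j. z j \<circ> (f \<circ> z' j \<circ> finv f)"]) simp_all
qed

lemma cg_finv: assumes "cg F f" shows "cg (\<lambda>j. finv (F j)) (finv f)"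
proof -
  obtain z where z: "Z z" "\<And>j. F j = z j \<circ> f" "f \<in> D" using assms unfolding cg_def by blast
  have "finv (F j) = (finv f \<circ> finv (z j) \<circ> finv (finv f)) \<circ> finv f" for j
    using z(3) Z_D[OF z(1)] by (simp add: z(2) fun_eq_iff D_finv_comp D_finv_finv)
  then show ?thesis
    using Z_conj[OF Z_finv[OF z(1)] D_finv[OF z(3)]] D_finv[OF z(3)]
    unfolding cg_def by (intro conjI exI[of _ "\<lambda>j. finv f \<circ> finv (z j) \<circ> finv (finv f)"]) simp_all
qed

lemma cg_comm: "cg F f \<Longrightarrow> cg G g \<Longrightarrow> cg (\<lambda>j. comm (F j) (G j)) (comm f g)"
  unfolding comm_def by (intro cg_comp cg_finv)

lemma cg_right: assumes "f \<in> D" "null p" "null q" shows "cg (\<lambda>j. f \<circ> comm (p j) (q j)) f"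
proof -
  have "f \<circ> comm (p j) (q j) = (f \<circ> comm (p j) (q j) \<circ> finv f) \<circ> f" for j
    using assms(1) by (simp add: fun_eq_iff)
  then show ?thesis
    using Z_conj[OF Z_comm[OF assms(2,3)] assms(1)] assms(1)
    unfolding cg_def by (intro conjI exI[of _ "\<lambda>j. f \<circ> comm (p j) (q j) \<circ> finv f"]) simp_all
qed

definition near :: "(nat \<Rightarrow> real \<Rightarrow> real) \<Rightarrow> (real \<Rightarrow> real) \<Rightarrow> bool" where
  "near F f \<longleftrightarrow> (\<forall>j. F j \<in> D) \<and> Cinf F f \<and> Cinf (\<lambda>j. finv (F j)) (finv f)"

lemma near_const: "f \<in> D \<Longrightarrow> near (\<lambda>_. f) f"
  by (simp add: near_def Cinf_const)

lemma null_near: "null N \<Longrightarrow> near N id"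
  by (simp add: near_def null_def inv_id[unfolded id_def[symmetric]])

lemma cg_near: assumes "cg F f" shows "near F f"
proof -
  obtain z where z: "Z z" "\<And>j. F j = z j \<circ> f" "f \<in> D" using assms unfolding cg_def by blast
  note n = Z_null[OF z(1)]
  have "Cinf (\<lambda>j. z j \<circ> f) (id \<circ> f)"
    by (rule Cinf_comp_D[OF null_D[OF n] z(3) D_id z(3) _ Cinf_const]) (use n in \<open>simp add: null_def\<close>)
  moreover have "Cinf (\<lambda>j. finv f \<circ> finv (z j)) (finv f \<circ> id)"
    by (rule Cinf_comp_D[OF D_finv[OF z(3)] D_finv[OF null_D[OF n]] D_finv[OF z(3)] D_id Cinf_const])
      (use n in \<open>simp add: null_def\<close>)
  moreover have "F = (\<lambda>j. z j \<circ> f)" using z(2) by (rule ext)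
  ultimately show ?thesis using z(3) null_D[OF n] by (simp add: near_def D_comp D_finv_comp)
qed

text \<open>The number \<open>Suc j\<close> of controlled derivatives grows with \<open>j\<close>,
  so each derivative is controlled eventually. The summand 2 keeps the bound at most
  \<open>1 / 2\<close>, as \<open>pm_D\<close> requires.\<close>

lemma null_pm:
  assumes \<phi>: "\<And>j. adm (\<phi> j)" "\<And>j. tiny (Suc j) (1 / (real j + 2)) (\<phi> j)"
  shows "null (\<lambda>j. pm (\<phi> j))"
proof -
  have h: "1 / (real j + 2) \<le> 1 / 2" for j by (simp add: field_simps)
  have D: "pm (\<phi> j) \<in> D" "deriv (pm (\<phi> j)) x \<ge> 1 / 2" for j x by (rule pm_D[OF \<phi> _ h]; simp)+
  have C: "Cinf (\<lambda>j. pm (\<phi> j)) id"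
    unfolding Cinf_def
  proof (intro allI uniform_limitI)
    fix k and e :: real assume e: "e > 0"
    have f: "(deriv ^^ k) (pm (\<phi> j)) = (\<lambda>x. (deriv ^^ k) id x + (deriv ^^ k) (\<phi> j) x)" for j
      using smooth_funpow_add[OF smooth_intros(2) adm_smooth[OF \<phi>(1)], of k j]
      unfolding pm_def[abs_def] id_def .
    have "(\<lambda>j. 1 / (real j + 2)) \<longlonglongrightarrow> 0" by real_asymp
    from order_tendstoD(2)[OF this e] have "\<forall>\<^sub>F j in sequentially. 1 / (real j + 2) < e" .
    moreover have "\<forall>\<^sub>F j in sequentially. k \<le> j" by (rule eventually_ge_at_top)
    ultimately show "\<forall>\<^sub>F j in sequentially. \<forall>x\<in>UNIV. dist ((deriv ^^ k) (pm (\<phi> j)) x) ((deriv ^^ k) id x) < e"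
    proof eventually_elim
      case (elim j)
      have "\<bar>(deriv ^^ k) (\<phi> j) x\<bar> \<le> 1 / (real j + 2)" for x
        using \<phi>(2)[of j] elim(2) by (simp only: tiny_def)
      then show ?case unfolding f dist_real_def using elim(1) by (auto intro: le_less_trans)
    qed
  qed
  from D C Cinf_finv[OF D_Diff01[OF D(1)] D(2) C] show ?thesis by (simp add: null_def)
qed

end

subsection \<open>Perturbing finitely supported actions\<close>

context translation
begin

text \<open>Prepared for induction over \<open>Z\<close>: from block \<open>m\<close> upwards the
  recursion is settled, below \<open>m\<close> the limit action is trivial, and the value that the
  recursion leaves for \<open>b\<close> in block \<open>m - 1\<close> is the error
  \<open>z\<close>.\<close>

definition repairable :: "(nat \<Rightarrow> real \<Rightarrow> real) \<Rightarrow> bool" where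
  "repairable z \<longleftrightarrow> (\<forall>F f M' m. (\<forall>j x n. F j x n \<in> D) \<longrightarrow> dat f \<longrightarrow> (\<forall>x n. near (\<lambda>j. F j x n) (f x n)) \<longrightarrow>
    (\<forall>j x n. n > M' \<longrightarrow> F j x n = id) \<longrightarrow> (\<forall>x n. n < m \<longrightarrow> f x n = id) \<longrightarrow>
    (\<forall>j n. n \<ge> m \<longrightarrow> F j GB (n - 1) = comm (F j GC n) (F j GD n) \<circ> F j GB n) \<longrightarrow>
    (\<forall>j. F j GB (m - 1) = z j) \<longrightarrow>
    (\<exists>F'. (\<forall>j. dat (F' j)) \<and> (\<forall>j x n. n \<ge> m \<longrightarrow> F' j x n = F j x n) \<and> conv (\<lambda>j. mk (F' j)) (mk f)))"

text \<open>For an error \<open>[p, q] z\<close>, put \<open>c = q\<close> and \<open>d = p\<close>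
  in block \<open>m - 1\<close>. The recursion then yields \<open>[q, p] [p, q] z = z\<close> for
  \<open>b\<close> in block \<open>m - 2\<close>, and the limit action is unchanged because
  \<open>p\<close> and \<open>q\<close> tend to the identity. Once the error is the identity,
  everything further down can be taken trivial.\<close>

lemma repair: assumes "Z z" shows "repairable z"
proof (rule Z_induct[where P = repairable, OF assms])
  show "repairable (\<lambda>j. id)"
    unfolding repairable_def
  proof (intro allI impI)
    fix F f M' m
    assume Z_id: "\<forall>j x n. F j x n \<in> D" "dat f" "\<forall>x n. near (\<lambda>j. F j x n) (f x n)"
      "\<forall>j x n. n > M' \<longrightarrow> F j x n = id" "\<forall>x n. n < m \<longrightarrow> f x n = id"
      "\<forall>j n. n \<ge> m \<longrightarrow> F j GB (n - 1) = comm (F j GC n) (F j GD n) \<circ> F j GB n"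
      "\<forall>j. F j GB (m - 1) = id"
    note Z_id = Z_id[rule_format]
    define F' where "F' j x n = (if n \<ge> m then F j x n else id)" for j x n
    define K where "K = nat (max \<bar>m\<bar> \<bar>M'\<bar>)"
    have supp: "F' j x n = id" if "\<bar>n\<bar> > int K" for j x n
    proof (cases "n \<ge> m")
      case True
      have "int K = max \<bar>m\<bar> \<bar>M'\<bar>" by (simp add: K_def)
      then have "n > M'" using that True by linarith
      then show ?thesis using Z_id(4) True by (simp only: F'_def if_True)
    next
      case False
      then show ?thesis by (simp only: F'_def if_False)
    qed
    have "F' j GB (n - 1) = comm (F' j GC n) (F' j GD n) \<circ> F' j GB n" for j n
    proof -
      consider "n > m" | "n = m" | "n < m" by linarith
      then show ?thesis
      proof cases
        case 2
        then show ?thesis using Z_id(6)[of n j] Z_id(7)[of j] by (simp add: F'_def)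
      qed (use Z_id(6)[of n j] in \<open>simp_all add: F'_def comm_def inv_id[unfolded id_def[symmetric]]\<close>)
    qed
    moreover have "F' j x n \<in> D" for j x n using Z_id(1) D_id by (simp add: F'_def)
    ultimately have dF: "dat (F' j)" for j using supp unfolding dat_def by blast
    have nr: "near (\<lambda>j. F' j x n) (f x n)" for x n
      using Z_id(3)[of x n] Z_id(5)[of n x] near_const[OF D_id] by (cases "n \<ge> m") (simp_all add: F'_def)
    have "conv (\<lambda>j. mk (F' j)) (mk f)"
      by (rule conv_mk[OF dF Z_id(2) supp]) (use nr in \<open>auto simp: near_def\<close>)
    then show "\<exists>F'. (\<forall>j. dat (F' j)) \<and> (\<forall>j x n. n \<ge> m \<longrightarrow> F' j x n = F j x n) \<and> conv (\<lambda>j. mk (F' j)) (mk f)"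
      using dF by (intro exI[of _ F']) (simp add: F'_def)
  qed
next
  fix z p q assume hyps: "Z z" "null p" "null q" and IH: "repairable z"
  show "repairable (\<lambda>j. comm (p j) (q j) \<circ> z j)"
    unfolding repairable_def
  proof (intro allI impI)
    fix F f M' m
    assume prems: "\<forall>j x n. F j x n \<in> D" "dat f" "\<forall>x n. near (\<lambda>j. F j x n) (f x n)"
      "\<forall>j x n. n > M' \<longrightarrow> F j x n = id" "\<forall>x n. n < m \<longrightarrow> f x n = id"
      "\<forall>j n. n \<ge> m \<longrightarrow> F j GB (n - 1) = comm (F j GC n) (F j GD n) \<circ> F j GB n"
      "\<forall>j. F j GB (m - 1) = comm (p j) (q j) \<circ> z j"
    note prems = prems[rule_format]
    define F1 where "F1 j = (F j)(GC := (F j GC)(m - 1 := q j), GD := (F j GD)(m - 1 := p j), GB := (F j GB)(m - 2 := z j))" for j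
    have F1: "F1 j GC (m - 1) = q j" "F1 j GD (m - 1) = p j" "F1 j GB (m - 2) = z j"
      "n \<ge> m \<Longrightarrow> F1 j x n = F j x n" "F1 j GB (m - 1) = F j GB (m - 1)"
      "F1 j x n = F j x n \<or> n = m - 1 \<and> x = GC \<and> F1 j x n = q j \<or> n = m - 1 \<and> x = GD \<and> F1 j x n = p j
        \<or> n = m - 2 \<and> x = GB \<and> F1 j x n = z j" for j x n
      by (auto simp: F1_def)
    note d = null_D[OF hyps(2)] null_D[OF hyps(3)] Z_D[OF hyps(1)]
    have "\<exists>F'. (\<forall>j. dat (F' j)) \<and> (\<forall>j x n. n \<ge> m - 1 \<longrightarrow> F' j x n = F1 j x n) \<and> conv (\<lambda>j. mk (F' j)) (mk f)"
    proof (rule IH[unfolded repairable_def, rule_format, where M' = "max M' m"])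
      show "F1 j x n \<in> D" for j x n using F1(6)[of j x n] d[of j] prems(1)[of j x n] by auto
      show "dat f" by fact
      show "near (\<lambda>j. F1 j x n) (f x n)" for x n
      proof -
        have f0: "f x n = id" if "n = m - 1 \<or> n = m - 2" by (rule prems(5)) (use that in auto)
        consider "x = GC \<and> n = m - 1" | "x = GD \<and> n = m - 1" | "x = GB \<and> n = m - 2"
          | "\<not> (x = GC \<and> n = m - 1)" "\<not> (x = GD \<and> n = m - 1)" "\<not> (x = GB \<and> n = m - 2)" by blast
        then show ?thesis
        proof cases
          case 1
          then have "(\<lambda>j. F1 j x n) = q" by (simp add: F1)
          then show ?thesis using f0 1 null_near[OF hyps(3)] by (simp only:) simp
        next
          case 2
          then have "(\<lambda>j. F1 j x n) = p" by (simp add: F1)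
          then show ?thesis using f0 2 null_near[OF hyps(2)] by (simp only:) simp
        next
          case 3
          then have "(\<lambda>j. F1 j x n) = z" by (simp add: F1)
          then show ?thesis using f0 3 null_near[OF Z_null[OF hyps(1)]] by (simp only:) simp
        next
          case 4
          have "F1 j x n = F j x n" for j using F1(6)[of j x n] 4 by blast
          then show ?thesis using prems(3)[of x n] by (simp only:)
        qed
      qed
      show "F1 j x n = id" if "n > max M' m" for j x n using that prems(4) F1(4) by simp
      show "f x n = id" if "n < m - 1" for x n using that prems(5) by simp
      show "F1 j GB (n - 1) = comm (F1 j GC n) (F1 j GD n) \<circ> F1 j GB n" if n: "n \<ge> m - 1" for j n
      proof -
        consider "n > m" | "n = m" | "n = m - 1" using n by linarith
        then show ?thesis
        proof cases
          case 3
          have e: "comm (q j) (p j) \<circ> (comm (p j) (q j) \<circ> z j) = z j"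
            using d[of j] by (simp add: fun_eq_iff comm_apply)
          have "n - 1 = m - 2" using 3 by simp
          then show ?thesis using 3 prems(7)[of j] by (simp add: F1 e)
        qed (use prems(6)[of n j] F1 in simp_all)
      qed
      show "F1 j GB (m - 1 - 1) = z j" for j using F1(3)[of j] by simp
    qed
    then obtain F' where F': "\<forall>j. dat (F' j)" "\<forall>j x n. n \<ge> m - 1 \<longrightarrow> F' j x n = F1 j x n" "conv (\<lambda>j. mk (F' j)) (mk f)" by blast
    then show "\<exists>F'. (\<forall>j. dat (F' j)) \<and> (\<forall>j x n. n \<ge> m \<longrightarrow> F' j x n = F j x n) \<and> conv (\<lambda>j. mk (F' j)) (mk f)"
      using F1(4) by (intro exI[of _ F']) simp
  qed
qed

lemma word_position_bound: "\<exists>M::nat. \<forall>u\<in>set xs. \<bar>fst (snd u)\<bar> \<le> int M" for xs :: pword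
proof (induction xs)
  case (Cons u xs)
  then obtain M where M: "\<forall>u\<in>set xs. \<bar>fst (snd u)\<bar> \<le> int M" by blast
  then show ?case by (intro exI[of _ "max M (nat \<bar>fst (snd u)\<bar>)"]) auto
qed simp

text \<open>On the base block \<open>W\<close> acts by a reduced word in \<open>b_M\<close> and the
  \<open>c_n, d_n\<close> of the window. These are modified independently until the word moves a
  point; the other \<open>b_n\<close> follow from the recursion downwards, and what it leaves below
  the window lies in \<open>Z\<close> and is repaired.\<close>

lemma perturb_word:
  assumes f: "dat f" and W: "expA W = 0" "\<not> weq W []"
  shows "\<exists>F. (\<forall>j. dat (F j)) \<and> conv (\<lambda>j. mk (F j)) (mk f) \<and>
    (\<forall>j. \<exists>y\<in>{l<..<r}. ev (mk (F j)) W y \<noteq> y)"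
proof -
  have fD: "f x n \<in> D" for x n using f by (simp add: dat_def)
  obtain M0 where M0: "\<And>x n. \<bar>n\<bar> > int M0 \<Longrightarrow> f x n = id" using f unfolding dat_def by blast
  obtain M1 where M1: "\<forall>u\<in>set (pull 0 W). \<bar>fst (snd u)\<bar> \<le> int M1" using word_position_bound[of "pull 0 W"] by blast
  \<comment> \<open>The successor makes \<open>f\<close> trivial already in the blocks
    \<open>M\<close> and \<open>- M\<close>; in particular \<open>b_M\<close> is the identity before
    the modification.\<close>
  define M where "M = Suc (max M0 M1)"
  have M: "\<And>x n. \<bar>n\<bar> \<ge> int M \<Longrightarrow> f x n = id" "\<And>u. u \<in> set (pull 0 W) \<Longrightarrow> \<bar>fst (snd u)\<bar> \<le> int M"
    using M0 M1 by (force simp: M_def)+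
  obtain \<rho> where \<rho>: "reduced \<rho>" "\<And>u. u \<in> set \<rho> \<Longrightarrow> pkey u \<in> window M" "weq W (pws \<rho> @ apow (expA W))"
    using normal_form[OF M(2)] by blast
  have wW: "weq W (pws \<rho>)" using \<rho>(3) W(1) by simp
  then have ne: "\<rho> \<noteq> []" using W(2) by auto
  define X where "X k = f (fst k) (snd k)" for k
  \<comment> \<open>Reversed, because \<open>foldl\<close> applies the first letter first and
    \<open>foldr\<close> the last.\<close>
  define ws where "ws = rev (map (\<lambda>u. (pkey u, snd (snd u))) \<rho>)"
  have ws: "ws \<noteq> []" "successively (\<lambda>w w'. \<not> (fst w = fst w' \<and> snd w \<noteq> snd w')) ws"
  proof -
    show "ws \<noteq> []" using ne by (simp add: ws_def)
    show "successively (\<lambda>w w'. \<not> (fst w = fst w' \<and> snd w \<noteq> snd w')) ws"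
      unfolding ws_def successively_rev successively_map
      by (rule successively_mono[OF \<rho>(1)[unfolded reduced_def]]) (auto simp: prod_eq_iff)
  qed
  have "\<exists>\<Phi>. (\<forall>k. adm (\<Phi> k) \<and> tiny (Suc j) (1 / (real j + 2)) (\<Phi> k)) \<and>
    (\<exists>x\<in>{l<..<r}. foldl (\<lambda>x (k, s). (if s then modified X \<Phi> k else finv (modified X \<Phi> k)) x) x ws \<noteq> x)" for j
    by (rule reduced_word_moves[OF _ ws]) (auto simp: X_def fD field_simps)
  from choice[OF allI[OF this]] obtain \<Phi> where all\<Phi>:
    "\<forall>j. (\<forall>k. adm (\<Phi> j k) \<and> tiny (Suc j) (1 / (real j + 2)) (\<Phi> j k)) \<and>
    (\<exists>x\<in>{l<..<r}. foldl (\<lambda>x (k, s). (if s then modified X (\<Phi> j) k else finv (modified X (\<Phi> j) k)) x) x ws \<noteq> x)" ..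
  then have \<Phi>: "adm (\<Phi> j k)" "tiny (Suc j) (1 / (real j + 2)) (\<Phi> j k)" and
    mov: "\<exists>x\<in>{l<..<r}. foldl (\<lambda>x (k, s). (if s then modified X (\<Phi> j) k else finv (modified X (\<Phi> j) k)) x) x ws \<noteq> x" for j k
    using spec[OF all\<Phi>, of j] by blast+
  have null: "null (\<lambda>j. pm (\<Phi> j k))" for k by (rule null_pm) (rule \<Phi>)+
  have cgm: "cg (\<lambda>j. modified X (\<Phi> j) k) (X k)" for k
    unfolding modified_def by (rule cg_right[OF _ null null]) (simp add: X_def fD)
  \<comment> \<open>\<open>b_M\<close> cannot simply be prescribed, as \<open>b\<close> has to be
    trivial further up. Its modification is a single commutator \<open>[p, q]\<close>, and taking
    \<open>p\<close> and \<open>q\<close> as \<open>c\<close> and \<open>d\<close> in block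
    \<open>M + 1\<close> makes the recursion produce it. The flag \<open>s\<close> is False for
    \<open>c\<close> and True for \<open>d\<close>.\<close>
  define C where "C x s j n = (if \<bar>n\<bar> \<le> int M then modified X (\<Phi> j) (x, n)
    else if n = int M + 1 then pm (\<Phi> j ((GB, int M), s)) else id)" for x s j n
  define b where "b j = rec_nat (modified X (\<Phi> j) (GB, int M))
    (\<lambda>k g. comm (C GC False j (int M - int k)) (C GD True j (int M - int k)) \<circ> g)" for j
  have b: "b j 0 = modified X (\<Phi> j) (GB, int M)"
    "b j (Suc k) = comm (C GC False j (int M - int k)) (C GD True j (int M - int k)) \<circ> b j k" for j k
    by (simp_all add: b_def)
  define F where "F j x n = (case x of GA \<Rightarrow> f GA n | GC \<Rightarrow> C GC False j n | GD \<Rightarrow> C GD True j n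
    | GB \<Rightarrow> if n > int M then id else b j (nat (int M - n)))" for j x n
  have cgC: "cg (\<lambda>j. C x s j n) (f x n)" if "n \<le> int M" for x s n
  proof (cases "\<bar>n\<bar> \<le> int M")
    case True
    then show ?thesis using cgm[of "(x, n)"] by (simp add: C_def X_def)
  next
    case False
    then have c: "\<not> - n \<le> int M" "n \<noteq> int M + 1" "int M \<le> \<bar>n\<bar>" using that by linarith+
    have "C x s j n = id" for j unfolding C_def using c(2) False by (simp only: if_False)
    then show ?thesis using M(1)[OF c(3), of x] cg_refl[OF D_id] by (simp only:)
  qed
  have cgb: "cg (\<lambda>j. b j k) (f GB (int M - int k))" for k
  proof (induction k)
    case 0
    then show ?case using cgm[of "(GB, int M)"] by (simp add: b X_def)
  next
    case (Suc k)
    have e: "f GB (int M - int (Suc k)) = comm (f GC (int M - int k)) (f GD (int M - int k)) \<circ> f GB (int M - int k)"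
      using f unfolding dat_def by (metis diff_diff_eq of_nat_Suc add.commute)
    have le: "int M - int k \<le> int M" by simp
    show ?case unfolding e b by (rule cg_comp[OF cg_comm[OF cgC[OF le] cgC[OF le]] Suc])
  qed
  have near: "near (\<lambda>j. F j x n) (f x n)" for x n
  proof -
    have nC: "near (\<lambda>j. C x s j n) (f x n)" for x s
    proof (cases "n \<le> int M")
      case True
      then show ?thesis by (rule cg_near[OF cgC])
    next
      case False
      then have "f x n = id" "\<not> \<bar>n\<bar> \<le> int M" using M(1)[of n x] by auto
      then show ?thesis using null_near[OF null] near_const[OF D_id]
        by (cases "n = int M + 1") (simp_all only: C_def if_True if_False simp_thms)
    qed
    show ?thesis
    proof (cases x)
      case GB
      show ?thesis
      proof (cases "n > int M")
        case True
        then show ?thesis using near_const[OF D_id] M(1)[of n GB] by (simp add: F_def GB)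
      next
        case False
        then show ?thesis using cg_near[OF cgb[of "nat (int M - n)"]] by (simp add: F_def GB)
      qed
    qed (use nC near_const[OF fD] in \<open>simp_all add: F_def\<close>)
  qed
  have FD: "F j x n \<in> D" for j x n using near by (simp add: near_def)
  have rec: "F j GB (n - 1) = comm (F j GC n) (F j GD n) \<circ> F j GB n" for j n
  proof -
    consider "n \<le> int M" | "n = int M + 1" | "n > int M + 1" by linarith
    then show ?thesis
    proof cases
      case 1
      then have e: "nat (int M - (n - 1)) = Suc (nat (int M - n))" "int M - int (nat (int M - n)) = n" by auto
      show ?thesis using 1 by (simp add: F_def e b)
    next
      case 2
      then show ?thesis using M(1)[of "int M" GB] by (simp add: F_def b C_def modified_def X_def)
    next
      case 3
      then show ?thesis by (simp add: F_def C_def comm_def inv_id[unfolded id_def[symmetric]])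
    qed
  qed
  \<comment> \<open>This is position \<open>- M - 1\<close>, the first one below the window. As
    \<open>f\<close> is trivial there, the congruence says that the value of \<open>b\<close> is a
    sequence in \<open>Z\<close>.\<close>
  have f0: "f GB (int M - int (2 * M + 1)) = id" by (rule M(1)) simp
  then obtain z where z: "Z z" "\<And>j. b j (2 * M + 1) = z j"
    using cgb[of "2 * M + 1"] unfolding cg_def by auto
  have "\<exists>F'. (\<forall>j. dat (F' j)) \<and> (\<forall>j x n. n \<ge> - int M \<longrightarrow> F' j x n = F j x n) \<and> conv (\<lambda>j. mk (F' j)) (mk f)"
  proof (rule repair[OF z(1), unfolded repairable_def, rule_format, where M' = "int M + 1"])
    show "F j x n = id" if "n > int M + 1" for j x n
      using that M(1)[of n x] by (cases x) (auto simp: F_def C_def)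
    show "F j GB (- int M - 1) = z j" for j
    proof -
      have "nat (int M - (- int M - 1)) = 2 * M + 1" by simp
      then show ?thesis using z(2)[of j] by (simp add: F_def)
    qed
  qed (use FD f near M(1) rec in auto)
  then obtain F' where F': "\<And>j. dat (F' j)" "\<And>j x n. n \<ge> - int M \<Longrightarrow> F' j x n = F j x n"
    "conv (\<lambda>j. mk (F' j)) (mk f)" by blast
  have moved: "\<exists>y\<in>{l<..<r}. ev (mk (F' j)) W y \<noteq> y" for j
  proof -
    have key: "F' j (fst u) (fst (snd u)) = modified X (\<Phi> j) (pkey u) \<and> fst u \<noteq> GA" if "u \<in> set \<rho>" for u
    proof -
      have "pkey u \<in> window M" by (rule \<rho>(2)[OF that])
      then have "fst u = GB \<and> fst (snd u) = int M \<or> (fst u = GC \<or> fst u = GD) \<and> \<bar>fst (snd u)\<bar> \<le> int M"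
        unfolding window_def by auto
      then show ?thesis using F'(2)[of "fst (snd u)" j "fst u"] by (auto simp: F_def C_def b)
    qed
    have le: "lett (F' j) u = (if snd (snd u) then modified X (\<Phi> j) (pkey u) else finv (modified X (\<Phi> j) (pkey u)))"
      if "u \<in> set \<rho>" for u using key[OF that] by (simp add: lett_def)
    obtain y where y: "y \<in> {l<..<r}" "foldl (\<lambda>x (k, s). (if s then modified X (\<Phi> j) k else finv (modified X (\<Phi> j) k)) x) y ws \<noteq> y"
      using mov by blast
    have "foldl (\<lambda>x (k, s). (if s then modified X (\<Phi> j) k else finv (modified X (\<Phi> j) k)) x) y ws = foldr (lett (F' j)) \<rho> y"
    proof -
      have "foldr (lett (F' j)) \<rho> y = foldr (\<lambda>u. (if snd (snd u) then modified X (\<Phi> j) (pkey u) else finv (modified X (\<Phi> j) (pkey u)))) \<rho> y"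
        by (rule foldr_cong) (simp_all add: le)
      then show ?thesis by (simp add: ws_def foldl_conv_foldr foldr_map o_def)
    qed
    moreover have "ev (mk (F' j)) (pws \<rho>) y = foldr (lett (F' j)) \<rho> y"
      using ev_pws[OF F'(1), of \<rho> y j] key y(1) by auto
    moreover have "ev (mk (F' j)) W = ev (mk (F' j)) (pws \<rho>)"
      by (rule surface_action.ev_phi_weq[OF mk_action[OF F'(1)] wW])
    ultimately show ?thesis using y by (intro bexI[of _ y]) simp_all
  qed
  show ?thesis using F'(1,3) moved by blast
qed

primrec lword :: "(gen \<Rightarrow> int \<Rightarrow> real \<Rightarrow> real) \<Rightarrow> pword \<Rightarrow> real \<Rightarrow> real" where
  "lword f [] = id"
| "lword f (u # \<rho>) = lett f u \<circ> lword f \<rho>"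

lemma lword_D: assumes "dat f" shows "lword f \<rho> \<in> D"
proof (induct \<rho>)
  case Nil
  show ?case by (simp only: lword.simps D_id)
next
  case (Cons u \<rho>)
  show ?case unfolding lword.simps by (rule D_comp[OF lett_D[OF assms] Cons])
qed

lemma lword_foldr: "foldr (lett f) \<rho> t = lword f \<rho> t"
  by (induct \<rho>) (simp_all only: foldr.simps lword.simps o_apply id_apply)

text \<open>On the open block \<open>W\<close> agrees with an element of \<open>D\<close>. If this
  were flat at one point, analyticity would make it the identity on the whole block, against the
  moved point \<open>y\<close>.\<close>

lemma no_flat_points:
  assumes f: "dat f" and W: "expA W = 0" and y: "y \<in> {l<..<r}" "ev (mk f) W y \<noteq> y" and x: "x \<in> {l<..<r}"
  shows "\<not> flat_at (ev (mk f) W) x"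
proof
  assume fl: "flat_at (ev (mk f) W) x"
  obtain M where "\<forall>u\<in>set (pull 0 W). \<bar>fst (snd u)\<bar> \<le> int M" using word_position_bound[of "pull 0 W"] by blast
  then have M: "\<bar>fst (snd u)\<bar> \<le> int M" if "u \<in> set (pull 0 W)" for u using that by blast
  obtain \<rho> where \<rho>: "\<And>u. u \<in> set \<rho> \<Longrightarrow> pkey u \<in> window M" "weq W (pws \<rho> @ apow (expA W))"
  proof (rule normal_form[OF M])
    fix \<rho> assume "\<And>u. u \<in> set \<rho> \<Longrightarrow> pkey u \<in> window M" "weq W (pws \<rho> @ apow (expA W))"
    then show thesis by (rule that)
  qed
  have nGA: "fst u \<noteq> GA" if "u \<in> set \<rho>" for u using \<rho>(1)[OF that] by (auto simp: window_def)
  have "ev (mk f) W = ev (mk f) (pws \<rho>)"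
    using surface_action.ev_phi_weq[OF mk_action[OF f] \<rho>(2)] W by simp
  then have e: "ev (mk f) W t = foldr (lett f) \<rho> t" if "t \<in> {l<..<r}" for t
    using ev_pws[OF f nGA, of \<rho> t] that by auto
  define g where "g = lword f \<rho>"
  have g: "foldr (lett f) \<rho> t = g t" for t unfolding g_def by (rule lword_foldr)
  have gD: "g \<in> D" unfolding g_def by (rule lword_D[OF f])
  have "flat_at g x"
    unfolding flat_at_def
  proof
    fix k
    have "(deriv ^^ k) (ev (mk f) W) x = (deriv ^^ k) g x"
      by (rule deriv_local[of "{l<..<r}"]) (use x e g in auto)
    then show "(deriv ^^ k) g x = (deriv ^^ k) id x" using fl unfolding flat_at_def by metis
  qed
  moreover have "ana_at g t" if "t \<in> {l<..<r}" for t using gD that by (simp add: D_def)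
  ultimately have "g y = y" using analytic_flat_imp_id[OF Diff01D(2)[OF D_Diff01[OF gD]] _ x _ y(1)] by blast
  then show False using y(2) e[OF y(1)] g by simp
qed

text \<open>In block \<open>M + 1\<close>, where the action is trivial, \<open>c\<close> becomes a
  small push \<open>N j\<close> to the right while \<open>d\<close> stays the identity. Their
  commutator is trivial, so the recursion is undisturbed and nothing has to be repaired. Carried
  back to the base block, the iterates of \<open>N j\<close> and its inverse sweep all of
  it.\<close>

lemma perturb_orbit:
  assumes f: "dat f" and pq: "l \<le> p" "p < q" "q \<le> r" and x0: "x0 \<in> {l<..<r}"
  shows "\<exists>F. (\<forall>j. dat (F j)) \<and> conv (\<lambda>j. mk (F j)) (mk f) \<and> (\<forall>j. \<exists>w. ev (mk (F j)) w x0 \<in> {p<..<q})"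
proof -
  have fD: "f x n \<in> D" for x n using f by (simp add: dat_def)
  obtain M where M: "\<And>x n. \<bar>n\<bar> > int M \<Longrightarrow> f x n = id" using f unfolding dat_def by blast
  define n0 where "n0 = int M + 1"
  \<comment> \<open>The first bound makes the pushes tend to the identity; the second makes them too
    short to jump over \<open>(p, q)\<close>.\<close>
  define \<eta> where "\<eta> j = min (1 / (real j + 2)) ((q - p) / 3)" for j
  have \<eta>: "0 < \<eta> j" "\<eta> j \<le> 1 / (real j + 2)" "\<eta> j < (q - p) / 2" for j using pq by (auto simp: \<eta>_def min_def)
  have "\<exists>c>0. tiny (Suc j) (\<eta> j) (\<lambda>x. c * bump l r x)" for j
  proof -
    have k: "ker_fun {} = bump l r" by (simp add: ker_fun_def[abs_def])
    obtain d where d: "d > 0" "\<And>c. \<bar>c\<bar> < d \<Longrightarrow> tiny (Suc j) (\<eta> j) (\<lambda>x. 0 + c * ker_fun {} x)"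
      using tiny_add_small[OF adm_zero adm_ker_fun[OF finite.emptyI] tiny_zero[OF order_refl] \<eta>(1)] by metis
    have "tiny (Suc j) (\<eta> j) (\<lambda>x. 0 + d / 2 * ker_fun {} x)" by (rule d(2)) (use d(1) in simp)
    then have "tiny (Suc j) (\<eta> j) (\<lambda>x. d / 2 * bump l r x)" unfolding add_0 k .
    moreover have "d / 2 > 0" using d(1) by simp
    ultimately show ?thesis by blast
  qed
  then obtain c where c: "\<And>j. c j > 0" "\<And>j. tiny (Suc j) (\<eta> j) (\<lambda>x. c j * bump l r x)" by metis
  define N where "N j = pm (\<lambda>x. c j * bump l r x)" for j
  have adm: "adm (\<lambda>x. c j * bump l r x)" for j
    using adm_add_cmult[OF adm_zero adm_ker_fun[OF finite.emptyI], of "c j"] by (simp add: ker_fun_def[abs_def])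
  have "tiny (Suc j) (1 / (real j + 2)) (\<lambda>x. c j * bump l r x)" for j
    using c(2)[of j] \<eta>(2)[of j] unfolding tiny_def by (meson order_trans)
  then have null: "null N" unfolding N_def[abs_def] by (intro null_pm adm)
  have ND: "N j \<in> D" for j by (rule null_D[OF null])
  have step: "N j x \<le> x + \<eta> j" "x < N j x \<longleftrightarrow> x \<in> {l<..<r}" for j x
  proof -
    have "\<bar>(deriv ^^ 0) (\<lambda>x. c j * bump l r x) x\<bar> \<le> \<eta> j" using c(2)[of j] unfolding tiny_def by blast
    then show "N j x \<le> x + \<eta> j" by (simp add: N_def pm_def abs_le_iff)
    show "x < N j x \<longleftrightarrow> x \<in> {l<..<r}"
      using bump_pos[of l x r] bump_zero[of x l r] c(1)[of j] by (cases "x \<in> {l<..<r}") (simp_all add: N_def pm_def)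
  qed
  define F where "F j = f(GC := (f GC)(n0 := N j))" for j
  have F: "F j x n = (if x = GC \<and> n = n0 then N j else f x n)" for j x n by (simp add: F_def)
  have f0: "f x n0 = id" for x using M[of n0 x] by (simp add: n0_def)
  have FD: "F j x n \<in> D" for j x n using ND fD by (simp add: F)
  have supp: "F j x n = id" if "\<bar>n\<bar> > int (Suc M)" for j x n
  proof -
    have "n \<noteq> n0" "\<bar>n\<bar> > int M" unfolding n0_def using that by linarith+
    then show ?thesis using M[of n x] by (simp only: F simp_thms if_False)
  qed
  have rec: "F j GB (n - 1) = comm (F j GC n) (F j GD n) \<circ> F j GB n" for j n
  proof (cases "n = n0")
    case True
    have "f GB (n0 - 1) = comm (f GC n0) (f GD n0) \<circ> f GB n0" using f unfolding dat_def by blast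
    then have "f GB (n0 - 1) = id" by (simp add: f0 comm_id inv_id[unfolded id_def[symmetric]])
    then show ?thesis using True by (simp add: F f0 comm_id D_cancel[OF ND])
  qed (use f in \<open>simp add: F dat_def\<close>)
  have dF: "dat (F j)" for j using FD supp rec unfolding dat_def by blast
  have near: "near (\<lambda>j. F j x n) (f x n)" for x n
    using null_near[OF null] near_const[OF fD] by (cases "x = GC \<and> n = n0") (auto simp: F f0)
  have cv: "conv (\<lambda>j. mk (F j)) (mk f)"
    by (rule conv_mk[where M = "Suc M", OF dF f supp]) (use near in \<open>auto simp: near_def\<close>)
  have "\<exists>w. ev (mk (F j)) w x0 \<in> {p<..<q}" for j
  proof -
    have letter: "ev (mk (F j)) (pw (GC, n0, s)) y = (if s then N j else finv (N j)) y" if "y \<in> {l..<r}" for s y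
      using ev_pw[OF dF _ that, of "(GC, n0, s)" j] by (simp add: lett_def F)
    have mem: "(N j ^^ k) y \<in> {l<..<r} \<longleftrightarrow> y \<in> {l<..<r}" "(finv (N j) ^^ k) y \<in> {l<..<r} \<longleftrightarrow> y \<in> {l<..<r}" for k y
      by (induction k) (simp_all only: funpow.simps o_apply id_apply D_mem[OF ND] D_mem[OF D_finv[OF ND]])
    have pow: "\<exists>w. ev (mk (F j)) w x0 = ((if s then N j else finv (N j)) ^^ k) x0" for s k
    proof (induction k)
      case 0
      show ?case by (rule exI[of _ "[]"]) simp
    next
      case (Suc k)
      then obtain w where w: "ev (mk (F j)) w x0 = ((if s then N j else finv (N j)) ^^ k) x0" by blast
      have "((if s then N j else finv (N j)) ^^ k) x0 \<in> {l..<r}"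
        using mem[of k x0] x0 by (cases s) auto
      then show ?case using w letter[of _ s]
        by (intro exI[of _ "pw (GC, n0, s) @ w"]) (simp add: ev_append del: pw.simps)
    qed
    have cont: "continuous_on UNIV (N j)" by (rule Diff01_cont[OF D_Diff01[OF ND]])
    have less_r: "N j x < r" if "x < r" for x
      using Diff01_mono[OF D_Diff01[OF ND] that] D_off[OF ND, of r] by simp
    define t where "t = (p + q) / 2"
    have t: "p < t" "t < q" "t \<in> {l<..<r}" using pq by (auto simp: t_def)
    have exc: "\<exists>k. (N j ^^ k) y > y'" if "y \<in> {l<..<r}" "y' < r" for y y'
      by (rule iterates_exceed[OF cont _ less_r]) (use that step in auto)
    have ex2: "\<exists>k. (N j ^^ k) y \<le> y' \<and> y' < (N j ^^ Suc k) y" if "y \<in> {l<..<r}" "y \<le> y'" "y' < r" for y y'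
    proof -
      define k where "k = (LEAST k. (N j ^^ k) y > y')"
      have k: "(N j ^^ k) y > y'" unfolding k_def using exc[OF that(1,3)] by (rule LeastI_ex)
      have "k \<noteq> 0" using k that(2) by (cases k) auto
      then obtain m where m: "k = Suc m" by (cases k) auto
      then have "\<not> (N j ^^ m) y > y'" using not_less_Least[of m "\<lambda>k. (N j ^^ k) y > y'"] unfolding k_def by simp
      then show ?thesis using k m by (intro exI[of _ m]) simp
    qed
    show ?thesis
    proof (cases "x0 \<le> p")
      case True
      obtain k where k: "(N j ^^ k) x0 \<le> p" "p < (N j ^^ Suc k) x0"
        using ex2[OF x0 True] pq by auto
      have "(N j ^^ Suc k) x0 \<le> (N j ^^ k) x0 + \<eta> j" using step(1) by simp
      then have h: "(N j ^^ Suc k) x0 \<in> {p<..<q}" using k \<eta>(3)[of j] pq by (simp add: field_simps)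
      obtain w where w: "ev (mk (F j)) w x0 = ((if True then N j else finv (N j)) ^^ Suc k) x0"
        using pow[of "Suc k" True] by blast
      show ?thesis by (rule exI[of _ w]) (simp only: w if_True h)
    next
      case False
      show ?thesis
      proof (cases "x0 < q")
        case True
        then show ?thesis using False by (intro exI[of _ "[]"]) simp
      next
        case q: False
        \<comment> \<open>To come from the right, \<open>x0\<close> is compared with the orbit of
          the midpoint \<open>t\<close>: if it lies between the \<open>k\<close>-th and the next
          iterate of \<open>t\<close>, then \<open>k\<close> steps backwards lead between
          \<open>t\<close> and \<open>N j t\<close>, hence into \<open>(p, q)\<close>.\<close>
        obtain k where k: "(N j ^^ k) t \<le> x0" "x0 < (N j ^^ Suc k) t"
          using ex2[OF t(3), of x0] t q x0 by auto
        have inv: "(finv (N j) ^^ k) ((N j ^^ k) y) = y" "(N j ^^ k) ((finv (N j) ^^ k) y) = y" for y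
          using bij_is_inj[OF D_bij[OF ND, of j]] inv_fn_o_fn_is_id[OF D_bij[OF ND, of j], of k] fn_o_inv_fn_is_id[OF D_bij[OF ND, of j], of k]
          by (simp_all add: fun_eq_iff)
        have mono: "(N j ^^ k) x < (N j ^^ k) y \<longleftrightarrow> x < y" for x y
          by (induction k) (simp_all add: Diff01_less_iff[OF D_Diff01[OF ND]])
        let ?v = "(finv (N j) ^^ k) x0"
        have "t \<le> ?v" using mono[of ?v t] k(1) inv(2)[of x0] by (simp only: not_less[symmetric] simp_thms)
        moreover have "?v < N j t"
          using mono[of ?v "N j t"] k(2) inv(2)[of x0] by (simp only: funpow_Suc_right o_apply simp_thms)
        ultimately have h: "?v \<in> {p<..<q}" using step(1)[of j t] t \<eta>(3)[of j] by (simp add: t_def field_simps)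
        obtain w where w: "ev (mk (F j)) w x0 = ((if False then N j else finv (N j)) ^^ k) x0"
          using pow[of k False] by blast
        show ?thesis by (rule exI[of _ w]) (simp only: w if_False h)
      qed
    qed
  qed
  then show ?thesis using dF cv by blast
qed

end

subsection \<open>Limits of finitely supported actions\<close>

instance gen :: countable
  by countable_datatype

lemma ucl_diff_iff: "ucl (\<lambda>j x. F j x - c x) (\<lambda>x. f x - c x) \<longleftrightarrow> ucl F f"
  by (simp add: uniform_limit_iff dist_real_def)

lemma ucl_tendsto:
  assumes F: "ucl F f" "isCont f x" "z \<longlonglongrightarrow> x"
  shows "(\<lambda>j. F j (z j)) \<longlonglongrightarrow> f x"
proof (rule Lim_transform)
  show "(\<lambda>j. f (z j)) \<longlonglongrightarrow> f x" using F(2,3) by (rule isCont_tendsto_compose)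
  show "(\<lambda>j. F j (z j) - f (z j)) \<longlonglongrightarrow> 0"
  proof (rule tendstoI)
    fix e :: real assume "e > 0"
    from uniform_limitD[OF F(1) this]
    show "\<forall>\<^sub>F j in sequentially. dist (F j (z j) - f (z j)) 0 < e"
      by (rule eventually_mono) (simp add: dist_real_def)
  qed
qed

lemma ucl_pointwise: "ucl F f \<Longrightarrow> (\<lambda>j. F j x) \<longlonglongrightarrow> f x"
  using tendsto_uniform_limitI by fastforce

lemma Cinf_pointwise: "Cinf F f \<Longrightarrow> (\<lambda>j. F j x) \<longlonglongrightarrow> f x"
  using ucl_pointwise[of F f x] CL_ucl Cinf_iff_CL by blast

text \<open>Subtracting the identity leaves a function that vanishes off \<open>[0,1]\<close>, hence
  a bounded one, whereas the map itself is unbounded.\<close>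

definition dev :: "nat \<Rightarrow> (real \<Rightarrow> real) \<Rightarrow> real \<Rightarrow> real" where
  "dev k f x = (deriv ^^ k) f x - (deriv ^^ k) id x"

lemma dev_bcontfun: assumes f: "f \<in> carrier Diff01" shows "dev k f \<in> bcontfun"
proof -
  have c: "continuous_on S (dev k f)" for S
    unfolding dev_def by (intro continuous_on_diff smooth_cont smooth_funpow Diff01D(2)[OF f] smooth_intros(3))
  have z: "dev k f x = 0" if "x \<notin> {0..1}" for x
  proof -
    have "(deriv ^^ k) f x = (deriv ^^ k) id x"
      by (rule deriv_local[of "- {0..1}"]) (use that Diff01D(4)[OF f] in auto)
    then show ?thesis by (simp only: dev_def diff_self)
  qed
  have "bounded (dev k f ` {0..1} \<union> {0})"
    using compact_imp_bounded[OF compact_continuous_image[OF c]] by simp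
  then have "bounded (range (dev k f))" by (rule bounded_subset) (use z in force)
  then show ?thesis using c by (simp add: bcontfun_def)
qed

text \<open>A point of a countable product of spaces of bounded continuous functions, with one
  factor for each letter and each order of derivative. The product is a complete metric space, and
  convergence in it is \<open>conv\<close>.\<close>

definition enc :: "(gen \<Rightarrow> real \<Rightarrow> real) \<Rightarrow> (gen \<times> bool) \<times> nat \<Rightarrow> real \<Rightarrow>\<^sub>C real" where
  "enc \<phi> i = Bcontfun (dev (snd i) (evl \<phi> (fst i)))"

lemma evl_Diff01: "(\<And>x. \<phi> x \<in> carrier Diff01) \<Longrightarrow> evl \<phi> u \<in> carrier Diff01"
  by (simp add: evl_def Diff01_finv)

lemma apply_enc: "(\<And>x. \<phi> x \<in> carrier Diff01) \<Longrightarrow> apply_bcontfun (enc \<phi> (u, k)) = dev k (evl \<phi> u)"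
  using Bcontfun_inverse[OF dev_bcontfun[OF evl_Diff01]] by (simp add: enc_def)

lemma tendsto_fun_iff:
  fixes f :: "nat \<Rightarrow> 'i \<Rightarrow> 'b::topological_space"
  shows "f \<longlonglongrightarrow> g \<longleftrightarrow> (\<forall>i. (\<lambda>j. f j i) \<longlonglongrightarrow> g i)"
  using limitin_componentwise[of "\<lambda>_. euclidean" UNIV f g sequentially]
  by (simp add: euclidean_product_topology)

lemma tendsto_bcontfun_iff:
  fixes f :: "nat \<Rightarrow> real \<Rightarrow>\<^sub>C real"
  shows "f \<longlonglongrightarrow> g \<longleftrightarrow> ucl (\<lambda>j. apply_bcontfun (f j)) (apply_bcontfun g)"
  using tendsto_bcontfun_uniform_limit uniform_limit_tendsto_bcontfun by blast

context translation
begin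

lemma conv_enc:
  assumes "\<And>j x. F j x \<in> carrier Diff01" "\<And>x. \<phi> x \<in> carrier Diff01"
  shows "conv F \<phi> \<longleftrightarrow> (\<lambda>j. enc (F j)) \<longlonglongrightarrow> enc \<phi>"
proof -
  have e: "(\<lambda>j. enc (F j) (u, k)) \<longlonglongrightarrow> enc \<phi> (u, k) \<longleftrightarrow>
      ucl (\<lambda>j. (deriv ^^ k) (evl (F j) u)) ((deriv ^^ k) (evl \<phi> u))" for u k
    unfolding tendsto_bcontfun_iff apply_enc[OF assms(1)] apply_enc[OF assms(2)] dev_def[abs_def] ucl_diff_iff ..
  have "conv F \<phi> \<longleftrightarrow> (\<forall>u k. (\<lambda>j. enc (F j) (u, k)) \<longlonglongrightarrow> enc \<phi> (u, k))"
    by (simp only: conv_def Cinf_def e)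
  also have "\<dots> \<longleftrightarrow> (\<lambda>j. enc (F j)) \<longlonglongrightarrow> enc \<phi>"
    by (simp only: tendsto_fun_iff split_paired_All)
  finally show ?thesis .
qed

definition fin :: "(gen \<Rightarrow> real \<Rightarrow> real) set" where
  "fin = mk ` Collect dat"

definition lim :: "(gen \<Rightarrow> real \<Rightarrow> real) set" where
  "lim = {\<phi>. (\<forall>x. \<phi> x \<in> carrier Diff01) \<and> (\<exists>F. (\<forall>j. F j \<in> fin) \<and> conv F \<phi>)}"

lemma fin_Diff01: "\<phi> \<in> fin \<Longrightarrow> \<phi> x \<in> carrier Diff01"
  by (auto simp: fin_def mk_Diff01)

lemma lim_Diff01: "\<phi> \<in> lim \<Longrightarrow> \<phi> x \<in> carrier Diff01"
  by (simp add: lim_def)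

lemma fin_lim: "\<phi> \<in> fin \<Longrightarrow> \<phi> \<in> lim"
  unfolding lim_def using fin_Diff01 Cinf_const by (auto intro!: exI[of _ "\<lambda>_. \<phi>"] simp: conv_def)

text \<open>The limits of the derivatives are the derivatives of the limit, and the limits of the
  inverse letters invert it. So every point of the closure encodes an action by
  diffeomorphisms.\<close>

lemma closure_fin:
  assumes "t \<in> closure (enc ` fin)"
  obtains \<phi> where "\<phi> \<in> lim" "enc \<phi> = t"
proof -
  obtain e where e: "\<forall>j. e j \<in> enc ` fin" "e \<longlonglongrightarrow> t"
    using closure_sequential[THEN iffD1, OF assms] by blast
  define F where "F j = inv_into fin enc (e j)" for j
  have F: "F j \<in> fin" "e j = enc (F j)" for j
    unfolding F_def using e(1) by (simp_all only: inv_into_into f_inv_into_f)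
  have FD: "F j x \<in> carrier Diff01" for j x by (rule fin_Diff01[OF F(1)])
  define g where "g u k x = apply_bcontfun (t (u, k)) x + (deriv ^^ k) id x" for u k x
  have u: "ucl (\<lambda>j. (deriv ^^ k) (evl (F j) u)) (g u k)" for u k
  proof -
    have "(\<lambda>j. e j (u, k)) \<longlonglongrightarrow> t (u, k)"
      by (rule tendsto_fun_iff[THEN iffD1, OF e(2), rule_format])
    then have "ucl (\<lambda>j x. (deriv ^^ k) (evl (F j) u) x - (deriv ^^ k) id x) (apply_bcontfun (t (u, k)))"
      unfolding F(2) tendsto_bcontfun_iff apply_enc[OF FD] dev_def[abs_def] .
    moreover have "apply_bcontfun (t (u, k)) = (\<lambda>x. g u k x - (deriv ^^ k) id x)" by (simp add: g_def)
    ultimately show ?thesis by (simp only: ucl_diff_iff)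
  qed
  have sm: "smooth (evl (F j) u)" for j u by (rule Diff01D(2)[OF evl_Diff01[OF FD]])
  have g: "smooth (g u 0)" "(deriv ^^ k) (g u 0) = g u k" for u k
    using Cinf_limit[where F = "\<lambda>j. evl (F j) u" and g = "g u", OF sm u] by blast+
  have u0: "ucl (\<lambda>j. evl (F j) v) (g v 0)" for v using u[of 0 v] by simp
  have inverse: "g u 0 (g (ilet u) 0 y) = y" for u y
  proof -
    have "(\<lambda>j. evl (F j) u (evl (F j) (ilet u) y)) \<longlonglongrightarrow> g u 0 (g (ilet u) 0 y)"
      by (rule ucl_tendsto[OF u0 _ ucl_pointwise[OF u0]])
        (use smooth_cont[OF g(1), of UNIV] in \<open>simp add: continuous_on_eq_continuous_at\<close>)
    moreover have "evl (F j) u (evl (F j) (ilet u) y) = y" for j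
      using Diff01_finv_simps[OF FD[of j "fst u"]] by (cases "snd u") (simp_all add: evl_def ilet_def)
    ultimately show ?thesis by (simp add: LIMSEQ_const_iff)
  qed
  define \<phi> where "\<phi> x = g (x, True) 0" for x
  have fi: "finv (\<phi> x) = g (x, False) 0" and bij: "bij (\<phi> x)" for x
  proof -
    have 1: "\<phi> x \<circ> g (x, False) 0 = id" "g (x, False) 0 \<circ> \<phi> x = id"
      using inverse[of "(x, True)"] inverse[of "(x, False)"] by (simp_all add: \<phi>_def ilet_def fun_eq_iff)
    then show "finv (\<phi> x) = g (x, False) 0" by (intro inv_unique_comp)
    show "bij (\<phi> x)" by (rule o_bij[OF 1(2,1)])
  qed
  have off: "\<phi> x y = y" if y: "y \<notin> {0<..<1}" for x y
  proof -
    have "(\<lambda>j. evl (F j) (x, True) y) \<longlonglongrightarrow> \<phi> x y" unfolding \<phi>_def by (rule ucl_pointwise[OF u0])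
    moreover have "evl (F j) (x, True) y = y" for j by (rule Diff01D(4)[OF evl_Diff01[OF FD] y])
    ultimately show ?thesis by (simp add: LIMSEQ_const_iff)
  qed
  have \<phi>D: "\<phi> x \<in> carrier Diff01" for x
    using off bij fi g(1) by (simp add: Diff01_def smooth_diffeo_def) (simp add: \<phi>_def g(1))
  have ev: "evl \<phi> u = g u 0" for u
    by (cases u) (simp add: evl_def fi[unfolded \<phi>_def] \<phi>_def)
  have "conv F \<phi>" unfolding conv_def Cinf_def ev g(2) using u by blast
  then have "\<phi> \<in> lim" using \<phi>D F(1) unfolding lim_def by blast
  moreover have "enc \<phi> = t"
  proof (rule ext)
    fix i show "enc \<phi> i = t i"
    proof (cases i)
      case (Pair v k)
      show ?thesis unfolding Pair
        by (rule bcontfun_eqI) (simp add: apply_enc[OF \<phi>D] dev_def ev g(2) g_def)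
    qed
  qed
  ultimately show ?thesis by (rule that)
qed

lemma enc_lim: "\<phi> \<in> lim \<Longrightarrow> enc \<phi> \<in> closure (enc ` fin)"
proof -
  assume \<phi>: "\<phi> \<in> lim"
  then obtain F where F: "\<And>j. F j \<in> fin" "conv F \<phi>" unfolding lim_def by blast
  have "(\<lambda>j. enc (F j)) \<longlonglongrightarrow> enc \<phi>"
    by (rule conv_enc[of F \<phi>, OF fin_Diff01[OF F(1)] lim_Diff01[OF \<phi>], THEN iffD1, OF F(2)])
  moreover have "\<forall>j. enc (F j) \<in> enc ` fin" using F(1) by (simp only: imageI simp_thms)
  ultimately show ?thesis unfolding closure_sequential by (intro exI[of _ "\<lambda>j. enc (F j)"] conjI)
qed

lemma enc_inj:
  assumes "\<phi> \<in> lim" "\<psi> \<in> lim" "enc \<phi> = enc \<psi>"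
  shows "\<phi> = \<psi>"
proof (intro ext)
  fix x y
  have "apply_bcontfun (enc \<phi> ((x, True), 0)) y = apply_bcontfun (enc \<psi> ((x, True), 0)) y"
    unfolding assms(3) ..
  then have "dev 0 (evl \<phi> (x, True)) y = dev 0 (evl \<psi> (x, True)) y"
    unfolding apply_enc[OF lim_Diff01[OF assms(1)]] apply_enc[OF lim_Diff01[OF assms(2)]] .
  then show "\<phi> x y = \<psi> x y" by (simp add: dev_def evl_def)
qed

text \<open>Openness of \<open>Q\<close> is stated sequentially: its negation passes to limits.
  Density need only be checked near finitely supported actions, since these are dense in
  \<open>lim\<close> by construction. Baire's theorem is applied to the closure of their
  encodings.\<close>

lemma baire:
  assumes cnt: "countable \<Q>"
    and op: "\<And>Q F \<phi>. Q \<in> \<Q> \<Longrightarrow> \<phi> \<in> lim \<Longrightarrow> (\<And>j. F j \<in> lim) \<Longrightarrow> conv F \<phi> \<Longrightarrow> (\<And>j. \<not> Q (F j)) \<Longrightarrow> \<not> Q \<phi>"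
    and dense: "\<And>Q f. Q \<in> \<Q> \<Longrightarrow> dat f \<Longrightarrow> \<exists>F. (\<forall>j. dat (F j)) \<and> conv (\<lambda>j. mk (F j)) (mk f) \<and> (\<forall>j. Q (mk (F j)))"
  shows "\<exists>\<phi>\<in>lim. \<forall>Q\<in>\<Q>. Q \<phi>"
proof -
  define X where "X = closure (enc ` fin)"
  define G where "G Q = enc ` {\<phi> \<in> lim. Q \<phi>}" for Q
  have GX: "G Q \<subseteq> X" for Q using enc_lim by (auto simp: G_def X_def)
  interpret S: Submetric UNIV dist X by unfold_locales auto
  have top: "S.sub.mtopology = top_of_set X" by (simp add: S.mtopology_submetric)
  have comp: "S.sub.mcomplete"
    by (subst S.closedin_eq_mcomplete[symmetric]) (simp_all add: X_def complete_UNIV)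
  have opG: "openin (top_of_set X) (G Q)" if Q: "Q \<in> \<Q>" for Q
  proof -
    have "closed (X - G Q)"
      unfolding closed_sequential_limits
    proof (intro allI impI, elim conjE)
      fix e t assume e: "\<forall>n. e n \<in> X - G Q" "e \<longlonglongrightarrow> t"
      have tX: "t \<in> X" using e closed_closure[of "enc ` fin"] unfolding X_def closed_sequential_limits by blast
      obtain \<phi> where \<phi>: "\<phi> \<in> lim" "enc \<phi> = t" using closure_fin tX unfolding X_def by blast
      have "\<forall>n. \<exists>\<psi>. \<psi> \<in> lim \<and> enc \<psi> = e n" using closure_fin e(1) unfolding X_def by (metis DiffD1)
      then obtain F where F: "\<And>n. F n \<in> lim" "\<And>n. enc (F n) = e n" by metis
      have "conv F \<phi>" unfolding conv_enc[of F \<phi>, OF lim_Diff01[OF F(1)] lim_Diff01[OF \<phi>(1)]] F(2) \<phi>(2) by (rule e(2))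
      moreover have "\<not> Q (F n)" for n
      proof
        assume "Q (F n)"
        then have "e n \<in> G Q" unfolding G_def using F by (metis (mono_tags) imageI mem_Collect_eq)
        then show False using e(1) by blast
      qed
      ultimately have n: "\<not> Q \<phi>" using op[OF Q \<phi>(1), of F] F(1) by blast
      have "t \<notin> G Q"
      proof
        assume "t \<in> G Q"
        then obtain \<psi> where "\<psi> \<in> lim" "Q \<psi>" "t = enc \<psi>" by (auto simp: G_def)
        then show False using n enc_inj[OF \<phi>(1), of \<psi>] \<phi>(2) by simp
      qed
      then show "t \<in> X - G Q" using tX by blast
    qed
    then have "openin (top_of_set X) (X - (X - G Q))"
      by (intro openin_diff closed_subset) auto
    moreover have "X - (X - G Q) = G Q" using GX by blast
    ultimately show ?thesis by simp
  qed
  have dnG: "(top_of_set X) closure_of (G Q) = X" if Q: "Q \<in> \<Q>" for Q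
  proof -
    have "enc ` fin \<subseteq> closure (G Q)"
    proof
      fix t assume "t \<in> enc ` fin"
      then obtain f where f: "dat f" "t = enc (mk f)" by (auto simp: fin_def)
      obtain F where F: "\<And>j. dat (F j)" "conv (\<lambda>j. mk (F j)) (mk f)" "\<And>j. Q (mk (F j))"
        using dense[OF Q f(1)] by blast
      have "(\<lambda>j. enc (mk (F j))) \<longlonglongrightarrow> enc (mk f)"
        using F(2) conv_enc[of "\<lambda>j. mk (F j)" "mk f", OF mk_Diff01[OF F(1)] mk_Diff01[OF f(1)]] by blast
      moreover have "enc (mk (F j)) \<in> G Q" for j
        unfolding G_def by (rule imageI) (use F fin_lim in \<open>auto simp: fin_def\<close>)
      ultimately show "t \<in> closure (G Q)" unfolding closure_sequential f(2)
        by (intro exI[of _ "\<lambda>j. enc (mk (F j))"]) simp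
    qed
    then have "X \<subseteq> closure (G Q)" unfolding X_def by (rule closure_minimal) simp
    moreover have "X \<inter> G Q = G Q" using GX by blast
    ultimately show ?thesis unfolding closure_of_subtopology by auto
  qed
  have "S.sub.mtopology closure_of \<Inter>(insert X (G ` \<Q>)) = X"
  proof (rule S.sub.metric_Baire_category[OF comp])
    show "countable (insert X (G ` \<Q>))" using cnt by simp
    fix T assume T: "T \<in> insert X (G ` \<Q>)"
    show "openin S.sub.mtopology T \<and> S.sub.mtopology closure_of T = X"
      unfolding top
    proof (cases "T = X")
      case True
      then show "openin (top_of_set X) T \<and> top_of_set X closure_of T = X"
        using closure_of_topspace[of "top_of_set X"] by simp
    next
      case False
      then obtain Q where "Q \<in> \<Q>" "T = G Q" using T by blast
      then show "openin (top_of_set X) T \<and> top_of_set X closure_of T = X" using opG dnG by simp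
    qed
  qed
  moreover have "X \<noteq> {}"
  proof -
    have "dat (\<lambda>_ _. id)" unfolding dat_def by (auto simp: D_id comm_id(1) inv_id)
    then have "enc (mk (\<lambda>_ _. id)) \<in> enc ` fin" by (simp add: fin_def)
    then show ?thesis using closure_subset unfolding X_def by blast
  qed
  ultimately have "\<Inter>(insert X (G ` \<Q>)) \<noteq> {}" by (metis closure_of_empty)
  then obtain t where t: "t \<in> X" "\<And>Q. Q \<in> \<Q> \<Longrightarrow> t \<in> G Q" by auto
  obtain \<phi> where \<phi>: "\<phi> \<in> lim" "enc \<phi> = t" using closure_fin t(1) unfolding X_def by blast
  have "Q \<phi>" if Q: "Q \<in> \<Q>" for Q
  proof -
    obtain \<psi> where "\<psi> \<in> lim" "Q \<psi>" "t = enc \<psi>" using t(2)[OF Q] by (auto simp: G_def)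
    then show ?thesis using enc_inj[OF \<phi>(1), of \<psi>] \<phi>(2) by simp
  qed
  then show ?thesis using \<phi>(1) by blast
qed

end

lemma ucl_subseq:
  assumes "ucl F f" "strict_mono s"
  shows "ucl (\<lambda>j. F (s j)) f"
proof (rule uniform_limitI)
  fix e :: real assume "e > 0"
  from eventually_subseq[OF assms(2) uniform_limitD[OF assms(1) this]]
  show "\<forall>\<^sub>F j in sequentially. \<forall>x\<in>UNIV. dist (F (s j) x) (f x) < e" .
qed

lemma expA_append: "expA (u @ v) = expA u + expA v"
  by (induction u rule: expA.induct) simp_all

lemma expA_apow: "expA (apow n) = n"
proof -
  have "expA (replicate k (GA, s)) = (if s then int k else - int k)" for k s
    by (induction k) simp_all
  then show ?thesis by (simp add: apow_def)
qed

context translation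
begin

definition x0 :: real where "x0 = (l + r) / 2"

lemma x0: "x0 \<in> {l<..<r}"
  using lr by (simp add: x0_def)

text \<open>Compact intervals that exhaust the open block. Absence of flat points on the open block
  itself would not be an open condition, since flat points of a sequence of actions might run to the
  ends.\<close>

definition core :: "nat \<Rightarrow> real set" where
  "core m = {l + (r - l) / (real m + 3) .. r - (r - l) / (real m + 3)}"

lemma core_subset: "core m \<subseteq> {l<..<r}"
proof -
  have "(r - l) / (real m + 3) > 0" using lr by simp
  then show ?thesis unfolding core_def by (intro subsetI) (simp only: atLeastAtMost_iff greaterThanLessThan_iff, linarith)
qed

lemma core_cover: assumes "x \<in> {l<..<r}" shows "\<exists>m. x \<in> core m"
proof -
  have "(\<lambda>m. (r - l) / (real m + 3)) \<longlonglongrightarrow> 0" by real_asymp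
  then have "\<forall>\<^sub>F m in sequentially. (r - l) / (real m + 3) < min (x - l) (r - x)"
    by (rule order_tendstoD) (use assms in auto)
  then obtain m where "(r - l) / (real m + 3) < min (x - l) (r - x)"
    using eventually_happens' sequentially_bot by blast
  then show ?thesis by (intro exI[of _ m]) (simp add: core_def)
qed

definition U :: "gword \<Rightarrow> nat \<Rightarrow> (gen \<Rightarrow> real \<Rightarrow> real) \<Rightarrow> bool" where
  "U W m \<phi> \<longleftrightarrow> (\<forall>x\<in>core m. \<not> flat_at (ev \<phi> W) x)"

definition V :: "real \<Rightarrow> real \<Rightarrow> (gen \<Rightarrow> real \<Rightarrow> real) \<Rightarrow> bool" where
  "V p q \<phi> \<longleftrightarrow> (\<exists>w. ev \<phi> w x0 \<in> {p<..<q})"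

lemma lim_conv_ev: "\<lbrakk>\<phi> \<in> lim; \<And>j. F j \<in> lim; conv F \<phi>\<rbrakk> \<Longrightarrow> Cinf (\<lambda>j. ev (F j) w) (ev \<phi> w)"
  by (rule conv_ev[OF lim_Diff01 lim_Diff01])

text \<open>Flat points in the compact set \<open>core m\<close> have an accumulation point, and
  equality of all derivatives with those of \<open>id\<close> survives there because the derivatives
  converge uniformly.\<close>

lemma U_open:
  assumes \<phi>: "\<phi> \<in> lim" "\<And>j. F j \<in> lim" "conv F \<phi>" "\<And>j. \<not> U W m (F j)"
  shows "\<not> U W m \<phi>"
proof -
  have "\<exists>x. x \<in> core m \<and> flat_at (ev (F j) W) x" for j using \<phi>(4)[of j] unfolding U_def by blast
  from choice[OF allI[OF this]] obtain x where x: "\<forall>j. x j \<in> core m \<and> flat_at (ev (F j) W) (x j)" ..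
  have "compact (core m)" by (simp add: core_def)
  then obtain y s where y: "y \<in> core m" "strict_mono s" "(x \<circ> s) \<longlonglongrightarrow> y"
    using x unfolding compact_def by metis
  have C: "Cinf (\<lambda>j. ev (F j) W) (ev \<phi> W)" by (rule lim_conv_ev[OF \<phi>(1-3)])
  have "flat_at (ev \<phi> W) y"
    unfolding flat_at_def
  proof
    fix k
    have "ucl (\<lambda>j. (deriv ^^ k) (ev (F j) W)) ((deriv ^^ k) (ev \<phi> W))" using C unfolding Cinf_def by (rule spec)
    from ucl_subseq[OF this y(2)] have "ucl (\<lambda>j. (deriv ^^ k) (ev (F (s j)) W)) ((deriv ^^ k) (ev \<phi> W))" .
    moreover have "continuous_on UNIV ((deriv ^^ k) (ev \<phi> W))"
      by (rule smooth_cont[OF smooth_funpow[OF Diff01D(2)[OF ev_Diff01[OF lim_Diff01[OF \<phi>(1)]]]]])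
    then have "isCont ((deriv ^^ k) (ev \<phi> W)) y" by (simp add: continuous_on_eq_continuous_at)
    moreover have "(\<lambda>j. x (s j)) \<longlonglongrightarrow> y" using y(3) by (simp add: o_def)
    ultimately have 1: "(\<lambda>j. (deriv ^^ k) (ev (F (s j)) W) (x (s j))) \<longlonglongrightarrow> (deriv ^^ k) (ev \<phi> W) y"
      by (rule ucl_tendsto)
    have e: "(deriv ^^ k) (ev (F (s j)) W) (x (s j)) = (deriv ^^ k) id (x (s j))" for j
      using x unfolding flat_at_def by blast
    have "continuous_on UNIV ((deriv ^^ k) (id :: real \<Rightarrow> real))" by (rule smooth_cont[OF smooth_funpow[OF smooth_intros(3)]])
    then have ic: "isCont ((deriv ^^ k) (id :: real \<Rightarrow> real)) y"
      unfolding continuous_on_eq_continuous_at[OF open_UNIV] by (rule bspec) (rule UNIV_I)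
    have xs: "(\<lambda>j. x (s j)) \<longlonglongrightarrow> y" using y(3) by (simp add: o_def)
    show "(deriv ^^ k) (ev \<phi> W) y = (deriv ^^ k) id y"
      by (rule LIMSEQ_unique[OF 1[unfolded e] isCont_tendsto_compose[OF ic xs]])
  qed
  then show ?thesis using y(1) unfolding U_def by blast
qed

lemma V_open:
  assumes \<phi>: "\<phi> \<in> lim" "\<And>j. F j \<in> lim" "conv F \<phi>" "\<And>j. \<not> V p q (F j)"
  shows "\<not> V p q \<phi>"
proof
  assume "V p q \<phi>"
  then obtain w where w: "ev \<phi> w x0 \<in> {p<..<q}" unfolding V_def by blast
  have "(\<lambda>j. ev (F j) w x0) \<longlonglongrightarrow> ev \<phi> w x0" by (rule Cinf_pointwise[OF lim_conv_ev[OF \<phi>(1-3)]])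
  from topological_tendstoD[OF this open_greaterThanLessThan w]
  obtain j where "ev (F j) w x0 \<in> {p<..<q}" using eventually_happens' sequentially_bot by blast
  then show False using \<phi>(4)[of j] unfolding V_def by blast
qed

lemma generic_action:
  "\<exists>\<phi>\<in>lim. (\<forall>W m. expA W = 0 \<longrightarrow> \<not> weq W [] \<longrightarrow> U W m \<phi>) \<and>
     (\<forall>p\<in>\<rat>. \<forall>q\<in>\<rat>. l \<le> p \<longrightarrow> p < q \<longrightarrow> q \<le> r \<longrightarrow> V p q \<phi>)"
proof -
  define QU where "QU = {U W m | W m. expA W = 0 \<and> \<not> weq W []}"
  define QV where "QV = {V p q | p q. p \<in> \<rat> \<and> q \<in> \<rat> \<and> l \<le> p \<and> p < q \<and> q \<le> r}"
  have "\<exists>\<phi>\<in>lim. \<forall>Q\<in>QU \<union> QV. Q \<phi>"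
  proof (rule baire)
    have "QU \<subseteq> (\<lambda>(W, m). U W m) ` UNIV" unfolding QU_def by auto
    moreover have "QV \<subseteq> (\<lambda>(p, q). V p q) ` (\<rat> \<times> \<rat>)" unfolding QV_def by auto
    ultimately show "countable (QU \<union> QV)"
      by (meson countable_SIGMA countable_Un countable_image countable_rat countable_subset countableI_type)
  next
    fix Q F \<phi> assume Q: "Q \<in> QU \<union> QV" and \<phi>: "\<phi> \<in> lim" "\<And>j. F j \<in> lim" "conv F \<phi>" "\<And>j. \<not> Q (F j)"
    from Q show "\<not> Q \<phi>"
    proof
      assume "Q \<in> QU"
      then obtain W m where "Q = U W m" unfolding QU_def by blast
      then show ?thesis using U_open[OF \<phi>(1-3), of W m] \<phi>(4) by blast
    next
      assume "Q \<in> QV"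
      then obtain p q where "Q = V p q" unfolding QV_def by blast
      then show ?thesis using V_open[OF \<phi>(1-3), of p q] \<phi>(4) by blast
    qed
  next
    fix Q f assume Q: "Q \<in> QU \<union> QV" and f: "dat f"
    from Q show "\<exists>F. (\<forall>j. dat (F j)) \<and> conv (\<lambda>j. mk (F j)) (mk f) \<and> (\<forall>j. Q (mk (F j)))"
    proof
      assume "Q \<in> QU"
      then obtain W m where W: "Q = U W m" "expA W = 0" "\<not> weq W []" unfolding QU_def by blast
      obtain F where F: "\<forall>j. dat (F j)" "conv (\<lambda>j. mk (F j)) (mk f)" "\<forall>j. \<exists>y\<in>{l<..<r}. ev (mk (F j)) W y \<noteq> y"
        using perturb_word[OF f W(2,3)] by blast
      have "Q (mk (F j))" for j
      proof -
        obtain y where y: "y \<in> {l<..<r}" "ev (mk (F j)) W y \<noteq> y" using F(3) by blast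
        show ?thesis unfolding W(1) U_def
          using no_flat_points[OF F(1)[rule_format] W(2) y] core_subset by blast
      qed
      then show ?thesis using F(1,2) by blast
    next
      assume "Q \<in> QV"
      then obtain p q where p: "Q = V p q" "l \<le> p" "p < q" "q \<le> r" unfolding QV_def by blast
      from perturb_orbit[OF f p(2-4) x0] show ?thesis unfolding p(1) V_def .
    qed
  qed
  then obtain \<phi> where \<phi>: "\<phi> \<in> lim" "\<forall>Q\<in>QU \<union> QV. Q \<phi>" by blast
  have "U W m \<phi>" if "expA W = 0" "\<not> weq W []" for W m
    using \<phi>(2) that unfolding QU_def by blast
  moreover have "V p q \<phi>" if "p \<in> \<rat>" "q \<in> \<rat>" "l \<le> p" "p < q" "q \<le> r" for p q
    using \<phi>(2) that unfolding QV_def by blast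
  ultimately show ?thesis using \<phi>(1) by blast
qed

lemma fin_seq:
  assumes "\<phi> \<in> lim"
  obtains F where "\<And>j. dat (F j)" "\<And>w y. (\<lambda>j. ev (mk (F j)) w y) \<longlonglongrightarrow> ev \<phi> w y"
proof -
  obtain G where G: "\<forall>j. G j \<in> fin" "conv G \<phi>" using assms unfolding lim_def by blast
  have "\<forall>j. \<exists>f. dat f \<and> G j = mk f" using G(1) unfolding fin_def by blast
  from choice[OF this] obtain F where F: "\<forall>j. dat (F j) \<and> G j = mk (F j)" ..
  show ?thesis
  proof (rule that)
    show "dat (F j)" for j using F by blast
    fix w y
    have "(\<lambda>j. ev (G j) w y) \<longlonglongrightarrow> ev \<phi> w y"
      by (rule Cinf_pointwise[OF lim_conv_ev[OF assms fin_lim G(2)]]) (use G(1) in blast)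
    then show "(\<lambda>j. ev (mk (F j)) w y) \<longlonglongrightarrow> ev \<phi> w y" using F by simp
  qed
qed

text \<open>The relation, the value at \<open>GA\<close> and the fixed end points of the blocks pass
  to pointwise limits. Since \<open>b\<close>, \<open>c\<close> and \<open>d\<close> fix all these
  end points, a word shifts them by its exponent in \<open>a\<close>.\<close>

lemma lim_action:
  assumes \<phi>: "\<phi> \<in> lim"
  shows "surface_action \<phi>" "\<phi> GA = a" "ev \<phi> W (ai n l) = ai (n + expA W) l"
proof -
  obtain F where F: "\<And>j. dat (F j)" "\<And>w y. (\<lambda>j. ev (mk (F j)) w y) \<longlonglongrightarrow> ev \<phi> w y"
    using fin_seq[OF \<phi>] by blast
  let ?u = "[(GA,True),(GB,True),(GA,False),(GB,False)]" and ?v = "[(GC,True),(GD,True),(GC,False),(GD,False)]"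
  have "ev (mk (F j)) ?u = ev (mk (F j)) ?v" for j
    using surface_action.relation[OF mk_action[OF F(1)], of j] by (simp add: evl_def o_assoc)
  then have "ev \<phi> ?u y = ev \<phi> ?v y" for y
    using LIMSEQ_unique[OF F(2)[of ?u y]] F(2)[of ?v y] by simp
  then have "ev \<phi> ?u = ev \<phi> ?v" by (rule ext)
  then show "surface_action \<phi>"
    by unfold_locales (simp_all add: Diff01D(1)[OF lim_Diff01[OF \<phi>]] evl_def o_assoc)
  have "\<phi> GA y = a y" for y
  proof -
    have "ev (mk (F j)) [(GA, True)] y = a y" for j by (simp add: evl_def mk_def)
    then show ?thesis using F(2)[of "[(GA, True)]" y] by (simp add: evl_def LIMSEQ_const_iff)
  qed
  then show A: "\<phi> GA = a" by (rule ext)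
  have fix1: "evl \<phi> (x, s) (ai n l) = ai n l" if x: "x \<noteq> GA" for x s n
  proof -
    have "l \<in> {l..<r}" using lr by simp
    moreover have "lett (F j) (x, n, s) l = l" for j by (rule D_off[OF lett_D[OF F(1)]]) simp
    ultimately have "ev (mk (F j)) [(x, s)] (ai n l) = ai n l" for j
      by (simp only: ev_simps o_id evl_mk[OF F(1) x] B_ai)
    then show ?thesis using F(2)[of "[(x, s)]" "ai n l"] by (simp add: LIMSEQ_const_iff)
  qed
  show "ev \<phi> W (ai n l) = ai (n + expA W) l"
  proof (induct W)
    case (Cons u W)
    obtain x s where u: "u = (x, s)" by (cases u)
    show ?case
    proof (cases "x = GA")
      case True
      have fa: "finv a = ai (- 1)" using ai_minus[of 1] by (simp add: ai_1)
      have "evl \<phi> (GA, s) = ai (if s then 1 else - 1)" by (simp add: evl_def A ai_1 fa)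
      then show ?thesis using True Cons by (simp add: u ai_ai ac_simps)
    next
      case False
      then show ?thesis using Cons fix1[OF False] by (simp add: u)
    qed
  qed simp
qed

end

theorem theorem1p1:
  shows "\<exists>G. subgroup G Diff01 \<and>
    (let H = Diff01\<lparr>carrier := G\<rparr>; I = {0<..<1::real} in
      (\<forall>x0 \<in> topspace (orientable_surface 2).
          H \<cong> fundamental_group (orientable_surface 2) x0) \<and>
      \<not> has_global_fixed_point H interval_action I \<and>
      topologically_transitive H interval_action I \<and>
      countable {x \<in> I. stabilizer H interval_action x \<noteq> {\<one>\<^bsub>H\<^esub>}})"
proof -
  obtain a where "a \<in> carrier Diff01" "\<forall>x\<in>{0<..<1}. x < a x" using exists_translation by blast
  then interpret translation a by unfold_locales auto
  obtain \<phi> where \<phi>: "\<phi> \<in> lim"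
    and U: "\<And>W m. expA W = 0 \<Longrightarrow> \<not> weq W [] \<Longrightarrow> U W m \<phi>"
    and V: "\<And>p q. p \<in> \<rat> \<Longrightarrow> q \<in> \<rat> \<Longrightarrow> l \<le> p \<Longrightarrow> p < q \<Longrightarrow> q \<le> r \<Longrightarrow> V p q \<phi>"
    using generic_action by blast
  interpret sa: surface_action \<phi> by (rule lim_action(1)[OF \<phi>])
  note A = lim_action(2)[OF \<phi>] and moves = lim_action(3)[OF \<phi>]
  have evD: "ev \<phi> W \<in> carrier Diff01" for W by (rule ev_Diff01[OF lim_Diff01[OF \<phi>]])
  define G where "G = range (ev \<phi>)"
  define H where "H = Diff01\<lparr>carrier := G\<rparr>"
  have H: "carrier H = range (ev \<phi>)" "mult H = (\<circ>)" "\<one>\<^bsub>H\<^esub> = id" by (simp_all add: H_def G_def Diff01_def)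
  have not_flat: "\<not> flat_at (ev \<phi> W) x" if "expA W = 0" "\<not> weq W []" "x \<in> {l<..<r}" for W x
    using core_cover[OF that(3)] U[OF that(1,2)] unfolding U_def by blast
  have faithful: "weq w []" if w: "ev \<phi> w = id" for w
  proof (rule ccontr)
    assume n: "\<not> weq w []"
    \<comment> \<open>The identity fixes the block end \<open>l\<close>, so the exponent vanishes;
      then genericity forbids flat points, while every point is flat for the identity.\<close>
    have e: "ai (expA w) l = l" using moves[of w 0] by (simp add: w ai_0)
    have "l \<in> {l..<r}" using lr by simp
    from blk_ai[OF this, of "expA w"] blk_ai[OF this, of 0]
    have "blk l = expA w" "blk l = 0" unfolding e ai_0 id_apply .
    then have "\<not> flat_at (ev \<phi> w) x0" using not_flat[OF _ n x0] by simp
    then show False unfolding w flat_at_def by blast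
  qed
  have sub: "subgroup G Diff01"
  proof
    show "G \<subseteq> carrier Diff01" using evD by (auto simp: G_def)
    show "\<one>\<^bsub>Diff01\<^esub> \<in> G" unfolding G_def by (rule image_eqI[of _ _ "[]"]) (simp_all add: Diff01_def)
    fix g h assume g: "g \<in> G"
    then obtain u where u: "g = ev \<phi> u" by (auto simp: G_def)
    show "g \<otimes>\<^bsub>Diff01\<^esub> h \<in> G" if h: "h \<in> G"
    proof -
      obtain v where "h = ev \<phi> v" using h by (auto simp: G_def)
      then have "g \<otimes>\<^bsub>Diff01\<^esub> h = ev \<phi> (u @ v)" by (simp add: Diff01_def u ev_append)
      then show ?thesis by (simp add: G_def)
    qed
    have i: "finv g = ev \<phi> (winv u)" unfolding u by (rule sa.ev_phi_winv[symmetric])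
    have gD: "g \<in> carrier Diff01" unfolding u by (rule evD)
    have "inv\<^bsub>Diff01\<^esub> g = finv g"
      unfolding m_inv_def
    proof (rule the_equality)
      have fi: "finv g \<circ> g = id" "g \<circ> finv g = id" using Diff01_finv_simps[OF gD] by (simp_all add: fun_eq_iff)
      then show "finv g \<in> carrier Diff01 \<and> g \<otimes>\<^bsub>Diff01\<^esub> finv g = \<one>\<^bsub>Diff01\<^esub> \<and> finv g \<otimes>\<^bsub>Diff01\<^esub> g = \<one>\<^bsub>Diff01\<^esub>"
        using Diff01_finv[OF gD] by (simp add: Diff01_def)
      fix y assume y: "y \<in> carrier Diff01 \<and> g \<otimes>\<^bsub>Diff01\<^esub> y = \<one>\<^bsub>Diff01\<^esub> \<and> y \<otimes>\<^bsub>Diff01\<^esub> g = \<one>\<^bsub>Diff01\<^esub>"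
      then have "g \<circ> y = id" "y \<circ> g = id" by (simp_all add: Diff01_def)
      then show "y = finv g" by (rule inv_unique_comp[symmetric])
    qed
    then show "inv\<^bsub>Diff01\<^esub> g \<in> G" unfolding i by (simp add: G_def)
  qed
  have aG: "a \<in> G" unfolding G_def by (rule image_eqI[of _ _ "[(GA, True)]"]) (simp_all add: evl_def A)
  have nofix: "\<not> has_global_fixed_point H interval_action {0<..<1}"
    unfolding has_global_fixed_point_def
  proof (intro notI, elim bexE)
    fix x :: real assume x: "x \<in> {0<..<1}" "\<forall>g\<in>carrier H. interval_action g x = x"
    have "interval_action a x = x" using x(2) aG by (simp add: H_def)
    then show False using a_gt[OF x(1)] x(1) by (simp add: interval_action_def)
  qed
  have x001: "x0 \<in> {0<..<1}" using J_01[of x0] x0 by simp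
  \<comment> \<open>The conditions \<open>V\<close> make the orbit of \<open>x0\<close> dense in the
    base block, and powers of \<open>a\<close> spread this to all blocks.\<close>
  have trans: "topologically_transitive H interval_action {0<..<1}"
    unfolding topologically_transitive_def
  proof (rule bexI[OF _ x001], rule subsetI)
    fix z :: real assume z: "z \<in> {0<..<1}"
    obtain n y where y: "y \<in> {l..<r}" "z = ai n y" using coord[OF z] by blast
    show "z \<in> closure (orbit H interval_action x0)"
      unfolding closure_iff_nhds_not_empty
    proof (intro allI impI)
      fix S T assume T: "T \<subseteq> S" "open T" "z \<in> T"
      have "open (ai n -` T)" by (rule open_vimage[OF T(2) Diff01_cont[OF ai_Diff01]])
      moreover have "y \<in> ai n -` T" using T(3) y(2) by simp
      ultimately obtain e where e: "e > 0" "ball y e \<subseteq> ai n -` T" using openE by metis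
      \<comment> \<open>Rational intervals to the right of \<open>y\<close> are used, so that
        \<open>y\<close> may also be the left end of the block.\<close>
      have lt: "y < min (y + e) r" using e(1) y(1) by simp
      obtain p where p: "p \<in> \<rat>" "y < p" "p < min (y + e) r" using Rats_dense_in_real[OF lt] by blast
      obtain q where q: "q \<in> \<rat>" "p < q" "q < min (y + e) r" using Rats_dense_in_real[OF p(3)] by blast
      have "V p q \<phi>" by (rule V[OF p(1) q(1) _ q(2)]) (use p q y(1) in auto)
      then obtain w where w: "p < ev \<phi> w x0" "ev \<phi> w x0 < q" unfolding V_def by auto
      have "ev \<phi> w x0 \<in> ball y e" using w p q by (simp add: dist_real_def)
      then have "ai n (ev \<phi> w x0) \<in> T" using e(2) by blast
      moreover have "interval_action (ev \<phi> (apow n @ w)) x0 = ai n (ev \<phi> w x0)"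
        using x001 by (simp add: interval_action_def ev_append ev_apow[of \<phi>, OF A])
      moreover have "interval_action (ev \<phi> (apow n @ w)) x0 \<in> orbit H interval_action x0"
        unfolding orbit_def H(1) by blast
      ultimately show "orbit H interval_action x0 \<inter> S \<noteq> {}" using T(1) by auto
    qed
  qed
  define P where "P W = {y \<in> {l<..<r}. ev \<phi> W y = y}" for W
  have cP: "countable (P W)" if W: "expA W = 0" "\<not> weq W []" for W
  proof (rule countable_isolated)
    fix x assume x: "x \<in> P W"
    then have "x \<in> {l<..<r}" "ev \<phi> W x = x" by (simp_all add: P_def)
    then obtain d where "d > 0" "\<And>y. \<bar>y - x\<bar> < d \<Longrightarrow> ev \<phi> W y = y \<Longrightarrow> y = x"
      using fixed_point_isolated[OF Diff01D(2)[OF evD] not_flat[OF W]] by metis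
    then show "\<exists>d>0. \<forall>y\<in>P W. \<bar>y - x\<bar> < d \<longrightarrow> y = x" unfolding P_def by blast
  qed
  \<comment> \<open>The ends of the blocks, and the translates of the isolated fixed points that
    words of exponent zero have in the open base block.\<close>
  define S where "S = range (\<lambda>n. ai n l) \<union> (\<Union>W\<in>{W. expA W = 0 \<and> \<not> weq W []}. \<Union>n. ai n ` P W)"
  have cS: "countable S"
    unfolding S_def by (intro countable_Un countable_image countable_UN countableI_type) (use cP in auto)
  have "x \<in> S" if x: "x \<in> {0<..<1}" "stabilizer H interval_action x \<noteq> {\<one>\<^bsub>H\<^esub>}" for x
  proof -
    have "id \<in> carrier H" unfolding H(1) by (rule image_eqI[of _ _ "[]"]) simp_all
    then have "id \<in> stabilizer H interval_action x" using x(1) by (simp add: stabilizer_def interval_action_def)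
    then obtain g where g: "g \<in> stabilizer H interval_action x" "g \<noteq> id" using x(2) unfolding H(3) by blast
    then obtain W where W: "g = ev \<phi> W" unfolding stabilizer_def H(1) by blast
    have gx: "ev \<phi> W x = x" using g(1) x(1) by (simp add: stabilizer_def interval_action_def W)
    obtain n y where y: "y \<in> {l..<r}" "x = ai n y" using coord[OF x(1)] by blast
    have bx: "blk x = n" unfolding y(2) by (rule blk_ai[OF y(1)])
    \<comment> \<open>Being monotone, \<open>ev \<phi> W\<close> carries whole blocks along with
      their ends, shifted by the exponent. A word that fixes a point therefore has exponent
      zero.\<close>
    have "ai (n + expA W) l \<le> ev \<phi> W x" "ev \<phi> W x < ai (n + 1 + expA W) l"
      using blk[OF x(1)] Diff01_le_iff[OF evD, of W "ai n l" x] Diff01_less_iff[OF evD, of W x "ai (n + 1) l"]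
      unfolding bx moves by simp_all
    then have "blk x = n + expA W" unfolding gx by (intro blk_eq) (simp_all add: ac_simps)
    then have e0: "expA W = 0" using bx by simp
    show ?thesis
    proof (cases "y = l")
      case True
      then show ?thesis using y(2) unfolding S_def by blast
    next
      case False
      then have yI: "y \<in> {l<..<r}" using y(1) by simp
      \<comment> \<open>This conjugate does in the base block what \<open>W\<close> does in the
        block of \<open>x\<close>; its exponent is still zero.\<close>
      define W' where "W' = apow (- n) @ W @ apow n"
      have W': "ev \<phi> W' t = ai (- n) (ev \<phi> W (ai n t))" for t
        by (simp add: W'_def ev_append ev_apow[of \<phi>, OF A])
      have "expA W' = 0" by (simp add: W'_def expA_append expA_apow e0)
      moreover have "\<not> weq W' []"
      proof
        assume "weq W' []"
        then have i: "ev \<phi> W' = id" using sa.ev_phi_weq[of W' "[]"] by simp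
        have "ev \<phi> W t = t" for t
        proof -
          have "ev \<phi> W t = ai n (ev \<phi> W' (ai (- n) t))" by (simp add: W')
          then show ?thesis by (simp add: i)
        qed
        then show False using g(2) W by (simp add: fun_eq_iff)
      qed
      moreover have "y \<in> P W'" using yI gx by (simp add: P_def W' y(2))
      ultimately show ?thesis unfolding S_def y(2) by blast
    qed
  qed
  then have cnt: "countable {x \<in> {0<..<1}. stabilizer H interval_action x \<noteq> {\<one>\<^bsub>H\<^esub>}}"
    by (intro countable_subset[OF _ cS]) blast
  have "H \<cong> fundamental_group (orientable_surface 2) z" if "z \<in> topspace (orientable_surface 2)" for z
    by (rule sa.fundamental_group_iso[OF faithful H(1,2) that])
  then show ?thesis
    using sub nofix trans cnt unfolding Let_def H_def by (intro exI[of _ G]) blast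
qed

end
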